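(* Let $V$ be a discrete valuation ring with fraction field $K$ and normalized valuation $v$. Let $y^2 = P(x)$ be the minimal Weierstrass equation with coefficients in $V$ of an elliptic curve $E$ over $K$, and suppose that $E$ has semi-stable reduction over $V$. Let $D$ be the scheme of zeroes of $P(x)$ in $\mathbb{P}^1_V$, and for each positive integer $n$ let $H_n$ be the Zariski closure in $\mathbb{P}^1_V$ of the image in $\mathbb{P}^1_K$, under the $x$-coordinate map $E_K \to \mathbb{P}^1_K$, of the kernel of multiplication by $n$ on $E_K$ minus the $2$-torsion. Then $$\lim_{n \to \infty} \frac{1}{n^2} (D.H_n)_v = \frac{1}{2} v(\Delta),$$ where $\Delta$ is the discriminant of $E$ over $V$ and $(-.-)_v$ denotes the geometric intersection pairing on the arithmetic surface $\mathbb{P}^1_V$.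
   Context: The $x$-coordinate map $E_K \to \mathbb{P}^1_K$ is the projection $(x,y)\mapsto x$ (the Weierstrass $\wp$-function), which identifies a point and its inverse. $D$ and $H_n$ are horizontal divisors on the regular surface $\mathbb{P}^1_V$, and $(D.H_n)_v$ is their intersection number, supported on the special fiber.
   Formalization: H_n is taken as the closure of the push-forward divisor under x of the kernel of multiplication by n minus the 2-torsion (a point and its inverse both count, with kernel-scheme multiplicities); with the reduced image the limit would be v(Δ)/4 (e.g. along n odd, prime to the residue characteristic). *)

theory Defs
  imports
    "HOL-Algebra.Algebraic_Closure_Type"
    "HOL-Analysis.Analysis"
begin

section \<open>Discrete valuation rings\<close>

text \<open>
  A discrete valuation ring is given as the valuation ring of a normalized (i.e. surjective)
  discrete valuation on its fraction field. The value at 0, which should be infinite, is left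
  unconstrained.
\<close>

definition discrete_valuation :: "('k::field \<Rightarrow> int) \<Rightarrow> bool" where
  "discrete_valuation v \<longleftrightarrow>
     (\<forall>x y. x \<noteq> 0 \<longrightarrow> y \<noteq> 0 \<longrightarrow> v (x * y) = v x + v y) \<and>
     (\<forall>x y. x \<noteq> 0 \<longrightarrow> y \<noteq> 0 \<longrightarrow> x + y \<noteq> 0 \<longrightarrow> min (v x) (v y) \<le> v (x + y)) \<and>
     v ` (UNIV - {0}) = UNIV"

definition val_ring :: "('k::field \<Rightarrow> int) \<Rightarrow> 'k set" where
  "val_ring v = {x. x = 0 \<or> 0 \<le> v x}"

definition val_ideal :: "('k::field \<Rightarrow> int) \<Rightarrow> 'k set" where
  "val_ideal v = {x. x = 0 \<or> 0 < v x}"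

text \<open>
  The residue field is presented as a type together with the reduction map; values of the map
  outside the valuation ring are irrelevant.
\<close>

definition residue_map :: "('k::field \<Rightarrow> int) \<Rightarrow> ('k \<Rightarrow> 'r::field) \<Rightarrow> bool" where
  "residue_map v red \<longleftrightarrow>
     red 1 = 1 \<and>
     (\<forall>x\<in>val_ring v. \<forall>y\<in>val_ring v. red (x + y) = red x + red y \<and> red (x * y) = red x * red y) \<and>
     (\<forall>x\<in>val_ring v. red x = 0 \<longleftrightarrow> x \<in> val_ideal v) \<and>
     red ` val_ring v = UNIV"


section \<open>Weierstrass equations\<close>

text \<open>The equation $y^2 + a_1 x y + a_3 y = x^3 + a_2 x^2 + a_4 x + a_6$.\<close>

datatype 'f weierstrass = Weierstrass (wa1: 'f) (wa2: 'f) (wa3: 'f) (wa4: 'f) (wa6: 'f)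

definition weierstrass_fun :: "'f::field weierstrass \<Rightarrow> 'f \<Rightarrow> 'f \<Rightarrow> 'f" where
  "weierstrass_fun W x y =
     y^2 + wa1 W * x * y + wa3 W * y - (x^3 + wa2 W * x^2 + wa4 W * x + wa6 W)"

definition discriminant :: "'f::field weierstrass \<Rightarrow> 'f" where
  "discriminant W =
     (let a1 = wa1 W; a2 = wa2 W; a3 = wa3 W; a4 = wa4 W; a6 = wa6 W;
          b2 = a1^2 + 4 * a2;
          b4 = 2 * a4 + a1 * a3;
          b6 = a3^2 + 4 * a6;
          b8 = a1^2 * a6 + 4 * a2 * a6 - a1 * a3 * a4 + a2 * a3^2 - a4^2
      in - (b2^2 * b8) - 8 * b4^3 - 27 * b6^2 + 9 * b2 * b4 * b6)"

text \<open>
  The equation in the coordinates $x', y'$ with $x = u^2 x' + r$ and $y = u^3 y' + s u^2 x' + t$.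
\<close>

definition change_vars :: "'f::field \<Rightarrow> 'f \<Rightarrow> 'f \<Rightarrow> 'f \<Rightarrow> 'f weierstrass \<Rightarrow> 'f weierstrass" where
  "change_vars u r s t W =
     (let a1 = wa1 W; a2 = wa2 W; a3 = wa3 W; a4 = wa4 W; a6 = wa6 W
      in Weierstrass
           ((a1 + 2 * s) / u)
           ((a2 - s * a1 + 3 * r - s^2) / u^2)
           ((a3 + r * a1 + 2 * t) / u^3)
           ((a4 - s * a3 + 2 * r * a2 - (t + r * s) * a1 + 3 * r^2 - 2 * s * t) / u^4)
           ((a6 + r * a4 + r^2 * a2 + r^3 - t * a3 - t^2 - r * t * a1) / u^6))"

definition integral_equation :: "('k::field \<Rightarrow> int) \<Rightarrow> 'k weierstrass \<Rightarrow> bool" where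
  "integral_equation v W \<longleftrightarrow> set_weierstrass W \<subseteq> val_ring v"

definition minimal_equation :: "('k::field \<Rightarrow> int) \<Rightarrow> 'k weierstrass \<Rightarrow> bool" where
  "minimal_equation v W \<longleftrightarrow>
     integral_equation v W \<and>
     (\<forall>u r s t. u \<noteq> 0 \<longrightarrow> integral_equation v (change_vars u r s t W) \<longrightarrow>
        v (discriminant W) \<le> v (discriminant (change_vars u r s t W)))"

text \<open>The point at infinity of a Weierstrass curve is always smooth.\<close>

definition singular_point :: "'f::field weierstrass \<Rightarrow> 'f \<Rightarrow> 'f \<Rightarrow> bool" where
  "singular_point W x y \<longleftrightarrow>
     weierstrass_fun W x y = 0 \<and>
     wa1 W * y - (3 * x^2 + 2 * wa2 W * x + wa4 W) = 0 \<and>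
     2 * y + wa1 W * x + wa3 W = 0"

text \<open>A singular point with two distinct tangent lines (of slopes \<open>\<alpha>\<close> and \<open>\<beta>\<close>).\<close>

definition node :: "'f::field weierstrass \<Rightarrow> 'f \<Rightarrow> 'f \<Rightarrow> bool" where
  "node W x0 y0 \<longleftrightarrow> singular_point W x0 y0 \<and>
     (\<exists>\<alpha> \<beta>. \<alpha> \<noteq> \<beta> \<and>
        (\<forall>x y. weierstrass_fun W x y =
           ((y - y0) - \<alpha> * (x - x0)) * ((y - y0) - \<beta> * (x - x0)) - (x - x0)^3))"

definition elliptic_curve :: "'k::field weierstrass \<Rightarrow> bool" where
  "elliptic_curve W \<longleftrightarrow> (\<forall>x y. \<not> singular_point (map_weierstrass to_ac W) x y)"

text \<open>
  To be applied to a minimal equation: the special fibre of the Weierstrass model is geometrically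
  smooth (good reduction) or has a node (multiplicative reduction).
\<close>

definition semistable_reduction :: "('k::field \<Rightarrow> 'r::field) \<Rightarrow> 'k weierstrass \<Rightarrow> bool" where
  "semistable_reduction red W \<longleftrightarrow>
     (let W' = map_weierstrass (\<lambda>a. to_ac (red a)) W
      in \<forall>x y. singular_point W' x y \<longrightarrow> node W' x y)"


section \<open>The group law and the kernel of multiplication by \<open>n\<close>\<close>

datatype 'f point = Infinity | Affine 'f 'f

fun on_curve :: "'f::field weierstrass \<Rightarrow> 'f point \<Rightarrow> bool" where
  "on_curve W Infinity \<longleftrightarrow> True"
| "on_curve W (Affine x y) \<longleftrightarrow> weierstrass_fun W x y = 0"

fun point_add :: "'f::field weierstrass \<Rightarrow> 'f point \<Rightarrow> 'f point \<Rightarrow> 'f point" where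
  "point_add W Infinity Q = Q"
| "point_add W (Affine x1 y1) Infinity = Affine x1 y1"
| "point_add W (Affine x1 y1) (Affine x2 y2) =
     (if x1 = x2 \<and> y1 + y2 + wa1 W * x2 + wa3 W = 0 then Infinity
      else let l = (if x1 = x2
                    then (3 * x1^2 + 2 * wa2 W * x1 + wa4 W - wa1 W * y1) /
                         (2 * y1 + wa1 W * x1 + wa3 W)
                    else (y2 - y1) / (x2 - x1));
               m = y1 - l * x1;
               x3 = l^2 + wa1 W * l - wa2 W - x1 - x2
           in Affine x3 (- (l + wa1 W) * x3 - m - wa3 W))"

definition point_mult :: "'f::field weierstrass \<Rightarrow> nat \<Rightarrow> 'f point \<Rightarrow> 'f point" where
  "point_mult W n T = (point_add W T ^^ n) Infinity"

text \<open>
  \<open>\<phi>, \<psi>\<close> identify the completed local ring of the smooth curve \<open>W\<close> at \<open>(x0, y0)\<close> with the ring of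
  power series.
\<close>

definition formal_parametrization ::
    "'f::field weierstrass \<Rightarrow> 'f \<Rightarrow> 'f \<Rightarrow> 'f fps \<Rightarrow> 'f fps \<Rightarrow> bool" where
  "formal_parametrization W x0 y0 \<phi> \<psi> \<longleftrightarrow>
     on_curve (map_weierstrass fls_const W) (Affine (fps_to_fls \<phi>) (fps_to_fls \<psi>)) \<and>
     fps_nth \<phi> 0 = x0 \<and> fps_nth \<psi> 0 = y0 \<and> (fps_nth \<phi> 1 \<noteq> 0 \<or> fps_nth \<psi> 1 \<noteq> 0)"

text \<open>
  The length of the local ring at \<open>(x0, y0)\<close> of the group scheme \<open>ker [n]\<close> over an algebraically
  closed field, for an affine point killed by \<open>n > 0\<close>: as \<open>x/y\<close> is a local parameter at the origin,
  this is the order of vanishing of \<open>x/y \<circ> [n]\<close>, computed on any formal parametrization. It is 1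
  unless the characteristic divides \<open>n\<close>.
\<close>

definition kernel_length :: "'f::field weierstrass \<Rightarrow> nat \<Rightarrow> 'f \<Rightarrow> 'f \<Rightarrow> nat" where
  "kernel_length W n x0 y0 =
     (SOME m. \<exists>\<phi> \<psi> \<xi> \<eta>. formal_parametrization W x0 y0 \<phi> \<psi> \<and>
        point_mult (map_weierstrass fls_const W) n (Affine (fps_to_fls \<phi>) (fps_to_fls \<psi>))
          = Affine \<xi> \<eta> \<and>
        fls_subdegree (\<xi> / \<eta>) = int m)"

definition torsion_minus_two :: "'f::field weierstrass \<Rightarrow> nat \<Rightarrow> ('f \<times> 'f) set" where
  "torsion_minus_two W n =
     {(x, y). on_curve W (Affine x y) \<and> point_mult W n (Affine x y) = Infinity \<and>
              point_mult W 2 (Affine x y) \<noteq> Infinity}"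

text \<open>
  The divisor of this polynomial is the image (push-forward) under \<open>x\<close> of the cycle of \<open>ker [n]\<close>
  minus the 2-torsion; a point and its inverse both contribute.
\<close>

definition torsion_poly :: "'f::field weierstrass \<Rightarrow> nat \<Rightarrow> 'f poly" where
  "torsion_poly W n = (\<Prod>(x, y)\<in>torsion_minus_two W n. [:- x, 1:] ^ kernel_length W n x y)"


section \<open>Length of modules\<close>

text \<open>Rings and modules are additive subgroups of a field; \<open>R\<close> is a subring.\<close>

definition submodule_of :: "'f::field set \<Rightarrow> 'f set \<Rightarrow> bool" where
  "submodule_of R N \<longleftrightarrow> 0 \<in> N \<and> (\<forall>a\<in>N. \<forall>b\<in>N. a + b \<in> N) \<and> (\<forall>r\<in>R. \<forall>a\<in>N. r * a \<in> N)"

definition generated_module :: "'f::field set \<Rightarrow> 'f set \<Rightarrow> 'f set" where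
  "generated_module R S = \<Inter> {N. submodule_of R N \<and> S \<subseteq> N}"

text \<open>The length of the \<open>R\<close>-module \<open>M / N\<close>.\<close>

definition quotient_length :: "'f::field set \<Rightarrow> 'f set \<Rightarrow> 'f set \<Rightarrow> enat" where
  "quotient_length R M N =
     Sup {enat n | n. \<exists>C. C 0 = N \<and> C n = M \<and>
       (\<forall>i\<le>n. submodule_of R (C i)) \<and> (\<forall>i<n. C i \<subset> C (Suc i))}"

definition maximal_ideal_of :: "'f::field set \<Rightarrow> 'f set \<Rightarrow> bool" where
  "maximal_ideal_of A M \<longleftrightarrow> submodule_of A M \<and> M \<subset> A \<and>
     (\<forall>J. submodule_of A J \<longrightarrow> M \<subseteq> J \<longrightarrow> J \<subseteq> A \<longrightarrow> J = M \<or> J = A)"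

definition localization :: "'f::field set \<Rightarrow> 'f set \<Rightarrow> 'f set" where
  "localization A M = {a / b | a b. a \<in> A \<and> b \<in> A - M}"


section \<open>The projective line over a discrete valuation ring\<close>

text \<open>
  The projective line over \<open>V\<close> is glued from the spectra of \<open>V[t]\<close> and \<open>V[1/t]\<close>, both subrings of
  its function field \<open>K(t)\<close>. As the scheme is integral and separated, its points are identified
  with their local rings, which are subrings of \<open>K(t)\<close>.
\<close>

definition coord :: "'k::field poly fract" where
  "coord = to_fract [:0, 1:]"

definition poly_at :: "'k::field poly fract \<Rightarrow> 'k poly \<Rightarrow> 'k poly fract" where
  "poly_at s p = poly (map_poly (\<lambda>c. to_fract [:c:]) p) s"

definition integral_polys :: "('k::field \<Rightarrow> int) \<Rightarrow> 'k poly set" where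
  "integral_polys v = {p. \<forall>i. Polynomial.coeff p i \<in> val_ring v}"

definition charts :: "('k::field \<Rightarrow> int) \<Rightarrow> 'k poly fract set set" where
  "charts v = {poly_at coord ` integral_polys v, poly_at (inverse coord) ` integral_polys v}"

text \<open>
  Closed points of the special fibre. The maximal ideals of a chart which do not contain the
  maximal ideal of \<open>V\<close> are points of the generic fibre.
\<close>

definition special_points :: "('k::field \<Rightarrow> int) \<Rightarrow> 'k poly fract set set" where
  "special_points v =
     {localization A M | A M. A \<in> charts v \<and> maximal_ideal_of A M \<and>
        (\<lambda>c. to_fract [:c:]) ` val_ideal v \<subseteq> M}"

text \<open>
  A closed subscheme of the projective line over \<open>V\<close> (or over \<open>K\<close>) is given by its ideals in the
  two charts, in terms of the respective coordinates \<open>t\<close> and \<open>1/t\<close>.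
\<close>

type_synonym 'k p1_subscheme = "'k poly set \<times> 'k poly set"

text \<open>
  The zeroes of \<open>P\<close> as a section of \<open>O(degree P)\<close>; in the coordinate \<open>1/t\<close> the section is
  \<open>t^(- degree P) * P(t)\<close>.
\<close>

definition zero_scheme :: "('k::field \<Rightarrow> int) \<Rightarrow> 'k poly \<Rightarrow> 'k p1_subscheme" where
  "zero_scheme v P =
     ((\<lambda>q. P * q) ` integral_polys v, (\<lambda>q. reflect_poly P * q) ` integral_polys v)"

text \<open>The divisor of a polynomial over the algebraic closure, mapped to the line over \<open>K\<close>.\<close>

definition image_over_base :: "'k::field alg_closure poly \<Rightarrow> 'k p1_subscheme" where
  "image_over_base h =
     ({f. h dvd map_poly to_ac f}, {f. reflect_poly h dvd map_poly to_ac f})"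

definition zariski_closure ::
    "('k::field \<Rightarrow> int) \<Rightarrow> 'k p1_subscheme \<Rightarrow> 'k p1_subscheme" where
  "zariski_closure v Z = (fst Z \<inter> integral_polys v, snd Z \<inter> integral_polys v)"

definition torsion_closure ::
    "('k::field \<Rightarrow> int) \<Rightarrow> 'k weierstrass \<Rightarrow> nat \<Rightarrow> 'k p1_subscheme" where
  "torsion_closure v W n =
     zariski_closure v (image_over_base (torsion_poly (map_weierstrass to_ac W) n))"


section \<open>Intersection numbers\<close>

definition stalk_ideal :: "'k::field p1_subscheme \<Rightarrow> 'k poly fract set \<Rightarrow> 'k poly fract set" where
  "stalk_ideal Z \<O> =
     generated_module \<O>
       (if coord \<in> \<O> then poly_at coord ` fst Z else poly_at (inverse coord) ` snd Z)"

definition local_intersection ::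
    "'k::field p1_subscheme \<Rightarrow> 'k p1_subscheme \<Rightarrow> 'k poly fract set \<Rightarrow> enat" where
  "local_intersection D H \<O> =
     quotient_length \<O> \<O> (generated_module \<O> (stalk_ideal D \<O> \<union> stalk_ideal H \<O>))"

text \<open>
  The degree over \<open>V/m\<close> of the residue field of a point of the special fibre: the dimension of
  this vector space is its length as a \<open>V\<close>-module.
\<close>

definition residue_degree :: "('k::field \<Rightarrow> int) \<Rightarrow> 'k poly fract set \<Rightarrow> enat" where
  "residue_degree v \<O> =
     quotient_length ((\<lambda>c. to_fract [:c:]) ` val_ring v) \<O> {a \<in> \<O>. a = 0 \<or> inverse a \<notin> \<O>}"

text \<open>
  Meaningful for divisors without common component, where the lengths are finite and almost all
  of them vanish.
\<close>

definition intersection_number ::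
    "('k::field \<Rightarrow> int) \<Rightarrow> 'k p1_subscheme \<Rightarrow> 'k p1_subscheme \<Rightarrow> nat" where
  "intersection_number v D H =
     (\<Sum>\<O>\<in>{\<O> \<in> special_points v. local_intersection D H \<O> \<noteq> 0}.
        the_enat (local_intersection D H \<O>) * the_enat (residue_degree v \<O>))"

end

theory Submission
  imports Defs
begin

text \<open>
  Write \<open>L n\<close> and \<open>n\<^sup>2 - e n\<close> for the leading coefficient and the degree of the square \<open>G n\<close> of the \<open>n\<close>-th
  division polynomial. Up to a constant, the torsion polynomial is \<open>G n\<close> for odd \<open>n\<close>, and the quotient of
  \<open>G n\<close> by the power of \<open>P\<close> dividing it for even \<open>n\<close>; modulo \<open>P\<close> it is a constant times a power of \<open>P'\<close>, with
  exponent \<open>(n\<^sup>2 - 1) / 2\<close>, respectively \<open>n\<^sup>2 / 2 - 2 * e (n / 2)\<close>. Since the lengths of the rings \<open>O / (P, g)\<close>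
  are additive in \<open>g\<close>, the intersection number with the torsion is this exponent times \<open>(P . P')\<close>, up to an
  error controlled by the valuations of the leading coefficients. For semi-stable reduction, \<open>(P . P')\<close> is the
  valuation of the discriminant of \<open>P\<close>: both vanish for good reduction, and at a node the ideal
  \<open>(P, P')\<close> is \<open>(x - a, P(a))\<close> for an integral \<open>a\<close> with \<open>P(a)\<close> equal to the discriminant up to a unit. Finally the error
  is \<open>o(n\<^sup>2)\<close>: multiplicativity of \<open>e\<close> and \<open>L\<close> under composition reduces this to the residue characteristic \<open>p\<close>,
  where \<open>e p < p\<^sup>2\<close> unless the reduction is good and \<open>L p\<close> is a unit.
\<close>

text \<open>The residue characteristic is never 2: in characteristic 2 the curve y^2 = P(x) has a
  singular point, and it is not a node. So 2 is a unit, and Delta = 16 disc(P) may be replaced by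
  disc(P). The field K itself may have positive characteristic; then n can vanish in K and the n-th
  division polynomial can lose its leading term. \<open>e n\<close> measures this loss: it is the
  ramification index at infinity of the map that [n] induces on the x-line. Degrees and nonvanishing
  can therefore not be read off from the coefficient n. The division polynomials are defined by the
  doubling recursions, and the other identities between them are proved at the generic point of the
  curve, where no term vanishes and division is allowed. As identities of polynomials they then
  specialise to torsion points, where terms do vanish. The integral point a of the nodal case lifts
  the double root of the reduction; its formula 2 (a2^2 - 3 a4) a = 9 a6 - a2 a4 comes from dividing
  9 P by P'. The exponent below 2 in the error term is log_p of a number strictly between
  \<open>e p\<close> and p^2.\<close>

section \<open>Elliptic divisibility sequences\<close>

text \<open>The division polynomials psi_n, with \<open>A\<close> = psi_2^2 = 4 P(x), \<alpha> = 3 x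
  + a2 and \<beta> = P'(x). For even \<open>n\<close> the factor psi_2 = 2 y is divided out, so that
  only its square enters and all values are polynomials in x.\<close>

fun divpol :: "'a::comm_ring_1 \<Rightarrow> 'a \<Rightarrow> 'a \<Rightarrow> nat \<Rightarrow> 'a" where
  "divpol A \<alpha> \<beta> n =
     (if n = 0 then 0 else if n \<le> 2 then 1
      else if n = 3 then A * \<alpha> - \<beta>^2
      else if n = 4 then 2 * \<beta> * (A * \<alpha> - \<beta>^2) - A^2
      else if even n then
        divpol A \<alpha> \<beta> (n div 2) *
          (divpol A \<alpha> \<beta> (n div 2 + 2) * divpol A \<alpha> \<beta> (n div 2 - 1)^2
           - divpol A \<alpha> \<beta> (n div 2 - 2) * divpol A \<alpha> \<beta> (n div 2 + 1)^2)
      else (if even (n div 2) then A^2 else 1) *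
          divpol A \<alpha> \<beta> (n div 2 + 2) * divpol A \<alpha> \<beta> (n div 2)^3
        - (if even (n div 2) then 1 else A^2) *
          divpol A \<alpha> \<beta> (n div 2 - 1) * divpol A \<alpha> \<beta> (n div 2 + 1)^3)"

declare divpol.simps [simp del]

lemma divpol_initial [simp]:
  "divpol A \<alpha> \<beta> 0 = 0" "divpol A \<alpha> \<beta> (Suc 0) = 1" "divpol A \<alpha> \<beta> 2 = 1"
  "divpol A \<alpha> \<beta> 3 = A * \<alpha> - \<beta>^2" "divpol A \<alpha> \<beta> 4 = 2 * \<beta> * (A * \<alpha> - \<beta>^2) - A^2"
  "divpol A \<alpha> \<beta> (Suc (Suc 0)) = 1" "divpol A \<alpha> \<beta> (Suc (Suc (Suc 0))) = A * \<alpha> - \<beta>^2"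
  by (subst divpol.simps; simp)+

lemma divpol_even:
  assumes "m \<ge> 2"
  shows "divpol A \<alpha> \<beta> (2 * m) = divpol A \<alpha> \<beta> m *
          (divpol A \<alpha> \<beta> (m + 2) * divpol A \<alpha> \<beta> (m - 1)^2
           - divpol A \<alpha> \<beta> (m - 2) * divpol A \<alpha> \<beta> (m + 1)^2)"
proof (cases "m = 2")
  case True
  then show ?thesis by simp
next
  case False
  with assms have "m \<ge> 3" by simp
  then show ?thesis by (subst divpol.simps) simp
qed

lemma divpol_odd:
  assumes "m \<ge> 1"
  shows "divpol A \<alpha> \<beta> (2 * m + 1) =
      (if even m then A^2 else 1) * divpol A \<alpha> \<beta> (m + 2) * divpol A \<alpha> \<beta> m^3
    - (if even m then 1 else A^2) * divpol A \<alpha> \<beta> (m - 1) * divpol A \<alpha> \<beta> (m + 1)^3"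
proof (cases "m = 1")
  case True
  then show ?thesis by simp
next
  case False
  with assms have "m \<ge> 2" by simp
  then show ?thesis by (subst divpol.simps) simp
qed

text \<open>Allows evaluating the sequence at points of the curve and moving it to an algebraic
  closure.\<close>

lemma divpol_hom:
  fixes h :: "'a::comm_ring_1 \<Rightarrow> 'b::comm_ring_1"
  assumes add: "\<And>x y. h (x + y) = h x + h y" and mult: "\<And>x y. h (x * y) = h x * h y"
    and one: "h 1 = 1"
  shows "h (divpol A \<alpha> \<beta> n) = divpol (h A) (h \<alpha>) (h \<beta>) n"
proof (induction n rule: less_induct)
  case (less n)
  have zero: "h 0 = 0" using add[of 0 0] by simp
  have minus: "h (x - y) = h x - h y" for x y
    using add[of "x - y" y] by (simp add: algebra_simps)
  have pow: "h (x ^ k) = h x ^ k" for x k by (induction k) (simp_all add: one mult)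
  have two: "h 2 = 2" using add[of 1 1] by (simp add: one)
  consider "n \<le> 4" | k where "k \<ge> 3" "n = 2 * k" | k where "k \<ge> 2" "n = 2 * k + 1"
  proof -
    assume a: "n \<le> 4 \<Longrightarrow> thesis" "\<And>k. 3 \<le> k \<Longrightarrow> n = 2 * k \<Longrightarrow> thesis"
      "\<And>k. 2 \<le> k \<Longrightarrow> n = 2 * k + 1 \<Longrightarrow> thesis"
    show thesis
    proof (cases "n \<le> 4")
      case False
      then show ?thesis using a(2,3)[of "n div 2"] by (cases "even n") auto
    qed (use a in auto)
  qed
  then show ?case
  proof cases
    case 1
    then have "n = 0 \<or> n = Suc 0 \<or> n = 2 \<or> n = 3 \<or> n = 4" by auto
    then show ?thesis by (auto simp: zero one minus mult pow two)
  next
    case 2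
    then have lt: "m < n" if "m \<le> k + 2" for m using that by auto
    show ?thesis using 2(1) unfolding 2(2)
      by (simp add: divpol_even minus mult pow less lt)
  next
    case 3
    then have lt: "m < n" if "m \<le> k + 2" for m using that by auto
    show ?thesis using 3(1) divpol_odd[of k A \<alpha> \<beta>] divpol_odd[of k "h A" "h \<alpha>" "h \<beta>"] unfolding 3(2)
      by (simp add: minus mult pow less lt one)
  qed
qed

text \<open>Puts the factor psi_2 back into the even terms, with \<open>b\<close> a square root of
  \<open>A\<close>. The recursions then have the same shape for all parities.\<close>

definition ell_seq :: "'a::comm_ring_1 \<Rightarrow> 'a \<Rightarrow> 'a \<Rightarrow> nat \<Rightarrow> 'a" where
  "ell_seq b \<alpha> \<beta> n = divpol (b^2) \<alpha> \<beta> n * (if even n then b else 1)"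

lemma ell_seq_initial [simp]:
  "ell_seq b \<alpha> \<beta> 0 = 0" "ell_seq b \<alpha> \<beta> (Suc 0) = 1" "ell_seq b \<alpha> \<beta> 2 = b"
  "ell_seq b \<alpha> \<beta> 3 = b^2 * \<alpha> - \<beta>^2" "ell_seq b \<alpha> \<beta> 4 = b * (2 * \<beta> * (b^2 * \<alpha> - \<beta>^2) - b^4)"
  "ell_seq b \<alpha> \<beta> (Suc (Suc 0)) = b" "ell_seq b \<alpha> \<beta> (Suc (Suc (Suc 0))) = b^2 * \<alpha> - \<beta>^2"
  by (simp_all add: ell_seq_def mult.commute flip: power_mult)

lemma ell_seq_even:
  assumes "m \<ge> 2"
  shows "b * ell_seq b \<alpha> \<beta> (2 * m) = ell_seq b \<alpha> \<beta> m *
          (ell_seq b \<alpha> \<beta> (m + 2) * ell_seq b \<alpha> \<beta> (m - 1)^2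
           - ell_seq b \<alpha> \<beta> (m - 2) * ell_seq b \<alpha> \<beta> (m + 1)^2)"
  unfolding ell_seq_def divpol_even[OF assms] using assms
  by (cases "even m") (simp_all add: power2_eq_square algebra_simps)

lemma ell_seq_odd:
  assumes "m \<ge> 1"
  shows "ell_seq b \<alpha> \<beta> (2 * m + 1) =
      ell_seq b \<alpha> \<beta> (m + 2) * ell_seq b \<alpha> \<beta> m^3 - ell_seq b \<alpha> \<beta> (m - 1) * ell_seq b \<alpha> \<beta> (m + 1)^3"
  using assms divpol_odd[OF assms, of "b^2" \<alpha> \<beta>]
  by (cases "even m") (simp_all add: ell_seq_def power2_eq_square power3_eq_cube algebra_simps)

text \<open>Serves to recognise the rescaled subsequence of the multiples of n. Since
  \<open>b\<close> is nonzero, the doubling recursion determines the even terms.\<close>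

lemma ell_seq_unique:
  fixes V :: "nat \<Rightarrow> 'a::field"
  assumes "V 0 = 0" "V 1 = 1" "V 2 = b" "V 3 = b^2 * \<alpha> - \<beta>^2"
    "V 4 = b * (2 * \<beta> * (b^2 * \<alpha> - \<beta>^2) - b^4)" and "b \<noteq> 0"
    and even: "\<And>m. m \<ge> 3 \<Longrightarrow> b * V (2 * m) = V m * (V (m + 2) * V (m - 1)^2 - V (m - 2) * V (m + 1)^2)"
    and odd: "\<And>m. m \<ge> 2 \<Longrightarrow> V (2 * m + 1) = V (m + 2) * V m ^3 - V (m - 1) * V (m + 1)^3"
  shows "V n = ell_seq b \<alpha> \<beta> n"
proof (induction n rule: less_induct)
  case (less n)
  show ?case
  proof (cases "n \<le> 4")
    case True
    then have "n = 0 \<or> n = 1 \<or> n = 2 \<or> n = 3 \<or> n = 4" by auto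
    with assms(1-5) show ?thesis by auto
  next
    case False
    define k where "k = n div 2"
    show ?thesis
    proof (cases "Parity.even n")
      case True
      then have k: "n = 2 * k" "k \<ge> 3" using False by (auto simp: k_def)
      then have lt: "m < n" if "m \<le> k + 2" for m using that by auto
      have "b * V n = b * ell_seq b \<alpha> \<beta> n"
        unfolding k(1) using even[OF k(2)] ell_seq_even[of k b \<alpha> \<beta>] k(2) by (simp add: less lt)
      then show ?thesis using \<open>b \<noteq> 0\<close> by simp
    next
      case odd': False
      then have k: "n = 2 * k + 1" "k \<ge> 2" using False by (auto simp: k_def)
      then have lt: "m < n" if "m \<le> k + 2" for m using that by auto
      then show ?thesis unfolding k(1) using odd[OF k(2)] ell_seq_odd[of k b \<alpha> \<beta>] k(2)
        by (simp add: less lt)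
    qed
  qed
qed

section \<open>Somos-4 sequences and the general elliptic relation\<close>

text \<open>The quotient (V(m+1)^2 V(m+4) + V(m+3)^2 V(m) + A V(m+2)^3) / (V(m+1) V(m+2) V(m+3))
  does not depend on m, and J is its value at m = 0. The induction step cancels V(m+1), hence the
  condition that the terms up to N are nonzero.\<close>

lemma somos_invariant:
  fixes V :: "nat \<Rightarrow> 'a::field"
  assumes "V 0 = 0" "V 1 = 1" "V 3 = c" "V 4 = J * c * V 2 - A * V 2 ^ 3"
    and nz: "\<And>j. 1 \<le> j \<Longrightarrow> j \<le> N \<Longrightarrow> V j \<noteq> 0"
    and S: "\<And>m. m + 4 \<le> N + 1 \<Longrightarrow> V (m + 4) * V m = A * V (m + 3) * V (m + 1) - c * V (m + 2)^2"
    and "m + 4 \<le> N + 1"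
  shows "V (m + 1)^2 * V (m + 4) + V (m + 3)^2 * V m =
      J * V (m + 3) * V (m + 1) * V (m + 2) - A * V (m + 2)^3"
  using \<open>m + 4 \<le> N + 1\<close>
proof (induction m)
  case 0
  then show ?case using assms(1-4)
    by (simp add: algebra_simps numeral_3_eq_3 numeral_2_eq_2 power2_eq_square power3_eq_cube)
next
  case (Suc m)
  define q2 q1 p0 p1 p2 p3 where "q2 = V m" "q1 = V (m + 1)" "p0 = V (m + 2)" "p1 = V (m + 3)"
    "p2 = V (m + 4)" "p3 = V (m + 5)"
  have i: "q1^2 * p2 + p1^2 * q2 = J * p1 * q1 * p0 - A * p0^3"
    using Suc by (simp add: q2_q1_p0_p1_p2_p3_def)
  have s: "p2 * q2 = A * p1 * q1 - c * p0^2" "p3 * q1 = A * p2 * p0 - c * p1^2"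
    using S[of m] S[of "m + 1"] Suc.prems by (simp_all add: q2_q1_p0_p1_p2_p3_def add.commute numeral_eq_Suc)
  have "q1 * (p0^2 * p3 + p2^2 * q1) = p0^2 * (p3 * q1) + p2 * (q1^2 * p2 + p1^2 * q2) - p1^2 * (p2 * q2)"
    by Groebner_Basis.algebra
  also have "\<dots> = q1 * (J * p2 * p0 * p1 - A * p1^3)"
    unfolding i s by Groebner_Basis.algebra
  finally have "q1 * (p0^2 * p3 + p2^2 * q1) = q1 * (J * p2 * p0 * p1 - A * p1^3)" .
  moreover have "q1 \<noteq> 0" using nz[of "m + 1"] Suc.prems by (simp add: q2_q1_p0_p1_p2_p3_def)
  ultimately have "p0^2 * p3 + p2^2 * q1 = J * p2 * p0 * p1 - A * p1^3" by simp
  then show ?case by (simp add: q2_q1_p0_p1_p2_p3_def add.commute numeral_eq_Suc)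
qed

text \<open>For n = 2 this is the Somos relation. For larger n, the product of the right sides for
  (m, n) and (m, n - 2) equals the product of those for (m + 1, n - 1) and (m - 1, n - 1); this
  follows from the Somos relation and the invariant, centred at m and at n - 1. The known factors
  are then cancelled.\<close>

lemma somos_elliptic:
  fixes V :: "nat \<Rightarrow> 'a::field"
  assumes ini: "V 0 = 0" "V 1 = 1" "V 2 ^ 2 = A" "V 3 = c" "V 4 = J * c * V 2 - A * V 2 ^ 3"
    and nz: "\<And>j. 1 \<le> j \<Longrightarrow> j \<le> N \<Longrightarrow> V j \<noteq> 0"
    and S: "\<And>m. m + 4 \<le> N + 1 \<Longrightarrow> V (m + 4) * V m = A * V (m + 3) * V (m + 1) - c * V (m + 2)^2"
    and "1 \<le> n" "n \<le> m" "m + n \<le> N + 1"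
  shows "V (m + n) * V (m - n) = V (m + 1) * V (m - 1) * V n ^ 2 - V (n + 1) * V (n - 1) * V m ^ 2"
  using \<open>1 \<le> n\<close> \<open>n \<le> m\<close> \<open>m + n \<le> N + 1\<close>
proof (induction n arbitrary: m rule: less_induct)
  case (less n)
  consider "n = 1" | "n = 2" | "n \<ge> 3" "m = n" | "n \<ge> 3" "m \<ge> n + 1" using less.prems by linarith
  then show ?case
  proof cases
    case 1
    then show ?thesis using ini by simp
  next
    case 2
    then obtain k where "m = k + 2" using less.prems by (metis add.commute le_Suc_ex)
    then show ?thesis using S[of k] 2 less.prems ini by (simp add: algebra_simps numeral_3_eq_3 eval_nat_numeral)
  next
    case 3
    then show ?thesis using ini by (simp add: algebra_simps)
  next
    case 4
    then obtain l where l: "n = l + 3" by (metis add.commute le_Suc_ex)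
    then obtain k where k: "m = l + k + 4" using 4 by (metis add.assoc add.commute le_Suc_ex numeral_plus_one semiring_norm(2,8) )
    define q2 q1 p0 p1 p2 where "q2 = V (m - 2)" "q1 = V (m - 1)" "p0 = V m" "p1 = V (m + 1)" "p2 = V (m + 2)"
    define s2 s1 r0 r1 r2 where "s2 = V l" "s1 = V (l + 1)" "r0 = V (l + 2)" "r1 = V (l + 3)" "r2 = V (l + 4)"
    note defs = q2_q1_p0_p1_p2_def s2_s1_r0_r1_r2_def
    have Im: "q1^2 * p2 + p1^2 * q2 = J * p1 * q1 * p0 - A * p0^3"
      using somos_invariant[of V c J A N "m - 2"] ini nz S less.prems 4
      by (simp add: defs k numeral_eq_Suc)
    have In: "s1^2 * r2 + r1^2 * s2 = J * r1 * s1 * r0 - A * r0^3"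
      using somos_invariant[of V c J A N l] ini nz S less.prems 4 l
      by (simp add: defs k numeral_eq_Suc)
    have Sm: "p2 * q2 = A * p1 * q1 - c * p0^2"
      using S[of "m - 2"] less.prems 4 by (simp add: defs k numeral_eq_Suc)
    have Sn: "r2 * s2 = A * r1 * s1 - c * r0^2"
      using S[of l] less.prems 4 l by (simp add: defs k numeral_eq_Suc)
    have e1: "V (m + n) * V (k + 3) = p2 * p0 * r0^2 - r1 * s1 * p1^2"
      using less.IH[of "l + 2" "m + 1"] l k less.prems by (simp add: defs numeral_eq_Suc)
    have e2: "V (m + l + 1) * V (k + 1) = p0 * q2 * r0^2 - r1 * s1 * q1^2"
      using less.IH[of "l + 2" "m - 1"] l k less.prems by (simp add: defs numeral_eq_Suc)
    have e3: "V (m + l + 1) * V (k + 3) = p1 * q1 * s1^2 - r0 * s2 * p0^2"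
      using less.IH[of "l + 1" "m"] l k less.prems by (simp add: defs numeral_eq_Suc)
    have "(p1 * q1 * r1^2 - r2 * r0 * p0^2) * (p1 * q1 * s1^2 - r0 * s2 * p0^2)
        = p1^2 * q1^2 * r1^2 * s1^2 - p0^2 * p1 * q1 * r0 * (s1^2 * r2 + r1^2 * s2) + r0^2 * p0^4 * (r2 * s2)"
      by Groebner_Basis.algebra
    also have "\<dots> = p1^2 * q1^2 * r1^2 * s1^2 - p0 * r0^2 * r1 * s1 * (q1^2 * p2 + p1^2 * q2) + p0^2 * r0^4 * (p2 * q2)"
      unfolding In Sn Im Sm by Groebner_Basis.algebra
    also have "\<dots> = (p2 * p0 * r0^2 - r1 * s1 * p1^2) * (p0 * q2 * r0^2 - r1 * s1 * q1^2)"
      by Groebner_Basis.algebra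
    also have "\<dots> = V (m + n) * V (k + 1) * (V (m + l + 1) * V (k + 3))"
      unfolding e1[symmetric] e2[symmetric] by (simp add: ac_simps)
    finally have "V (m + n) * V (k + 1) * (V (m + l + 1) * V (k + 3))
        = (p1 * q1 * r1^2 - r2 * r0 * p0^2) * (V (m + l + 1) * V (k + 3))"
      unfolding e3 by (rule sym)
    moreover have "V (m + l + 1) \<noteq> 0" "V (k + 3) \<noteq> 0"
      by (rule nz; use l k less.prems in simp)+
    ultimately have "V (m + n) * V (k + 1) = p1 * q1 * r1^2 - r2 * r0 * p0^2" by simp
    then show ?thesis using l k by (simp add: defs numeral_eq_Suc)
  qed
qed

text \<open>The sequence is defined by doubling, so the Somos relation needs a proof. Replace the
  term m + 4 by the value that the Somos relation forces. The new sequence satisfies all elliptic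
  relations up to there; those with index difference 1 or 2 are the defining recursion, so the
  forced value is the true one. The bound N is essential: the lemma is also applied while only the
  earlier terms are known to be nonzero.\<close>

lemma ell_seq_somos_bounded:
  fixes b \<alpha> \<beta> :: "'a::field"
  defines "W \<equiv> ell_seq b \<alpha> \<beta>"
  assumes nz: "\<And>j. 1 \<le> j \<Longrightarrow> j \<le> N \<Longrightarrow> W j \<noteq> 0" and "m + 4 \<le> N + 1"
  shows "W (m + 4) * W m = b^2 * W (m + 3) * W (m + 1) - (b^2 * \<alpha> - \<beta>^2) * W (m + 2)^2"
  using \<open>m + 4 \<le> N + 1\<close>
proof (induction m rule: less_induct)
  case (less m)
  show ?case
  proof (cases "m = 0")
    case True
    then show ?thesis by (simp add: W_def)
  next
    case False
    define c where "c = b^2 * \<alpha> - \<beta>^2"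
    define V where "V = W(m + 4 := (b^2 * W (m + 3) * W (m + 1) - c * W (m + 2)^2) / W m)"
    have V: "V j = W j" if "j < m + 4" for j using that by (simp add: V_def)
    have Wm: "W m \<noteq> 0" using nz[of m] False less.prems by simp
    have b: "b \<noteq> 0" using nz[of 2] less.prems by (simp add: W_def)
    have ini: "V 0 = 0" "V 1 = 1" "V 2 ^ 2 = b^2" "V 3 = c" "V 4 = (2 * \<beta>) * c * V 2 - b^2 * V 2 ^ 3"
      using False by (simp_all add: V) (simp_all add: W_def c_def algebra_simps power2_eq_square power3_eq_cube power4_eq_xxxx)
    have nzV: "V j \<noteq> 0" if "1 \<le> j" "j \<le> m + 3" for j using that nz[of j] V[of j] less.prems by simp
    have S: "V (k + 4) * V k = b^2 * V (k + 3) * V (k + 1) - c * V (k + 2)^2" if "k + 4 \<le> (m + 3) + 1" for k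
    proof (cases "k = m")
      case True
      have "V (m + 4) = (b^2 * W (m + 3) * W (m + 1) - c * W (m + 2)^2) / W m" by (simp add: V_def)
      then show ?thesis using True Wm by (simp add: V)
    next
      case False
      then show ?thesis using that less.IH[of k] less.prems by (simp add: V c_def)
    qed
    note E = somos_elliptic[OF ini nzV S]
    have "V (m + 4) = W (m + 4)"
    proof (cases "even m")
      case True
      then obtain k where k: "m = 2 * k" "k \<ge> 1" using False by auto
      have lt: "V (k + 4) = W (k + 4)" "V (k + 3) = W (k + 3)" "V (k + 2) = W (k + 2)" "V (k + 1) = W (k + 1)"
         "V k = W k" "V 2 = b"
        using k by (auto intro!: V simp: ) (simp add: V_def W_def)
      have "V (m + 4) * b = V (k + 4) * V (k + 2) * V (k + 1) ^ 2 - V (k + 2) * V k * V (k + 3) ^ 2"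
      proof -
        have idx: "k + 3 + (k + 1) = m + 4" "k + 3 - (k + 1) = 2" "k + 3 + 1 = k + 4" "k + 3 - 1 = k + 2"
          "k + 1 + 1 = k + 2" "k + 1 - 1 = k" using k by auto
        show ?thesis
          by (rule E[where n = "k + 1" and m = "k + 3", unfolded idx lt(6)]) (use k in auto)
      qed
      moreover have "b * W (m + 4) = W (k + 2) * (W (k + 4) * W (k + 1) ^ 2 - W k * W (k + 3) ^ 2)"
        using ell_seq_even[of "k + 2" b \<alpha> \<beta>] unfolding W_def k(1) by (simp add: numeral_eq_Suc)
      ultimately have "b * V (m + 4) = b * W (m + 4)" unfolding lt by Groebner_Basis.algebra
      then show ?thesis using b by simp
    next
      case odd: False
      then obtain k where k: "m = 2 * k + 1" by (elim oddE)
      have lt: "V (k + 4) = W (k + 4)" "V (k + 3) = W (k + 3)" "V (k + 2) = W (k + 2)" "V (k + 1) = W (k + 1)"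
        using k by (auto intro!: V)
      have "V (m + 4) = V (k + 4) * V (k + 2) * V (k + 2) ^ 2 - V (k + 3) * V (k + 1) * V (k + 3) ^ 2"
      proof -
        have idx: "k + 3 + (k + 2) = m + 4" "k + 3 - (k + 2) = 1" "k + 3 + 1 = k + 4" "k + 3 - 1 = k + 2"
          "k + 2 + 1 = k + 3" "k + 2 - 1 = k + 1" using k by auto
        show ?thesis
          using E[where n = "k + 2" and m = "k + 3", unfolded idx ini(2)] k by simp
      qed
      moreover have "W (m + 4) = W (k + 4) * W (k + 2) ^ 3 - W (k + 1) * W (k + 3) ^ 3"
        using ell_seq_odd[of "k + 2" b \<alpha> \<beta>] unfolding W_def k(1) by (simp add: numeral_eq_Suc)
      ultimately show ?thesis unfolding lt by Groebner_Basis.algebra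
    qed
    then show ?thesis using S[of m] by (simp add: V c_def)
  qed
qed

section \<open>Division polynomials of a cubic\<close>

text \<open>A formal leading term: \<open>c\<close> may be 0, as happens when the characteristic
  divides it. In this form leading terms can be added and multiplied in prescribed degrees without
  case distinctions.\<close>

definition lead_at :: "'a::comm_ring_1 poly \<Rightarrow> nat \<Rightarrow> 'a \<Rightarrow> bool" where
  "lead_at p d c \<longleftrightarrow> degree p \<le> d \<and> coeff p d = c"

lemma lead_at_zero [simp]: "lead_at 0 d 0"
  by (simp add: lead_at_def)

lemma lead_at_one [simp]: "lead_at 1 0 1"
  by (simp add: lead_at_def)

lemma lead_at_mult: "lead_at p d c \<Longrightarrow> lead_at q e c' \<Longrightarrow> lead_at (p * q) (d + e) (c * c')"
proof -
  assume "lead_at p d c" "lead_at q e c'"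
  then have d: "degree p \<le> d" "coeff p d = c" "degree q \<le> e" "coeff q e = c'"
    by (auto simp: lead_at_def)
  have "coeff (p * q) (d + e) = (\<Sum>i\<le>d + e. coeff p i * coeff q (d + e - i))"
    by (simp add: coeff_mult)
  also have "\<dots> = (\<Sum>i\<in>{d}. coeff p i * coeff q (d + e - i))"
  proof (rule sum.mono_neutral_right)
    show "\<forall>i\<in>{..d + e} - {d}. coeff p i * coeff q (d + e - i) = 0"
    proof
      fix i assume "i \<in> {..d + e} - {d}"
      then consider "i > d" | "d + e - i > e" by fastforce
      then show "coeff p i * coeff q (d + e - i) = 0"
        using d by cases (auto simp: coeff_eq_0)
    qed
  qed auto
  finally show ?thesis
    using d degree_mult_le[of p q] by (auto simp: lead_at_def)
qed

lemma lead_at_power: "lead_at p d c \<Longrightarrow> lead_at (p ^ k) (k * d) (c ^ k)"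
  by (induction k) (simp_all add: lead_at_mult)

lemma lead_at_diff: "lead_at p d c \<Longrightarrow> lead_at q d c' \<Longrightarrow> lead_at (p - q) d (c - c')"
  by (auto simp: lead_at_def intro: degree_diff_le)

lemma lead_at_add: "lead_at p d c \<Longrightarrow> lead_at q d c' \<Longrightarrow> lead_at (p + q) d (c + c')"
  by (auto simp: lead_at_def intro: degree_add_le)

lemma lead_at_mono: "lead_at p d c \<Longrightarrow> d < e \<Longrightarrow> lead_at p e 0"
  by (auto simp: lead_at_def coeff_eq_0)

lemma lead_at_cong: "lead_at p d c \<Longrightarrow> d = d' \<Longrightarrow> c = c' \<Longrightarrow> lead_at p d' c'"
  by simp

lemma lead_at_nonzero: "lead_at p d c \<Longrightarrow> c \<noteq> 0 \<Longrightarrow> p \<noteq> 0 \<and> degree p = d \<and> lead_coeff p = c"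
proof -
  assume a: "lead_at p d c" "c \<noteq> 0"
  then have "degree p = d" by (auto simp: lead_at_def intro: antisym le_degree)
  then show ?thesis using a by (auto simp: lead_at_def)
qed

text \<open>The discriminant of x^3 + a2 x^2 + a4 x + a6.\<close>

definition cubic_disc :: "'a::comm_ring_1 \<Rightarrow> 'a \<Rightarrow> 'a \<Rightarrow> 'a" where
  "cubic_disc a2 a4 a6 = a2^2 * a4^2 - 4 * a4^3 - 4 * a2^3 * a6 - 27 * a6^2 + 18 * a2 * a4 * a6"

locale cubic =
  fixes a2 a4 a6 :: "'a::field"
  assumes two: "(2::'a) \<noteq> 0" and disc: "cubic_disc a2 a4 a6 \<noteq> 0"
begin

definition "P = [:a6, a4, a2, 1:]"
definition "P' = [:a4, 2 * a2, 3:]"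
text \<open>In classical terms \<open>f n\<close> is psi_n for odd n and psi_n / psi_2 for even n,
  \<open>G n\<close> is psi_n^2, \<Theta> n is psi_(n+1) psi_(n-1), and \<Phi> n / G n is the
  x-coordinate of the n-th multiple.\<close>

definition "f n = divpol (4 * P) [:a2, 3:] P' n"
definition "G n = (if even n then 4 * P else 1) * f n ^ 2"
definition "\<Theta> n = (if even n then 1 else 4 * P) * f (n + 1) * f (n - 1)"
definition "\<Phi> n = [:0, 1:] * G n - \<Theta> n"

lemma four: "(4::'a) \<noteq> 0"
  using two by (metis mult_eq_0_iff mult_2 numeral_Bit0 one_add_one)

text \<open>The resultant identity of P and P'. Its cofactors are integral polynomials in the
  coefficients, so that it can also be used over V.\<close>

lemma bezout_disc:
  "[:-4 * a2^3 + 15 * a2 * a4 - 27 * a6, 18 * a4 - 6 * a2^2:] * P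
   + [:a2^2 * a4 - 4 * a4^2 + 3 * a2 * a6, 2 * a2^3 - 7 * a2 * a4 + 9 * a6, 2 * a2^2 - 6 * a4:] * P'
   = [:cubic_disc a2 a4 a6:]"
  by (simp add: P_def P'_def cubic_disc_def power2_eq_square power3_eq_cube algebra_simps)

lemma P_nz [simp]: "P \<noteq> 0" and degree_P [simp]: "degree P = 3" and lead_P [simp]: "lead_coeff P = 1"
  by (simp_all add: P_def)

lemma power_mod_cong:
  fixes a b c :: "'b::field poly"
  shows "a mod c = b mod c \<Longrightarrow> a ^ k mod c = b ^ k mod c"
  by (metis power_mod)

text \<open>P' is invertible modulo P, because disc(P) is nonzero.\<close>

lemma not_P_dvd_P'_power: "\<not> P dvd smult c (P' ^ k)" if "c \<noteq> 0"
proof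
  assume *: "P dvd smult c (P' ^ k)"
  obtain u w where uw: "u * P + w * P' = [:cubic_disc a2 a4 a6:]" using bezout_disc by blast
  have "(w * P') ^ k mod P = ([:cubic_disc a2 a4 a6:] - u * P) ^ k mod P"
    unfolding uw[symmetric] by simp
  also have "\<dots> = [:cubic_disc a2 a4 a6:] ^ k mod P"
    by (rule power_mod_cong) (simp add: mod_eq_dvd_iff)
  finally have "P dvd (w * P') ^ k \<longleftrightarrow> P dvd [:cubic_disc a2 a4 a6:] ^ k"
    by (simp add: dvd_eq_mod_eq_0)
  moreover have "P dvd (w * P') ^ k"
    using * that by (simp add: power_mult_distrib dvd_smult_iff)
  ultimately have "P dvd [:cubic_disc a2 a4 a6 ^ k:]" by (simp add: poly_const_pow)
  then have "degree P \<le> degree [:cubic_disc a2 a4 a6 ^ k:]"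
    using disc by (intro dvd_imp_degree_le) auto
  then show False by simp
qed

lemma f_initial [simp]: "f 0 = 0" "f (Suc 0) = 1" "f 2 = 1" "f 3 = 4 * P * [:a2, 3:] - P'^2"
  "f (Suc (Suc 0)) = 1"
  by (simp_all add: f_def)

lemma f_even: "m \<ge> 2 \<Longrightarrow> f (2 * m) = f m * (f (m + 2) * f (m - 1)^2 - f (m - 2) * f (m + 1)^2)"
  by (simp add: f_def divpol_even)

lemma f_odd: "m \<ge> 1 \<Longrightarrow> f (2 * m + 1) =
      (if even m then (4 * P)^2 else 1) * f (m + 2) * f m^3
    - (if even m then 1 else (4 * P)^2) * f (m - 1) * f (m + 1)^3"
  unfolding f_def by (rule divpol_odd)

definition "signed_power_mod_P a i \<longleftrightarrow> P dvd a - P' ^ i \<or> P dvd a + P' ^ i"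

lemma signed_power_mod_P_mult:
  assumes "signed_power_mod_P a i" "signed_power_mod_P b j"
  shows "signed_power_mod_P (a * b) (i + j)"
proof -
  have "P dvd a * b - P' ^ (i + j)" if "P dvd a - P' ^ i" "P dvd b - P' ^ j"
  proof -
    have "a * b - P' ^ (i + j) = (a - P' ^ i) * b + P' ^ i * (b - P' ^ j)"
      by (simp add: power_add algebra_simps)
    then show ?thesis using that by simp
  qed
  moreover have "P dvd a * b + P' ^ (i + j)" if "P dvd a - P' ^ i" "P dvd b + P' ^ j"
  proof -
    have "a * b + P' ^ (i + j) = (a - P' ^ i) * b + P' ^ i * (b + P' ^ j)"
      by (simp add: power_add algebra_simps)
    then show ?thesis using that by simp
  qed
  moreover have "P dvd a * b + P' ^ (i + j)" if "P dvd a + P' ^ i" "P dvd b - P' ^ j"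
  proof -
    have "a * b + P' ^ (i + j) = (a + P' ^ i) * b - P' ^ i * (b - P' ^ j)"
      by (simp add: power_add algebra_simps)
    then show ?thesis using that by simp
  qed
  moreover have "P dvd a * b - P' ^ (i + j)" if "P dvd a + P' ^ i" "P dvd b + P' ^ j"
  proof -
    have "a * b - P' ^ (i + j) = (a + P' ^ i) * b - P' ^ i * (b + P' ^ j)"
      by (simp add: power_add algebra_simps)
    then show ?thesis using that by simp
  qed
  ultimately show ?thesis using assms unfolding signed_power_mod_P_def by argo
qed

lemma signed_power_mod_P_cube:
  assumes "signed_power_mod_P a i" "signed_power_mod_P b j"
  shows "signed_power_mod_P (a * b ^ 3) (i + 3 * j)"
proof -
  have "signed_power_mod_P (a * (b * (b * b))) (i + (j + (j + j)))"
    by (intro signed_power_mod_P_mult assms)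
  moreover have "i + (j + (j + j)) = i + 3 * j" by simp
  ultimately show ?thesis by (simp add: power3_eq_cube mult.assoc)
qed

lemma signed_power_mod_P_shift:
  assumes "signed_power_mod_P a i"
  shows "signed_power_mod_P (P * c - a) i" "signed_power_mod_P (a - P * c) i"
proof -
  have 1: "P * c - a - P' ^ i = P * c - (a + P' ^ i)" "P * c - a + P' ^ i = P * c - (a - P' ^ i)"
    "a - P * c - P' ^ i = (a - P' ^ i) - P * c" "a - P * c + P' ^ i = (a + P' ^ i) - P * c"
    by simp_all
  have "P dvd P * c" by simp
  then show "signed_power_mod_P (P * c - a) i" "signed_power_mod_P (a - P * c) i"
    using assms dvd_diff unfolding signed_power_mod_P_def 1 by metis+
qed

text \<open>In the recursion for index 2 k + 1 one of the two terms carries the factor (4 P)^2 and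
  vanishes modulo P; the other one involves odd indices only, and its exponents of P' add up to k (k
  + 1).\<close>

lemma f_odd_mod_P: "signed_power_mod_P (f (2 * k + 1)) (k * (k + 1))"
proof (induction k rule: less_induct)
  case (less k)
  have "k = 0 \<or> k = 1 \<or> (\<exists>j. k = 2 * Suc j) \<or> (\<exists>j. k = 2 * Suc j + 1)"
    by presburger
  then consider "k = 0" | "k = 1" | j where "k = 2 * Suc j" | j where "k = 2 * Suc j + 1"
    by blast
  then show ?case
  proof cases
    case 1
    then show ?thesis by (simp add: signed_power_mod_P_def)
  next
    case 2
    have "signed_power_mod_P (P * (4 * [:a2, 3:]) - P'^2) 2"
      by (rule signed_power_mod_P_shift) (simp add: signed_power_mod_P_def)
    moreover have "f (2 * k + 1) = P * (4 * [:a2, 3:]) - P'^2"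
      using 2 f_initial(4) by (simp only: mult_1_right mult.assoc mult.left_commute[of P 4]) simp
    ultimately show ?thesis using 2 by (simp add: numeral_2_eq_2)
  next
    case (3 j)
    have e: "f (2 * k + 1) = P * (16 * P * f (k + 2) * f k^3) - f (2 * j + 1) * f (2 * Suc j + 1)^3"
    proof -
      have "k - 1 = 2 * j + 1" "k + 1 = 2 * Suc j + 1" "k \<ge> 1" "even k" using 3 by auto
      then show ?thesis using f_odd[of k] by (simp add: power_mult_distrib power2_eq_square mult.assoc mult.left_commute)
    qed
    have "k * (k + 1) = j * (j + 1) + 3 * (Suc j * (Suc j + 1))"
      using 3 by (auto simp: algebra_simps)
    then show ?thesis unfolding e
      by (simp only:) (intro signed_power_mod_P_shift(1) signed_power_mod_P_cube less; use 3 in simp)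
  next
    case (4 j)
    have e: "f (2 * k + 1) = f (2 * Suc (Suc j) + 1) * f (2 * Suc j + 1)^3 - P * (16 * P * f (k - 1) * f (k + 1)^3)"
    proof -
      have "k + 2 = 2 * Suc (Suc j) + 1" "k = 2 * Suc j + 1" "k \<ge> 1" "odd k" using 4 by auto
      then show ?thesis using f_odd[of k] by (simp add: power_mult_distrib power2_eq_square mult.assoc mult.left_commute)
    qed
    have "k * (k + 1) = Suc (Suc j) * (Suc (Suc j) + 1) + 3 * (Suc j * (Suc j + 1))"
      using 4 by (auto simp: algebra_simps)
    then show ?thesis unfolding e
      by (simp only:) (intro signed_power_mod_P_shift(2) signed_power_mod_P_cube less; use 4 in simp)
  qed
qed

lemma f_odd_nz: "f (2 * k + 1) \<noteq> 0"
  using f_odd_mod_P[of k] not_P_dvd_P'_power[of 1 "k * (k + 1)"]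
  unfolding signed_power_mod_P_def by fastforce

lemma G_odd_mod_P: "P dvd G (2 * k + 1) - P' ^ (2 * k * (k + 1))"
proof -
  define D where "D = P' ^ (k * (k + 1))"
  have "2 * k * (k + 1) = k * (k + 1) + k * (k + 1)" by simp
  then have "P' ^ (2 * k * (k + 1)) = D * D" unfolding D_def by (metis power_add)
  then have "G (2 * k + 1) - P' ^ (2 * k * (k + 1)) = (f (2 * k + 1) - D) * (f (2 * k + 1) + D)"
    by (auto simp: G_def power2_eq_square ring_distribs)
  then show ?thesis using f_odd_mod_P[of k] unfolding signed_power_mod_P_def D_def by auto
qed

text \<open>The formal leading coefficient of psi_n is n. After division by psi_2 = 2 y it becomes n
  / 2 for even n, which is again a natural number and thus makes sense in every
  characteristic.\<close>

lemma lead_f_odd_even: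
  "lead_at (f (2 * k + 1)) (2 * k^2 + 2 * k) (of_nat (2 * k + 1)) \<and>
   (k \<ge> 1 \<longrightarrow> lead_at (f (2 * k)) (2 * k^2 - 2) (of_nat k))"
proof -
  have P: "lead_at (4 * P) 3 4"
  proof -
    have "lead_at ([:4:] * P) (0 + 3) (4 * 1)"
      by (rule lead_at_mult) (simp_all add: lead_at_def P_def numeral_3_eq_3)
    then show ?thesis by (simp add: numeral_poly)
  qed
  have al: "lead_at [:a2, 3:] 1 3" and be: "lead_at P' 2 3"
    by (simp_all add: lead_at_def P'_def numeral_2_eq_2)
  have c: "lead_at (f 3) 4 3"
    unfolding f_initial(4)
    by (rule lead_at_cong[OF lead_at_diff[OF lead_at_mult[OF P al] lead_at_cong[OF lead_at_power[OF be, of 2]]]])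
       auto
  have d: "lead_at (f 4) 6 2"
  proof -
    have e: "f 4 = ([:2:] * P') * f 3 - (4 * P)^2" by (simp add: f_def numeral_poly)
    show ?thesis unfolding e
      by (rule lead_at_cong[OF lead_at_diff[OF lead_at_mult[OF lead_at_mult[OF _ be] c]
              lead_at_cong[OF lead_at_power[OF P, of 2]]]])
         (auto simp: lead_at_def)
  qed
  have P2: "lead_at ((4 * P)^2) 6 16"
    by (rule lead_at_cong[OF lead_at_power[OF P, of 2]]) auto
  \<comment> \<open>Both parities are treated in one induction, because each recursion mixes
    them.\<close>
  have lo: "lead_at (f (2 * k + 1)) (2 * k^2 + 2 * k) (of_nat (2 * k + 1))"
    and le: "lead_at (f (2 * Suc k)) (2 * (Suc k)^2 - 2) (of_nat (Suc k))" for k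
  proof (induction k rule: less_induct)
    case (less k)
    {
      case 1
      have "k = 0 \<or> k = 1 \<or> (\<exists>j. k = 2 * Suc j) \<or> (\<exists>j. k = 2 * Suc j + 1)"
        by presburger
      then consider "k = 0" | "k = 1" | j where "k = 2 * Suc j" | j where "k = 2 * Suc j + 1"
        by blast
      then show ?case
      proof cases
        case 1
        then show ?thesis by simp
      next
        case 2
        then show ?thesis using c by (simp add: numeral_eq_Suc)
      next
        case (3 j)
        have e: "f (2 * k + 1) = (4 * P)^2 * f (2 * Suc (Suc j)) * f (2 * Suc j)^3 - 1 * f (2 * j + 1) * f (2 * Suc j + 1)^3"
          using f_odd[of k] 3 by simp
        have "lead_at ((4 * P)^2 * f (2 * Suc (Suc j)) * f (2 * Suc j)^3) (2 * k^2 + 2 * k)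
            (16 * of_nat (Suc (Suc j)) * of_nat (Suc j)^3)"
          by (rule lead_at_cong[OF lead_at_mult[OF lead_at_mult[OF P2 less(2)] lead_at_power[OF less(2)]]])
             (use 3 in \<open>auto simp: power2_eq_square algebra_simps\<close>)
        moreover have "lead_at (1 * f (2 * j + 1) * f (2 * Suc j + 1)^3) (2 * k^2 + 2 * k)
            (1 * of_nat (2 * j + 1) * of_nat (2 * Suc j + 1)^3)"
          by (rule lead_at_cong[OF lead_at_mult[OF lead_at_mult[OF lead_at_one less(1)] lead_at_power[OF less(1)]]])
             (use 3 in \<open>auto simp: power2_eq_square algebra_simps\<close>)
        ultimately show ?thesis unfolding e
          by (rule lead_at_cong[OF lead_at_diff])
             (use 3 in \<open>auto simp: power2_eq_square power3_eq_cube algebra_simps\<close>)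
      next
        case (4 j)
        have e: "f (2 * k + 1) = 1 * f (2 * Suc (Suc j) + 1) * f (2 * Suc j + 1)^3 - (4 * P)^2 * f (2 * Suc j) * f (2 * Suc (Suc j))^3"
        proof -
          have "odd k" "k \<ge> 1" using 4 by auto
          then have "f (2 * k + 1) = 1 * f (k + 2) * f k^3 - (4 * P)^2 * f (k - 1) * f (k + 1)^3"
            using f_odd[of k] by simp
          moreover have "k + 2 = 2 * Suc (Suc j) + 1" "f k = f (2 * Suc j + 1)" "k - 1 = 2 * Suc j"
            "k + 1 = 2 * Suc (Suc j)" using 4 by auto
          ultimately show ?thesis by (simp only:)
        qed
        have "lead_at (1 * f (2 * Suc (Suc j) + 1) * f (2 * Suc j + 1)^3) (2 * k^2 + 2 * k)
            (1 * of_nat (2 * Suc (Suc j) + 1) * of_nat (2 * Suc j + 1)^3)"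
          by (rule lead_at_cong[OF lead_at_mult[OF lead_at_mult[OF lead_at_one less(1)] lead_at_power[OF less(1)]]])
             (use 4 in \<open>auto simp: power2_eq_square algebra_simps\<close>)
        moreover have "lead_at ((4 * P)^2 * f (2 * Suc j) * f (2 * Suc (Suc j))^3) (2 * k^2 + 2 * k)
            (16 * of_nat (Suc j) * of_nat (Suc (Suc j))^3)"
          by (rule lead_at_cong[OF lead_at_mult[OF lead_at_mult[OF P2 less(2)] lead_at_power[OF less(2)]]])
             (use 4 in \<open>auto simp: power2_eq_square algebra_simps\<close>)
        ultimately show ?thesis unfolding e
          by (rule lead_at_cong[OF lead_at_diff])
             (use 4 in \<open>auto simp: power2_eq_square power3_eq_cube algebra_simps\<close>)
      qed
    next
      case 2
      have "k = 0 \<or> k = 1 \<or> k = 2 \<or> (\<exists>j. k = 2 * Suc j + 1) \<or> (\<exists>j. k = 2 * Suc (Suc j))"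
        by presburger
      then consider "k = 0" | "k = 1" | "k = 2" | j where "k = 2 * Suc j + 1" | j where "k = 2 * Suc (Suc j)"
        by blast
      then show ?case
      proof cases
        case 1
        then show ?thesis by (simp add: numeral_2_eq_2[symmetric])
      next
        case 2
        then show ?thesis using d by (simp add: power2_eq_square)
      next
        case 3
        have e: "f (2 * Suc k) = f (2 * 1 + 1) * (f (2 * 2 + 1) * f (2 * Suc 0) ^ 2 - 1 * f (2 * Suc 1)^2)"
          using f_even[of 3] 3 by (simp add: numeral_eq_Suc)
        have 4: "lead_at (f (2 * 1 + 1)) 4 3" using c by simp
        have 5: "lead_at (f (2 * Suc 0)) 0 1" by (simp add: numeral_2_eq_2[symmetric])
        have 6: "lead_at (f (2 * Suc 1)) 6 2" using d by simp
        have 7: "lead_at (f (2 * 2 + 1)) 12 5"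
        proof -
          have "f (2 * 2 + 1) = (4 * P)^2 * f 4 - f 3 ^ 3"
            using f_odd[of 2] by (simp add: numeral_eq_Suc)
          moreover have "lead_at ((4 * P)^2 * f 4 - f 3 ^ 3) 12 5"
            by (rule lead_at_cong[OF lead_at_diff[OF lead_at_mult[OF P2 d] lead_at_cong[OF lead_at_power[OF c, of 3]]]]) auto
          ultimately show ?thesis by simp
        qed
        have 8: "lead_at (f (2 * 2 + 1) * f (2 * Suc 0) ^ 2) 12 5"
          by (rule lead_at_cong[OF lead_at_mult[OF 7 lead_at_power[OF 5]]]) auto
        have 9: "lead_at (1 * f (2 * Suc 1)^2) 12 4"
          by (rule lead_at_cong[OF lead_at_mult[OF lead_at_one lead_at_power[OF 6]]]) auto
        show ?thesis unfolding e
          by (rule lead_at_cong[OF lead_at_mult[OF 4 lead_at_diff[OF 8 9]]]) (use 3 in auto)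
      next
        case (4 j)
        have e: "f (2 * Suc k) = f (2 * Suc (Suc j)) *
          (f (2 * Suc (Suc (Suc j))) * f (2 * Suc j + 1)^2 - f (2 * Suc j) * f (2 * Suc (Suc j) + 1)^2)"
          using f_even[of "Suc k"] 4 by (simp add: numeral_eq_Suc)
        have A: "lead_at (f (2 * Suc (Suc (Suc j))) * f (2 * Suc j + 1)^2) (6 * (Suc (Suc j))^2)
           (of_nat (Suc (Suc (Suc j))) * of_nat (2 * Suc j + 1)^2)"
          by (rule lead_at_cong[OF lead_at_mult[OF less(2) lead_at_power[OF less(1)]]])
             (use 4 in \<open>auto simp: power2_eq_square algebra_simps\<close>)
        have B: "lead_at (f (2 * Suc j) * f (2 * Suc (Suc j) + 1)^2) (6 * (Suc (Suc j))^2)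
           (of_nat (Suc j) * of_nat (2 * Suc (Suc j) + 1)^2)"
          by (rule lead_at_cong[OF lead_at_mult[OF less(2) lead_at_power[OF less(1)]]])
             (use 4 in \<open>auto simp: power2_eq_square algebra_simps\<close>)
        show ?thesis unfolding e
          by (rule lead_at_cong[OF lead_at_mult[OF less(2) lead_at_diff[OF A B]]])
             (use 4 in \<open>auto simp: power2_eq_square algebra_simps\<close>)
      next
        case (5 j)
        have e: "f (2 * Suc k) = f (2 * Suc (Suc j) + 1) *
          (f (2 * Suc (Suc (Suc j)) + 1) * f (2 * Suc (Suc j))^2 - f (2 * Suc j + 1) * f (2 * Suc (Suc (Suc j)))^2)"
          using f_even[of "Suc k"] 5 by (simp add: numeral_eq_Suc)
        have A: "lead_at (f (2 * Suc (Suc (Suc j)) + 1) * f (2 * Suc (Suc j))^2) (6 * (Suc (Suc j))^2 + 6 * Suc (Suc j))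
           (of_nat (2 * Suc (Suc (Suc j)) + 1) * of_nat (Suc (Suc j))^2)"
          by (rule lead_at_cong[OF lead_at_mult[OF less(1) lead_at_power[OF less(2)]]])
             (use 5 in \<open>auto simp: power2_eq_square algebra_simps\<close>)
        have B: "lead_at (f (2 * Suc j + 1) * f (2 * Suc (Suc (Suc j)))^2) (6 * (Suc (Suc j))^2 + 6 * Suc (Suc j))
           (of_nat (2 * Suc j + 1) * of_nat (Suc (Suc (Suc j)))^2)"
          by (rule lead_at_cong[OF lead_at_mult[OF less(1) lead_at_power[OF less(2)]]])
             (use 5 in \<open>auto simp: power2_eq_square algebra_simps\<close>)
        show ?thesis unfolding e
          by (rule lead_at_cong[OF lead_at_mult[OF less(1) lead_at_diff[OF A B]]])
             (use 5 in \<open>auto simp: power2_eq_square algebra_simps\<close>)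
      qed
    }
  qed
  show ?thesis using lo[of k] le[of "k - 1"] by (cases k) auto
qed

end

section \<open>Composition: the sequence belonging to a multiple of a point\<close>

lemma ell_seq_elliptic:
  fixes b \<alpha> \<beta> :: "'a::field"
  defines "W \<equiv> ell_seq b \<alpha> \<beta>"
  assumes nz: "\<And>j. 1 \<le> j \<Longrightarrow> W j \<noteq> 0" and "1 \<le> n" "n \<le> m"
  shows "W (m + n) * W (m - n) = W (m + 1) * W (m - 1) * W n ^ 2 - W (n + 1) * W (n - 1) * W m ^ 2"
proof -
  have S: "W (m + 4) * W m = b^2 * W (m + 3) * W (m + 1) - (b^2 * \<alpha> - \<beta>^2) * W (m + 2)^2" for m
    unfolding W_def by (rule ell_seq_somos_bounded[where N = "m + 4"]) (use nz in \<open>auto simp: W_def\<close>)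
  show ?thesis
    by (rule somos_elliptic[where N = "m + n" and A = "b^2" and c = "b^2 * \<alpha> - \<beta>^2" and J = "2 * \<beta>"])
       (use assms S in \<open>auto simp: algebra_simps power2_eq_square power3_eq_cube power4_eq_xxxx\<close>)
qed

lemma ell_seq_invariant:
  fixes b \<alpha> \<beta> :: "'a::field"
  defines "W \<equiv> ell_seq b \<alpha> \<beta>"
  assumes nz: "\<And>j. 1 \<le> j \<Longrightarrow> j \<le> N \<Longrightarrow> W j \<noteq> 0" and "m + 4 \<le> N + 1"
  shows "W (m + 1)^2 * W (m + 4) + W (m + 3)^2 * W m =
      2 * \<beta> * W (m + 3) * W (m + 1) * W (m + 2) - b^2 * W (m + 2)^3"
  by (rule somos_invariant[where N = N and c = "b^2 * \<alpha> - \<beta>^2"])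
     (use assms ell_seq_somos_bounded[of N b \<alpha> \<beta>] in
        \<open>auto simp: W_def algebra_simps power2_eq_square power3_eq_cube power4_eq_xxxx\<close>)

text \<open>The base on the left is b W(2n) / W(n) by the doubling recursion. By (s - t)^2 = (s +
  t)^2 - 4 s t its square is known: the invariant gives the sum and the Somos relation the product.
  The result involves only psi_n^2 and psi_(n+1) psi_(n-1).\<close>

lemma doubling_square:
  fixes b \<alpha> \<beta> p2 p1 p0 q1 q2 :: "'a::field"
  assumes S: "p2 * q2 = b^2 * p1 * q1 - (b^2 * \<alpha> - \<beta>^2) * p0^2"
    and I: "q1^2 * p2 + p1^2 * q2 = 2 * \<beta> * p1 * q1 * p0 - b^2 * p0^3"
  shows "(p2 * q1^2 - q2 * p1^2)^2 =
     b^2 * (b^2 * (p0^2)^3 - 4 * \<beta> * (p1 * q1) * (p0^2)^2 + 4 * \<alpha> * (p1 * q1)^2 * p0^2 - 4 * (p1 * q1)^3)"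
proof -
  have "(p2 * q1^2 - q2 * p1^2)^2 = (q1^2 * p2 + p1^2 * q2)^2 - 4 * p1^2 * q1^2 * (p2 * q2)"
    by Groebner_Basis.algebra
  also have "\<dots> = b^2 * (b^2 * (p0^2)^3 - 4 * \<beta> * (p1 * q1) * (p0^2)^2 + 4 * \<alpha> * (p1 * q1)^2 * p0^2 - 4 * (p1 * q1)^3)"
    unfolding S I by Groebner_Basis.algebra
  finally show ?thesis .
qed

text \<open>The terms of index divisible by \<open>n\<close> form, after rescaling, the sequence of the \<open>n\<close>-th multiple
  of the point.\<close>

lemma ell_seq_compose:
  fixes b \<alpha> \<beta> :: "'a::field"
  defines "W \<equiv> ell_seq b \<alpha> \<beta>"
  assumes nz: "\<And>j. 1 \<le> j \<Longrightarrow> W j \<noteq> 0" and n: "1 \<le> n"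
  defines "u \<equiv> W (n + 1) * W (n - 1) / W n ^ 2"
  defines "b' \<equiv> W (2 * n) / W n ^ 4" and "\<alpha>' \<equiv> \<alpha> - 3 * u" and "\<beta>' \<equiv> \<beta> - 2 * \<alpha> * u + 3 * u^2"
  shows "b'^2 = b^2 - 4 * \<beta> * u + 4 * \<alpha> * u^2 - 4 * u^3"
    and "W (k * n) = W n ^ (k^2) * ell_seq b' \<alpha>' \<beta>' k"
proof -
  have "b'^2 = b^2 - 4 * \<beta> * u + 4 * \<alpha> * u^2 - 4 * u^3 \<and> W (k * n) = W n ^ (k^2) * ell_seq b' \<alpha>' \<beta>' k"
  proof (cases "n = 1")
    case True
    then have "u = 0" "b' = b" by (simp_all add: u_def b'_def W_def)
    then show ?thesis using True by (simp add: \<alpha>'_def \<beta>'_def W_def)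
  next
    case False
    with n have n2: "n \<ge> 2" by simp
    have E: "W (m + j) * W (m - j) = W (m + 1) * W (m - 1) * W j ^ 2 - W (j + 1) * W (j - 1) * W m ^ 2"
      if "1 \<le> j" "j \<le> m" for m j
      unfolding W_def by (rule ell_seq_elliptic) (use nz that in \<open>auto simp: W_def\<close>)
    \<comment> \<open>\<open>U m\<close> is x minus the x-coordinate of the m-th multiple. So x - u
      is the x-coordinate of the n-th multiple, and b', \<alpha>' and \<beta>' are its values of 2
      y, 3 x + a2 and P'(x), the last two by Taylor expansion.\<close>
    define U where "U m = W (m + 1) * W (m - 1) / W m ^ 2" for m
    have EU: "W (m + j) * W (m - j) = W m ^ 2 * W j ^ 2 * (U m - U j)" if "1 \<le> j" "j \<le> m" for m j
    proof -
      have "W (m + 1) * W (m - 1) = U m * W m ^ 2" "W (j + 1) * W (j - 1) = U j * W j ^ 2"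
        using nz[of m] nz[of j] that by (simp_all add: U_def)
      then show ?thesis using E[OF that] by (simp only:) (simp add: algebra_simps)
    qed
    define q p1 q1 p2 q2 where "q = W n" "p1 = W (n + 1)" "q1 = W (n - 1)" "p2 = W (n + 2)" "q2 = W (n - 2)"
    note defs = q_p1_q1_p2_q2_def
    have nzs: "q \<noteq> 0" "p1 \<noteq> 0" "q1 \<noteq> 0" "b \<noteq> 0" "W (2 * n) \<noteq> 0" "W (3 * n) \<noteq> 0"
      using nz[of n] nz[of "n + 1"] nz[of "n - 1"] nz[of 2] nz[of "2 * n"] nz[of "3 * n"] n2
      by (auto simp: defs W_def)
    then have b'nz: "b' \<noteq> 0" by (simp add: b'_def defs)
    have unz: "u \<noteq> 0" using nzs by (simp add: u_def defs)
    have uq: "p1 * q1 = u * q^2" using nzs by (simp add: u_def defs)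
    have Un: "U n = u" by (simp add: U_def u_def)
    have W2n: "W (2 * n) = b' * q^4" using nzs by (simp add: b'_def defs)
    obtain l where l: "n = l + 2" using n2 by (metis add.commute le_Suc_ex)
    have S: "p2 * q2 = b^2 * p1 * q1 - (b^2 * \<alpha> - \<beta>^2) * q^2"
      using ell_seq_somos_bounded[of "n + 2" b \<alpha> \<beta> l] nz unfolding defs W_def l
      by (simp add: numeral_eq_Suc)
    have I: "q1^2 * p2 + p1^2 * q2 = 2 * \<beta> * p1 * q1 * q - b^2 * q^3"
      using ell_seq_invariant[of "n + 2" b \<alpha> \<beta> l] nz unfolding defs W_def l
      by (simp add: numeral_eq_Suc)
    have ev: "b * W (2 * n) = q * (p2 * q1^2 - q2 * p1^2)"
      using ell_seq_even[OF n2, of b \<alpha> \<beta>] by (simp add: defs W_def)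
    have "(b * W (2 * n))^2 = q^2 * (b^2 * (b^2 * (q^2)^3 - 4 * \<beta> * (p1 * q1) * (q^2)^2 + 4 * \<alpha> * (p1 * q1)^2 * q^2 - 4 * (p1 * q1)^3))"
      unfolding ev power_mult_distrib doubling_square[OF S I] ..
    then have "(b^2 * q^8) * b'^2 = (b^2 * q^8) * (b^2 - 4 * \<beta> * u + 4 * \<alpha> * u^2 - 4 * u^3)"
      unfolding W2n uq by Groebner_Basis.algebra
    then have A': "b'^2 = b^2 - 4 * \<beta> * u + 4 * \<alpha> * u^2 - 4 * u^3" using nzs by simp
    \<comment> \<open>The difference between x and the x-coordinate of the multiple by 2 n. The odd
      recursions for 2 n + 1 and 2 n - 1 make z b'^2 a polynomial in u.\<close>
    define z where "z = U (2 * n)"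
    have o1: "W (2 * n + 1) = p2 * q^3 - q1 * p1^3"
      using ell_seq_odd[of n b \<alpha> \<beta>] n by (simp add: defs W_def)
    have o2: "W (2 * n - 1) = p1 * q1^3 - q2 * q^3"
      using ell_seq_odd[of "n - 1" b \<alpha> \<beta>] n2 l by (simp add: defs W_def)
    have "z * W (2 * n)^2 = W (2 * n + 1) * W (2 * n - 1)"
      using nzs by (simp add: z_def U_def)
    also have "\<dots> = q^3 * (p1 * q1) * (q1^2 * p2 + p1^2 * q2) - (p1 * q1)^4 - q^6 * (p2 * q2)"
      unfolding o1 o2 by Groebner_Basis.algebra
    also have "\<dots> = q^8 * (2 * \<beta> * u^2 - u^4 - 2 * b^2 * u + (b^2 * \<alpha> - \<beta>^2))"
    proof -
      have "q^3 * (p1 * q1) * (2 * \<beta> * (p1 * q1) * q - b^2 * q^3) - (p1 * q1)^4 - q^6 * (b^2 * (p1 * q1) - (b^2 * \<alpha> - \<beta>^2) * q^2)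
         = q^8 * (2 * \<beta> * u^2 - u^4 - 2 * b^2 * u + (b^2 * \<alpha> - \<beta>^2))"
        unfolding uq by Groebner_Basis.algebra
      then show ?thesis unfolding S I by (simp add: mult.assoc)
    qed
    finally have "q^8 * (z * b'^2) = q^8 * (2 * \<beta> * u^2 - u^4 - 2 * b^2 * u + (b^2 * \<alpha> - \<beta>^2))"
      unfolding W2n by Groebner_Basis.algebra
    then have zA: "z * b'^2 = 2 * \<beta> * u^2 - u^4 - 2 * b^2 * u + (b^2 * \<alpha> - \<beta>^2)"
      using nzs by simp
    \<comment> \<open>The scaling factor W(n)^(k^2) normalises the subsequence to the value 1 at k =
      1.\<close>
    define V where "V k = W (k * n) / q ^ (k^2)" for k
    have Vnz: "V k \<noteq> 0" if "k \<ge> 1" for k using that n nzs nz[of "k * n"] by (simp add: V_def)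
    have V01: "V 0 = 0" "V 1 = 1"
      using nzs(1) by (simp add: V_def W_def) (use nzs(1) in \<open>simp add: V_def defs\<close>)
    \<comment> \<open>The scaling factors on both sides agree by the parallelogram law for
      squares.\<close>
    have VD: "V (k + j) * V (k - j) = V k ^ 2 * V j ^ 2 * (U (k * n) - U (j * n))" if "1 \<le> j" "j \<le> k" for k j
    proof -
      have "(k + j)^2 + (k - j)^2 = 2 * k^2 + 2 * j^2"
      proof -
        define i where "i = k - j"
        then have "k = j + i" "k - j = i" using that by auto
        then show ?thesis by (simp add: power2_eq_square distrib_left distrib_right)
      qed
      then have "q ^ ((k + j)^2) * q ^ ((k - j)^2) = q ^ (2 * k^2 + 2 * j^2)"
        by (metis power_add)
      also have "\<dots> = (q ^ (k^2)) ^ 2 * (q ^ (j^2)) ^ 2"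
        by (simp only: power_add power_mult[symmetric] mult.commute[of _ "2::nat"])
      finally have pw: "q ^ ((k + j)^2) * q ^ ((k - j)^2) = (q ^ (k^2)) ^ 2 * (q ^ (j^2)) ^ 2" .
      have "W ((k + j) * n) * W ((k - j) * n) = W (k * n) ^ 2 * W (j * n) ^ 2 * (U (k * n) - U (j * n))"
        using EU[of "j * n" "k * n"] that n by (simp add: add_mult_distrib diff_mult_distrib)
      then show ?thesis unfolding V_def using pw by (simp add: power_divide)
    qed
    have V1: "V (k + 1) * V (k - 1) = V k ^ 2 * (U (k * n) - u)" if "1 \<le> k" for k
      using VD[of 1 k] that V01 Un by simp
    have VE: "V (k + j) * V (k - j) = V (k + 1) * V (k - 1) * V j ^ 2 - V (j + 1) * V (j - 1) * V k ^ 2"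
      if "1 \<le> j" "j \<le> k" for k j
    proof -
      have "1 \<le> k" using that by simp
      show ?thesis unfolding VD[OF that] V1[OF \<open>1 \<le> k\<close>] V1[OF that(1)] by Groebner_Basis.algebra
    qed
    have V2: "V 2 = b'" by (simp add: V_def b'_def defs)
    have V3: "V 3 = b'^2 * \<alpha>' - \<beta>'^2"
    proof -
      have "V 3 = z * b'^2 - u * b'^2"
        using V1[of 2] V2 V01 by (simp add: z_def numeral_3_eq_3 numeral_2_eq_2 algebra_simps)
      also have "\<dots> = b'^2 * \<alpha>' - \<beta>'^2"
        unfolding zA unfolding A' \<alpha>'_def \<beta>'_def by Groebner_Basis.algebra
      finally show ?thesis .
    qed
    have V3': "V 3 = b'^2 * (z - u)"
      using V1[of 2] V2 V01 by (simp add: z_def numeral_3_eq_3 numeral_2_eq_2 algebra_simps)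
    have V4: "V 4 = b' * (2 * \<beta>' * (b'^2 * \<alpha>' - \<beta>'^2) - b'^4)"
    proof -
      \<comment> \<open>The corresponding difference for 3 n. It is found by multiplying the
        relations for (2 n, n + 1) and (2 n, n - 1), whose left sides contain W(3n+1) and
        W(3n-1).\<close>
      define t where "t = U (3 * n)"
      have Ep: "u^2 * U (n + 1) * q^3 = p2 * q1^2" "u^2 * U (n - 1) * q^3 = q2 * p1^2"
        using nzs unfolding U_def u_def defs l by (simp_all add: field_simps power2_eq_square power3_eq_cube)
      have e1: "W (3 * n + 1) * W (n - 1) = W (2 * n)^2 * p1^2 * (z - U (n + 1))"
        using EU[of "n + 1" "2 * n"] n2 by (simp add: defs z_def algebra_simps mult_2 numeral_3_eq_3)
      have e2: "W (3 * n - 1) * W (n + 1) = W (2 * n)^2 * q1^2 * (z - U (n - 1))"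
      proof -
        have "2 * n + (n - 1) = 3 * n - 1" "2 * n - (n - 1) = n + 1" using n2 by auto
        then show ?thesis using EU[of "n - 1" "2 * n"] n2 unfolding defs z_def by auto
      qed
      have e3: "W (3 * n) * q = W (2 * n)^2 * q^2 * (z - u)"
        using EU[of n "2 * n"] n Un by (simp add: defs z_def)
      have e4: "t * W (3 * n)^2 = W (3 * n + 1) * W (3 * n - 1)"
        using nzs by (simp add: t_def U_def)
      have "t * u * (z - u)^2 * (W (2 * n)^4 * q^4) = (t * W (3 * n)^2) * (p1 * q1)"
      proof -
        have "(t * W (3 * n)^2) * (p1 * q1) = t * u * (W (3 * n) * q)^2" unfolding uq by Groebner_Basis.algebra
        then show ?thesis unfolding e3 by Groebner_Basis.algebra
      qed
      also have "\<dots> = (W (3 * n + 1) * W (n - 1)) * (W (3 * n - 1) * W (n + 1))"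
        unfolding e4 defs by (simp add: ac_simps)
      also have "\<dots> = W (2 * n)^4 * (p1 * q1)^2 * (z - U (n + 1)) * (z - U (n - 1))"
        unfolding e1 e2 by Groebner_Basis.algebra
      also have "\<dots> = (u^2 * (z - U (n + 1)) * (z - U (n - 1))) * (W (2 * n)^4 * q^4)"
        unfolding uq by Groebner_Basis.algebra
      finally have "t * u * (z - u)^2 = u^2 * (z - U (n + 1)) * (z - U (n - 1))"
        using nzs by simp
      then have "(t * u * (z - u)^2) * (u^2 * q^6) = (u^2 * (z - U (n + 1)) * (z - U (n - 1))) * (u^2 * q^6)"
        by simp
      also have "\<dots> = u^4 * q^6 * z^2 - z * u^2 * q^3 * (u^2 * U (n + 1) * q^3 + u^2 * U (n - 1) * q^3)
          + (u^2 * U (n + 1) * q^3) * (u^2 * U (n - 1) * q^3)"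
        by Groebner_Basis.algebra
      also have "\<dots> = u^4 * q^6 * z^2 - z * u^2 * q^3 * (q1^2 * p2 + p1^2 * q2) + (p1 * q1)^2 * (p2 * q2)"
        unfolding Ep by Groebner_Basis.algebra
      also have "\<dots> = (u^2 * z^2 - z * (2 * \<beta> * u - b^2) + (b^2 * u - (b^2 * \<alpha> - \<beta>^2))) * (u^2 * q^6)"
      proof -
        have "u^4 * q^6 * z^2 - z * u^2 * q^3 * (2 * \<beta> * (p1 * q1) * q - b^2 * q^3) + (p1 * q1)^2 * (b^2 * (p1 * q1) - (b^2 * \<alpha> - \<beta>^2) * q^2)
          = (u^2 * z^2 - z * (2 * \<beta> * u - b^2) + (b^2 * u - (b^2 * \<alpha> - \<beta>^2))) * (u^2 * q^6)"
          unfolding uq by Groebner_Basis.algebra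
        then show ?thesis unfolding S I by (simp add: mult.assoc)
      qed
      finally have H: "t * u * (z - u)^2 = u^2 * z^2 - z * (2 * \<beta> * u - b^2) + (b^2 * u - (b^2 * \<alpha> - \<beta>^2))"
        using nzs unz by simp
      have "V 4 * b' = V 3 ^ 2 * (t - u)"
        using V1[of 3] V2 by (simp add: t_def numeral_eq_Suc)
      then have "u * (V 4 * b') = b'^4 * (t * u * (z - u)^2 - u^2 * (z - u)^2)"
        unfolding V3' by Groebner_Basis.algebra
      also have "\<dots> = b'^4 * (u * (2 * \<beta>' * (z - u) - b'^2))"
      proof -
        have c: "b^2 * \<alpha> - \<beta>^2 = z * b'^2 + u^4 - 2 * \<beta> * u^2 + 2 * b^2 * u" using zA by simp
        have "u^2 * z^2 - z * (2 * \<beta> * u - b^2) + (b^2 * u - (z * b'^2 + u^4 - 2 * \<beta> * u^2 + 2 * b^2 * u)) - u^2 * (z - u)^2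
            = u * (2 * \<beta>' * (z - u) - b'^2)"
          unfolding A' \<beta>'_def by Groebner_Basis.algebra
        then show ?thesis unfolding H c by simp
      qed
      finally have "(u * b') * V 4 = (u * b') * (b' * (2 * \<beta>' * (b'^2 * (z - u)) - b'^4))"
        by Groebner_Basis.algebra
      then show ?thesis using unz b'nz V3 V3' by simp
    qed
    have "V k = ell_seq b' \<alpha>' \<beta>' k"
    proof (rule ell_seq_unique)
      show "b' * V (2 * m) = V m * (V (m + 2) * V (m - 1)^2 - V (m - 2) * V (m + 1)^2)" if "m \<ge> 3" for m
      proof -
        have "m + 1 + (m - 1) = 2 * m" "m + 1 - (m - 1) = 2" "m + 1 + 1 = m + 2" "m + 1 - 1 = m"
          "m - 1 + 1 = m" "m - 1 - 1 = m - 2" using that by auto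
        then have "V (2 * m) * V 2 = V (m + 2) * V m * V (m - 1)^2 - V m * V (m - 2) * V (m + 1)^2"
          using VE[of "m - 1" "m + 1"] that by (simp only:)
        then show ?thesis unfolding V2 by (simp add: algebra_simps)
      qed
      show "V (2 * m + 1) = V (m + 2) * V m ^3 - V (m - 1) * V (m + 1)^3" if "m \<ge> 2" for m
      proof -
        have "m + 1 + m = 2 * m + 1" "m + 1 - m = 1" "m + 1 + 1 = m + 2" "m + 1 - 1 = m" by auto
        then have "V (2 * m + 1) * V 1 = V (m + 2) * V m * V m^2 - V (m + 1) * V (m - 1) * V (m + 1)^2"
          using VE[of m "m + 1"] that by (simp only:)
        then show ?thesis unfolding V01 by (simp add: power2_eq_square power3_eq_cube ac_simps)
      qed
    qed (use V01 V2 V3 V4 b'nz in auto)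
    then have "W (k * n) = W n ^ (k^2) * ell_seq b' \<alpha>' \<beta>' k"
      using nzs by (simp add: V_def defs field_simps)
    with A' show ?thesis by simp
  qed
  then show "b'^2 = b^2 - 4 * \<beta> * u + 4 * \<alpha> * u^2 - 4 * u^3"
    and "W (k * n) = W n ^ (k^2) * ell_seq b' \<alpha>' \<beta>' k" by auto
qed

section \<open>Leading terms, nonvanishing and specialisation of the division polynomials\<close>

context cubic
begin

lemma four_poly: "(4 :: 'a poly) \<noteq> 0"
  using four by (simp add: numeral_poly)

lemma lead_G: "n \<ge> 1 \<Longrightarrow> lead_at (G n) (n^2 - 1) (of_nat n ^ 2)"
proof -
  assume n: "n \<ge> 1"
  have P: "lead_at (4 * P) 3 4"
  proof -
    have "lead_at ([:4:] * P) (0 + 3) (4 * 1)"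
      by (rule lead_at_mult) (simp_all add: lead_at_def P_def numeral_3_eq_3)
    then show ?thesis by (simp add: numeral_poly)
  qed
  show ?thesis
  proof (cases "even n")
    case True
    then obtain k where k: "n = 2 * k" "k \<ge> 1" using n by auto
    have "lead_at (4 * P * f (2 * k)^2) (3 + 2 * (2 * k^2 - 2)) (4 * of_nat k^2)"
      using lead_f_odd_even[of k] k by (intro lead_at_mult lead_at_power P) auto
    moreover have "3 + 2 * (2 * k^2 - 2) = n^2 - 1"
    proof -
      have "k^2 \<ge> 1" using k by simp
      then show ?thesis unfolding k(1) power_mult_distrib by simp
    qed
    ultimately show ?thesis using k by (simp add: G_def power_mult_distrib)
  next
    case False
    then obtain k where k: "n = 2 * k + 1" by (elim oddE)
    have "lead_at (f (2 * k + 1)^2) (2 * (2 * k^2 + 2 * k)) (of_nat (2 * k + 1)^2)"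
      using lead_f_odd_even[of k] by (intro lead_at_power) auto
    moreover have "2 * (2 * k^2 + 2 * k) = n^2 - 1" using k by (simp add: power2_eq_square)
    ultimately show ?thesis using k by (simp add: G_def)
  qed
qed

lemma lead_\<Theta>: "n \<ge> 1 \<Longrightarrow> lead_at (\<Theta> n) (n^2) (of_nat n ^ 2 - 1)"
proof -
  assume n: "n \<ge> 1"
  have P: "lead_at (4 * P) 3 4"
  proof -
    have "lead_at ([:4:] * P) (0 + 3) (4 * 1)"
      by (rule lead_at_mult) (simp_all add: lead_at_def P_def numeral_3_eq_3)
    then show ?thesis by (simp add: numeral_poly)
  qed
  show ?thesis
  proof (cases "even n")
    case True
    then obtain k where k: "n = 2 * Suc k" using n by (metis evenE not0_implies_Suc mult_0_right not_one_le_zero)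
    have "lead_at (f (2 * Suc k + 1) * f (2 * k + 1)) ((2 * (Suc k)^2 + 2 * Suc k) + (2 * k^2 + 2 * k))
       (of_nat (2 * Suc k + 1) * of_nat (2 * k + 1))"
      by (rule lead_at_mult) (use lead_f_odd_even[of k] lead_f_odd_even[of "Suc k"] in auto)
    moreover have "(2 * (Suc k)^2 + 2 * Suc k) + (2 * k^2 + 2 * k) = n^2"
      using k by (simp add: power2_eq_square)
    moreover have "(of_nat (2 * Suc k + 1) * of_nat (2 * k + 1) :: 'a) = of_nat n ^ 2 - 1"
      using k by (simp add: power2_eq_square algebra_simps)
    ultimately show ?thesis using k by (simp add: \<Theta>_def)
  next
    case False
    show ?thesis
    proof (cases "n = 1")
      case True
      then show ?thesis by (simp add: \<Theta>_def)
    next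
      case n1: False
      with False obtain k where k: "n = 2 * Suc k + 1" by (metis oddE not0_implies_Suc mult_0_right add_0)
      have "lead_at (4 * P * f (2 * Suc (Suc k)) * f (2 * Suc k)) (3 + (2 * (Suc (Suc k))^2 - 2) + (2 * (Suc k)^2 - 2))
         (4 * of_nat (Suc (Suc k)) * of_nat (Suc k))"
        by (intro lead_at_mult P) (use lead_f_odd_even[of "Suc (Suc k)"] lead_f_odd_even[of "Suc k"] in auto)
      moreover have "3 + (2 * (Suc (Suc k))^2 - 2) + (2 * (Suc k)^2 - 2) = n^2"
        using k by (simp add: power2_eq_square)
      moreover have "(4 * of_nat (Suc (Suc k)) * of_nat (Suc k) :: 'a) = of_nat n ^ 2 - 1"
        using k by (simp add: power2_eq_square algebra_simps)
      ultimately show ?thesis using k by (simp add: \<Theta>_def)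
    qed
  qed
qed

text \<open>The formal leading coefficients n^2 of x \<open>G n\<close> and n^2 - 1 of \<Theta> n
  differ by 1, so the leading term survives in every characteristic.\<close>

lemma lead_\<Phi>: "n \<ge> 1 \<Longrightarrow> lead_at (\<Phi> n) (n^2) 1"
proof -
  assume n: "n \<ge> 1"
  have "lead_at ([:0, 1:] * G n) (1 + (n^2 - 1)) (1 * of_nat n ^ 2)"
    by (rule lead_at_mult[OF _ lead_G[OF n]]) (simp add: lead_at_def)
  moreover have "1 + (n^2 - 1) = n^2" using n by simp
  ultimately show ?thesis
    unfolding \<Phi>_def using lead_at_diff[OF _ lead_\<Theta>[OF n], of "[:0, 1:] * G n" "of_nat n^2"] by simp
qed

lemma degree_G_less: "n \<ge> 1 \<Longrightarrow> degree (G n) < n^2"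
proof -
  assume n: "n \<ge> 1"
  then have "n^2 > 0" by simp
  then show ?thesis using lead_G[OF n] unfolding lead_at_def by linarith
qed

text \<open>An arbitrary ring homomorphism \<open>h\<close> out of the polynomial ring, together with a square root
  \<open>b\<close> of the image of \<open>4 P\<close>, is a point of the curve.\<close>

definition curve_hom :: "('a poly \<Rightarrow> 'b::field) \<Rightarrow> 'b \<Rightarrow> bool" where
  "curve_hom h b \<longleftrightarrow> (\<forall>p q. h (p + q) = h p + h q) \<and> (\<forall>p q. h (p * q) = h p * h q) \<and> h 1 = 1
     \<and> b^2 = h (4 * P)"

text \<open>The values of psi_n at the point given by \<open>h\<close> and \<open>b\<close>.\<close>

definition pt_seq :: "('a poly \<Rightarrow> 'b::field) \<Rightarrow> 'b \<Rightarrow> nat \<Rightarrow> 'b" where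
  "pt_seq h b = ell_seq b (h [:a2, 3:]) (h P')"

lemma curve_hom_simps:
  assumes "curve_hom h b"
  shows "h (p + q) = h p + h q" "h (p * q) = h p * h q" "h 1 = 1" "h 0 = 0" "h (p - q) = h p - h q"
    "h (p ^ n) = h p ^ n" "h (- p) = - h p" "h (numeral w) = numeral w" "b^2 = h (4 * P)"
proof -
  show add: "h (p + q) = h p + h q" for p q using assms by (simp add: curve_hom_def)
  show mult: "h (p * q) = h p * h q" for p q using assms by (simp add: curve_hom_def)
  show one: "h 1 = 1" using assms by (simp add: curve_hom_def)
  show zero: "h 0 = 0" using add[of 0 0] by (metis add_cancel_right_right add_0)
  show diff: "h (p - q) = h p - h q" for p q using add[of "p - q" q] by (simp add: algebra_simps)
  show "h (p ^ n) = h p ^ n" by (induction n) (simp_all add: one mult)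
  show "h (- p) = - h p" using diff[of 0 p] zero by simp
  have "h (of_nat k) = of_nat k" for k by (induction k) (simp_all add: zero one add)
  from this[of "numeral w"] show "h (numeral w) = numeral w" by simp
  show "b^2 = h (4 * P)" using assms by (simp add: curve_hom_def)
qed

lemma pt_seq_eq: "curve_hom h b \<Longrightarrow> pt_seq h b n = h (f n) * (if even n then b else 1)"
  unfolding pt_seq_def ell_seq_def f_def
  by (subst divpol_hom[of h]) (simp_all add: curve_hom_simps)

lemma pt_seq_window:
  assumes "curve_hom h b"
  shows "even m \<Longrightarrow> pt_seq h b m = h (f m) * b" "even m \<Longrightarrow> pt_seq h b (m + 1) = h (f (m + 1))"
    "even m \<Longrightarrow> pt_seq h b (m + 2) = h (f (m + 2)) * b" "even m \<Longrightarrow> pt_seq h b (m + 3) = h (f (m + 3))"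
    "even m \<Longrightarrow> pt_seq h b (m + 4) = h (f (m + 4)) * b"
    "odd m \<Longrightarrow> pt_seq h b m = h (f m)" "odd m \<Longrightarrow> pt_seq h b (m + 1) = h (f (m + 1)) * b"
    "odd m \<Longrightarrow> pt_seq h b (m + 2) = h (f (m + 2))" "odd m \<Longrightarrow> pt_seq h b (m + 3) = h (f (m + 3)) * b"
    "odd m \<Longrightarrow> pt_seq h b (m + 4) = h (f (m + 4))"
  by (simp_all add: pt_seq_eq[OF assms])

lemma pt_seq_square: "curve_hom h b \<Longrightarrow> pt_seq h b n ^ 2 = h (G n)"
  by (simp add: pt_seq_eq G_def curve_hom_simps power_mult_distrib)

lemma pt_seq_neighbours: "curve_hom h b \<Longrightarrow> n \<ge> 1 \<Longrightarrow> pt_seq h b (n + 1) * pt_seq h b (n - 1) = h (\<Theta> n)"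
  using curve_hom_simps(9)[of h b]
  by (simp add: pt_seq_eq \<Theta>_def curve_hom_simps power2_eq_square ac_simps)

text \<open>The generic point of the curve: an algebraic closure of K(x) contains a square root of 4
  P, and no psi_n with n > 0 vanishes there.\<close>

definition gen_emb :: "'a poly \<Rightarrow> 'a poly fract alg_closure" where
  "gen_emb p = to_ac (to_fract p)"

definition gen_b :: "'a poly fract alg_closure" where
  "gen_b = (SOME b. b^2 = gen_emb (4 * P))"

lemma gen_hom: "curve_hom gen_emb gen_b"
proof -
  have "\<exists>b. b^2 = gen_emb (4 * P)" by (rule nth_root_exists) simp
  then have "gen_b^2 = gen_emb (4 * P)" unfolding gen_b_def by (rule someI_ex)
  then show ?thesis by (simp add: curve_hom_def gen_emb_def)
qed

lemma gen_emb_eq_iff [simp]: "gen_emb p = gen_emb q \<longleftrightarrow> p = q"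
  by (simp add: gen_emb_def)

lemma gen_emb_eq_0_iff [simp]: "gen_emb p = 0 \<longleftrightarrow> p = 0"
  by (simp add: gen_emb_def)

lemma gen_b_nz [simp]: "gen_b \<noteq> 0"
  using curve_hom_simps(9)[OF gen_hom] four_poly by (auto simp del: )

lemma pt_seq_gen_nz_iff: "pt_seq gen_emb gen_b n \<noteq> 0 \<longleftrightarrow> f n \<noteq> 0"
  by (simp add: pt_seq_eq[OF gen_hom])

text \<open>By Taylor expansion both sides are 4 g^3 P(x - t / g). With g = psi_n^2 and t = \<Theta>
  n this is the bracket of the doubling formula, expressed by \<Phi> n and psi_n^2.\<close>

lemma curve_value_hom:
  "4 * P * g ^ 3 - 4 * P' * t * g ^ 2 + 4 * [:a2, 3:] * t ^ 2 * g - 4 * t ^ 3 =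
   4 * (([:0, 1:] * g - t) ^ 3 + [:a2:] * ([:0, 1:] * g - t) ^ 2 * g + [:a4:] * ([:0, 1:] * g - t) * g ^ 2 + [:a6:] * g ^ 3)"
proof -
  define x where "x = [:0, 1 :: 'a:]"
  have e: "P = x^3 + [:a2:] * x^2 + [:a4:] * x + [:a6:]" "P' = 3 * x^2 + 2 * [:a2:] * x + [:a4:]"
    "[:a2, 3:] = 3 * x + [:a2:]"
    by (simp_all add: x_def P_def P'_def numeral_poly power2_eq_square power3_eq_cube)
  show ?thesis unfolding x_def[symmetric] e by Groebner_Basis.algebra
qed

text \<open>The formal leading coefficient may vanish in K and cannot decide this. Odd terms are
  powers of P' up to sign modulo P. For n = 2 m the doubling formula gives the square of b psi_(2m)
  / psi_m as a multiple of the cubic form P evaluated at \<Phi> m and psi_m^2, whose leading term is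
  that of (\<Phi> m)^3.\<close>

lemma f_nz: "n \<ge> 1 \<Longrightarrow> f n \<noteq> 0"
proof (induction n rule: less_induct)
  case (less n)
  show ?case
  proof (cases "even n")
    case False
    then show ?thesis using f_odd_nz by (elim oddE) simp
  next
    case True
    show ?thesis
    proof (cases "n = 2")
      case True
      then show ?thesis by simp
    next
      case n2: False
      obtain l where l: "n = 2 * (l + 2)"
      proof -
        obtain k where "n = 2 * k" using True by (elim evenE)
        moreover have "k \<ge> 2" using calculation less.prems n2 by auto
        ultimately show ?thesis using that by (metis add.commute le_Suc_ex)
      qed
      define m where "m = l + 2"
      define W where "W = pt_seq gen_emb gen_b"
      have nz: "W j \<noteq> 0" if "1 \<le> j" "j \<le> n - 1" for j
        using less.IH[of j] that less.prems unfolding W_def pt_seq_gen_nz_iff by simp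
      have W': "W = ell_seq gen_b (gen_emb [:a2, 3:]) (gen_emb P')" by (simp add: W_def pt_seq_def)
      \<comment> \<open>Only the terms before n are known to be nonzero at this stage, hence the
        bounded versions with N = n - 1.\<close>
      have S: "W (l + 4) * W l = gen_b^2 * W (l + 3) * W (l + 1) -
          (gen_b^2 * gen_emb [:a2, 3:] - gen_emb P'^2) * W (l + 2)^2"
        unfolding W' by (rule ell_seq_somos_bounded[of "n - 1"]) (use nz l in \<open>auto simp: W'\<close>)
      have I: "W (l + 1)^2 * W (l + 4) + W (l + 3)^2 * W l =
          2 * gen_emb P' * W (l + 3) * W (l + 1) * W (l + 2) - gen_b^2 * W (l + 2)^3"
        unfolding W' by (rule ell_seq_invariant[of "n - 1"]) (use nz l in \<open>auto simp: W'\<close>)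
      have sq: "W (l + 2) ^ 2 = gen_emb (G m)" unfolding W_def m_def by (rule pt_seq_square[OF gen_hom])
      have th: "W (l + 3) * W (l + 1) = gen_emb (\<Theta> m)"
        using pt_seq_neighbours[OF gen_hom, of m] unfolding W_def m_def by (simp add: numeral_eq_Suc)
      have "(W (l + 4) * W (l + 1)^2 - W l * W (l + 3)^2)^2 = gen_emb (4 * P * 
          (4 * P * G m ^ 3 - 4 * P' * \<Theta> m * G m ^ 2 + 4 * [:a2, 3:] * \<Theta> m ^ 2 * G m - 4 * \<Theta> m ^ 3))"
        unfolding doubling_square[OF S I] sq th curve_hom_simps(9)[OF gen_hom]
        unfolding curve_hom_simps(1-8)[OF gen_hom] by (simp only: mult.assoc)
      also have "\<dots> \<noteq> 0"
      proof -
        have m1: "m \<ge> 1" by (simp add: m_def)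
        have lt: "lead_at (G m) (m^2) 0"
          by (rule lead_at_mono[OF lead_G[OF m1]]) (simp add: m_def)
        have c: "lead_at [:c:] 0 c" for c :: 'a by (simp add: lead_at_def)
        have "lead_at (\<Phi> m ^ 3 + [:a2:] * \<Phi> m ^ 2 * G m + [:a4:] * \<Phi> m * G m ^ 2 + [:a6:] * G m ^ 3) (3 * m^2)
           (1^3 + a2 * 1^2 * 0 + a4 * 1 * 0^2 + a6 * 0^3)"
          by (intro lead_at_add lead_at_power lead_\<Phi> m1
              lead_at_cong[OF lead_at_mult[OF lead_at_mult[OF c lead_at_power[OF lead_\<Phi>[OF m1]]] lt]]
              lead_at_cong[OF lead_at_mult[OF lead_at_mult[OF c lead_\<Phi>[OF m1]] lead_at_power[OF lt]]]
              lead_at_cong[OF lead_at_mult[OF c lead_at_power[OF lt]]]) auto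
        then have "\<Phi> m ^ 3 + [:a2:] * \<Phi> m ^ 2 * G m + [:a4:] * \<Phi> m * G m ^ 2 + [:a6:] * G m ^ 3 \<noteq> 0"
          using lead_at_nonzero by force
        then show ?thesis
          unfolding curve_value_hom \<Phi>_def[symmetric] gen_emb_eq_0_iff mult_eq_0_iff using four_poly by simp
      qed
      finally have "W (l + 4) * W (l + 1)^2 - W l * W (l + 3)^2 \<noteq> 0" by auto
      moreover have "gen_b * W n = W (l + 2) * (W (l + 4) * W (l + 1)^2 - W l * W (l + 3)^2)"
        using ell_seq_even[of "l + 2" gen_b "gen_emb [:a2, 3:]" "gen_emb P'"] unfolding W' l
        by (simp add: numeral_eq_Suc)
      moreover have "W (l + 2) \<noteq> 0" using nz[of "l + 2"] l by simp
      ultimately have "W n \<noteq> 0" by auto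
      then show ?thesis unfolding W_def pt_seq_gen_nz_iff .
    qed
  qed
qed

lemma gen_nz: "n \<ge> 1 \<Longrightarrow> pt_seq gen_emb gen_b n \<noteq> 0"
  by (simp add: pt_seq_gen_nz_iff f_nz)

lemma G_nz: "n \<ge> 1 \<Longrightarrow> G n \<noteq> 0"
  using f_nz[of n] four_poly by (auto simp: G_def)

text \<open>Collects the powers of b in the relations for psi_n, so that they can be cancelled or
  replaced by 4 P, which leaves relations between the polynomials \<open>f n\<close>.\<close>

lemma parity_algebra:
  fixes b c \<beta> p0 p1 p2 p3 p4 :: "'b::field"
  shows "(p4 * b) * (p0 * b) = b^2 * p3 * p1 - c * (p2 * b)^2 \<longleftrightarrow>
      b^2 * (p4 * p0) = b^2 * (p3 * p1 - c * p2^2)" (is ?A)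
    and "p4 * p0 = b^2 * (p3 * b) * (p1 * b) - c * p2^2 \<longleftrightarrow>
      p4 * p0 = (b^2)^2 * p3 * p1 - c * p2^2" (is ?B)
    and "p1^2 * (p4 * b) + p3^2 * (p0 * b) = 2 * \<beta> * p3 * p1 * (p2 * b) - b^2 * (p2 * b)^3 \<longleftrightarrow>
      b * (p1^2 * p4 + p3^2 * p0) = b * (2 * \<beta> * p3 * p1 * p2 - (b^2)^2 * p2^3)" (is ?C)
    and "(p1 * b)^2 * p4 + (p3 * b)^2 * p0 = 2 * \<beta> * (p3 * b) * (p1 * b) * p2 - b^2 * p2^3 \<longleftrightarrow>
      b^2 * (p1^2 * p4 + p3^2 * p0) = b^2 * (2 * \<beta> * p3 * p1 * p2 - p2^3)" (is ?D)
proof -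
  have e: "(p4 * b) * (p0 * b) = b^2 * (p4 * p0)"
    "b^2 * p3 * p1 - c * (p2 * b)^2 = b^2 * (p3 * p1 - c * p2^2)"
    "b^2 * (p3 * b) * (p1 * b) - c * p2^2 = (b^2)^2 * p3 * p1 - c * p2^2"
    "p1^2 * (p4 * b) + p3^2 * (p0 * b) = b * (p1^2 * p4 + p3^2 * p0)"
    "2 * \<beta> * p3 * p1 * (p2 * b) - b^2 * (p2 * b)^3 = b * (2 * \<beta> * p3 * p1 * p2 - (b^2)^2 * p2^3)"
    "(p1 * b)^2 * p4 + (p3 * b)^2 * p0 = b^2 * (p1^2 * p4 + p3^2 * p0)"
    "2 * \<beta> * (p3 * b) * (p1 * b) * p2 - b^2 * p2^3 = b^2 * (2 * \<beta> * p3 * p1 * p2 - p2^3)"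
    by Groebner_Basis.algebra+
  show ?A ?B ?C ?D unfolding e by (rule refl)+
qed

text \<open>Proved at the generic point, where all terms are nonzero and powers of b may be
  cancelled. Being an identity of polynomials, it then holds at every point, including torsion
  points, where the sequence has zeros.\<close>

lemma f_somos:
  "f (m + 4) * f m = (if even m then 1 else (4 * P)^2) * f (m + 3) * f (m + 1) - f 3 * f (m + 2)^2"
proof -
  have "pt_seq gen_emb gen_b (m + 4) * pt_seq gen_emb gen_b m =
      gen_b^2 * pt_seq gen_emb gen_b (m + 3) * pt_seq gen_emb gen_b (m + 1)
      - (gen_b^2 * gen_emb [:a2, 3:] - gen_emb P'^2) * pt_seq gen_emb gen_b (m + 2)^2"
    unfolding pt_seq_def
    by (rule ell_seq_somos_bounded[of "m + 4"]) (use gen_nz in \<open>auto simp: pt_seq_def\<close>)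
  moreover have "gen_b^2 * gen_emb [:a2, 3:] - gen_emb P'^2 = gen_emb (f 3)"
    by (simp only: curve_hom_simps[OF gen_hom] f_initial)
  ultimately have *: "pt_seq gen_emb gen_b (m + 4) * pt_seq gen_emb gen_b m =
      gen_b^2 * pt_seq gen_emb gen_b (m + 3) * pt_seq gen_emb gen_b (m + 1)
      - gen_emb (f 3) * pt_seq gen_emb gen_b (m + 2)^2" by simp
  have "gen_emb (f (m + 4) * f m) = gen_emb ((if even m then 1 else (4 * P)^2) * f (m + 3) * f (m + 1) - f 3 * f (m + 2)^2)"
  proof (cases "even m")
    case True
    have "gen_b^2 * (gen_emb (f (m + 4)) * gen_emb (f m)) =
       gen_b^2 * (gen_emb (f (m + 3)) * gen_emb (f (m + 1)) - gen_emb (f 3) * gen_emb (f (m + 2))^2)"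
      using * unfolding pt_seq_window(1-5)[OF gen_hom True] parity_algebra(1) .
    then have "gen_emb (f (m + 4)) * gen_emb (f m) =
       gen_emb (f (m + 3)) * gen_emb (f (m + 1)) - gen_emb (f 3) * gen_emb (f (m + 2))^2" by simp
    then show ?thesis using True by (simp only: curve_hom_simps[OF gen_hom] if_True mult_1_left)
  next
    case False
    have "gen_emb (f (m + 4)) * gen_emb (f m) =
       (gen_b^2)^2 * gen_emb (f (m + 3)) * gen_emb (f (m + 1)) - gen_emb (f 3) * gen_emb (f (m + 2))^2"
      using * unfolding pt_seq_window(6-10)[OF gen_hom False] parity_algebra(2) .
    then show ?thesis using False by (simp only: curve_hom_simps[OF gen_hom] if_False)
  qed
  then show ?thesis by (simp only: gen_emb_eq_iff)
qed

lemma f_invariant: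
  "f (m + 1)^2 * f (m + 4) + f (m + 3)^2 * f m =
   2 * P' * f (m + 3) * f (m + 1) * f (m + 2) - (if even m then (4 * P)^2 else 1) * f (m + 2)^3"
proof -
  have *: "pt_seq gen_emb gen_b (m + 1)^2 * pt_seq gen_emb gen_b (m + 4)
      + pt_seq gen_emb gen_b (m + 3)^2 * pt_seq gen_emb gen_b m =
      2 * gen_emb P' * pt_seq gen_emb gen_b (m + 3) * pt_seq gen_emb gen_b (m + 1) * pt_seq gen_emb gen_b (m + 2)
      - gen_b^2 * pt_seq gen_emb gen_b (m + 2)^3"
    unfolding pt_seq_def
    by (rule ell_seq_invariant[of "m + 4"]) (use gen_nz in \<open>auto simp: pt_seq_def\<close>)
  have "gen_emb (f (m + 1)^2 * f (m + 4) + f (m + 3)^2 * f m) =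
    gen_emb (2 * P' * f (m + 3) * f (m + 1) * f (m + 2) - (if even m then (4 * P)^2 else 1) * f (m + 2)^3)"
  proof (cases "even m")
    case True
    have "gen_b * (gen_emb (f (m + 1))^2 * gen_emb (f (m + 4)) + gen_emb (f (m + 3))^2 * gen_emb (f m)) =
       gen_b * (2 * gen_emb P' * gen_emb (f (m + 3)) * gen_emb (f (m + 1)) * gen_emb (f (m + 2))
         - (gen_b^2)^2 * gen_emb (f (m + 2))^3)"
      using * unfolding pt_seq_window(1-5)[OF gen_hom True] parity_algebra(3) .
    then have "gen_emb (f (m + 1))^2 * gen_emb (f (m + 4)) + gen_emb (f (m + 3))^2 * gen_emb (f m) =
       2 * gen_emb P' * gen_emb (f (m + 3)) * gen_emb (f (m + 1)) * gen_emb (f (m + 2))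
         - (gen_b^2)^2 * gen_emb (f (m + 2))^3" by simp
    then show ?thesis using True by (simp only: curve_hom_simps[OF gen_hom] if_True)
  next
    case False
    have "gen_b^2 * (gen_emb (f (m + 1))^2 * gen_emb (f (m + 4)) + gen_emb (f (m + 3))^2 * gen_emb (f m)) =
       gen_b^2 * (2 * gen_emb P' * gen_emb (f (m + 3)) * gen_emb (f (m + 1)) * gen_emb (f (m + 2))
         - gen_emb (f (m + 2))^3)"
      using * unfolding pt_seq_window(6-10)[OF gen_hom False] parity_algebra(4) .
    then have "gen_emb (f (m + 1))^2 * gen_emb (f (m + 4)) + gen_emb (f (m + 3))^2 * gen_emb (f m) =
       2 * gen_emb P' * gen_emb (f (m + 3)) * gen_emb (f (m + 1)) * gen_emb (f (m + 2))
         - gen_emb (f (m + 2))^3" by simp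
    then show ?thesis using False by (simp only: curve_hom_simps[OF gen_hom] if_False mult_1_left)
  qed
  then show ?thesis by (simp only: gen_emb_eq_iff)
qed

lemma pt_seq_somos:
  assumes h: "curve_hom h b"
  shows "pt_seq h b (m + 4) * pt_seq h b m =
      b^2 * pt_seq h b (m + 3) * pt_seq h b (m + 1) - h (f 3) * pt_seq h b (m + 2)^2"
proof -
  note s = curve_hom_simps[OF h]
  have "h (f (m + 4)) * h (f m) =
     (if even m then 1 else (b^2)^2) * h (f (m + 3)) * h (f (m + 1)) - h (f 3) * h (f (m + 2))^2"
    using arg_cong[OF f_somos[of m], of h] s(9) by (cases "even m") (simp_all only: s if_True if_False)
  note * = this
  show ?thesis
  proof (cases "even m")
    case True
    show ?thesis unfolding pt_seq_window(1-5)[OF h True] parity_algebra(1) using * True by simp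
  next
    case False
    show ?thesis unfolding pt_seq_window(6-10)[OF h False] parity_algebra(2) using * False by simp
  qed
qed

lemma pt_seq_invariant:
  assumes h: "curve_hom h b"
  shows "pt_seq h b (m + 1)^2 * pt_seq h b (m + 4) + pt_seq h b (m + 3)^2 * pt_seq h b m =
      2 * h P' * pt_seq h b (m + 3) * pt_seq h b (m + 1) * pt_seq h b (m + 2) - b^2 * pt_seq h b (m + 2)^3"
proof -
  note s = curve_hom_simps[OF h]
  have "h (f (m + 1))^2 * h (f (m + 4)) + h (f (m + 3))^2 * h (f m) =
     2 * h P' * h (f (m + 3)) * h (f (m + 1)) * h (f (m + 2)) - (if even m then (b^2)^2 else 1) * h (f (m + 2))^3"
    using arg_cong[OF f_invariant[of m], of h] s(9) by (cases "even m") (simp_all only: s if_True if_False)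
  note * = this
  show ?thesis
  proof (cases "even m")
    case True
    show ?thesis unfolding pt_seq_window(1-5)[OF h True] parity_algebra(3) using * True by simp
  next
    case False
    show ?thesis unfolding pt_seq_window(6-10)[OF h False] parity_algebra(4) using * False by simp
  qed
qed

end

section \<open>Evaluation at points and the composition formula\<close>

lemma map_poly_hom_add:
  fixes \<iota> :: "'a::comm_ring_1 \<Rightarrow> 'b::comm_ring_1"
  assumes "\<And>x y. \<iota> (x + y) = \<iota> x + \<iota> y" "\<iota> 0 = 0"
  shows "map_poly \<iota> (p + q) = map_poly \<iota> p + map_poly \<iota> q"
  by (rule poly_eqI) (simp add: coeff_map_poly assms)

lemma map_poly_hom_mult:
  fixes \<iota> :: "'a::comm_ring_1 \<Rightarrow> 'b::comm_ring_1"
  assumes add: "\<And>x y. \<iota> (x + y) = \<iota> x + \<iota> y" and mult: "\<And>x y. \<iota> (x * y) = \<iota> x * \<iota> y" and zero: "\<iota> 0 = 0"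
  shows "map_poly \<iota> (p * q) = map_poly \<iota> p * map_poly \<iota> q"
proof (rule poly_eqI)
  fix n
  have s: "\<iota> (sum g A) = (\<Sum>i\<in>A. \<iota> (g i))" for g and A :: "nat set"
    by (induction A rule: infinite_finite_induct) (simp_all add: zero add)
  show "coeff (map_poly \<iota> (p * q)) n = coeff (map_poly \<iota> p * map_poly \<iota> q) n"
    by (simp add: coeff_map_poly zero coeff_mult s mult)
qed

lemma poly_eq_sum_le:
  fixes p :: "'a::comm_ring_1 poly"
  assumes "degree p \<le> N"
  shows "poly p x = (\<Sum>j\<le>N. coeff p j * x ^ j)"
  unfolding poly_altdef using assms by (intro sum.mono_neutral_left) (auto simp: coeff_eq_0)

lemma taylor_cubic:
  fixes x u c2 c4 c6 :: "'b::field"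
  shows "4 * ((x - u)^3 + c2 * (x - u)^2 + c4 * (x - u) + c6) =
      4 * (x^3 + c2 * x^2 + c4 * x + c6) - 4 * (3 * x^2 + 2 * c2 * x + c4) * u + 4 * (3 * x + c2) * u^2 - 4 * u^3"
    and "3 * (x - u)^2 + 2 * c2 * (x - u) + c4 = (3 * x^2 + 2 * c2 * x + c4) - 2 * (3 * x + c2) * u + 3 * u^2"
    and "3 * (x - u) + c2 = (3 * x + c2) - 3 * u"
  by Groebner_Basis.algebra+

text \<open>Adding (x, y) to its n-th multiple (x - u, Y). Here x - v is the x-coordinate of the
  next multiple, and r is u^2 times the difference for the previous one; \<open>sum\<close> and
  \<open>prod\<close> are the invariant and the Somos relation. The slope satisfies 2 y l = \<beta>
  - u v, and both coordinates follow from this.\<close>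

lemma chord_step:
  fixes x y a u v \<beta> r Y l :: "'b::field"
  assumes nz: "y \<noteq> 0" "(2::'b) \<noteq> 0" "u \<noteq> 0"
    and sum: "u^2 * v + r = 2 * \<beta> * u - 4 * y^2"
    and prod: "u^2 * v * r = u^2 * (4 * y^2 * u - (4 * y^2 * (3 * x + a) - \<beta>^2))"
    and Y: "Y = (u^2 * v - r) / (4 * y)" and l: "l = (Y - y) / ((x - u) - x)"
  shows "l^2 - a - x - (x - u) = x - v"
    and "- l * (x - v) - (y - l * x) = (2 * \<beta> * v - 4 * y^2 - 2 * u * v^2) / (4 * y)"
proof -
  have four: "(4::'b) \<noteq> 0" using nz(2) by (metis mult_eq_0_iff mult_2 numeral_Bit0 one_add_one)
  have r: "r = 2 * \<beta> * u - 4 * y^2 - u^2 * v" using sum by (simp add: algebra_simps)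
  have vr: "v * r = 4 * y^2 * u - (4 * y^2 * (3 * x + a) - \<beta>^2)" using prod nz(3) by simp
  have Y': "4 * y * Y = u^2 * v - r" using Y nz four by simp
  have "4 * y * (2 * y * (u * l)) = 4 * y * (\<beta> * u - u^2 * v)"
  proof -
    have ul: "u * l = y - Y" using l nz(3) by (simp add: field_simps)
    have "4 * y * (2 * y * (u * l)) = 2 * y * (4 * y^2 - 4 * y * Y)" unfolding ul by Groebner_Basis.algebra
    also have "\<dots> = 4 * y * (\<beta> * u - u^2 * v)" unfolding Y' r by Groebner_Basis.algebra
    finally show ?thesis .
  qed
  then have "(4 * y * u) * (2 * y * l) = (4 * y * u) * (\<beta> - u * v)" by Groebner_Basis.algebra
  moreover have "4 * y * u \<noteq> 0" using nz four by simp
  ultimately have l2: "2 * y * l = \<beta> - u * v" by (metis mult_left_cancel)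
  have "4 * y^2 * (l^2 - a - x - (x - u)) = (2 * y * l)^2 - 4 * y^2 * (a + 2 * x - u)"
    by Groebner_Basis.algebra
  also have "\<dots> = \<beta>^2 - v * (2 * \<beta> * u - 4 * y^2 - u^2 * v) - 4 * y^2 * v - 4 * y^2 * (a + 2 * x - u)"
    unfolding l2 by Groebner_Basis.algebra
  also have "\<dots> = 4 * y^2 * (x - v)"
    unfolding r[symmetric] vr by Groebner_Basis.algebra
  finally show "l^2 - a - x - (x - u) = x - v" using nz four by simp
  have "4 * y * (- l * (x - v) - (y - l * x)) = 2 * v * (2 * y * l) - 4 * y^2"
    by Groebner_Basis.algebra
  also have "\<dots> = 2 * \<beta> * v - 4 * y^2 - 2 * u * v^2"
    unfolding l2 by Groebner_Basis.algebra
  finally show "- l * (x - v) - (y - l * x) = (2 * \<beta> * v - 4 * y^2 - 2 * u * v^2) / (4 * y)"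
    using nz four by (simp add: field_simps)
qed

text \<open>The addition when the n-th multiple is the point itself; c is psi_3, so that c / (4 y^2)
  is the difference of x-coordinates under doubling.\<close>

lemma tangent_step:
  fixes x y a \<beta> l c :: "'b::field"
  assumes nz: "y \<noteq> 0" "(2::'b) \<noteq> 0" and c: "c = 4 * y^2 * (3 * x + a) - \<beta>^2" and l: "l = \<beta> / (2 * y)"
  shows "l^2 - a - x - x = x - c / (4 * y^2)"
    and "- l * (x - c / (4 * y^2)) - (y - l * x) = (2 * \<beta> * c / (4 * y^2) - 4 * y^2) / (4 * y)"
proof -
  have four: "(4::'b) \<noteq> 0" using nz(2) by (metis mult_eq_0_iff mult_2 numeral_Bit0 one_add_one)
  have l2: "2 * y * l = \<beta>" using l nz by simp
  have "4 * y^2 * (l^2 - a - x - x) = (2 * y * l)^2 - 4 * y^2 * (a + 2 * x)" by Groebner_Basis.algebra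
  also have "\<dots> = 4 * y^2 * x - c" unfolding l2 c by Groebner_Basis.algebra
  also have "\<dots> = 4 * y^2 * (x - c / (4 * y^2))" using nz four by (simp add: field_simps)
  finally show "l^2 - a - x - x = x - c / (4 * y^2)" using nz four by simp
  define d where "d = c / (4 * y^2)"
  have "4 * y * (- l * (x - d) - (y - l * x)) = 2 * d * (2 * y * l) - 4 * y^2" by Groebner_Basis.algebra
  also have "\<dots> = 2 * \<beta> * d - 4 * y^2" unfolding l2 by Groebner_Basis.algebra
  finally have "- l * (x - d) - (y - l * x) = (2 * \<beta> * d - 4 * y^2) / (4 * y)"
    using nz four by (simp add: field_simps)
  then show "- l * (x - c / (4 * y^2)) - (y - l * x) = (2 * \<beta> * c / (4 * y^2) - 4 * y^2) / (4 * y)"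
    by (simp add: d_def)
qed

context cubic
begin

lemma eval_hom:
  fixes \<iota> :: "'a \<Rightarrow> 'b::field"
  assumes add: "\<And>x y. \<iota> (x + y) = \<iota> x + \<iota> y" and mult: "\<And>x y. \<iota> (x * y) = \<iota> x * \<iota> y" and one: "\<iota> 1 = 1"
    and b: "b^2 = 4 * (x^3 + \<iota> a2 * x^2 + \<iota> a4 * x + \<iota> a6)"
  defines "h \<equiv> \<lambda>p. poly (map_poly \<iota> p) x"
  shows "curve_hom h b" "h [:c:] = \<iota> c" "h [:0, 1:] = x" "h [:a2, 3:] = 3 * x + \<iota> a2"
    "h P' = 3 * x^2 + 2 * \<iota> a2 * x + \<iota> a4" "h P = x^3 + \<iota> a2 * x^2 + \<iota> a4 * x + \<iota> a6"
proof -
  have zero: "\<iota> 0 = 0" using add[of 0 0] by (metis add_cancel_right_right add_0)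
  have hadd: "h (p + q) = h p + h q" for p q
    unfolding h_def by (subst map_poly_hom_add[of \<iota>]) (simp_all add: add zero)
  have hmult: "h (p * q) = h p * h q" for p q
    unfolding h_def by (subst map_poly_hom_mult[of \<iota>]) (simp_all add: add mult zero)
  have hone: "h 1 = 1" by (simp add: h_def one)
  show c: "h [:c:] = \<iota> c" for c by (simp add: h_def map_poly_pCons zero)
  show X: "h [:0, 1:] = x" by (simp add: h_def map_poly_pCons zero one)
  have two: "\<iota> 2 = 2" "\<iota> 3 = 3"
  proof -
    have "(2::'a) = 1 + 1" "(3::'a) = 1 + 1 + 1" by simp_all
    then show "\<iota> 2 = 2" "\<iota> 3 = 3" by (simp_all only: add one) simp_all
  qed
  show "h [:a2, 3:] = 3 * x + \<iota> a2" by (simp add: h_def map_poly_pCons zero two mult.commute add.commute)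
  show "h P' = 3 * x^2 + 2 * \<iota> a2 * x + \<iota> a4"
    by (simp add: h_def P'_def map_poly_pCons zero two mult power2_eq_square algebra_simps)
  show hP: "h P = x^3 + \<iota> a2 * x^2 + \<iota> a4 * x + \<iota> a6"
    by (simp add: h_def P_def map_poly_pCons zero one mult power2_eq_square power3_eq_cube algebra_simps)
  have "h 4 = 4" using hadd[of 2 2] hadd[of 1 1] hone by simp
  then show "curve_hom h b" unfolding curve_hom_def using hadd hmult hone b hP by simp
qed

text \<open>psi_(kn)^2 is psi_n^(2 k^2) times psi_k^2 at the n-th multiple, whose x-coordinate is
  \<Phi> n / G n. Clearing denominators gives the homogenisation of \<open>G k\<close> in degree
  k^2. The computation takes place at the generic point.\<close>

lemma G_compose:
  assumes n: "n \<ge> 1" and k: "k \<ge> 1"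
  shows "G (k * n) = (\<Sum>j\<le>degree (G k). smult (coeff (G k) j) (\<Phi> n ^ j * G n ^ (k^2 - j)))"
proof -
  define W where "W = pt_seq gen_emb gen_b"
  define g where "g = gen_emb (G n)"
  define u where "u = W (n + 1) * W (n - 1) / W n ^ 2"
  define b' where "b' = W (2 * n) / W n ^ 4"
  define x0 where "x0 = gen_emb [:0, 1:]"
  define \<iota> where "\<iota> c = gen_emb [:c:]" for c
  define h where "h p = poly (map_poly \<iota> p) (x0 - u)" for p
  note s = curve_hom_simps[OF gen_hom]
  have W': "W = ell_seq gen_b (gen_emb [:a2, 3:]) (gen_emb P')" by (simp add: W_def pt_seq_def)
  have nz: "W j \<noteq> 0" if "1 \<le> j" for j using gen_nz that by (simp add: W_def)
  have gnz: "g \<noteq> 0" using G_nz[OF n] by (simp add: g_def)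
  have sq: "W m ^ 2 = gen_emb (G m)" for m unfolding W_def by (rule pt_seq_square[OF gen_hom])
  \<comment> \<open>The x-coordinate of the n-th multiple of the generic point.\<close>
  have xu: "x0 - u = gen_emb (\<Phi> n) / g"
  proof -
    have "u = gen_emb (\<Theta> n) / g"
      unfolding u_def sq g_def using pt_seq_neighbours[OF gen_hom n] by (simp add: W_def)
    moreover have "gen_emb (\<Phi> n) = x0 * g - gen_emb (\<Theta> n)"
      unfolding \<Phi>_def x0_def g_def by (simp only: s)
    ultimately show ?thesis using gnz by (simp add: field_simps)
  qed
  have cmp1: "b'^2 = gen_b^2 - 4 * gen_emb P' * u + 4 * gen_emb [:a2, 3:] * u^2 - 4 * u^3"
    using ell_seq_compose(1)[of gen_b "gen_emb [:a2, 3:]" "gen_emb P'" n] nz n unfolding b'_def u_def W' by simp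
  have cmp2: "W (k * n) = W n ^ (k^2) * ell_seq b' (gen_emb [:a2, 3:] - 3 * u) (gen_emb P' - 2 * gen_emb [:a2, 3:] * u + 3 * u^2) k"
    using ell_seq_compose(2)[of gen_b "gen_emb [:a2, 3:]" "gen_emb P'" n k] nz n unfolding b'_def u_def W' by simp
  have i: "\<iota> (c + d) = \<iota> c + \<iota> d" "\<iota> (c * d) = \<iota> c * \<iota> d" "\<iota> 1 = 1" for c d
    unfolding \<iota>_def using s(1)[of "[:c:]" "[:d:]"] s(2)[of "[:c:]" "[:d:]"] s(3) by (simp_all add: one_pCons mult.commute)
  have e: "gen_emb [:a2, 3:] = 3 * x0 + \<iota> a2" "gen_emb P' = 3 * x0^2 + 2 * \<iota> a2 * x0 + \<iota> a4"
    "gen_b^2 = 4 * (x0^3 + \<iota> a2 * x0^2 + \<iota> a4 * x0 + \<iota> a6)"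
  proof -
    have "[:a2, 3:] = 3 * [:0, 1:] + [:a2:]" "P' = 3 * [:0, 1:]^2 + 2 * [:a2:] * [:0, 1:] + [:a4:]"
      "4 * P = 4 * ([:0, 1:]^3 + [:a2:] * [:0, 1:]^2 + [:a4:] * [:0, 1:] + [:a6:])"
      by (simp_all add: P_def P'_def numeral_poly power2_eq_square power3_eq_cube)
    then show "gen_emb [:a2, 3:] = 3 * x0 + \<iota> a2" "gen_emb P' = 3 * x0^2 + 2 * \<iota> a2 * x0 + \<iota> a4"
      "gen_b^2 = 4 * (x0^3 + \<iota> a2 * x0^2 + \<iota> a4 * x0 + \<iota> a6)"
      by (simp_all only: s x0_def \<iota>_def)
  qed
  have hb: "b'^2 = 4 * ((x0 - u)^3 + \<iota> a2 * (x0 - u)^2 + \<iota> a4 * (x0 - u) + \<iota> a6)"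
    unfolding cmp1 e taylor_cubic(1) ..
  have hom: "curve_hom h b'" and h\<alpha>: "h [:a2, 3:] = gen_emb [:a2, 3:] - 3 * u"
    and h\<beta>: "h P' = gen_emb P' - 2 * gen_emb [:a2, 3:] * u + 3 * u^2"
    unfolding h_def e taylor_cubic(2,3)[symmetric] using eval_hom[OF i hb] by auto
  have "gen_emb (G (k * n)) = (W n ^ 2) ^ (k^2) * pt_seq h b' k ^ 2"
    unfolding sq[symmetric] cmp2 pt_seq_def h\<alpha> h\<beta> power_mult_distrib
    by (simp add: power_mult[symmetric] mult.commute)
  also have "\<dots> = g ^ (k^2) * h (G k)"
    unfolding pt_seq_square[OF hom] sq g_def ..
  also have "h (G k) = (\<Sum>j\<le>degree (G k). \<iota> (coeff (G k) j) * (gen_emb (\<Phi> n) / g) ^ j)"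
    unfolding h_def xu
    by (subst poly_eq_sum_le[where N = "degree (G k)"]) (simp_all add: map_poly_degree_leq coeff_map_poly \<iota>_def s)
  also have "g ^ (k^2) * \<dots> = (\<Sum>j\<le>degree (G k). \<iota> (coeff (G k) j) * (gen_emb (\<Phi> n) ^ j * g ^ (k^2 - j)))"
    unfolding sum_distrib_left
  proof (rule sum.cong[OF refl])
    fix j assume "j \<in> {..degree (G k)}"
    then have "j \<le> k^2" using degree_G_less[OF k] by simp
    then have "g ^ (k^2) = g ^ j * g ^ (k^2 - j)" by (simp flip: power_add)
    then show "g ^ k\<^sup>2 * (\<iota> (coeff (G k) j) * (gen_emb (\<Phi> n) / g) ^ j) =
        \<iota> (coeff (G k) j) * (gen_emb (\<Phi> n) ^ j * g ^ (k\<^sup>2 - j))"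
      using gnz by (simp add: power_divide)
  qed
  also have "\<dots> = gen_emb (\<Sum>j\<le>degree (G k). smult (coeff (G k) j) (\<Phi> n ^ j * G n ^ (k^2 - j)))"
  proof -
    have es: "gen_emb (sum q A) = (\<Sum>i\<in>A. gen_emb (q i))" for q and A :: "nat set"
      by (induction A rule: infinite_finite_induct) (simp_all add: s)
    have sm: "gen_emb (smult c p) = \<iota> c * gen_emb p" for c p
      using s(2)[of "[:c:]" p] by (simp add: \<iota>_def)
    show ?thesis by (simp add: es sm s g_def)
  qed
  finally show ?thesis by simp
qed

text \<open>As \<Phi> n has degree n^2, this is the order of the pole of \<Phi> n / G n at infinity,
  the ramification index there of the map that [n] induces on the x-line. It is 1 if n is nonzero in
  K.\<close>

definition "e n = n^2 - degree (G n)"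
definition "L n = lead_coeff (G n)"

lemma e_pos: "n \<ge> 1 \<Longrightarrow> e n \<ge> 1"
  using degree_G_less[of n] unfolding e_def by linarith

lemma degree_G: "n \<ge> 1 \<Longrightarrow> degree (G n) = n^2 - e n"
  using degree_G_less[of n] unfolding e_def by linarith

lemma L_nz: "n \<ge> 1 \<Longrightarrow> L n \<noteq> 0"
  using G_nz by (simp add: L_def)

lemma lead_at_sum:
  assumes "finite A" "\<And>i. i \<in> A \<Longrightarrow> lead_at (q i) d (c i)"
  shows "lead_at (sum q A) d (sum c A)"
  using assms by (induction A rule: finite_induct) (simp_all add: lead_at_add)

lemma lead_at_smult: "lead_at p d c \<Longrightarrow> lead_at (smult a p) d (a * c)"
  by (auto simp: lead_at_def intro: order.trans[OF degree_smult_le])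

lemma lead_at_lead_coeff: "lead_at p (degree p) (lead_coeff p)"
  by (simp add: lead_at_def)

text \<open>Since Z has smaller degree than Y, trading a factor Z for a factor Y raises the degree;
  so the summand with j = \<open>degree p\<close> alone determines the leading term.\<close>

lemma lead_hom_sum:
  fixes p Y Z :: "'a poly"
  assumes Y: "lead_at Y N 1" and Z: "degree Z < N" and D: "degree p \<le> D"
  shows "lead_at (\<Sum>j\<le>degree p. smult (coeff p j) (Y ^ j * Z ^ (D - j)))
     (degree p * N + (D - degree p) * degree Z) (lead_coeff p * lead_coeff Z ^ (D - degree p))"
proof -
  define c where "c j = (if j = degree p then lead_coeff p * lead_coeff Z ^ (D - degree p) else 0)" for j
  have "lead_at (\<Sum>j\<le>degree p. smult (coeff p j) (Y ^ j * Z ^ (D - j)))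
     (degree p * N + (D - degree p) * degree Z) (\<Sum>j\<le>degree p. c j)"
  proof (rule lead_at_sum)
    fix j assume j: "j \<in> {..degree p}"
    have l: "lead_at (smult (coeff p j) (Y ^ j * Z ^ (D - j))) (j * N + (D - j) * degree Z)
        (coeff p j * (1 ^ j * lead_coeff Z ^ (D - j)))"
      by (intro lead_at_smult lead_at_mult lead_at_power Y lead_at_lead_coeff)
    show "lead_at (smult (coeff p j) (Y ^ j * Z ^ (D - j))) (degree p * N + (D - degree p) * degree Z) (c j)"
    proof (cases "j = degree p")
      case True
      then show ?thesis using l by (simp add: c_def)
    next
      case False
      define i where "i = degree p - j"
      have i: "degree p = j + i" "i > 0" using j False by (auto simp: i_def)
      define m where "m = D - degree p"
      have m: "D - j = m + i" using D i by (simp add: m_def)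
      have "j * N + (D - j) * degree Z < degree p * N + (D - degree p) * degree Z"
      proof -
        have "i * degree Z < i * N" using Z i(2) by simp
        then have "j * N + (m + i) * degree Z < (j + i) * N + m * degree Z" by (simp add: add_mult_distrib)
        then show ?thesis using m i(1) m_def by simp
      qed
      then show ?thesis using lead_at_mono[OF l] False by (simp add: c_def)
    qed
  qed simp
  then show ?thesis by (simp add: c_def)
qed

text \<open>Ramification indices multiply along [k n] = [k] o [n], and the leading coefficient of
  the inner map enters with the ramification index of the outer one. Both are read off from the top
  summand of the composition formula.\<close>

lemma e_L_mult:
  assumes n: "n \<ge> 1" and k: "k \<ge> 1"
  shows "e (k * n) = e k * e n" "L (k * n) = L k * L n ^ e k"
proof -
  have "lead_at (G (k * n)) (degree (G k) * n^2 + (k^2 - degree (G k)) * degree (G n))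
     (lead_coeff (G k) * lead_coeff (G n) ^ (k^2 - degree (G k)))"
    unfolding G_compose[OF n k]
    by (rule lead_hom_sum) (use lead_\<Phi>[OF n] degree_G_less[OF n] degree_G_less[OF k] in auto)
  then have *: "lead_at (G (k * n)) (degree (G k) * n^2 + e k * degree (G n)) (L k * L n ^ e k)"
    by (simp add: L_def e_def)
  have **: "degree (G (k * n)) = degree (G k) * n^2 + e k * degree (G n)" "L (k * n) = L k * L n ^ e k"
    using lead_at_nonzero[OF *] L_nz[OF n] L_nz[OF k] unfolding L_def by auto
  show "L (k * n) = L k * L n ^ e k" by (rule **)
  have 1: "degree (G k) + e k = k^2" "degree (G n) + e n = n^2"
    using degree_G_less[OF k] degree_G_less[OF n] by (auto simp: e_def)
  have "degree (G (k * n)) + e k * e n = (degree (G k) + e k) * n^2"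
    unfolding **(1) 1(2)[symmetric] by (simp add: algebra_simps)
  then show "e (k * n) = e k * e n" unfolding 1 by (simp add: e_def power_mult_distrib)
qed

lemma e_L_of_nat: "(of_nat n :: 'a) \<noteq> 0 \<Longrightarrow> e n = 1 \<and> L n = of_nat n ^ 2"
proof -
  assume *: "(of_nat n :: 'a) \<noteq> 0"
  then have "n \<ge> 1" by (cases n) auto
  then show ?thesis
    using lead_at_nonzero[OF lead_G[of n]] * unfolding e_def L_def
    by (metis One_nat_def Suc_leI bot_nat_0.not_eq_extremum diff_diff_cancel less_le_trans power_not_zero zero_less_power zero_less_one)
qed

text \<open>The homogenisation of \<open>G k\<close> in its own degree, not in degree k^2. Compared
  with the composition formula for 2 k this drops the factor (4 P)^(e k), which is the full power of
  P contained in psi_(2k)^2.\<close>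

definition "M k = (\<Sum>j\<le>degree (G k). smult (coeff (G k) j) (\<Phi> 2 ^ j * G 2 ^ (degree (G k) - j)))"

lemma G_2: "G 2 = 4 * P"
  by (simp add: G_def)

lemma G_even: "k \<ge> 1 \<Longrightarrow> G (2 * k) = (4 * P) ^ e k * M k"
proof -
  assume k: "k \<ge> 1"
  have "G (k * 2) = (\<Sum>j\<le>degree (G k). smult (coeff (G k) j) (\<Phi> 2 ^ j * G 2 ^ (k^2 - j)))"
    by (rule G_compose) (use k in auto)
  also have "\<dots> = (\<Sum>j\<le>degree (G k). G 2 ^ e k * smult (coeff (G k) j) (\<Phi> 2 ^ j * G 2 ^ (degree (G k) - j)))"
  proof (rule sum.cong[OF refl])
    fix j assume "j \<in> {..degree (G k)}"
    then have "k^2 - j = e k + (degree (G k) - j)" using degree_G_less[OF k] by (simp add: e_def)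
    then show "smult (coeff (G k) j) (\<Phi> 2 ^ j * G 2 ^ (k^2 - j)) =
        G 2 ^ e k * smult (coeff (G k) j) (\<Phi> 2 ^ j * G 2 ^ (degree (G k) - j))"
      by (simp add: power_add ac_simps)
  qed
  finally show ?thesis by (simp add: M_def sum_distrib_left G_2 mult.commute)
qed

lemma lead_M: "k \<ge> 1 \<Longrightarrow> degree (M k) = 4 * degree (G k) \<and> lead_coeff (M k) = L k"
proof -
  assume k: "k \<ge> 1"
  have "lead_at (M k) (degree (G k) * 2^2 + (degree (G k) - degree (G k)) * degree (G 2))
     (lead_coeff (G k) * lead_coeff (G 2) ^ (degree (G k) - degree (G k)))"
    unfolding M_def by (rule lead_hom_sum) (use lead_\<Phi>[of 2] degree_G_less[of 2] in auto)
  note c = lead_at_nonzero[OF this]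
  have "lead_coeff (G k) * lead_coeff (G 2) ^ (degree (G k) - degree (G k)) \<noteq> 0"
    using G_nz[OF k] by simp
  from c[OF this] show ?thesis
    by (elim conjE) (intro conjI, simp, simp only: L_def diff_self_eq_0 power_0 mult_1_right)
qed

text \<open>Since \<open>G 2\<close> = 4 P, only the top summand survives modulo P, and \<Phi> 2 is
  congruent to P'^2.\<close>

lemma M_mod_P: "P dvd M k - smult (L k) (P' ^ (2 * degree (G k)))"
proof -
  have P2: "P dvd \<Phi> 2 - P'^2"
  proof -
    have "\<Phi> 2 - P'^2 = P * (4 * [:0, 1:] - 4 * [:a2, 3:])"
      by (simp add: \<Phi>_def \<Theta>_def G_2 numeral_3_eq_3[symmetric] ring_distribs del: mult_pCons_left mult_pCons_right)
    then show ?thesis by simp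
  qed
  have "\<Phi> 2 ^ m mod P = (P'^2) ^ m mod P" for m
    by (rule power_mod_cong) (use P2 in \<open>simp add: mod_eq_dvd_iff\<close>)
  then have P3: "P dvd \<Phi> 2 ^ m - P' ^ (2 * m)" for m
    by (simp add: mod_eq_dvd_iff power_mult)
  define R where "R = (\<Sum>j<degree (G k). smult (coeff (G k) j) (\<Phi> 2 ^ j * G 2 ^ (degree (G k) - j)))"
  have "M k = smult (L k) (\<Phi> 2 ^ degree (G k)) + R"
    unfolding M_def R_def lessThan_Suc_atMost[symmetric] sum.lessThan_Suc by (simp add: L_def)
  then have "M k - smult (L k) (P' ^ (2 * degree (G k))) =
      smult (L k) (\<Phi> 2 ^ degree (G k) - P' ^ (2 * degree (G k))) + R"
    by (simp add: smult_diff_right)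
  moreover have "P dvd R"
    unfolding R_def
  proof (rule dvd_sum)
    fix j assume "j \<in> {..<degree (G k)}"
    then obtain i where "degree (G k) - j = Suc i" by (metis lessThan_iff Suc_diff_Suc)
    then show "P dvd smult (coeff (G k) j) (\<Phi> 2 ^ j * G 2 ^ (degree (G k) - j))"
      by (intro dvd_smult) (simp add: G_2)
  qed
  moreover have "P dvd smult (L k) (\<Phi> 2 ^ degree (G k) - P' ^ (2 * degree (G k)))"
    by (intro dvd_smult P3)
  ultimately show ?thesis
    by (metis dvd_add)
qed

end

section \<open>Multiplication by \<open>n\<close>\<close>

text \<open>The \<open>n\<close>-th multiple of \<open>(x, y)\<close>, given the sequence \<open>w\<close> of values of the division
  polynomials; \<open>w\<close> at \<open>-1\<close> is \<open>-1\<close>.\<close>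

definition seq_pred2 :: "(nat \<Rightarrow> 'b::field) \<Rightarrow> nat \<Rightarrow> 'b" where
  "seq_pred2 w n = (if n = 1 then - 1 else w (n - 2))"

definition seq_point :: "'b::field \<Rightarrow> 'b \<Rightarrow> (nat \<Rightarrow> 'b) \<Rightarrow> nat \<Rightarrow> 'b point" where
  "seq_point x y w n = (if w n = 0 then Infinity else
     Affine (x - w (n + 1) * w (n - 1) / w n ^ 2)
       ((w (n + 2) * w (n - 1)^2 - seq_pred2 w n * w (n + 1)^2) / (4 * y * w n ^ 3)))"

text \<open>Induction on n, adding (x, y) once more. Two consecutive terms never vanish together.
  The n-th multiple is infinity if w n = 0, the negative of the point if w (n+1) = 0, and the point
  itself if w (n-1) = 0; otherwise the chord applies. The value of \<open>seq_pred2\<close> at n = 1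
  lets the relations start at that index.\<close>

lemma point_mult_seq:
  fixes x y c2 c4 c6 \<beta> c :: "'b::field"
  assumes nz: "y \<noteq> 0" "(2::'b) \<noteq> 0"
    and \<beta>: "\<beta> = 3 * x^2 + 2 * c2 * x + c4" and c: "c = 4 * y^2 * (3 * x + c2) - \<beta>^2"
    and w: "w 0 = 0" "w 1 = 1" "w 2 = 2 * y" "w 3 = c"
    and S: "\<And>m. w (m + 4) * w m = 4 * y^2 * w (m + 3) * w (m + 1) - c * w (m + 2)^2"
    and I: "\<And>m. w (m + 1)^2 * w (m + 4) + w (m + 3)^2 * w m =
        2 * \<beta> * w (m + 3) * w (m + 1) * w (m + 2) - 4 * y^2 * w (m + 2)^3"
  shows "n \<ge> 1 \<Longrightarrow> w n = 0 \<Longrightarrow> w (n + 1) \<noteq> 0"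
    and "n \<ge> 1 \<Longrightarrow> w (n + 2) * seq_pred2 w n = 4 * y^2 * w (n + 1) * w (n - 1) - c * w n ^ 2"
    and "n \<ge> 1 \<Longrightarrow> w (n - 1)^2 * w (n + 2) + w (n + 1)^2 * seq_pred2 w n =
        2 * \<beta> * w (n + 1) * w (n - 1) * w n - 4 * y^2 * w n ^ 3"
    and "n \<ge> 1 \<Longrightarrow> point_mult (Weierstrass 0 c2 0 c4 c6) n (Affine x y) = seq_point x y w n"
proof -
  have four: "(4::'b) \<noteq> 0" using nz(2) by (metis mult_eq_0_iff mult_2 numeral_Bit0 one_add_one)
  show S1: "w (n + 2) * seq_pred2 w n = 4 * y^2 * w (n + 1) * w (n - 1) - c * w n ^ 2" if "n \<ge> 1" for n
  proof (cases "n = 1")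
    case True
    then show ?thesis using w by (simp add: seq_pred2_def numeral_3_eq_3)
  next
    case False
    define m where "m = n - 2"
    have m: "n = m + 2" using that False by (simp add: m_def)
    show ?thesis using S[of m] unfolding m seq_pred2_def by (simp add: numeral_eq_Suc)
  qed
  show I1: "w (n - 1)^2 * w (n + 2) + w (n + 1)^2 * seq_pred2 w n =
        2 * \<beta> * w (n + 1) * w (n - 1) * w n - 4 * y^2 * w n ^ 3" if "n \<ge> 1" for n
  proof (cases "n = 1")
    case True
    then show ?thesis using w by (simp add: seq_pred2_def numeral_2_eq_2 power2_eq_square)
  next
    case False
    define m where "m = n - 2"
    have m: "n = m + 2" using that False by (simp add: m_def)
    show ?thesis using I[of m] unfolding m seq_pred2_def by (simp add: numeral_eq_Suc)
  qed
  show nc: "w (n + 1) \<noteq> 0" if "n \<ge> 1" "w n = 0" for n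
    using that
  proof (induction n rule: nat_induct_at_least)
    case base
    then show ?case using w by simp
  next
    case (Suc n)
    show ?case
    proof
      assume 0: "w (Suc n + 1) = 0"
      \<comment> \<open>In the invariant two adjacent zeros force the preceding term to vanish too,
        and this descends to w 1 = 1.\<close>
      have "4 * y^2 * w n ^ 3 = 0" using I1[OF Suc.hyps] Suc.prems 0 by simp
      then have "w n = 0" using nz four by simp
      then show False using Suc.IH Suc.prems by simp
    qed
  qed
  define E where "E = Weierstrass 0 c2 0 c4 c6"
  have E: "wa1 E = 0" "wa2 E = c2" "wa3 E = 0" "wa4 E = c4" "wa6 E = c6" by (simp_all add: E_def)
  show "point_mult (Weierstrass 0 c2 0 c4 c6) n (Affine x y) = seq_point x y w n" if "n \<ge> 1" for n
    unfolding E_def[symmetric] using that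
  proof (induction n rule: nat_induct_at_least)
    case base
    show ?case using w nz four
      by (simp add: point_mult_def seq_point_def seq_pred2_def numeral_2_eq_2 power2_eq_square)
  next
    case (Suc n)
    define q2 q1 p0 p1 p2 p3 where "q2 = seq_pred2 w n" "q1 = w (n - 1)" "p0 = w n" "p1 = w (n + 1)"
      "p2 = w (n + 2)" "p3 = w (n + 3)"
    note defs = q2_q1_p0_p1_p2_p3_def
    have pr: "seq_pred2 w (Suc n) = q1" using Suc.hyps by (simp add: seq_pred2_def defs numeral_2_eq_2)
    have sn: "p2 * q2 = 4 * y^2 * p1 * q1 - c * p0^2" using S1[OF Suc.hyps] by (simp add: defs)
    have iN: "q1^2 * p2 + p1^2 * q2 = 2 * \<beta> * p1 * q1 * p0 - 4 * y^2 * p0^3"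
      using I1[OF Suc.hyps] by (simp add: defs)
    have sn': "p3 * q1 = 4 * y^2 * p2 * p0 - c * p1^2"
      using S1[of "Suc n"] pr by (simp add: defs numeral_eq_Suc)
    have iN': "p0^2 * p3 + p2^2 * q1 = 2 * \<beta> * p2 * p0 * p1 - 4 * y^2 * p1^3"
      using I1[of "Suc n"] pr by (simp add: defs numeral_eq_Suc)
    have goal: "seq_point x y w (Suc n) = (if p1 = 0 then Infinity else
        Affine (x - p2 * p0 / p1^2) ((p3 * p0^2 - q1 * p2^2) / (4 * y * p1^3)))"
      unfolding seq_point_def pr by (simp add: defs numeral_eq_Suc)
    have IH: "point_mult E n (Affine x y) = (if p0 = 0 then Infinity else
        Affine (x - p1 * q1 / p0^2) ((p2 * q1^2 - q2 * p1^2) / (4 * y * p0^3)))"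
      using Suc.IH unfolding seq_point_def by (simp add: defs)
    have step: "point_mult E (Suc n) (Affine x y) = point_add E (Affine x y) (point_mult E n (Affine x y))"
      by (simp add: point_mult_def)
    show ?case
    proof (cases "p0 = 0")
      case True
      have p1: "p1 \<noteq> 0" using nc[OF Suc.hyps] True by (simp add: defs)
      have "p3 * p0^2 - q1 * p2^2 = 4 * y^2 * p1^3" using iN' True by (simp add: algebra_simps)
      then have "(p3 * p0^2 - q1 * p2^2) / (4 * y * p1^3) = y"
        using nz four p1 by (simp add: field_simps power2_eq_square)
      then show ?thesis unfolding step IH goal using True p1 by simp
    next
      case p0: False
      define u where "u = p1 * q1 / p0^2"
      define Y where "Y = (p2 * q1^2 - q2 * p1^2) / (4 * y * p0^3)"
      have IH': "point_mult E n (Affine x y) = Affine (x - u) Y" using IH p0 by (simp add: u_def Y_def)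
      have Y4: "4 * y * p0^3 * Y = p2 * q1^2 - q2 * p1^2" using p0 nz four by (simp add: Y_def)
      show ?thesis
      proof (cases "u = 0")
        case False
        then have p1: "p1 \<noteq> 0" and q1: "q1 \<noteq> 0" by (auto simp: u_def)
        define v where "v = p2 * p0 / p1^2"
        define r where "r = q2 * p1^2 / p0^3"
        have uv: "u^2 * v = p2 * q1^2 / p0^3"
          using p0 p1 by (simp add: u_def v_def field_simps power2_eq_square power3_eq_cube)
        have "(u^2 * v + r) * p0^3 = q1^2 * p2 + p1^2 * q2"
          unfolding uv using p0 by (simp add: r_def field_simps)
        also have "\<dots> = (2 * \<beta> * u - 4 * y^2) * p0^3"
          unfolding iN using p0 by (simp add: u_def field_simps power2_eq_square power3_eq_cube)
        finally have sum: "u^2 * v + r = 2 * \<beta> * u - 4 * y^2" using p0 by simp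
        have "(u^2 * v * r) * p0^6 = (p1 * q1)^2 * (p2 * q2)"
          unfolding uv using p0 by (simp add: r_def field_simps power2_eq_square eval_nat_numeral)
        also have "\<dots> = (u^2 * (4 * y^2 * u - c)) * p0^6"
          unfolding sn using p0 by (simp add: u_def field_simps power2_eq_square eval_nat_numeral)
        finally have prod: "u^2 * v * r = u^2 * (4 * y^2 * u - (4 * y^2 * (3 * x + c2) - \<beta>^2))"
          using p0 c by simp
        have Y: "Y = (u^2 * v - r) / (4 * y)"
          unfolding uv using p0 nz four by (simp add: Y_def r_def diff_divide_distrib mult.commute)
        define l where "l = (Y - y) / ((x - u) - x)"
        note cs = chord_step[OF nz False sum prod Y l_def]
        have "uv2": "u * v^2 = q1 * p2^2 / p1^3"
          using p0 p1 by (simp add: u_def v_def field_simps power2_eq_square power3_eq_cube)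
        have "(p3 * p0^2 - q1 * p2^2) / p1^3 = (2 * \<beta> * p2 * p0 * p1 - 4 * y^2 * p1^3 - 2 * q1 * p2^2) / p1^3"
          using iN' by (simp add: algebra_simps)
        also have "\<dots> = 2 * \<beta> * v - 4 * y^2 - 2 * (q1 * p2^2 / p1^3)"
          using p1 by (simp add: v_def field_simps power2_eq_square power3_eq_cube)
        finally have "(p3 * p0^2 - q1 * p2^2) / p1^3 = 2 * \<beta> * v - 4 * y^2 - 2 * (u * v^2)"
          unfolding uv2 .
        moreover have "(p3 * p0^2 - q1 * p2^2) / (4 * y * p1^3) = (p3 * p0^2 - q1 * p2^2) / p1^3 / (4 * y)"
          by (simp add: mult.commute)
        ultimately have "(p3 * p0^2 - q1 * p2^2) / (4 * y * p1^3) = (2 * \<beta> * v - 4 * y^2 - 2 * u * v^2) / (4 * y)"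
          by (simp only: mult.assoc)
        then have goal': "seq_point x y w (Suc n) = Affine (x - v) (- l * (x - v) - (y - l * x))"
          unfolding goal cs(2) using p1 by (simp add: v_def)
        have "x \<noteq> x - u" using False by simp
        then have "point_add E (Affine x y) (Affine (x - u) Y) =
           Affine (l^2 - c2 - x - (x - u)) (- l * (l^2 - c2 - x - (x - u)) - (y - l * x))"
          by (simp add: E Let_def l_def)
        then show ?thesis unfolding step IH' goal' cs(1) .
      next
        case u0: True
        show ?thesis
        proof (cases "p1 = 0")
          case True
          have "4 * y * p0^3 * Y = 4 * y * p0^3 * (- y)"
            unfolding Y4 using iN True by (simp add: power2_eq_square power3_eq_cube algebra_simps)
          moreover have "4 * y * p0^3 \<noteq> 0" using nz four p0 by simp
          ultimately have "Y = - y" by (metis mult_left_cancel)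
          then show ?thesis unfolding step IH' goal using u0 True E by simp
        next
          case p1: False
          then have q1: "q1 = 0" using u0 p0 by (auto simp: u_def)
          have "4 * y * p0^3 * Y = 4 * y * p0^3 * y"
            unfolding Y4 using iN q1 by (simp add: power2_eq_square power3_eq_cube algebra_simps)
          moreover have "4 * y * p0^3 \<noteq> 0" using nz four p0 by simp
          ultimately have Y: "Y = y" by (metis mult_left_cancel)
          define l where "l = \<beta> / (2 * y)"
          note ts = tangent_step[OF nz c l_def]
          have v: "p2 * p0 / p1^2 = c / (4 * y^2)"
            using sn' q1 p1 nz four by (simp add: field_simps)
          have num: "p3 * p0^2 - q1 * p2^2 = 2 * \<beta> * p2 * p0 * p1 - 4 * y^2 * p1^3"
            using iN' q1 by (simp add: algebra_simps)
          have "(p3 * p0^2 - q1 * p2^2) / p1^3 = 2 * \<beta> * (p2 * p0 / p1^2) - 4 * y^2"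
            unfolding num using p1 by (simp add: field_simps power2_eq_square power3_eq_cube)
          moreover have "(p3 * p0^2 - q1 * p2^2) / (4 * y * p1^3) = (p3 * p0^2 - q1 * p2^2) / p1^3 / (4 * y)"
            by (simp add: mult.commute)
          ultimately have "(p3 * p0^2 - q1 * p2^2) / (4 * y * p1^3) = (2 * \<beta> * c / (4 * y^2) - 4 * y^2) / (4 * y)"
            unfolding v by (simp only: times_divide_eq_right)
          then have goal': "seq_point x y w (Suc n) = Affine (x - c / (4 * y^2)) (- l * (x - c / (4 * y^2)) - (y - l * x))"
            unfolding goal v ts(2) using p1 by simp
          have "y + y \<noteq> 0" using nz by (metis mult_2 mult_eq_0_iff)
          then have "point_add E (Affine x y) (Affine x y) =
             Affine (l^2 - c2 - x - x) (- l * (l^2 - c2 - x - x) - (y - l * x))"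
            by (simp add: E Let_def l_def \<beta>)
          then show ?thesis unfolding step IH' goal' ts(1) using u0 Y by simp
        qed
      qed
    qed
  qed
qed

text \<open>With root y + r the equation reads 2 y r + r^2 = g - y^2, and the series 2 y X + X^2 has
  an inverse under composition because 2 y is nonzero.\<close>

lemma fps_sqrt_exists:
  fixes g :: "'a::field fps"
  assumes y: "y \<noteq> 0" "(2::'a) \<noteq> 0" and g: "fps_nth g 0 = y^2"
  shows "\<exists>s. s^2 = g \<and> fps_nth s 0 = y"
proof -
  define q where "q = fps_const (2 * y) * fps_X + fps_X ^ 2"
  have q: "fps_nth q 0 = 0" "fps_nth q 1 \<noteq> 0"
    using y by (simp_all add: q_def power2_eq_square)
  define d where "d = g - fps_const (y^2)"
  have d: "fps_nth d 0 = 0" using g by (simp add: d_def)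
  have i0: "fps_nth (fps_inv q) 0 = 0" by (simp add: fps_inv_def)
  define r where "r = fps_inv q oo d"
  have r0: "fps_nth r 0 = 0" by (simp add: r_def i0)
  have "q oo r = (q oo fps_inv q) oo d"
    unfolding r_def by (rule fps_compose_assoc) (use d i0 in auto)
  also have "\<dots> = d" using fps_inv_right[OF q] d by simp
  finally have "fps_const (2 * y) * r + r^2 = d"
    unfolding q_def by (simp add: fps_compose_add_distrib fps_compose_mult_distrib[OF r0] fps_compose_power[OF r0, symmetric] r0)
  then have "(fps_const y + r)^2 = g"
    unfolding d_def by (simp add: power2_eq_square algebra_simps fps_const_add[symmetric] fps_const_mult[symmetric] numeral_fps_const del: fps_const_add fps_const_mult)
  moreover have "fps_nth (fps_const y + r) 0 = y" using r0 by simp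
  ultimately show ?thesis by blast
qed

lemma prod_linear_proots:
  fixes p :: "'a::alg_closed_field poly"
  assumes "p \<noteq> 0"
  shows "p = smult (lead_coeff p) (\<Prod>x\<in>#proots p. [:-x, 1:])"
proof -
  obtain A where A: "p = smult (lead_coeff p) (\<Prod>x\<in>#A. [:-x, 1:])"
    using alg_closed_imp_factorization[OF assms] by blast
  have "proots (\<Prod>x\<in>#A. [:-x, 1:]) = A"
  proof (induction A)
    case (add x A)
    have "(\<Prod>x\<in>#A. [:-x, 1:]) \<noteq> 0" by (auto simp: prod_mset_zero_iff)
    then have "proots ([:-x, 1:] * (\<Prod>x\<in>#A. [:-x, 1:])) = proots [:-x, 1:] + A"
      using add by (subst proots_mult) (auto simp del: mult_pCons_left)
    then show ?case by (simp del: mult_pCons_left)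
  qed simp
  moreover have "proots p = proots (\<Prod>x\<in>#A. [:-x, 1:])"
    using assms by (subst A) simp
  ultimately show ?thesis using A by simp
qed

section \<open>Torsion points and their multiplicities\<close>

context cubic
begin

text \<open>Realises the abstract sequence of \<open>point_mult_seq\<close> by the values of psi_n
  at (x, y). It is applied over the base field and over the Laurent series that contain a formal
  parametrisation.\<close>

lemma pt_point:
  fixes \<iota> :: "'a \<Rightarrow> 'b::field"
  assumes hom: "\<And>x y. \<iota> (x + y) = \<iota> x + \<iota> y" "\<And>x y. \<iota> (x * y) = \<iota> x * \<iota> y" "\<iota> 1 = 1"
    and y: "y \<noteq> 0" "(2::'b) \<noteq> 0" "y^2 = x^3 + \<iota> a2 * x^2 + \<iota> a4 * x + \<iota> a6"
  defines "w \<equiv> pt_seq (\<lambda>p. poly (map_poly \<iota> p) x) (2 * y)"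
    and "\<beta> \<equiv> 3 * x^2 + 2 * \<iota> a2 * x + \<iota> a4"
  defines "c \<equiv> 4 * y^2 * (3 * x + \<iota> a2) - \<beta>^2"
  shows "curve_hom (\<lambda>p. poly (map_poly \<iota> p) x) (2 * y)"
    and "w 0 = 0" "w 1 = 1" "w 2 = 2 * y"
    and "n \<ge> 1 \<Longrightarrow> w n = 0 \<Longrightarrow> w (n + 1) \<noteq> 0"
    and "n \<ge> 1 \<Longrightarrow> w (n + 2) * seq_pred2 w n = 4 * y^2 * w (n + 1) * w (n - 1) - c * w n ^ 2"
    and "n \<ge> 1 \<Longrightarrow> w (n - 1)^2 * w (n + 2) + w (n + 1)^2 * seq_pred2 w n =
        2 * \<beta> * w (n + 1) * w (n - 1) * w n - 4 * y^2 * w n ^ 3"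
    and "n \<ge> 1 \<Longrightarrow> point_mult (Weierstrass 0 (\<iota> a2) 0 (\<iota> a4) c6) n (Affine x y) = seq_point x y w n"
proof -
  have b: "(2 * y)^2 = 4 * (x^3 + \<iota> a2 * x^2 + \<iota> a4 * x + \<iota> a6)"
    unfolding power_mult_distrib y(3) by simp
  note ev = eval_hom[OF hom b]
  show ch: "curve_hom (\<lambda>p. poly (map_poly \<iota> p) x) (2 * y)" by (rule ev(1))
  have c': "poly (map_poly \<iota> (f 3)) x = c"
  proof -
    have "poly (map_poly \<iota> (f 3)) x = (2 * y)^2 * (3 * x + \<iota> a2) - \<beta>^2"
      unfolding f_initial(4) using curve_hom_simps[OF ch] ev(4,5) unfolding \<beta>_def by (simp only:)
    then show ?thesis by (simp add: c_def power_mult_distrib)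
  qed
  show w: "w 0 = 0" "w 1 = 1" "w 2 = 2 * y"
    by (simp_all add: w_def pt_seq_def)
  have w3: "w 3 = c" unfolding w_def using pt_seq_eq[OF ch, of 3] c' by simp
  have S: "w (m + 4) * w m = 4 * y^2 * w (m + 3) * w (m + 1) - c * w (m + 2)^2" for m
    using pt_seq_somos[OF ch, of m] unfolding w_def c' by (simp add: power_mult_distrib)
  have I: "w (m + 1)^2 * w (m + 4) + w (m + 3)^2 * w m =
        2 * \<beta> * w (m + 3) * w (m + 1) * w (m + 2) - 4 * y^2 * w (m + 2)^3" for m
    using pt_seq_invariant[OF ch, of m] unfolding w_def ev(5) \<beta>_def by (simp add: power_mult_distrib)
  note pm = point_mult_seq[OF y(1,2) \<beta>_def[THEN meta_eq_to_obj_eq] c_def[THEN meta_eq_to_obj_eq] w w3 S I]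
  show "n \<ge> 1 \<Longrightarrow> w n = 0 \<Longrightarrow> w (n + 1) \<noteq> 0" by (rule pm(1))
  show "n \<ge> 1 \<Longrightarrow> w (n + 2) * seq_pred2 w n = 4 * y^2 * w (n + 1) * w (n - 1) - c * w n ^ 2" by (rule pm(2))
  show "n \<ge> 1 \<Longrightarrow> w (n - 1)^2 * w (n + 2) + w (n + 1)^2 * seq_pred2 w n =
        2 * \<beta> * w (n + 1) * w (n - 1) * w n - 4 * y^2 * w n ^ 3" by (rule pm(3))
  show "n \<ge> 1 \<Longrightarrow> point_mult (Weierstrass 0 (\<iota> a2) 0 (\<iota> a4) c6) n (Affine x y) = seq_point x y w n"
    by (rule pm(4))
qed

lemma poly_P: "poly P x = x^3 + a2 * x^2 + a4 * x + a6"
  by (simp add: P_def power2_eq_square power3_eq_cube algebra_simps)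

text \<open>At an n-torsion point with y0 nonzero the terms of index n - 1, n + 1 and n + 2 are
  units, so x/y composed with [n] is psi_n times a unit. As \<phi> - x0 is a local parameter there,
  its order is the multiplicity of x0 as a root of \<open>f n\<close>.\<close>

lemma param_subdegree:
  assumes par: "formal_parametrization (Weierstrass 0 a2 0 a4 a6) x0 y0 \<phi> \<psi>"
    and y0: "y0 \<noteq> 0" and n: "n \<ge> 1" and root: "poly (f n) x0 = 0"
  shows "\<exists>\<xi> \<eta>. point_mult (map_weierstrass fls_const (Weierstrass 0 a2 0 a4 a6)) n
            (Affine (fps_to_fls \<phi>) (fps_to_fls \<psi>)) = Affine \<xi> \<eta> \<and>
          fls_subdegree (\<xi> / \<eta>) = int (order x0 (f n))"
proof -
  define x where "x = fps_to_fls \<phi>"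
  define y where "y = fps_to_fls \<psi>"
  have c0: "fps_nth \<phi> 0 = x0" "fps_nth \<psi> 0 = y0" and d0: "fps_nth \<phi> 1 \<noteq> 0 \<or> fps_nth \<psi> 1 \<noteq> 0"
    using par by (auto simp: formal_parametrization_def)
  have crv: "y^2 = x^3 + fls_const a2 * x^2 + fls_const a4 * x + fls_const a6"
    using par by (simp add: formal_parametrization_def weierstrass_fun_def x_def y_def)
  have "fps_to_fls (\<psi>^2) = fps_to_fls (\<phi>^3 + fps_const a2 * \<phi>^2 + fps_const a4 * \<phi> + fps_const a6)"
    using crv by (simp add: x_def y_def fls_times_fps_to_fls fps_to_fls_power)
  then have crvf: "\<psi>^2 = \<phi>^3 + fps_const a2 * \<phi>^2 + fps_const a4 * \<phi> + fps_const a6"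
    by (simp only: fps_to_fls_eq_iff)
  have crv0: "y0^2 = x0^3 + a2 * x0^2 + a4 * x0 + a6"
    using arg_cong[OF crvf, of "\<lambda>s. fps_nth s 0"] by (simp add: c0 power2_eq_square power3_eq_cube)
  \<comment> \<open>The linear terms of the curve equation give 2 y0 \<psi>'(0) = P'(x0) \<phi>'(0).
    If \<phi>'(0) were 0, then so would be \<psi>'(0), against the definition of a
    parametrisation.\<close>
  have \<phi>1: "fps_nth \<phi> 1 \<noteq> 0"
  proof
    assume 0: "fps_nth \<phi> 1 = 0"
    have "2 * y0 * fps_nth \<psi> 1 = 0"
      using arg_cong[OF crvf, of "\<lambda>s. fps_nth s 1"] 0
      by (simp add: c0 power2_eq_square power3_eq_cube fps_mult_nth_1)
    then show False using 0 d0 y0 two by simp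
  qed
  have y: "y \<noteq> 0" using c0(2) y0 by (auto simp: y_def)
  have two': "(2::'a fls) \<noteq> 0"
  proof -
    have "fps_nth (2::'a fps) 0 = 2" by (simp add: numeral_fps_const)
    then have "(2::'a fps) \<noteq> 0" using two by auto
    then show ?thesis using fps_to_fls_eq_0_iff[of "2::'a fps"] by simp
  qed
  have hom: "fls_const (a + b) = fls_const a + fls_const b" "fls_const (a * b) = fls_const a * fls_const b"
    "fls_const (1::'a) = 1" for a b :: 'a
  proof -
    show "fls_const (a + b) = fls_const a + fls_const b"
      using fps_to_fls_plus[of "fps_const a" "fps_const b"] by simp
    show "fls_const (a * b) = fls_const a * fls_const b"
      using fls_times_fps_to_fls[of "fps_const a" "fps_const b"] by simp
  qed simp
  note pt = pt_point[OF hom y two' crv]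
  define w where "w = pt_seq (\<lambda>p. poly (map_poly fls_const p) x) (2 * y)"
  have hom0: "(\<lambda>c::'a. c) (a + b) = (\<lambda>c. c) a + (\<lambda>c. c) b" "(\<lambda>c::'a. c) (a * b) = (\<lambda>c. c) a * (\<lambda>c. c) b"
    "(\<lambda>c::'a. c) 1 = 1" for a b by simp_all
  note pt0 = pt_point[OF hom0 y0 two crv0, unfolded map_poly_id']
  define w0 where "w0 = pt_seq (\<lambda>p. poly p x0) (2 * y0)"
  define hf where "hf p = poly (map_poly fps_const p) \<phi>" for p
  have hf_fls: "fps_to_fls (hf p) = poly (map_poly fls_const p) x" for p
    unfolding hf_def by (induction p) (simp_all add: map_poly_pCons fls_times_fps_to_fls x_def)
  have hf_add: "hf (p + q) = hf p + hf q" for p q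
    unfolding hf_def by (subst map_poly_hom_add[of fps_const]) simp_all
  have hf_mult: "hf (p * q) = hf p * hf q" for p q
    unfolding hf_def by (subst map_poly_hom_mult[of fps_const]) simp_all
  have hf_0: "fps_nth (hf p) 0 = poly p x0" for p
    unfolding hf_def by (induction p) (simp_all add: map_poly_pCons c0)
  define wf where "wf k = hf (f k) * (if even k then 2 * \<psi> else 1)" for k
  have w_wf: "w k = fps_to_fls (wf k)" for k
    unfolding w_def pt_seq_eq[OF pt(1)] wf_def by (simp add: fls_times_fps_to_fls hf_fls y_def)
  have w0_wf: "w0 k = fps_nth (wf k) 0" for k
    unfolding w0_def pt_seq_eq[OF pt0(1)] wf_def by (simp add: hf_0 c0)
  have w0n: "w0 n = 0" unfolding w0_def pt_seq_eq[OF pt0(1)] using root by simp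
  have n1: "n \<noteq> 1" using w0n pt0(3) by (auto simp: w0_def)
  have p1: "w0 (n + 1) \<noteq> 0" using pt0(5)[OF n] w0n by (simp add: w0_def)
  have "n - 1 \<ge> 1" using n n1 by simp
  then have q1: "w0 (n - 1) \<noteq> 0" using pt0(5)[of "n - 1"] n w0n by (auto simp: w0_def)
  have I0: "w0 (n - 1)^2 * w0 (n + 2) + w0 (n + 1)^2 * seq_pred2 w0 n = 0"
    using pt0(7)[OF n] w0n by (simp add: w0_def)
  have "w0 (n + 2) * seq_pred2 w0 n = 4 * y0^2 * w0 (n + 1) * w0 (n - 1)"
    using pt0(6)[OF n] w0n by (simp add: w0_def)
  then have p2: "w0 (n + 2) \<noteq> 0" using p1 q1 y0 four by auto
  \<comment> \<open>\<open>Nf\<close> and \<open>Df\<close> come from the numerators of the y- and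
    of the x-coordinate of the n-th multiple; x/y composed with [n] is w n times \<open>Df\<close> /
    \<open>Nf\<close>.\<close>
  define Nf where "Nf = wf (n + 2) * wf (n - 1)^2 - wf (n - 2) * wf (n + 1)^2"
  \<comment> \<open>Where w n vanishes, the invariant makes the two terms of \<open>Nf\<close> equal
    up to sign in such a way that they add up.\<close>
  have N0: "fps_nth Nf 0 \<noteq> 0"
  proof -
    have "fps_nth Nf 0 = w0 (n + 2) * w0 (n - 1)^2 - w0 (n + 1)^2 * seq_pred2 w0 n"
      using n1 unfolding Nf_def w0_wf seq_pred2_def by (simp add: power2_eq_square w0_wf algebra_simps)
    also have "\<dots> = 2 * w0 (n + 2) * w0 (n - 1)^2" using I0 by (simp add: algebra_simps eq_neg_iff_add_eq_0)
    finally show ?thesis using p2 q1 two by simp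
  qed
  define Df where "Df = 4 * \<psi> * (\<phi> * wf n ^ 2 - wf (n + 1) * wf (n - 1))"
  have D0: "fps_nth Df 0 \<noteq> 0"
  proof -
    have "fps_nth (4 :: 'a fps) 0 = 4" by (simp add: numeral_fps_const)
    then have "fps_nth Df 0 = - (4 * y0 * (w0 (n + 1) * w0 (n - 1)))"
      unfolding Df_def using w0n w0_wf[of n] by (simp add: c0 w0_wf power2_eq_square)
    then show ?thesis using p1 q1 y0 four by simp
  qed
  obtain q where q: "f n = [:- x0, 1:] ^ order x0 (f n) * q" "poly q x0 \<noteq> 0"
    using order_decomp[OF f_nz[OF n], of x0] by (auto simp: poly_eq_0_iff_dvd)
  have sub: "subdegree (wf n) = order x0 (f n)" and wfn: "wf n \<noteq> 0"
  proof -
    have lin: "hf [:- x0, 1:] = \<phi> - fps_const x0"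
      by (simp add: hf_def map_poly_pCons)
    have s1: "subdegree (\<phi> - fps_const x0) = 1"
      by (rule subdegreeI) (use \<phi>1 c0 in auto)
    then have nz1: "\<phi> - fps_const x0 \<noteq> 0" by auto
    have hp: "hf (p ^ k) = hf p ^ k" for p k
      by (induction k) (simp_all add: hf_mult, simp add: hf_def)
    define U where "U = hf q * (if even n then 2 * \<psi> else 1)"
    have U0: "fps_nth U 0 \<noteq> 0" unfolding U_def using q(2) y0 two by (simp add: hf_0 c0)
    have e: "wf n = (\<phi> - fps_const x0) ^ order x0 (f n) * U"
      unfolding wf_def U_def using arg_cong[OF q(1), of hf] by (simp add: hf_mult hp lin mult.assoc)
    have Un: "U \<noteq> 0" using U0 by auto
    have "subdegree U = 0" using U0 by (simp add: subdegree_eq_0_iff)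
    then show "subdegree (wf n) = order x0 (f n)" unfolding e using nz1 Un s1 by (simp add: subdegree_mult subdegree_power)
    show "wf n \<noteq> 0" unfolding e using nz1 Un by simp
  qed
  have wn: "w n \<noteq> 0" using wfn by (simp add: w_wf)
  define \<xi> where "\<xi> = x - w (n + 1) * w (n - 1) / w n ^ 2"
  define \<eta> where "\<eta> = (w (n + 2) * w (n - 1)^2 - seq_pred2 w n * w (n + 1)^2) / (4 * y * w n ^ 3)"
  have "point_mult (Weierstrass 0 (fls_const a2) 0 (fls_const a4) (fls_const a6)) n (Affine x y) = Affine \<xi> \<eta>"
    using pt(8)[OF n] wn unfolding w_def[symmetric] seq_point_def \<xi>_def \<eta>_def by simp
  then have pm: "point_mult (map_weierstrass fls_const (Weierstrass 0 a2 0 a4 a6)) n (Affine x y) = Affine \<xi> \<eta>"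
    by simp
  have Nf': "fps_to_fls Nf = w (n + 2) * w (n - 1)^2 - seq_pred2 w n * w (n + 1)^2"
    using n1 by (simp add: Nf_def seq_pred2_def w_wf fls_times_fps_to_fls fps_to_fls_power)
  have Df': "fps_to_fls Df = 4 * y * (x * w n ^ 2 - w (n + 1) * w (n - 1))"
    by (simp add: Df_def w_wf fls_times_fps_to_fls fps_to_fls_power x_def y_def)
  have Nnz: "Nf \<noteq> 0" and Dnz: "Df \<noteq> 0" using N0 D0 by auto
  have four': "(4::'a fls) \<noteq> 0" using two' by (metis mult_eq_0_iff mult_2 numeral_Bit0 one_add_one)
  have "\<xi> / \<eta> = w n * fps_to_fls Df / fps_to_fls Nf"
    unfolding \<xi>_def \<eta>_def Nf'[symmetric] Df' using wn y four' Nnz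
    by (simp add: field_simps power2_eq_square power3_eq_cube)
  also have "\<dots> = fps_to_fls (wf n) * (fps_to_fls Df * inverse (fps_to_fls Nf))"
    by (simp add: w_wf divide_inverse mult.assoc)
  finally have "fls_subdegree (\<xi> / \<eta>) = int (order x0 (f n))"
    using wfn Nnz Dnz N0 D0 sub by (simp add: fls_subdegree_fls_to_fps subdegree_eq_0_iff)
  then show ?thesis using pm unfolding x_def y_def by blast
qed

text \<open>The choice in the definition is independent of the parametrisation by
  \<open>param_subdegree\<close>, and a parametrisation exists: x0 + X together with a square root
  of P(x0 + X).\<close>

lemma kernel_length_eq:
  assumes y0: "y0 \<noteq> 0" "y0^2 = poly P x0" and n: "n \<ge> 1" and root: "poly (f n) x0 = 0"
  shows "kernel_length (Weierstrass 0 a2 0 a4 a6) n x0 y0 = order x0 (f n)"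
proof -
  define \<phi> where "\<phi> = fps_const x0 + fps_X"
  define g where "g = \<phi>^3 + fps_const a2 * \<phi>^2 + fps_const a4 * \<phi> + fps_const a6"
  have "fps_nth g 0 = y0^2"
    unfolding y0(2) poly_P by (simp add: g_def \<phi>_def power2_eq_square power3_eq_cube)
  then obtain \<psi> where \<psi>: "\<psi>^2 = g" "fps_nth \<psi> 0 = y0"
    using fps_sqrt_exists[OF y0(1) two] by blast
  have "fps_to_fls \<psi> ^ 2 = fps_to_fls g" using \<psi>(1) by (simp flip: fps_to_fls_power)
  then have par: "formal_parametrization (Weierstrass 0 a2 0 a4 a6) x0 y0 \<phi> \<psi>"
    using \<psi>(2) unfolding formal_parametrization_def
    by (simp add: weierstrass_fun_def g_def fls_times_fps_to_fls fps_to_fls_power) (simp add: \<phi>_def)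
  show ?thesis unfolding kernel_length_def
  proof (rule some_equality)
    show "\<exists>\<phi> \<psi> \<xi> \<eta>. formal_parametrization (Weierstrass 0 a2 0 a4 a6) x0 y0 \<phi> \<psi> \<and>
        point_mult (map_weierstrass fls_const (Weierstrass 0 a2 0 a4 a6)) n (Affine (fps_to_fls \<phi>) (fps_to_fls \<psi>)) = Affine \<xi> \<eta> \<and>
        fls_subdegree (\<xi> / \<eta>) = int (order x0 (f n))"
      using param_subdegree[OF par y0(1) n root] par by blast
  next
    fix m
    assume "\<exists>\<phi> \<psi> \<xi> \<eta>. formal_parametrization (Weierstrass 0 a2 0 a4 a6) x0 y0 \<phi> \<psi> \<and>
        point_mult (map_weierstrass fls_const (Weierstrass 0 a2 0 a4 a6)) n (Affine (fps_to_fls \<phi>) (fps_to_fls \<psi>)) = Affine \<xi> \<eta> \<and>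
        fls_subdegree (\<xi> / \<eta>) = int m"
    then obtain \<phi> \<psi> \<xi> \<eta> where 1: "formal_parametrization (Weierstrass 0 a2 0 a4 a6) x0 y0 \<phi> \<psi>"
      "point_mult (map_weierstrass fls_const (Weierstrass 0 a2 0 a4 a6)) n (Affine (fps_to_fls \<phi>) (fps_to_fls \<psi>)) = Affine \<xi> \<eta>"
      "fls_subdegree (\<xi> / \<eta>) = int m" by blast
    from param_subdegree[OF 1(1) y0(1) n root] 1(2,3) show "m = order x0 (f n)" by auto
  qed
qed

lemma torsion_minus_two_eq:
  assumes n: "n \<ge> 1"
  shows "torsion_minus_two (Weierstrass 0 a2 0 a4 a6) n =
    {(x, y). y \<noteq> 0 \<and> y^2 = poly P x \<and> poly (f n) x = 0}"
proof -
  have hom0: "(\<lambda>c::'a. c) (a + b) = (\<lambda>c. c) a + (\<lambda>c. c) b" "(\<lambda>c::'a. c) (a * b) = (\<lambda>c. c) a * (\<lambda>c. c) b"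
    "(\<lambda>c::'a. c) 1 = 1" for a b by simp_all
  have "on_curve (Weierstrass 0 a2 0 a4 a6) (Affine x y) \<and>
      point_mult (Weierstrass 0 a2 0 a4 a6) n (Affine x y) = Infinity \<and>
      point_mult (Weierstrass 0 a2 0 a4 a6) 2 (Affine x y) \<noteq> Infinity \<longleftrightarrow>
      y \<noteq> 0 \<and> y^2 = poly P x \<and> poly (f n) x = 0" (is "?A \<longleftrightarrow> ?B") for x y
  proof (cases "y = 0")
    case True
    have "point_mult (Weierstrass 0 a2 0 a4 a6) 2 (Affine x 0) = Infinity"
      by (simp add: point_mult_def numeral_2_eq_2)
    then show ?thesis using True by simp
  next
    case y: False
    show ?thesis
    proof (cases "y^2 = poly P x")
      case True
      note pt = pt_point[OF hom0 y two True[unfolded poly_P], unfolded map_poly_id']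
      have "point_mult (Weierstrass 0 a2 0 a4 a6) n (Affine x y) = Infinity \<longleftrightarrow> poly (f n) x = 0"
        using pt(8)[OF n] y two unfolding seq_point_def pt_seq_eq[OF pt(1)] by simp
      moreover have "point_mult (Weierstrass 0 a2 0 a4 a6) 2 (Affine x y) \<noteq> Infinity"
        using pt(8)[of 2] y two unfolding seq_point_def pt(4) by simp
      ultimately show ?thesis using y True by (simp add: weierstrass_fun_def poly_P)
    next
      case False
      then show ?thesis by (simp add: weierstrass_fun_def poly_P)
    qed
  qed
  then show ?thesis unfolding torsion_minus_two_def by auto
qed

lemma poly_P'_nz: "poly P x = 0 \<Longrightarrow> poly P' x \<noteq> 0"
  using arg_cong[OF bezout_disc, of "\<lambda>p. poly p x"] disc by auto

end

locale cubic_ac = cubic a2 a4 a6 for a2 a4 a6 :: "'a::alg_closed_field"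
begin

text \<open>Over a root x0 of \<open>f n\<close> that is no root of P there lie exactly two points
  (x0, y) and (x0, -y), each with multiplicity the order of \<open>f n\<close>; hence the factor 2.
  Polynomials with the same roots and multiplicities differ by a constant.\<close>

lemma torsion_poly_eq:
  assumes n: "n \<ge> 1" and Q: "Q \<noteq> 0"
    and ord: "\<And>x. poly P x \<noteq> 0 \<Longrightarrow> order x Q = 2 * order x (f n)"
    and unit: "\<And>x. poly P x = 0 \<Longrightarrow> poly Q x \<noteq> 0"
  shows "Q = smult (lead_coeff Q) (torsion_poly (Weierstrass 0 a2 0 a4 a6) n)"
proof -
  define S where "S = {(x, y). y \<noteq> 0 \<and> y^2 = poly P x \<and> poly (f n) x = 0}"
  define T where "T = (\<Prod>(x, y)\<in>S. [:- x, 1:] ^ order x (f n))"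
  have T: "torsion_poly (Weierstrass 0 a2 0 a4 a6) n = T"
    unfolding torsion_poly_def T_def torsion_minus_two_eq[OF n] S_def
    by (rule prod.cong) (auto simp: kernel_length_eq[OF _ _ n])
  have fin_sqrt: "finite {y. y^2 = c}" for c :: 'a
  proof -
    have "{y. y^2 = c} \<subseteq> {y. poly [:- c, 0, 1:] y = 0}" by (auto simp: power2_eq_square)
    then show ?thesis using poly_roots_finite[of "[:- c, 0, 1:]"] finite_subset by auto
  qed
  have "S \<subseteq> (SIGMA x:{x. poly (f n) x = 0}. {y. y^2 = poly P x})" by (auto simp: S_def)
  moreover have "finite (SIGMA x:{x. poly (f n) x = 0}. {y. y^2 = poly P x})"
    using poly_roots_finite[OF f_nz[OF n]] fin_sqrt by auto
  ultimately have fin: "finite S" by (rule finite_subset)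
  have Tnz: "T \<noteq> 0" using fin by (auto simp: T_def)
  have lcT: "lead_coeff T = 1"
    unfolding T_def by (simp add: lead_coeff_prod lead_coeff_power case_prod_beta)
  have "proots Q = proots T"
  proof (rule multiset_eqI)
    fix x0
    have "count (proots T) x0 = (\<Sum>(x, y)\<in>S. if x = x0 then order x0 (f n) else 0)"
      unfolding T_def by (subst proots_prod) (auto simp: count_sum proots_power intro!: sum.cong)
    also have "\<dots> = (\<Sum>p\<in>{p \<in> S. fst p = x0}. order x0 (f n))"
      using fin by (subst sum.inter_filter) (auto intro!: sum.cong)
    also have "\<dots> = card {p \<in> S. fst p = x0} * order x0 (f n)" by simp
    also have "\<dots> = order x0 Q"
    proof (cases "poly P x0 = 0 \<or> poly (f n) x0 \<noteq> 0")
      case True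
      then have empty: "{p \<in> S. fst p = x0} = {}" by (auto simp: S_def)
      have "order x0 Q = 0"
        using True ord[of x0] unit[of x0] order_0I[of Q x0] order_0I[of "f n" x0]
        by (cases "poly P x0 = 0") auto
      then show ?thesis unfolding empty by simp
    next
      case False
      obtain y where y: "y^2 = poly P x0" using nth_root_exists[of 2 "poly P x0"] by auto
      have ynz: "y \<noteq> 0" using y False by auto
      have "{p \<in> S. fst p = x0} = {(x0, y), (x0, - y)}"
      proof -
        have "z^2 = poly P x0 \<longleftrightarrow> z = y \<or> z = - y" for z
          unfolding y[symmetric] by (rule power2_eq_iff)
        then have "z \<noteq> 0 \<and> z^2 = poly P x0 \<longleftrightarrow> z \<in> {y, - y}" for z using ynz by fastforce
        then have "{z. z \<noteq> 0 \<and> z^2 = poly P x0} = {y, - y}" by blast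
        moreover have "{p \<in> S. fst p = x0} = Pair x0 ` {z. z \<noteq> 0 \<and> z^2 = poly P x0}"
          using False unfolding S_def by fastforce
        ultimately show ?thesis by simp
      qed
      moreover have "y \<noteq> - y"
      proof
        assume a: "y = - y"
        have "2 * y = 0" using arg_cong[OF a, of "(+) y"] unfolding mult_2 by (metis add.right_inverse)
        then show False using ynz two by simp
      qed
      ultimately have "card {p \<in> S. fst p = x0} = 2" by simp
      then show ?thesis using ord False by simp
    qed
    finally show "count (proots Q) x0 = count (proots T) x0" using Q by simp
  qed
  then have "Q = smult (lead_coeff Q) (\<Prod>x\<in>#proots T. [:-x, 1:])"
    using prod_linear_proots[OF Q] by simp
  also have "(\<Prod>x\<in>#proots T. [:-x, 1:]) = T"
    using prod_linear_proots[OF Tnz] lcT by simp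
  finally show ?thesis unfolding T .
qed

lemma torsion_poly_odd:
  assumes "odd n"
  shows "G n = smult (L n) (torsion_poly (Weierstrass 0 a2 0 a4 a6) n)"
proof -
  obtain k where k: "n = 2 * k + 1" using assms by (elim oddE)
  have n: "n \<ge> 1" using k by simp
  show ?thesis unfolding L_def
  proof (rule torsion_poly_eq[OF n G_nz[OF n]])
    fix x assume "poly P x \<noteq> 0"
    show "order x (G n) = 2 * order x (f n)"
      using assms f_nz[OF n] by (simp add: G_def power2_eq_square order_mult)
  next
    fix x assume 0: "poly P x = 0"
    obtain q where q: "G n - P' ^ (2 * k * (k + 1)) = P * q" using G_odd_mod_P[of k] k by (elim dvdE) simp
    have "poly (G n - P' ^ (2 * k * (k + 1))) x = 0" unfolding q poly_mult 0 by simp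
    then have "poly (G n) x = poly P' x ^ (2 * k * (k + 1))" using 0 by (simp add: poly_power)
    then show "poly (G n) x \<noteq> 0" using poly_P'_nz[OF 0] by simp
  qed
qed

text \<open>Away from the roots of P, the orders of \<open>M k\<close> are those of psi_(2k)^2. At
  the roots of P it does not vanish, which accounts for leaving out the 2-torsion.\<close>

lemma torsion_poly_even:
  assumes k: "k \<ge> 1"
  shows "M k = smult (L k) (torsion_poly (Weierstrass 0 a2 0 a4 a6) (2 * k))"
proof -
  have n: "2 * k \<ge> 1" using k by simp
  have Mnz: "M k \<noteq> 0" using lead_M[OF k] L_nz[OF k] by auto
  have "M k = smult (lead_coeff (M k)) (torsion_poly (Weierstrass 0 a2 0 a4 a6) (2 * k))"
  proof (rule torsion_poly_eq[OF n Mnz])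
    fix x assume 0: "poly P x \<noteq> 0"
    have P4: "4 * P \<noteq> 0" using four_poly by simp
    have "order x (4 * P) = 0" using 0 four by (intro order_0I) simp
    then have o: "order x ((4 * P) ^ m) = 0" for m
      using 0 four by (intro order_0I) (simp add: poly_power)
    have "4 * P * (f (2 * k) * f (2 * k)) = (4 * P) ^ e k * M k"
      using G_even[OF k] by (simp add: G_def power2_eq_square)
    then have "order x (4 * P * (f (2 * k) * f (2 * k))) = order x ((4 * P) ^ e k * M k)" by simp
    moreover have "order x (4 * P * (f (2 * k) * f (2 * k))) = order x (4 * P) + (order x (f (2 * k)) + order x (f (2 * k)))"
      using P4 f_nz[OF n] by (subst order_mult, simp, subst order_mult) simp_all
    moreover have "order x ((4 * P) ^ e k * M k) = order x ((4 * P) ^ e k) + order x (M k)"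
      using P4 Mnz by (intro order_mult) simp
    ultimately show "order x (M k) = 2 * order x (f (2 * k))"
      using o[of "e k"] \<open>order x (4 * P) = 0\<close> by simp
  next
    fix x assume 0: "poly P x = 0"
    obtain q where q: "M k - smult (L k) (P' ^ (2 * degree (G k))) = P * q" using M_mod_P[of k] by (elim dvdE)
    have "poly (M k - smult (L k) (P' ^ (2 * degree (G k)))) x = 0" unfolding q poly_mult 0 by simp
    then have "poly (M k) x = L k * poly P' x ^ (2 * degree (G k))" using 0 by (simp add: poly_power)
    then show "poly (M k) x \<noteq> 0" using poly_P'_nz[OF 0] L_nz[OF k] by simp
  qed
  then show ?thesis using lead_M[OF k] by metis
qed

end

section \<open>Length of quotient modules\<close>

definition ring_set :: "'f::field set \<Rightarrow> bool" where
  "ring_set R \<longleftrightarrow> 1 \<in> R \<and> -1 \<in> R \<and> (\<forall>a\<in>R. \<forall>b\<in>R. a + b \<in> R \<and> a * b \<in> R)"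

lemma ring_setD:
  assumes "ring_set R"
  shows "1 \<in> R" "0 \<in> R" "a \<in> R \<Longrightarrow> b \<in> R \<Longrightarrow> a + b \<in> R" "a \<in> R \<Longrightarrow> b \<in> R \<Longrightarrow> a * b \<in> R"
    "a \<in> R \<Longrightarrow> - a \<in> R" "a \<in> R \<Longrightarrow> b \<in> R \<Longrightarrow> a - b \<in> R" "a \<in> R \<Longrightarrow> a ^ n \<in> R"
proof -
  show *: "1 \<in> R" "a \<in> R \<Longrightarrow> b \<in> R \<Longrightarrow> a + b \<in> R" "a \<in> R \<Longrightarrow> b \<in> R \<Longrightarrow> a * b \<in> R" for a b
    using assms by (auto simp: ring_set_def)
  have m: "-1 \<in> R" using assms by (simp add: ring_set_def)
  show "0 \<in> R" using *(2)[OF *(1) m] by simp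
  show neg: "a \<in> R \<Longrightarrow> - a \<in> R" for a using *(3)[OF m, of a] by simp
  show "a \<in> R \<Longrightarrow> b \<in> R \<Longrightarrow> a - b \<in> R" using *(2)[of a "- b"] neg[of b] by simp
  show "a \<in> R \<Longrightarrow> a ^ n \<in> R" by (induction n) (auto intro: *)
qed

lemma submoduleD:
  assumes "submodule_of R N"
  shows "0 \<in> N" "a \<in> N \<Longrightarrow> b \<in> N \<Longrightarrow> a + b \<in> N" "r \<in> R \<Longrightarrow> a \<in> N \<Longrightarrow> r * a \<in> N"
  using assms by (auto simp: submodule_of_def)

lemma submodule_diff:
  assumes "ring_set R" "submodule_of R N" "a \<in> N" "b \<in> N"
  shows "a - b \<in> N"
proof -
  have "(-1) * b \<in> N" using assms by (intro submoduleD(3)[OF assms(2)]) (auto simp: ring_set_def)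
  from submoduleD(2)[OF assms(2,3) this] show ?thesis by simp
qed

lemma submodule_self: "ring_set R \<Longrightarrow> submodule_of R R"
  by (auto simp: submodule_of_def ring_setD)

definition has_chain :: "'f::field set \<Rightarrow> 'f set \<Rightarrow> 'f set \<Rightarrow> nat \<Rightarrow> bool" where
  "has_chain R M N n \<longleftrightarrow> (\<exists>C. C 0 = N \<and> C n = M \<and>
       (\<forall>i\<le>n. submodule_of R (C i)) \<and> (\<forall>i<n. C i \<subset> C (Suc i)))"

lemma quotient_length_alt: "quotient_length R M N = Sup {enat n | n. has_chain R M N n}"
  by (simp add: quotient_length_def has_chain_def)

lemma has_chain_le: "has_chain R M N n \<Longrightarrow> enat n \<le> quotient_length R M N"
  unfolding quotient_length_alt by (rule Sup_upper) auto

lemma quotient_length_leI: "(\<And>n. has_chain R M N n \<Longrightarrow> enat n \<le> k) \<Longrightarrow> quotient_length R M N \<le> k"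
  unfolding quotient_length_alt by (rule Sup_least) auto

lemma has_chain_refl: "submodule_of R N \<Longrightarrow> has_chain R N N 0"
  unfolding has_chain_def by (rule exI[of _ "\<lambda>_. N"]) simp

lemma has_chain_one: "submodule_of R N \<Longrightarrow> submodule_of R M \<Longrightarrow> N \<subset> M \<Longrightarrow> has_chain R M N 1"
  unfolding has_chain_def by (rule exI[of _ "\<lambda>i. if i = 0 then N else M"]) auto

lemma has_chain_append:
  assumes "has_chain R L N m" "has_chain R M L n"
  shows "has_chain R M N (m + n)"
proof -
  obtain C D where C: "C 0 = N" "C m = L" "\<forall>i\<le>m. submodule_of R (C i)" "\<forall>i<m. C i \<subset> C (Suc i)"
    and D: "D 0 = L" "D n = M" "\<forall>i\<le>n. submodule_of R (D i)" "\<forall>i<n. D i \<subset> D (Suc i)"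
    using assms unfolding has_chain_def by blast
  define F where "F i = (if i \<le> m then C i else D (i - m))" for i
  have "F 0 = N" "F (m + n) = M" using C D by (auto simp: F_def)
  moreover have "\<forall>i\<le>m + n. submodule_of R (F i)" using C D by (auto simp: F_def)
  moreover have "F i \<subset> F (Suc i)" if i: "i < m + n" for i
  proof -
    consider "i < m" | "i = m" | "i > m" by linarith
    then show ?thesis
    proof cases
      case 1
      then show ?thesis using C by (simp add: F_def)
    next
      case 2
      have "D 0 \<subset> D (Suc 0)" using D(4) i 2 by auto
      then show ?thesis using 2 C D by (simp add: F_def)
    next
      case 3
      then have "Suc i - m = Suc (i - m)" "i - m < n" using i by auto
      then show ?thesis using 3 D by (simp add: F_def)
    qed
  qed
  ultimately show ?thesis unfolding has_chain_def by blast
qed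

lemma has_chain_exists:
  "submodule_of R N \<Longrightarrow> submodule_of R M \<Longrightarrow> N \<subseteq> M \<Longrightarrow> \<exists>n. has_chain R M N n"
  using has_chain_refl[of R N] has_chain_one[of R N M] by (cases "N = M") blast+

text \<open>Repetitions are deleted from a weakly increasing chain.\<close>

lemma has_chain_weak:
  assumes "\<And>i. i \<le> n \<Longrightarrow> submodule_of R (D i)" "\<And>i. i < n \<Longrightarrow> D i \<subseteq> D (Suc i)"
  shows "has_chain R (D n) (D 0) (card {i. i < n \<and> D i \<noteq> D (Suc i)})"
  using assms
proof (induction n)
  case 0
  then show ?case by (simp add: has_chain_refl)
next
  case (Suc n)
  have IH: "has_chain R (D n) (D 0) (card {i. i < n \<and> D i \<noteq> D (Suc i)})" using Suc by simp
  show ?case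
  proof (cases "D n = D (Suc n)")
    case True
    then have "{i. i < Suc n \<and> D i \<noteq> D (Suc i)} = {i. i < n \<and> D i \<noteq> D (Suc i)}"
      by (auto simp: less_Suc_eq)
    then show ?thesis using IH True by simp
  next
    case False
    then have "{i. i < Suc n \<and> D i \<noteq> D (Suc i)} = insert n {i. i < n \<and> D i \<noteq> D (Suc i)}"
      by (auto simp: less_Suc_eq)
    moreover have "has_chain R (D (Suc n)) (D n) 1"
      by (rule has_chain_one) (use Suc.prems False in auto)
    ultimately show ?thesis using has_chain_append[OF IH, of "D (Suc n)" 1] by simp
  qed
qed

lemma Sup_enat_attained:
  assumes "n \<in> Z" "\<And>m. m \<in> Z \<Longrightarrow> m \<le> k"
  shows "\<exists>m\<in>Z. Sup {enat i | i. i \<in> Z} = enat m"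
proof -
  have fin: "finite Z" using assms(2) by (metis finite_nat_set_iff_bounded_le)
  have "Sup {enat i | i. i \<in> Z} = enat (Max Z)"
  proof (rule antisym)
    show "Sup {enat i | i. i \<in> Z} \<le> enat (Max Z)" by (rule Sup_least) (use fin in auto)
    show "enat (Max Z) \<le> Sup {enat i | i. i \<in> Z}" by (rule Sup_upper) (use fin assms(1) Max_in in auto)
  qed
  then show ?thesis using fin assms(1) Max_in by blast
qed

text \<open>A chain from N to M yields two weak chains, its intersections with L and its sums with
  L; by the modular law each strict step remains strict in at least one of them. Conversely, chains
  can be concatenated, and if the total length is finite then both suprema are attained.\<close>

lemma quotient_length_add:
  assumes R: "ring_set R" and N: "submodule_of R N" and L: "submodule_of R L" and M: "submodule_of R M"
    and sub: "N \<subseteq> L" "L \<subseteq> M"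
  shows "quotient_length R M N = quotient_length R M L + quotient_length R L N"
proof (rule antisym)
  show "quotient_length R M N \<le> quotient_length R M L + quotient_length R L N"
  proof (rule quotient_length_leI)
    fix n assume "has_chain R M N n"
    then obtain C where C: "C 0 = N" "C n = M" "\<And>i. i \<le> n \<Longrightarrow> submodule_of R (C i)" "\<And>i. i < n \<Longrightarrow> C i \<subset> C (Suc i)"
      unfolding has_chain_def by blast
    define D where "D i = C i \<inter> L" for i
    define F where "F i = {a + b | a b. a \<in> C i \<and> b \<in> L}" for i
    have D: "submodule_of R (D i)" if "i \<le> n" for i
      using C(3)[OF that] L by (auto simp: submodule_of_def D_def)
    have F: "submodule_of R (F i)" if "i \<le> n" for i
    proof -
      note c = submoduleD[OF C(3)[OF that]] and l = submoduleD[OF L]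
      show ?thesis unfolding submodule_of_def
      proof (intro conjI ballI)
        show "0 \<in> F i" unfolding F_def using c(1) l(1) by force
      next
        fix a b assume "a \<in> F i" "b \<in> F i"
        then obtain a1 a2 b1 b2 where "a = a1 + a2" "b = b1 + b2" "a1 \<in> C i" "b1 \<in> C i" "a2 \<in> L" "b2 \<in> L"
          unfolding F_def by blast
        then show "a + b \<in> F i" unfolding F_def using c(2) l(2)
          by (intro CollectI exI[of _ "a1 + b1"] exI[of _ "a2 + b2"]) auto
      next
        fix r a assume r: "r \<in> R" and "a \<in> F i"
        then obtain a1 a2 where "a = a1 + a2" "a1 \<in> C i" "a2 \<in> L" unfolding F_def by blast
        then show "r * a \<in> F i" unfolding F_def using c(3)[OF r] l(3)[OF r]
          by (intro CollectI exI[of _ "r * a1"] exI[of _ "r * a2"]) (auto simp: distrib_left)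
      qed
    qed
    have e: "D 0 = N" "D n = L" "F 0 = L" "F n = M"
    proof -
      show "D 0 = N" "D n = L" using C sub by (auto simp: D_def)
      have sum: "{a + b | a b. a \<in> Y \<and> b \<in> Z} = T" if "submodule_of R T" "Y \<subseteq> T" "Z \<subseteq> T" "0 \<in> Y" "0 \<in> Z" "T = Y \<or> T = Z" for Y Z T
      proof
        show "{a + b | a b. a \<in> Y \<and> b \<in> Z} \<subseteq> T" using that(1-3) submoduleD(2) by blast
        show "T \<subseteq> {a + b | a b. a \<in> Y \<and> b \<in> Z}"
        proof
          fix x assume "x \<in> T"
          from that(6) show "x \<in> {a + b | a b. a \<in> Y \<and> b \<in> Z}"
          proof
            assume "T = Y"
            then show ?thesis using \<open>x \<in> T\<close> that(5) by (intro CollectI exI[of _ x] exI[of _ 0]) auto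
          next
            assume "T = Z"
            then show ?thesis using \<open>x \<in> T\<close> that(4) by (intro CollectI exI[of _ 0] exI[of _ x]) auto
          qed
        qed
      qed
      show "F 0 = L" unfolding F_def C(1)
        by (rule sum) (use sub L submoduleD(1)[OF L] submoduleD(1)[OF N] in auto)
      show "F n = M" unfolding F_def C(2)
        by (rule sum) (use sub M submoduleD(1)[OF L] submoduleD(1)[OF M] in auto)
    qed
    have Dm: "D i \<subseteq> D (Suc i)" "F i \<subseteq> F (Suc i)" if "i < n" for i
      using C(4)[OF that] by (auto simp: D_def F_def)
    have strict: "D i \<noteq> D (Suc i) \<or> F i \<noteq> F (Suc i)" if "i < n" for i
    proof (rule ccontr)
      assume "\<not> (D i \<noteq> D (Suc i) \<or> F i \<noteq> F (Suc i))"
      then have eq: "D i = D (Suc i)" "F i = F (Suc i)" by auto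
      have "C (Suc i) \<subseteq> C i"
      proof
        fix x assume x: "x \<in> C (Suc i)"
        then have "x \<in> F (Suc i)" unfolding F_def using submoduleD(1)[OF L]
          by (intro CollectI exI[of _ x] exI[of _ 0]) auto
        then obtain a b where ab: "x = a + b" "a \<in> C i" "b \<in> L" using eq(2) unfolding F_def by blast
        have "b = x - a" using ab by simp
        also have "x - a \<in> C (Suc i)"
          by (rule submodule_diff[OF R C(3)]) (use that x ab C(4)[OF that] in auto)
        finally have "b \<in> D i" using ab eq(1) by (simp add: D_def)
        then show "x \<in> C i" using ab submoduleD(2)[OF C(3)[of i]] that by (simp add: D_def)
      qed
      then show False using C(4)[OF that] by auto
    qed
    define A where "A = {i. i < n \<and> D i \<noteq> D (Suc i)}"
    define B where "B = {i. i < n \<and> F i \<noteq> F (Suc i)}"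
    have "has_chain R L N (card A)" "has_chain R M L (card B)"
      using has_chain_weak[of n R D] has_chain_weak[of n R F] D F Dm e unfolding A_def B_def by auto
    then have le: "enat (card B) \<le> quotient_length R M L" "enat (card A) \<le> quotient_length R L N"
      by (auto intro: has_chain_le)
    have "n \<le> card A + card B"
    proof -
      have "{..<n} \<subseteq> A \<union> B" using strict by (auto simp: A_def B_def)
      then have "card {..<n} \<le> card (A \<union> B)" by (intro card_mono) (auto simp: A_def B_def)
      then show ?thesis using card_Un_le[of A B] by simp
    qed
    then have "enat n \<le> enat (card B) + enat (card A)" by simp
    also have "\<dots> \<le> quotient_length R M L + quotient_length R L N" by (rule add_mono[OF le])
    finally show "enat n \<le> quotient_length R M L + quotient_length R L N" .
  qed
next
  show "quotient_length R M L + quotient_length R L N \<le> quotient_length R M N"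
  proof (cases "quotient_length R M N")
    case (enat k)
    define A where "A = {n. has_chain R M L n}"
    define B where "B = {n. has_chain R L N n}"
    obtain a b where ab: "a \<in> A" "b \<in> B"
      using has_chain_exists[OF L M sub(2)] has_chain_exists[OF N L sub(1)] by (auto simp: A_def B_def)
    have k: "m + n \<le> k" if "n \<in> A" "m \<in> B" for m n
      using has_chain_le[OF has_chain_append, of R L N m M n] that enat by (simp add: A_def B_def)
    have "\<exists>m\<in>A. Sup {enat i | i. i \<in> A} = enat m"
    proof (rule Sup_enat_attained[OF ab(1)])
      show "i \<le> k" if "i \<in> A" for i using k[OF that ab(2)] by simp
    qed
    then obtain m where m: "m \<in> A" "quotient_length R M L = enat m" unfolding quotient_length_alt A_def by auto
    have "\<exists>m\<in>B. Sup {enat i | i. i \<in> B} = enat m"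
    proof (rule Sup_enat_attained[OF ab(2)])
      show "i \<le> k" if "i \<in> B" for i using k[OF ab(1) that] by simp
    qed
    then obtain m' where m': "m' \<in> B" "quotient_length R L N = enat m'" unfolding quotient_length_alt B_def by auto
    show ?thesis unfolding m(2) m'(2) enat using k[OF m(1) m'(1)] by simp
  qed simp
qed

lemma quotient_length_antimono:
  assumes "ring_set R" "submodule_of R N" "submodule_of R L" "submodule_of R M" "N \<subseteq> L" "L \<subseteq> M"
  shows "quotient_length R M L \<le> quotient_length R M N"
  using quotient_length_add[OF assms] by simp

text \<open>Compares lengths of modules over possibly different rings: an operation on submodules
  that keeps inclusions strict carries chains to chains.\<close>

lemma quotient_length_mono_map:
  assumes "\<Phi> N = N'" "\<Phi> M = M'"
    and "\<And>C. submodule_of R C \<Longrightarrow> N \<subseteq> C \<Longrightarrow> C \<subseteq> M \<Longrightarrow> submodule_of R' (\<Phi> C)"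
    and "\<And>C C'. submodule_of R C \<Longrightarrow> submodule_of R C' \<Longrightarrow> N \<subseteq> C \<Longrightarrow> C \<subset> C' \<Longrightarrow> C' \<subseteq> M \<Longrightarrow> \<Phi> C \<subset> \<Phi> C'"
  shows "quotient_length R M N \<le> quotient_length R' M' N'"
proof (rule quotient_length_leI)
  fix n assume "has_chain R M N n"
  then obtain C where C: "C 0 = N" "C n = M" "\<And>i. i \<le> n \<Longrightarrow> submodule_of R (C i)" "\<And>i. i < n \<Longrightarrow> C i \<subset> C (Suc i)"
    unfolding has_chain_def by blast
  have Ci: "N \<subseteq> C i" if "i \<le> n" for i
    using that
  proof (induction i)
    case (Suc i)
    then have "C i \<subset> C (Suc i)" by (intro C(4)) auto
    then show ?case using Suc by auto
  qed (use C in simp)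
  have CM: "C (n - j) \<subseteq> M" if "j \<le> n" for j
    using that
  proof (induction j)
    case (Suc j)
    then have "C (n - Suc j) \<subset> C (Suc (n - Suc j))" by (intro C(4)) auto
    moreover have "Suc (n - Suc j) = n - j" using Suc.prems by simp
    ultimately show ?case using Suc by auto
  qed (use C in simp)
  have CM': "C i \<subseteq> M" if "i \<le> n" for i using CM[of "n - i"] that by simp
  have "has_chain R' M' N' n"
    unfolding has_chain_def
  proof (intro exI[of _ "\<lambda>i. \<Phi> (C i)"] conjI allI impI)
    show "\<Phi> (C 0) = N'" "\<Phi> (C n) = M'" using C assms by auto
    show "submodule_of R' (\<Phi> (C i))" if "i \<le> n" for i using assms(3) C(3) Ci CM' that by blast
    show "\<Phi> (C i) \<subset> \<Phi> (C (Suc i))" if "i < n" for i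
      using that C(3)[of i] C(3)[of "Suc i"] Ci[of i] CM'[of "Suc i"] C(4)[of i] by (intro assms(4)) auto
  qed
  then show "enat n \<le> quotient_length R' M' N'" by (rule has_chain_le)
qed

lemma quotient_length_refl: "submodule_of R N \<Longrightarrow> ring_set R \<Longrightarrow> quotient_length R N N = 0"
proof -
  assume N: "submodule_of R N" and R: "ring_set R"
  have "quotient_length R N N \<le> 0"
  proof (rule quotient_length_leI)
    fix n assume "has_chain R N N n"
    then obtain C where C: "C 0 = N" "C n = N" "\<And>i. i < n \<Longrightarrow> C i \<subset> C (Suc i)"
      unfolding has_chain_def by blast
    have "n = 0"
    proof (rule ccontr)
      assume "n \<noteq> 0"
      have "N \<subset> C (Suc i)" if "Suc i \<le> n" for i
        using that
      proof (induction i)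
        case 0
        then show ?case using C(3)[of 0] C(1) by simp
      next
        case (Suc i)
        then show ?case using C(3)[of "Suc i"] by auto
      qed
      from this[of "n - 1"] show False using \<open>n \<noteq> 0\<close> C by simp
    qed
    then show "enat n \<le> 0" by (simp add: zero_enat_def)
  qed
  then show ?thesis by simp
qed

section \<open>Local rings of the projective line over a discrete valuation ring\<close>

locale loc_ring =
  fixes A Mx :: "'f::field set"
  assumes rA0: "ring_set A" and mx: "maximal_ideal_of A Mx"
begin

definition "Ox = localization A Mx"

lemma Mx_sub: "submodule_of A Mx" "Mx \<subset> A"
  using mx by (auto simp: maximal_ideal_of_def)

lemma one_notin: "1 \<notin> Mx"
proof
  assume "1 \<in> Mx"
  then have "a \<in> Mx" if "a \<in> A" for a using submoduleD(3)[OF Mx_sub(1) that, of 1] by simp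
  then show False using Mx_sub(2) by auto
qed

lemma comax:
  assumes a: "a \<in> A" "a \<notin> Mx"
  shows "\<exists>r\<in>A. \<exists>m\<in>Mx. 1 = a * r + m"
proof -
  note rA = ring_setD[OF rA0] and m = submoduleD[OF Mx_sub(1)]
  define J where "J = {a * r + m | r m. r \<in> A \<and> m \<in> Mx}"
  have "submodule_of A J"
    unfolding submodule_of_def
  proof (intro conjI ballI)
    show "0 \<in> J" unfolding J_def using rA(2) m(1) by (intro CollectI exI[of _ 0]) auto
  next
    fix x y assume "x \<in> J" "y \<in> J"
    then obtain r m r' m' where "x = a * r + m" "y = a * r' + m'" "r \<in> A" "r' \<in> A" "m \<in> Mx" "m' \<in> Mx"
      unfolding J_def by blast
    then show "x + y \<in> J" unfolding J_def using rA(3) m(2)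
      by (intro CollectI exI[of _ "r + r'"] exI[of _ "m + m'"]) (auto simp: algebra_simps)
  next
    fix s x assume s: "s \<in> A" and "x \<in> J"
    then obtain r m where "x = a * r + m" "r \<in> A" "m \<in> Mx" unfolding J_def by blast
    then show "s * x \<in> J" unfolding J_def using rA(4)[OF s] submoduleD(3)[OF Mx_sub(1) s]
      by (intro CollectI exI[of _ "s * r"] exI[of _ "s * m"]) (auto simp: algebra_simps)
  qed
  moreover have "Mx \<subseteq> J"
  proof
    fix x assume "x \<in> Mx"
    then show "x \<in> J" unfolding J_def using rA(2) by (intro CollectI exI[of _ 0] exI[of _ x]) auto
  qed
  moreover have "J \<subseteq> A"
    unfolding J_def using rA a Mx_sub(2) by (auto simp: subset_iff psubset_eq)
  moreover have "a \<in> J"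
    unfolding J_def using rA(1) m(1) by (intro CollectI exI[of _ 1] exI[of _ 0]) auto
  ultimately have "J = A" using mx a(2) unfolding maximal_ideal_of_def by blast
  then have "1 \<in> J" using rA(1) by simp
  then show ?thesis unfolding J_def by blast
qed

lemma prime_Mx:
  assumes "a \<in> A" "b \<in> A" "a * b \<in> Mx"
  shows "a \<in> Mx \<or> b \<in> Mx"
proof (rule ccontr)
  assume n: "\<not> ?thesis"
  then obtain r m where rm: "r \<in> A" "m \<in> Mx" "1 = a * r + m" using comax[OF assms(1)] by blast
  have "b = r * (a * b) + b * m" using arg_cong[OF rm(3), of "\<lambda>z. b * z"] by (simp add: algebra_simps)
  also have "\<dots> \<in> Mx"
    using submoduleD[OF Mx_sub(1)] assms rm by auto
  finally show False using n by simp
qed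

lemma zero_Mx: "0 \<in> Mx"
  by (rule submoduleD(1)[OF Mx_sub(1)])

lemma Ox_iff: "x \<in> Ox \<longleftrightarrow> (\<exists>a s. x = a / s \<and> a \<in> A \<and> s \<in> A \<and> s \<notin> Mx)"
  by (auto simp: Ox_def localization_def)

lemma Ox_I: "a \<in> A \<Longrightarrow> s \<in> A \<Longrightarrow> s \<notin> Mx \<Longrightarrow> a / s \<in> Ox"
  by (auto simp: Ox_iff)

lemma A_Ox: "A \<subseteq> Ox"
  using Ox_I[of _ 1] ring_setD[OF rA0] one_notin by auto

lemma unit_Ox: "s \<in> A \<Longrightarrow> s \<notin> Mx \<Longrightarrow> 1 / s \<in> Ox"
  using Ox_I ring_setD[OF rA0] by auto

lemma ring_Ox: "ring_set Ox"
  unfolding ring_set_def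
proof (intro conjI ballI)
  note rA = ring_setD[OF rA0]
  show "1 \<in> Ox" "-1 \<in> Ox" using A_Ox rA by auto
  fix x y assume "x \<in> Ox" "y \<in> Ox"
  then obtain a s b t where xy: "x = a / s" "y = b / t" "a \<in> A" "b \<in> A" "s \<in> A" "t \<in> A" "s \<notin> Mx" "t \<notin> Mx"
    unfolding Ox_iff by blast
  have st: "s * t \<in> A" "s * t \<notin> Mx" using xy rA(4) prime_Mx[of s t] by blast+
  have nz: "s \<noteq> 0" "t \<noteq> 0" using xy zero_Mx by auto
  have "x + y = (a * t + b * s) / (s * t)" using nz xy by (simp add: field_simps)
  then show "x + y \<in> Ox" using Ox_I st xy rA by simp
  have "x * y = (a * b) / (s * t)" using xy by simp
  then show "x * y \<in> Ox" using Ox_I st xy rA by simp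
qed

lemmas rO = ring_setD[OF ring_Ox]

lemma Ox_common:
  assumes "x \<in> Ox" "y \<in> Ox"
  obtains a b s where "x = a / s" "y = b / s" "a \<in> A" "b \<in> A" "s \<in> A" "s \<notin> Mx" "s \<noteq> 0"
proof -
  note rA = ring_setD[OF rA0]
  obtain a s b t where xy: "x = a / s" "y = b / t" "a \<in> A" "b \<in> A" "s \<in> A" "t \<in> A" "s \<notin> Mx" "t \<notin> Mx"
    using assms unfolding Ox_iff by blast
  have st: "s * t \<in> A" "s * t \<notin> Mx" using xy rA(4) prime_Mx[of s t] by blast+
  have nz: "s \<noteq> 0" "t \<noteq> 0" using xy zero_Mx by auto
  show thesis
    by (rule that[of "a * t" "s * t" "b * s"]) (use xy nz st rA in auto)
qed

end

locale dvr =
  fixes v :: "'k::field \<Rightarrow> int"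
  assumes dv: "discrete_valuation v"
begin

lemma v_mult: "x \<noteq> 0 \<Longrightarrow> y \<noteq> 0 \<Longrightarrow> v (x * y) = v x + v y"
  and v_add: "x \<noteq> 0 \<Longrightarrow> y \<noteq> 0 \<Longrightarrow> x + y \<noteq> 0 \<Longrightarrow> min (v x) (v y) \<le> v (x + y)"
  using dv by (auto simp: discrete_valuation_def)

lemma v_one [simp]: "v 1 = 0"
  using v_mult[of 1 1] by simp

lemma v_minus: "v (- x) = v x"
proof (cases "x = 0")
  case False
  have "v (-1) + v (-1) = 0" using v_mult[of "-1" "-1"] by simp
  then show ?thesis using v_mult[of "-1" x] False by simp
qed simp

lemma v_inverse: "x \<noteq> 0 \<Longrightarrow> v (inverse x) = - v x"
  using v_mult[of x "inverse x"] by simp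

lemma v_divide: "x \<noteq> 0 \<Longrightarrow> y \<noteq> 0 \<Longrightarrow> v (x / y) = v x - v y"
  using v_mult[of x "inverse y"] v_inverse[of y] by (simp add: divide_inverse)

lemma v_power: "x \<noteq> 0 \<Longrightarrow> v (x ^ n) = int n * v x"
  by (induction n) (simp_all add: v_mult algebra_simps)

lemma ring_V: "ring_set (val_ring v)"
  unfolding ring_set_def
proof (intro conjI ballI)
  show "1 \<in> val_ring v" "-1 \<in> val_ring v" by (simp_all add: val_ring_def v_minus)
  fix a b assume ab: "a \<in> val_ring v" "b \<in> val_ring v"
  show "a * b \<in> val_ring v" using ab by (cases "a = 0 \<or> b = 0") (auto simp: val_ring_def v_mult)
  show "a + b \<in> val_ring v"
    using ab v_add[of a b] by (cases "a = 0 \<or> b = 0 \<or> a + b = 0") (auto simp: val_ring_def)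
qed

lemma uniformizer: "\<exists>\<pi>. \<pi> \<noteq> 0 \<and> v \<pi> = 1"
proof -
  have "1 \<in> v ` (UNIV - {0})" using dv by (simp add: discrete_valuation_def)
  then show ?thesis by force
qed

lemma integral_ring:
  "p \<in> integral_polys v \<Longrightarrow> q \<in> integral_polys v \<Longrightarrow> p + q \<in> integral_polys v"
  "p \<in> integral_polys v \<Longrightarrow> q \<in> integral_polys v \<Longrightarrow> p * q \<in> integral_polys v"
  "p \<in> integral_polys v \<Longrightarrow> - p \<in> integral_polys v"
  "p \<in> integral_polys v \<Longrightarrow> q \<in> integral_polys v \<Longrightarrow> p - q \<in> integral_polys v"
  "c \<in> val_ring v \<Longrightarrow> [:c:] \<in> integral_polys v" "1 \<in> integral_polys v" "0 \<in> integral_polys v"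
  "[:0, 1:] \<in> integral_polys v" "c \<in> val_ring v \<Longrightarrow> p \<in> integral_polys v \<Longrightarrow> smult c p \<in> integral_polys v"
  "p \<in> integral_polys v \<Longrightarrow> p ^ n \<in> integral_polys v"
proof -
  note r = ring_setD[OF ring_V]
  have s: "(\<And>i. i \<in> I \<Longrightarrow> g i \<in> val_ring v) \<Longrightarrow> sum g I \<in> val_ring v" for g and I :: "nat set"
    by (induction I rule: infinite_finite_induct) (auto simp: r)
  show "p \<in> integral_polys v \<Longrightarrow> q \<in> integral_polys v \<Longrightarrow> p + q \<in> integral_polys v"
    by (simp add: integral_polys_def r)
  show mult: "p \<in> integral_polys v \<Longrightarrow> q \<in> integral_polys v \<Longrightarrow> p * q \<in> integral_polys v" for p q
    by (auto simp: integral_polys_def coeff_mult intro!: s r)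
  show "p \<in> integral_polys v \<Longrightarrow> - p \<in> integral_polys v"
    "p \<in> integral_polys v \<Longrightarrow> q \<in> integral_polys v \<Longrightarrow> p - q \<in> integral_polys v"
    by (simp_all add: integral_polys_def r)
  show "c \<in> val_ring v \<Longrightarrow> [:c:] \<in> integral_polys v"
    by (auto simp: integral_polys_def r coeff_pCons split: nat.split)
  show one: "1 \<in> integral_polys v" "0 \<in> integral_polys v"
    by (auto simp: integral_polys_def r)
  show "[:0, 1:] \<in> integral_polys v"
    by (auto simp: integral_polys_def r coeff_pCons split: nat.split)
  show "c \<in> val_ring v \<Longrightarrow> p \<in> integral_polys v \<Longrightarrow> smult c p \<in> integral_polys v"
    by (simp add: integral_polys_def r)
  show "p \<in> integral_polys v \<Longrightarrow> p ^ n \<in> integral_polys v"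
    by (induction n) (simp_all add: one mult)
qed

text \<open>As Q is monic, the leading coefficient of c is that of Q c and hence integral. Subtract
  the leading term of c and induct on the degree.\<close>

lemma integral_divide_monic:
  assumes Q: "Q \<in> integral_polys v" "lead_coeff Q = 1" and QC: "Q * c \<in> integral_polys v"
  shows "c \<in> integral_polys v"
  using QC
proof (induction "degree c" arbitrary: c rule: less_induct)
  case less
  note r = ring_setD[OF ring_V]
  show ?case
  proof (cases "c = 0")
    case True
    then show ?thesis by (simp add: integral_ring)
  next
    case False
    define l where "l = lead_coeff c"
    have "coeff (Q * c) (degree Q + degree c) = l"
      using Q(2) by (simp add: coeff_mult_degree_sum l_def)
    then have l: "l \<in> val_ring v" using less.prems unfolding integral_polys_def by (metis mem_Collect_eq)
    have mon: "monom l (degree c) \<in> integral_polys v"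
      using l by (auto simp: integral_polys_def r)
    define c' where "c' = c - monom l (degree c)"
    have i: "Q * c' \<in> integral_polys v"
      unfolding c'_def right_diff_distrib by (intro integral_ring less.prems Q mon)
    show ?thesis
    proof (cases "degree c = 0")
      case True
      then obtain k where k: "c = [:k:]" by (rule degree_eq_zeroE)
      then have "c = [:l:]" by (simp add: l_def)
      then show ?thesis using l by (simp add: integral_ring)
    next
      case False
      have "degree c' < degree c"
      proof (cases "c' = 0")
        case False
        show ?thesis
        proof (rule degree_less_if_less_eqI[OF _ _ False])
          show "degree c' \<le> degree c" unfolding c'_def by (intro degree_diff_le) (simp_all add: degree_monom_le)
          show "coeff c' (degree c) = 0" by (simp add: c'_def l_def)
        qed
      qed (use False in simp)
      then have "c' \<in> integral_polys v" using less.hyps i by blast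
      then have "c' + monom l (degree c) \<in> integral_polys v" using mon by (intro integral_ring)
      then show ?thesis by (simp add: c'_def)
    qed
  qed
qed

text \<open>The ring V[t] of the first chart, inside K(t).\<close>

definition "A = to_fract ` integral_polys v"

lemma ring_A: "ring_set A"
  unfolding ring_set_def A_def
proof (intro conjI ballI)
  show "1 \<in> to_fract ` integral_polys v" by (rule image_eqI[of _ _ 1]) (simp_all add: integral_ring)
  show "-1 \<in> to_fract ` integral_polys v" by (rule image_eqI[of _ _ "-1"]) (simp_all add: integral_ring)
  fix a b assume "a \<in> to_fract ` integral_polys v" "b \<in> to_fract ` integral_polys v"
  then obtain p q where "a = to_fract p" "b = to_fract q" "p \<in> integral_polys v" "q \<in> integral_polys v" by blast
  then have "a + b = to_fract (p + q)" "a * b = to_fract (p * q)" "p + q \<in> integral_polys v" "p * q \<in> integral_polys v"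
    by (simp_all add: integral_ring)
  then show "a + b \<in> to_fract ` integral_polys v" "a * b \<in> to_fract ` integral_polys v"
    by blast+
qed

lemma A_I: "p \<in> integral_polys v \<Longrightarrow> to_fract p \<in> A"
  by (simp add: A_def)

definition "Vc = (\<lambda>c. to_fract [:c:]) ` val_ring v"

lemma ring_Vc: "ring_set Vc"
  unfolding ring_set_def Vc_def
proof (intro conjI ballI)
  note r = ring_setD[OF ring_V]
  show "1 \<in> (\<lambda>c. to_fract [:c:]) ` val_ring v" by (rule image_eqI[of _ _ 1]) (simp_all add: r one_pCons[symmetric])
  show "-1 \<in> (\<lambda>c. to_fract [:c:]) ` val_ring v"
  proof (rule image_eqI[of _ _ "-1"])
    have "[:- 1:] = - (1 :: 'k poly)" by (simp add: one_pCons)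
    then show "- 1 = to_fract [:- 1 :: 'k:]" by (simp only: to_fract_uminus to_fract_1)
  qed (simp add: r)
  fix a b assume "a \<in> (\<lambda>c. to_fract [:c:]) ` val_ring v" "b \<in> (\<lambda>c. to_fract [:c:]) ` val_ring v"
  then obtain p q where pq: "a = to_fract [:p:]" "b = to_fract [:q:]" "p \<in> val_ring v" "q \<in> val_ring v" by blast
  have "a + b = to_fract [:p + q:]" "a * b = to_fract [:p * q:]"
    using pq by (simp_all flip: to_fract_add to_fract_mult add: mult.commute)
  then show "a + b \<in> (\<lambda>c. to_fract [:c:]) ` val_ring v" "a * b \<in> (\<lambda>c. to_fract [:c:]) ` val_ring v"
    using r pq by auto
qed

lemma Vc_A: "Vc \<subseteq> A"
  by (auto simp: Vc_def A_def integral_ring)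

lemma submodule_restrict: "submodule_of R N \<Longrightarrow> R' \<subseteq> R \<Longrightarrow> submodule_of R' N"
  by (auto simp: submodule_of_def)

end

text \<open>A closed point of the special fibre lying in the first chart, given by a maximal ideal
  of V[t] that contains the maximal ideal of V.\<close>

locale special_pt = dvr v + loc_ring "dvr.A v" Mx for v :: "'k::field \<Rightarrow> int" and Mx +
  assumes pi_Mx: "(\<lambda>c. to_fract [:c:]) ` val_ideal v \<subseteq> Mx"
begin

lemma tf_Ox: "p \<in> integral_polys v \<Longrightarrow> to_fract p \<in> Ox"
  using A_I A_Ox by auto

definition "ideal2 Q g = {to_fract Q * x + to_fract g * y | x y. x \<in> Ox \<and> y \<in> Ox}"

lemma ideal2_submodule: "submodule_of Ox (ideal2 Q g)"
  unfolding submodule_of_def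
proof (intro conjI ballI)
  show "0 \<in> ideal2 Q g" unfolding ideal2_def using rO(2) by (intro CollectI exI[of _ 0]) auto
next
  fix a b assume "a \<in> ideal2 Q g" "b \<in> ideal2 Q g"
  then obtain x y x' y' where "a = to_fract Q * x + to_fract g * y" "b = to_fract Q * x' + to_fract g * y'"
    "x \<in> Ox" "y \<in> Ox" "x' \<in> Ox" "y' \<in> Ox" unfolding ideal2_def by blast
  then show "a + b \<in> ideal2 Q g" unfolding ideal2_def using rO(3)
    by (intro CollectI exI[of _ "x + x'"] exI[of _ "y + y'"]) (auto simp: algebra_simps)
next
  fix r a assume r: "r \<in> Ox" and "a \<in> ideal2 Q g"
  then obtain x y where a: "a = to_fract Q * x + to_fract g * y" "x \<in> Ox" "y \<in> Ox" unfolding ideal2_def by blast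
  then have "r * a = to_fract Q * (r * x) + to_fract g * (r * y)" by (simp add: algebra_simps)
  moreover have "r * x \<in> Ox" "r * y \<in> Ox" using a rO(4)[OF r] by auto
  ultimately show "r * a \<in> ideal2 Q g" unfolding ideal2_def by blast
qed

lemma ideal2_gens: "to_fract Q \<in> ideal2 Q g" "to_fract g \<in> ideal2 Q g"
proof -
  show "to_fract Q \<in> ideal2 Q g" unfolding ideal2_def using rO(1,2)
    by (intro CollectI exI[of _ 1] exI[of _ 0]) auto
  show "to_fract g \<in> ideal2 Q g" unfolding ideal2_def using rO(1,2)
    by (intro CollectI exI[of _ 0] exI[of _ 1]) auto
qed

lemma ideal2_least:
  assumes "submodule_of Ox N" "to_fract Q \<in> N" "to_fract g \<in> N"
  shows "ideal2 Q g \<subseteq> N"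
proof
  fix z assume "z \<in> ideal2 Q g"
  then obtain x y where z: "z = x * to_fract Q + y * to_fract g" "x \<in> Ox" "y \<in> Ox"
    unfolding ideal2_def by (auto simp: mult.commute)
  then show "z \<in> N" using submoduleD[OF assms(1)] assms by auto
qed

lemma ideal2_sub_Ox: "Q \<in> integral_polys v \<Longrightarrow> g \<in> integral_polys v \<Longrightarrow> ideal2 Q g \<subseteq> Ox"
  by (rule ideal2_least) (auto intro: submodule_self ring_Ox tf_Ox)

lemma mem_ideal2I: "x \<in> Ox \<Longrightarrow> y \<in> Ox \<Longrightarrow> to_fract Q * x + to_fract g * y \<in> ideal2 Q g"
  unfolding ideal2_def by blast

definition "len Q g = quotient_length Ox Ox (ideal2 Q g)"

lemma ideal2_cong:
  assumes "Q \<in> integral_polys v" "c \<in> integral_polys v" "g = h + Q * c"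
  shows "ideal2 Q g = ideal2 Q h"
proof -
  have c: "to_fract c \<in> Ox" using assms by (simp add: tf_Ox)
  have s: "submodule_of Ox (ideal2 Q g)" "submodule_of Ox (ideal2 Q h)" by (rule ideal2_submodule)+
  have "to_fract g = to_fract h + to_fract c * to_fract Q" using assms by simp
  then have g: "to_fract g \<in> ideal2 Q h"
    using submoduleD[OF s(2)] ideal2_gens c by metis
  have "to_fract h = to_fract g - to_fract c * to_fract Q" using assms by simp
  then have h: "to_fract h \<in> ideal2 Q g"
    using submodule_diff[OF ring_Ox s(1)] submoduleD(3)[OF s(1) c] ideal2_gens by metis
  show ?thesis using ideal2_least s ideal2_gens g h by (meson subset_antisym)
qed

text \<open>Multiplication by f induces an isomorphism from O / (Q, g) onto (Q, f) / (Q, f g),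
  because f is a nonzerodivisor modulo Q. The two inequalities of lengths come from preimages and
  from images of submodules.\<close>

lemma len_mult:
  assumes Q: "Q \<in> integral_polys v" "lead_coeff Q = 1" and f: "f \<in> integral_polys v" and g: "g \<in> integral_polys v"
    and cop: "\<And>a. Q dvd f * a \<Longrightarrow> Q dvd a"
  shows "len Q (f * g) = len Q f + len Q g"
proof -
  let ?f = "to_fract f" and ?Q = "to_fract Q" and ?g = "to_fract g"
  have fg: "f * g \<in> integral_polys v" using f g by (rule integral_ring)
  \<comment> \<open>After clearing denominators, Q divides the numerator of h over K by coprimality,
    and the quotient is integral because Q is monic.\<close>
  have cancel: "\<exists>z\<in>Ox. h = ?Q * z" if hx: "h \<in> Ox" "x \<in> Ox" "?f * h = ?Q * x" for h x
  proof -
    obtain a b s where s: "h = a / s" "x = b / s" "a \<in> A" "b \<in> A" "s \<in> A" "s \<notin> Mx" "s \<noteq> 0"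
      by (rule Ox_common[OF hx(1,2)])
    obtain p q where pq: "a = to_fract p" "b = to_fract q" "p \<in> integral_polys v"
      using s(3,4) by (auto simp: A_def)
    have "?f * a = ?Q * b" using hx(3) s by (simp add: field_simps)
    then have "to_fract (f * p) = to_fract (Q * q)" using pq by simp
    then have "f * p = Q * q" by (simp only: to_fract_eq_iff)
    then have "Q dvd p" using cop by (metis dvd_triv_left)
    then obtain c where c: "p = Q * c" by (elim dvdE)
    have "c \<in> integral_polys v" by (rule integral_divide_monic[OF Q]) (use c pq in simp)
    then have "to_fract c / s \<in> Ox" using Ox_I A_I s by blast
    moreover have "h = ?Q * (to_fract c / s)" using s pq c by simp
    ultimately show ?thesis by blast
  qed
  have sub: "ideal2 Q (f * g) \<subseteq> ideal2 Q f"
  proof (rule ideal2_least[OF ideal2_submodule ideal2_gens(1)])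
    have "?g * ?f \<in> ideal2 Q f" using submoduleD(3)[OF ideal2_submodule tf_Ox[OF g]] ideal2_gens by blast
    then show "to_fract (f * g) \<in> ideal2 Q f" by (simp add: mult.commute)
  qed
  have "len Q (f * g) = len Q f + quotient_length Ox (ideal2 Q f) (ideal2 Q (f * g))"
    unfolding len_def
    by (rule quotient_length_add) (use sub ring_Ox ideal2_submodule submodule_self ideal2_sub_Ox Q f in auto)
  moreover have "quotient_length Ox (ideal2 Q f) (ideal2 Q (f * g)) = len Q g"
  proof (rule antisym)
    define \<Psi> where "\<Psi> D = {h \<in> Ox. ?f * h \<in> D}" for D
    show "quotient_length Ox (ideal2 Q f) (ideal2 Q (f * g)) \<le> len Q g"
      unfolding len_def
    proof (rule quotient_length_mono_map[of \<Psi>])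
      show "\<Psi> (ideal2 Q (f * g)) = ideal2 Q g"
      proof
        show "\<Psi> (ideal2 Q (f * g)) \<subseteq> ideal2 Q g"
        proof
          fix h assume "h \<in> \<Psi> (ideal2 Q (f * g))"
          then obtain x y where h: "h \<in> Ox" "?f * h = ?Q * x + to_fract (f * g) * y" "x \<in> Ox" "y \<in> Ox"
            unfolding \<Psi>_def ideal2_def by blast
          have "?f * (h - ?g * y) = ?Q * x" using h(2) by (simp add: algebra_simps)
          moreover have "h - ?g * y \<in> Ox" using h rO tf_Ox[OF g] by auto
          ultimately obtain z where z: "z \<in> Ox" "h - ?g * y = ?Q * z" using cancel h(3) by blast
          then have "h = ?Q * z + ?g * y" by (simp add: algebra_simps)
          then show "h \<in> ideal2 Q g" using mem_ideal2I z h by simp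
        qed
        show "ideal2 Q g \<subseteq> \<Psi> (ideal2 Q (f * g))"
        proof
          fix h assume h: "h \<in> ideal2 Q g"
          then obtain x y where xy: "h = ?Q * x + ?g * y" "x \<in> Ox" "y \<in> Ox" unfolding ideal2_def by blast
          have "?f * h = ?Q * (?f * x) + to_fract (f * g) * y" using xy by (simp add: algebra_simps)
          moreover have "?f * x \<in> Ox" using rO tf_Ox[OF f] xy by auto
          ultimately have "?f * h \<in> ideal2 Q (f * g)" by (simp only: mem_ideal2I xy(3))
          then show "h \<in> \<Psi> (ideal2 Q (f * g))" unfolding \<Psi>_def using ideal2_sub_Ox[OF Q(1) g] h by auto
        qed
      qed
      show "\<Psi> (ideal2 Q f) = Ox"
      proof -
        have "?f * h \<in> ideal2 Q f" if "h \<in> Ox" for h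
          using submoduleD(3)[OF ideal2_submodule that, of ?f Q f] ideal2_gens by (simp add: mult.commute)
        then show ?thesis unfolding \<Psi>_def by auto
      qed
      show "submodule_of Ox (\<Psi> C)" if "submodule_of Ox C" for C
        unfolding submodule_of_def
      proof (intro conjI ballI)
        show "0 \<in> \<Psi> C" using rO submoduleD(1)[OF that] by (simp add: \<Psi>_def)
        show "a + b \<in> \<Psi> C" if "a \<in> \<Psi> C" "b \<in> \<Psi> C" for a b
          using that rO submoduleD(2)[OF \<open>submodule_of Ox C\<close>] by (simp add: \<Psi>_def distrib_left)
        show "r * a \<in> \<Psi> C" if "r \<in> Ox" "a \<in> \<Psi> C" for r a
          using that rO submoduleD(3)[OF \<open>submodule_of Ox C\<close>, of r "?f * a"] by (simp add: \<Psi>_def mult.left_commute)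
      qed
      fix C C' assume C: "submodule_of Ox C" "submodule_of Ox C'" "ideal2 Q (f * g) \<subseteq> C" "C \<subset> C'" "C' \<subseteq> ideal2 Q f"
      then obtain d where d: "d \<in> C'" "d \<notin> C" by blast
      then obtain x y where xy: "d = ?Q * x + ?f * y" "x \<in> Ox" "y \<in> Ox" using C(5) unfolding ideal2_def by blast
      have Qx: "x * ?Q \<in> ideal2 Q (f * g)" by (rule submoduleD(3)[OF ideal2_submodule xy(2) ideal2_gens(1)])
      have "?f * y = d - x * ?Q" using xy by simp
      also have "\<dots> \<in> C'" using submodule_diff[OF ring_Ox C(2) d(1)] Qx C(3,4) by blast
      finally have "y \<in> \<Psi> C'" using xy by (simp add: \<Psi>_def)
      moreover have "y \<notin> \<Psi> C"
      proof
        assume "y \<in> \<Psi> C"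
        then have "x * ?Q + ?f * y \<in> C" using submoduleD(2)[OF C(1)] Qx C(3) by (auto simp: \<Psi>_def)
        then show False using d xy by (simp add: mult.commute)
      qed
      moreover have "\<Psi> C \<subseteq> \<Psi> C'" using C(4) by (auto simp: \<Psi>_def)
      ultimately show "\<Psi> C \<subset> \<Psi> C'" by blast
    qed
  next
    define \<Phi> where "\<Phi> C = {?Q * x + ?f * c | x c. x \<in> Ox \<and> c \<in> C}" for C
    show "len Q g \<le> quotient_length Ox (ideal2 Q f) (ideal2 Q (f * g))"
      unfolding len_def
    proof (rule quotient_length_mono_map[of \<Phi>])
      show "\<Phi> Ox = ideal2 Q f" by (simp add: \<Phi>_def ideal2_def)
      show "\<Phi> (ideal2 Q g) = ideal2 Q (f * g)"
      proof
        show "\<Phi> (ideal2 Q g) \<subseteq> ideal2 Q (f * g)"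
        proof
          fix z assume "z \<in> \<Phi> (ideal2 Q g)"
          then obtain x a b where z: "z = ?Q * x + ?f * (?Q * a + ?g * b)" "x \<in> Ox" "a \<in> Ox" "b \<in> Ox"
            unfolding \<Phi>_def ideal2_def by blast
          have "z = ?Q * (x + ?f * a) + to_fract (f * g) * b" using z by (simp add: algebra_simps)
          moreover have "x + ?f * a \<in> Ox" using z rO tf_Ox[OF f] by auto
          ultimately show "z \<in> ideal2 Q (f * g)" by (simp only: mem_ideal2I z(4))
        qed
        show "ideal2 Q (f * g) \<subseteq> \<Phi> (ideal2 Q g)"
        proof
          fix z assume "z \<in> ideal2 Q (f * g)"
          then obtain a b where z: "z = ?Q * a + to_fract (f * g) * b" "a \<in> Ox" "b \<in> Ox"
            unfolding ideal2_def by blast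
          have "?g * b \<in> ideal2 Q g" using mem_ideal2I[of 0 b Q g] rO z by simp
          moreover have "z = ?Q * a + ?f * (?g * b)" unfolding z(1) by (simp add: mult.assoc)
          ultimately show "z \<in> \<Phi> (ideal2 Q g)" unfolding \<Phi>_def using z by blast
        qed
      qed
      show "submodule_of Ox (\<Phi> C)" if C: "submodule_of Ox C" for C
        unfolding submodule_of_def
      proof (intro conjI ballI)
        show "0 \<in> \<Phi> C" unfolding \<Phi>_def using rO submoduleD(1)[OF C] by (intro CollectI exI[of _ 0]) auto
      next
        fix a b assume "a \<in> \<Phi> C" "b \<in> \<Phi> C"
        then obtain x c x' c' where ab: "a = ?Q * x + ?f * c" "b = ?Q * x' + ?f * c'" "x \<in> Ox" "x' \<in> Ox" "c \<in> C" "c' \<in> C"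
          unfolding \<Phi>_def by blast
        then have "a + b = ?Q * (x + x') + ?f * (c + c')" by (simp add: algebra_simps)
        moreover have "x + x' \<in> Ox" "c + c' \<in> C" using rO(3) submoduleD(2)[OF C] ab by auto
        ultimately show "a + b \<in> \<Phi> C" unfolding \<Phi>_def by blast
      next
        fix r a assume r: "r \<in> Ox" and "a \<in> \<Phi> C"
        then obtain x c where a: "a = ?Q * x + ?f * c" "x \<in> Ox" "c \<in> C" unfolding \<Phi>_def by blast
        then have "r * a = ?Q * (r * x) + ?f * (r * c)" by (simp add: algebra_simps)
        moreover have "r * x \<in> Ox" "r * c \<in> C" using rO(4)[OF r] submoduleD(3)[OF C r] a by auto
        ultimately show "r * a \<in> \<Phi> C" unfolding \<Phi>_def by blast
      qed
      fix C C' assume C: "submodule_of Ox C" "submodule_of Ox C'" "ideal2 Q g \<subseteq> C" "C \<subset> C'" "C' \<subseteq> Ox"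
      then obtain d where d: "d \<in> C'" "d \<notin> C" by blast
      have "?f * d \<in> \<Phi> C'" unfolding \<Phi>_def using d rO by (intro CollectI exI[of _ 0] exI[of _ d]) auto
      moreover have "?f * d \<notin> \<Phi> C"
      proof
        assume "?f * d \<in> \<Phi> C"
        then obtain x c where xc: "?f * d = ?Q * x + ?f * c" "x \<in> Ox" "c \<in> C" unfolding \<Phi>_def by blast
        have "d \<in> Ox" "c \<in> Ox" using d xc(3) C(4,5) by auto
        then have "d - c \<in> Ox" by (rule rO(6))
        moreover have "?f * (d - c) = ?Q * x" using xc by (simp add: algebra_simps)
        ultimately obtain z where z: "z \<in> Ox" "d - c = ?Q * z" using cancel xc(2) by blast
        have "?Q \<in> C" using ideal2_gens(1)[of Q g] C(3) by auto
        then have "z * ?Q \<in> C" by (rule submoduleD(3)[OF C(1) z(1)])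
        then have "c + z * ?Q \<in> C" by (rule submoduleD(2)[OF C(1) xc(3)])
        moreover have "c + z * ?Q = d" using z by (simp add: algebra_simps)
        ultimately show False using d by simp
      qed
      moreover have "\<Phi> C \<subseteq> \<Phi> C'" using C(4) unfolding \<Phi>_def by blast
      ultimately show "\<Phi> C \<subset> \<Phi> C'" by blast
    qed
  qed
  ultimately show ?thesis by simp
qed

end

lemma quotient_length_le_one:
  assumes "\<And>C. submodule_of R C \<Longrightarrow> N \<subset> C \<Longrightarrow> C \<subseteq> M \<Longrightarrow> C = M"
  shows "quotient_length R M N \<le> 1"
proof (rule quotient_length_leI)
  fix n assume "has_chain R M N n"
  then obtain C where C: "C 0 = N" "C n = M" "\<And>i. i \<le> n \<Longrightarrow> submodule_of R (C i)" "\<And>i. i < n \<Longrightarrow> C i \<subset> C (Suc i)"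
    unfolding has_chain_def by blast
  have "n \<le> 1"
  proof (rule ccontr)
    assume "\<not> n \<le> 1"
    then have n: "n \<ge> 2" by simp
    have up: "C 1 \<subset> C (j + 2)" if "j + 2 \<le> n" for j
      using that
    proof (induction j)
      case 0
      then show ?case using C(4)[of 1] by (simp add: numeral_2_eq_2)
    next
      case (Suc j)
      then show ?case using C(4)[of "j + 2"] by fastforce
    qed
    define j where "j = n - 2"
    have "n = j + 2" using n by (simp add: j_def)
    then have "C 1 \<subset> M" using up[of j] C(2) by (metis order_refl)
    moreover have "N \<subset> C 1" using C(4)[of 0] n C(1) by simp
    ultimately show False using assms[OF C(3)[of 1]] n by auto
  qed
  then show "enat n \<le> 1" by (simp add: one_enat_def)
qed

section \<open>Finiteness of the fibre of a monic polynomial\<close>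

context dvr
begin

lemma integral_division:
  assumes Q: "Q \<in> integral_polys v" "lead_coeff Q = 1" and p: "p \<in> integral_polys v"
  shows "\<exists>c r. c \<in> integral_polys v \<and> r \<in> integral_polys v \<and> p = Q * c + r \<and> (\<forall>k\<ge>degree Q. coeff r k = 0)"
  using p
proof (induction "degree p" arbitrary: p rule: less_induct)
  case less
  note r = ring_setD[OF ring_V]
  show ?case
  proof (cases "\<forall>k\<ge>degree Q. coeff p k = 0")
    case True
    then show ?thesis using less.prems by (intro exI[of _ 0] exI[of _ p]) (simp add: integral_ring)
  next
    case False
    then obtain k where k: "k \<ge> degree Q" "coeff p k \<noteq> 0" by blast
    then have dp: "degree p \<ge> degree Q" using le_degree[of p k] by simp
    define l where "l = lead_coeff p"
    have l: "l \<in> val_ring v" using less.prems unfolding integral_polys_def l_def by blast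
    define m where "m = monom l (degree p - degree Q)"
    have mi: "m \<in> integral_polys v" using l by (auto simp: integral_polys_def r m_def)
    define p' where "p' = p - Q * m"
    have p'i: "p' \<in> integral_polys v" unfolding p'_def by (intro integral_ring less.prems Q mi)
    have Qnz: "Q \<noteq> 0" using Q(2) by auto
    show ?thesis
    proof (cases "p' = 0")
      case True
      then have "p = Q * m + 0" by (simp add: p'_def)
      then show ?thesis using mi integral_ring(7) by fastforce
    next
      case p'nz: False
      have cQm: "coeff (Q * m) (degree p) = l"
      proof -
        have "coeff (Q * m) (degree p) = coeff (m * Q) ((degree p - degree Q) + degree Q)"
          using dp by (simp add: mult.commute)
        also have "\<dots> = l" unfolding m_def using Q(2) by (simp add: coeff_monom_mult)
        finally show ?thesis .
      qed
      have dQm: "degree (Q * m) \<le> degree p"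
        using degree_mult_le[of Q m] degree_monom_le[of l "degree p - degree Q"] dp unfolding m_def by linarith
      have le: "degree p' \<le> degree p" unfolding p'_def using dQm by (intro degree_diff_le) auto
      have c0: "coeff p' (degree p) = 0" unfolding p'_def using cQm by (simp add: l_def)
      have "degree p' < degree p" by (rule degree_less_if_less_eqI[OF le c0 p'nz])
      from less.hyps[OF this p'i] obtain c s where cs: "c \<in> integral_polys v" "s \<in> integral_polys v"
        "p' = Q * c + s" "\<forall>k\<ge>degree Q. coeff s k = 0" by blast
      have "p = Q * (c + m) + s" using cs(3) unfolding p'_def by (simp add: algebra_simps)
      then show ?thesis using cs integral_ring(1)[OF cs(1) mi] by blast
    qed
  qed
qed

lemma poly_integral: "p \<in> integral_polys v \<Longrightarrow> a \<in> val_ring v \<Longrightarrow> poly p a \<in> val_ring v"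
proof -
  assume p: "p \<in> integral_polys v" and a: "a \<in> val_ring v"
  note r = ring_setD[OF ring_V]
  have s: "(\<And>i. i \<in> I \<Longrightarrow> g i \<in> val_ring v) \<Longrightarrow> sum g I \<in> val_ring v" for g and I :: "nat set"
    by (induction I rule: infinite_finite_induct) (auto simp: r)
  show ?thesis unfolding poly_altdef using p a by (auto intro!: s r simp: integral_polys_def)
qed

lemma val_unit: "c \<in> val_ring v \<Longrightarrow> c \<notin> val_ideal v \<Longrightarrow> c \<noteq> 0 \<and> v c = 0 \<and> inverse c \<in> val_ring v"
  by (auto simp: val_ring_def val_ideal_def v_inverse)

lemma val_ideal_div:
  assumes "\<pi> \<noteq> 0" "v \<pi> = 1" "c \<in> val_ideal v"
  shows "\<exists>d\<in>val_ring v. c = \<pi> * d"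
proof (rule bexI[of _ "c / \<pi>"])
  show "c / \<pi> \<in> val_ring v"
    using assms v_divide[of c \<pi>] by (cases "c = 0") (auto simp: val_ring_def val_ideal_def)
qed (use assms in simp)

lemma Vc_I: "c \<in> val_ring v \<Longrightarrow> to_fract [:c:] \<in> Vc"
  by (simp add: Vc_def)

lemma tf_const: "to_fract [:c * d:] = to_fract [:c:] * to_fract [:d:]" "to_fract [:c + d:] = to_fract [:c:] + to_fract [:d:]"
  "to_fract [:1::'k:] = 1"
  by (simp_all flip: to_fract_mult to_fract_add add: one_pCons[symmetric] mult.commute)

text \<open>The ideal of V[t] generated by Q and the maximal ideal of V. The quotient is the ring of
  the zeroes of Q in the special fibre.\<close>

definition "baseideal Q = {to_fract Q * x + to_fract [:c:] * y | x c y. x \<in> A \<and> c \<in> val_ideal v \<and> y \<in> A}"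

lemma val_ideal_sum:
  assumes "\<pi> \<noteq> 0" "v \<pi> = 1"
  shows "baseideal Q = {to_fract Q * x + to_fract [:\<pi>:] * y | x y. x \<in> A \<and> y \<in> A}"
proof
  note rA = ring_setD[OF ring_A]
  show "baseideal Q \<subseteq> {to_fract Q * x + to_fract [:\<pi>:] * y | x y. x \<in> A \<and> y \<in> A}"
  proof
    fix z assume "z \<in> baseideal Q"
    then obtain x c y where z: "z = to_fract Q * x + to_fract [:c:] * y" "x \<in> A" "c \<in> val_ideal v" "y \<in> A"
      unfolding baseideal_def by blast
    obtain d where d: "d \<in> val_ring v" "c = \<pi> * d" using val_ideal_div[OF assms z(3)] by blast
    have "z = to_fract Q * x + to_fract [:\<pi>:] * (to_fract [:d:] * y)"
      unfolding z(1) d(2) tf_const(1) by (simp add: mult.assoc)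
    moreover have "to_fract [:d:] * y \<in> A" using rA(4) Vc_A Vc_I[OF d(1)] z(4) by blast
    ultimately show "z \<in> {to_fract Q * x + to_fract [:\<pi>:] * y | x y. x \<in> A \<and> y \<in> A}" using z by blast
  qed
  have "\<pi> \<in> val_ideal v" using assms by (simp add: val_ideal_def)
  then show "{to_fract Q * x + to_fract [:\<pi>:] * y | x y. x \<in> A \<and> y \<in> A} \<subseteq> baseideal Q"
    unfolding baseideal_def by blast
qed

text \<open>Filters V[t] / (Q, m) by degree, where m is the maximal ideal of V. Each step is a
  quotient of the residue field.\<close>

definition "filt Q i = {to_fract q + j | q j. q \<in> integral_polys v \<and> (\<forall>k\<ge>i. coeff q k = 0) \<and> j \<in> baseideal Q}"

lemma baseideal_submodule: "submodule_of A (baseideal Q)"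
proof -
  note rA = ring_setD[OF ring_A]
  obtain \<pi> where pi: "\<pi> \<noteq> 0" "v \<pi> = 1" using uniformizer by blast
  show ?thesis unfolding submodule_of_def val_ideal_sum[OF pi]
  proof (intro conjI ballI)
    show "0 \<in> {to_fract Q * x + to_fract [:\<pi>:] * y | x y. x \<in> A \<and> y \<in> A}"
      using rA(2) by (intro CollectI exI[of _ 0]) auto
  next
    fix a b assume "a \<in> {to_fract Q * x + to_fract [:\<pi>:] * y | x y. x \<in> A \<and> y \<in> A}"
      "b \<in> {to_fract Q * x + to_fract [:\<pi>:] * y | x y. x \<in> A \<and> y \<in> A}"
    then obtain x y x' y' where ab: "a = to_fract Q * x + to_fract [:\<pi>:] * y" "b = to_fract Q * x' + to_fract [:\<pi>:] * y'"
      "x \<in> A" "y \<in> A" "x' \<in> A" "y' \<in> A" by blast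
    then have "a + b = to_fract Q * (x + x') + to_fract [:\<pi>:] * (y + y')" by (simp add: algebra_simps)
    moreover have "x + x' \<in> A" "y + y' \<in> A" using ab rA(3) by auto
    ultimately show "a + b \<in> {to_fract Q * x + to_fract [:\<pi>:] * y | x y. x \<in> A \<and> y \<in> A}" by blast
  next
    fix r a assume r: "r \<in> A" and "a \<in> {to_fract Q * x + to_fract [:\<pi>:] * y | x y. x \<in> A \<and> y \<in> A}"
    then obtain x y where a: "a = to_fract Q * x + to_fract [:\<pi>:] * y" "x \<in> A" "y \<in> A" by blast
    then have "r * a = to_fract Q * (r * x) + to_fract [:\<pi>:] * (r * y)" by (simp add: algebra_simps)
    moreover have "r * x \<in> A" "r * y \<in> A" using a r rA(4) by auto
    ultimately show "r * a \<in> {to_fract Q * x + to_fract [:\<pi>:] * y | x y. x \<in> A \<and> y \<in> A}" by blast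
  qed
qed

lemma baseideal_sub: "Q \<in> integral_polys v \<Longrightarrow> baseideal Q \<subseteq> A"
proof -
  assume Q: "Q \<in> integral_polys v"
  note rA = ring_setD[OF ring_A]
  obtain \<pi> where pi: "\<pi> \<noteq> 0" "v \<pi> = 1" using uniformizer by blast
  have "to_fract [:\<pi>:] \<in> A" "to_fract Q \<in> A" using pi Q by (auto intro!: A_I integral_ring simp: val_ring_def)
  then show ?thesis unfolding val_ideal_sum[OF pi] using rA(3,4) by blast
qed

lemma filt_submodule: "submodule_of Vc (filt Q i)"
  unfolding submodule_of_def
proof (intro conjI ballI)
  note b = submoduleD[OF baseideal_submodule]
  show "0 \<in> filt Q i" unfolding filt_def using b(1) integral_ring(7)
    by (intro CollectI exI[of _ 0]) auto
  fix x y assume "x \<in> filt Q i" "y \<in> filt Q i"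
  then obtain q j q' j' where xy: "x = to_fract q + j" "y = to_fract q' + j'" "q \<in> integral_polys v" "q' \<in> integral_polys v"
    "\<forall>k\<ge>i. coeff q k = 0" "\<forall>k\<ge>i. coeff q' k = 0" "j \<in> baseideal Q" "j' \<in> baseideal Q" unfolding filt_def by blast
  have "x + y = to_fract (q + q') + (j + j')" using xy by simp
  moreover have "\<forall>k\<ge>i. coeff (q + q') k = 0" using xy by simp
  ultimately show "x + y \<in> filt Q i" unfolding filt_def using xy b(2) integral_ring(1) by blast
next
  note b = submoduleD[OF baseideal_submodule]
  fix r x assume "r \<in> Vc" "x \<in> filt Q i"
  then obtain c q j where r: "r = to_fract [:c:]" "c \<in> val_ring v" and
    x: "x = to_fract q + j" "q \<in> integral_polys v" "\<forall>k\<ge>i. coeff q k = 0" "j \<in> baseideal Q" unfolding filt_def Vc_def by blast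
  have "r * x = to_fract (smult c q) + r * j" using x r by (simp add: distrib_left flip: to_fract_mult)
  moreover have "r * j \<in> baseideal Q" using b(3) Vc_A Vc_I[OF r(2)] x(4) unfolding r(1) by blast
  moreover have "\<forall>k\<ge>i. coeff (smult c q) k = 0" using x by simp
  ultimately show "r * x \<in> filt Q i" unfolding filt_def using integral_ring(9)[OF r(2) x(2)] by blast
qed

lemma filt_mono: "filt Q i \<subseteq> filt Q (Suc i)"
  unfolding filt_def by (blast dest: Suc_leD)

lemma filt_0: "filt Q 0 = baseideal Q"
proof -
  have z: "q = 0" if "\<forall>k\<ge>0. coeff q k = 0" for q :: "'k poly" using that by (auto intro: poly_eqI)
  show ?thesis
  proof
    show "filt Q 0 \<subseteq> baseideal Q"
    proof
      fix x assume "x \<in> filt Q 0"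
      then obtain q j where q: "x = to_fract q + j" "\<forall>k\<ge>0. coeff q k = 0" "j \<in> baseideal Q"
        unfolding filt_def by blast
      then show "x \<in> baseideal Q" using z[OF q(2)] by simp
    qed
    show "baseideal Q \<subseteq> filt Q 0"
    proof
      fix x assume "x \<in> baseideal Q"
      then show "x \<in> filt Q 0" unfolding filt_def using integral_ring(7)
        by (intro CollectI exI[of _ 0] exI[of _ x]) auto
    qed
  qed
qed

text \<open>A larger submodule contains an element whose coefficient at t^i is a unit, since
  otherwise that term would lie in \<open>baseideal Q\<close>. Scaling gives t^i itself, and this
  generates the next step.\<close>

lemma filt_step: "quotient_length Vc (filt Q (Suc i)) (filt Q i) \<le> 1"
proof (rule quotient_length_le_one)
  note rA = ring_setD[OF ring_A] and rV = ring_setD[OF ring_V]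
  fix C assume C: "submodule_of Vc C" "filt Q i \<subset> C" "C \<subseteq> filt Q (Suc i)"
  note c = submoduleD[OF C(1)]
  define T where "T = to_fract (monom (1::'k) i)"
  obtain z where z: "z \<in> C" "z \<notin> filt Q i" using C(2) by blast
  obtain q j where qj: "z = to_fract q + j" "q \<in> integral_polys v" "\<forall>k\<ge>Suc i. coeff q k = 0" "j \<in> baseideal Q"
    using z(1) C(3) unfolding filt_def by blast
  have dec: "\<exists>q' d. q = q' + monom d i \<and> d = coeff q i \<and> d \<in> val_ring v \<and> q' \<in> integral_polys v \<and> (\<forall>k\<ge>i. coeff q' k = 0)"
    if q: "q \<in> integral_polys v" "\<forall>k\<ge>Suc i. coeff q k = 0" for q
  proof (intro exI[of _ "q - monom (coeff q i) i"] exI[of _ "coeff q i"] conjI)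
    show "coeff q i \<in> val_ring v" using q(1) by (simp add: integral_polys_def)
    then have "monom (coeff q i) i \<in> integral_polys v" by (auto simp: integral_polys_def rV)
    then show "q - monom (coeff q i) i \<in> integral_polys v" using q(1) by (rule integral_ring(4)[rotated])
    show "\<forall>k\<ge>i. coeff (q - monom (coeff q i) i) k = 0"
    proof (intro allI impI)
      fix k assume "k \<ge> i"
      then show "coeff (q - monom (coeff q i) i) k = 0" using q(2) by (cases "k = i") auto
    qed
  qed auto
  have mT: "to_fract (monom d i) = to_fract [:d:] * T" for d
    unfolding T_def by (simp flip: to_fract_mult add: smult_monom)
  have TA: "T \<in> A" unfolding T_def by (rule A_I) (auto simp: integral_polys_def rV)
  obtain q' d where q': "q = q' + monom d i" "d \<in> val_ring v" "q' \<in> integral_polys v" "\<forall>k\<ge>i. coeff q' k = 0"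
    using dec[OF qj(2,3)] by blast
  have in_filt: "to_fract q' + j \<in> filt Q i" unfolding filt_def using q' qj by blast
  have "d \<notin> val_ideal v"
  proof
    assume "d \<in> val_ideal v"
    then have "to_fract (monom d i) \<in> baseideal Q"
      unfolding mT baseideal_def using TA rA(2) by (intro CollectI exI[of _ 0] exI[of _ d] exI[of _ T]) auto
    then have "j + to_fract (monom d i) \<in> baseideal Q" using submoduleD(2)[OF baseideal_submodule qj(4)] by blast
    moreover have "z = to_fract q' + (j + to_fract (monom d i))" using qj q' by simp
    ultimately have "z \<in> filt Q i" unfolding filt_def using q' by blast
    then show False using z by simp
  qed
  then have d: "d \<noteq> 0" "inverse d \<in> val_ring v" using val_unit[OF q'(2)] by auto
  have "to_fract [:d:] * T = z - (to_fract q' + j)" unfolding mT[symmetric] using qj q' by simp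
  also have "\<dots> \<in> C" using submodule_diff[OF ring_Vc C(1) z(1)] in_filt C(2) by blast
  finally have "to_fract [:inverse d:] * (to_fract [:d:] * T) \<in> C" using c(3) Vc_I[OF d(2)] by blast
  then have T: "T \<in> C" using d(1) tf_const(1)[of "inverse d" d] tf_const(3) by (simp add: mult.assoc[symmetric])
  show "C = filt Q (Suc i)"
  proof
    show "filt Q (Suc i) \<subseteq> C"
    proof
      fix x assume "x \<in> filt Q (Suc i)"
      then obtain p j' where p: "x = to_fract p + j'" "p \<in> integral_polys v" "\<forall>k\<ge>Suc i. coeff p k = 0" "j' \<in> baseideal Q"
        unfolding filt_def by blast
      obtain p' e where p': "p = p' + monom e i" "e \<in> val_ring v" "p' \<in> integral_polys v" "\<forall>k\<ge>i. coeff p' k = 0"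
        using dec[OF p(2,3)] by blast
      have "to_fract p' + j' \<in> C" using p p' C(2) unfolding filt_def by blast
      moreover have "to_fract [:e:] * T \<in> C" using c(3)[OF Vc_I[OF p'(2)] T] .
      ultimately have "(to_fract p' + j') + to_fract [:e:] * T \<in> C" by (rule c(2))
      moreover have "x = (to_fract p' + j') + to_fract [:e:] * T" unfolding mT[symmetric] using p p' by simp
      ultimately show "x \<in> C" by simp
    qed
  qed (rule C(3))
qed

lemma filt_length: "quotient_length Vc (filt Q i) (baseideal Q) \<le> enat i"
proof (induction i)
  case 0
  then show ?case
    using quotient_length_refl[OF filt_submodule ring_Vc, of Q 0] by (simp add: filt_0 zero_enat_def)
next
  case (Suc i)
  have "baseideal Q \<subseteq> filt Q j" for j
    by (induction j) (use filt_0 filt_mono in blast)+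
  then have "quotient_length Vc (filt Q (Suc i)) (baseideal Q) =
      quotient_length Vc (filt Q (Suc i)) (filt Q i) + quotient_length Vc (filt Q i) (baseideal Q)"
    by (intro quotient_length_add ring_Vc filt_submodule filt_mono)
       (auto intro: submodule_restrict[OF baseideal_submodule Vc_A])
  also have "\<dots> \<le> 1 + enat i" by (intro add_mono filt_step Suc)
  finally show ?case by (simp add: one_enat_def)
qed

text \<open>Division with remainder by the monic Q shows that the filtration reaches all of V[t] at
  step \<open>degree Q\<close>.\<close>

lemma base_length:
  assumes Q: "Q \<in> integral_polys v" "lead_coeff Q = 1"
  shows "quotient_length Vc A (baseideal Q) \<le> enat (degree Q)"
proof -
  have "filt Q (degree Q) = A"
  proof
    show "filt Q (degree Q) \<subseteq> A"
      unfolding filt_def using ring_setD(3)[OF ring_A] A_I baseideal_sub[OF Q(1)] by blast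
    show "A \<subseteq> filt Q (degree Q)"
    proof
      fix x assume "x \<in> A"
      then obtain p where p: "x = to_fract p" "p \<in> integral_polys v" by (auto simp: A_def)
      obtain c r where cr: "c \<in> integral_polys v" "r \<in> integral_polys v" "p = Q * c + r" "\<forall>k\<ge>degree Q. coeff r k = 0"
        using integral_division[OF Q p(2)] by blast
      have "to_fract Q * to_fract c \<in> baseideal Q"
        unfolding baseideal_def using A_I[OF cr(1)] ring_setD(2)[OF ring_A]
        by (intro CollectI exI[of _ "to_fract c"] exI[of _ 0] exI[of _ 0]) (auto simp: val_ideal_def)
      moreover have "x = to_fract r + to_fract Q * to_fract c" using p cr by simp
      ultimately show "x \<in> filt Q (degree Q)" unfolding filt_def using cr by blast
    qed
  qed
  then show ?thesis using filt_length[of Q "degree Q"] by simp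
qed

end

context loc_ring
begin

text \<open>The maximal ideal of the local ring. Described through units it depends on the ring
  alone, so a point can be recovered from its local ring.\<close>

definition "mO = {a \<in> Ox. a = 0 \<or> inverse a \<notin> Ox}"

lemma mO_iff: "a \<in> A \<Longrightarrow> s \<in> A \<Longrightarrow> s \<notin> Mx \<Longrightarrow> a / s \<in> mO \<longleftrightarrow> a \<in> Mx"
proof
  assume as: "a \<in> A" "s \<in> A" "s \<notin> Mx"
  have snz: "s \<noteq> 0" using as zero_Mx by auto
  show "a \<in> Mx" if m: "a / s \<in> mO"
  proof (rule ccontr)
    assume n: "a \<notin> Mx"
    then have "a \<noteq> 0" using zero_Mx by auto
    moreover have "s / a \<in> Ox" using Ox_I as n by blast
    ultimately show False using m snz by (simp add: mO_def)
  qed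
  show "a / s \<in> mO" if m: "a \<in> Mx"
  proof (rule ccontr)
    assume n: "a / s \<notin> mO"
    then have anz: "a \<noteq> 0" and "s / a \<in> Ox" using Ox_I[OF as] by (auto simp: mO_def)
    then obtain b t where bt: "s / a = b / t" "b \<in> A" "t \<in> A" "t \<notin> Mx" unfolding Ox_iff by blast
    have tnz: "t \<noteq> 0" using bt zero_Mx by auto
    have "s * t = b * a" using bt(1) anz tnz by (simp add: field_simps)
    also have "\<dots> \<in> Mx" by (rule submoduleD(3)[OF Mx_sub(1) bt(2) m])
    finally show False using prime_Mx[of s t] as bt by blast
  qed
qed

lemma mO_A: "mO \<inter> A = Mx"
  using mO_iff[of _ 1] ring_setD(1)[OF rA0] one_notin Mx_sub(2) by auto

lemma mO_submodule: "submodule_of Ox mO"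
proof -
  have *: "mO = {m / s | m s. m \<in> Mx \<and> s \<in> A \<and> s \<notin> Mx}"
  proof
    show "mO \<subseteq> {m / s | m s. m \<in> Mx \<and> s \<in> A \<and> s \<notin> Mx}"
    proof
      fix x assume x: "x \<in> mO"
      then obtain a s where "x = a / s" "a \<in> A" "s \<in> A" "s \<notin> Mx" unfolding mO_def Ox_iff by blast
      then show "x \<in> {m / s | m s. m \<in> Mx \<and> s \<in> A \<and> s \<notin> Mx}" using mO_iff x by blast
    qed
    show "{m / s | m s. m \<in> Mx \<and> s \<in> A \<and> s \<notin> Mx} \<subseteq> mO" using mO_iff Mx_sub(2) by blast
  qed
  note m = submoduleD[OF Mx_sub(1)] and rA = ring_setD[OF rA0]
  show ?thesis unfolding submodule_of_def
  proof (intro conjI ballI)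
    show "0 \<in> mO" using rO(2) by (simp add: mO_def)
  next
    fix x y assume "x \<in> mO" "y \<in> mO"
    then obtain a s b t where xy: "x = a / s" "y = b / t" "a \<in> Mx" "b \<in> Mx" "s \<in> A" "t \<in> A" "s \<notin> Mx" "t \<notin> Mx"
      unfolding * by blast
    have nz: "s \<noteq> 0" "t \<noteq> 0" using xy zero_Mx by auto
    have "x + y = (t * a + s * b) / (s * t)" using nz xy by (simp add: field_simps)
    moreover have "t * a + s * b \<in> Mx" using m xy by blast
    moreover have "s * t \<in> A" "s * t \<notin> Mx" using xy rA(4) prime_Mx[of s t] by blast+
    ultimately show "x + y \<in> mO" unfolding * by blast
  next
    fix r x assume "r \<in> Ox" "x \<in> mO"
    then obtain a s b t where xy: "r = a / s" "x = b / t" "a \<in> A" "b \<in> Mx" "s \<in> A" "t \<in> A" "s \<notin> Mx" "t \<notin> Mx"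
      unfolding * Ox_iff by blast
    have "r * x = (a * b) / (s * t)" using xy by simp
    moreover have "a * b \<in> Mx" using m xy by blast
    moreover have "s * t \<in> A" "s * t \<notin> Mx" using xy rA(4) prime_Mx[of s t] by blast+
    ultimately show "r * x \<in> mO" unfolding * by blast
  qed
qed

end

context special_pt
begin

lemma ideal2_top:
  assumes "Q \<in> integral_polys v" "g \<in> integral_polys v" "1 \<in> ideal2 Q g"
  shows "ideal2 Q g = Ox" "len Q g = 0"
proof -
  have "x \<in> ideal2 Q g" if "x \<in> Ox" for x
    using submoduleD(3)[OF ideal2_submodule that assms(3)] by simp
  then show "ideal2 Q g = Ox" using ideal2_sub_Ox[OF assms(1,2)] by auto
  then show "len Q g = 0"
    unfolding len_def using quotient_length_refl[OF submodule_self[OF ring_Ox] ring_Ox] by simp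
qed

lemma ideal2_top_if_unit:
  assumes "Q \<in> integral_polys v" "g \<in> integral_polys v" "p \<in> integral_polys v" "to_fract p \<notin> Mx"
    and "to_fract p \<in> ideal2 Q g"
  shows "len Q g = 0"
proof (rule ideal2_top(2)[OF assms(1,2)])
  have "to_fract p \<noteq> 0" using assms(4) zero_Mx by auto
  moreover have "1 / to_fract p * to_fract p \<in> ideal2 Q g"
    by (rule submoduleD(3)[OF ideal2_submodule unit_Ox[OF A_I[OF assms(3)] assms(4)] assms(5)])
  ultimately show "1 \<in> ideal2 Q g" by simp
qed

lemma const_unit_notin: "c \<in> val_ring v \<Longrightarrow> c \<notin> val_ideal v \<Longrightarrow> to_fract [:c:] \<notin> Mx"
proof
  assume c: "c \<in> val_ring v" "c \<notin> val_ideal v" and m: "to_fract [:c:] \<in> Mx"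
  have "to_fract [:inverse c:] * to_fract [:c:] \<in> Mx"
    by (rule submoduleD(3)[OF Mx_sub(1) _ m]) (use val_unit[OF c] in \<open>auto intro!: A_I integral_ring\<close>)
  moreover have "to_fract [:inverse c:] * to_fract [:c:] = 1"
    using val_unit[OF c] tf_const(1)[of "inverse c" c] tf_const(3) by simp
  ultimately show False using one_notin by simp
qed

lemma len_const_unit_mult:
  assumes Q: "Q \<in> integral_polys v" and u: "u \<in> val_ring v" "u \<notin> val_ideal v" and g: "g \<in> integral_polys v"
  shows "ideal2 Q (smult u g) = ideal2 Q g"
proof
  note s = submoduleD[OF ideal2_submodule]
  have e: "to_fract (smult u g) = to_fract [:u:] * to_fract g" by (simp flip: to_fract_mult)
  have iu: "inverse u \<in> val_ring v" "u \<noteq> 0" using val_unit[OF u] by auto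
  have m: "to_fract [:u:] \<in> Ox" "to_fract [:inverse u:] \<in> Ox" using u iu by (auto intro!: tf_Ox integral_ring)
  show "ideal2 Q (smult u g) \<subseteq> ideal2 Q g"
    by (rule ideal2_least[OF ideal2_submodule ideal2_gens(1)]) (unfold e, rule s(3)[OF m(1) ideal2_gens(2)])
  have "to_fract g = to_fract [:inverse u:] * to_fract (smult u g)"
    unfolding e using iu tf_const(1)[of "inverse u" u] tf_const(3) by (simp add: mult.assoc[symmetric])
  then have "to_fract g \<in> ideal2 Q (smult u g)" using s(3)[OF m(2) ideal2_gens(2)] by metis
  then show "ideal2 Q g \<subseteq> ideal2 Q (smult u g)"
    by (rule ideal2_least[OF ideal2_submodule ideal2_gens(1)])
qed

text \<open>Write c as a unit times a power of \<pi>; nonzero constants are nonzerodivisors modulo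
  Q, so additivity of lengths applies.\<close>

lemma len_const:
  assumes Q: "Q \<in> integral_polys v" "lead_coeff Q = 1" and pi: "\<pi> \<noteq> 0" "v \<pi> = 1" and c: "c \<noteq> 0" "v c \<ge> 0"
  shows "len Q [:c:] = of_nat (nat (v c)) * len Q [:\<pi>:]"
proof -
  have pV: "\<pi> \<in> val_ring v" using pi by (simp add: val_ring_def)
  have pk: "len Q [:\<pi> ^ k:] = of_nat k * len Q [:\<pi>:]" for k
  proof (induction k)
    case 0
    have "ideal2 Q 1 = Ox" "len Q 1 = 0"
      by (rule ideal2_top[OF Q(1) integral_ring(6)]; use ideal2_gens(2)[of 1 Q] in simp)+
    then show ?case by (simp add: one_pCons[symmetric])
  next
    case (Suc k)
    have "len Q ([:\<pi>:] * [:\<pi> ^ k:]) = len Q [:\<pi>:] + len Q [:\<pi> ^ k:]"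
    proof (rule len_mult[OF Q])
      show "[:\<pi>:] \<in> integral_polys v" "[:\<pi> ^ k:] \<in> integral_polys v"
        using pV ring_setD(7)[OF ring_V] by (auto intro!: integral_ring)
      show "Q dvd [:\<pi>:] * a \<Longrightarrow> Q dvd a" for a using pi by (simp add: dvd_smult_iff)
    qed
    then show ?case using Suc by (simp add: algebra_simps)
  qed
  define k where "k = nat (v c)"
  define u where "u = c / \<pi> ^ k"
  have unz: "u \<noteq> 0" using c pi by (simp add: u_def)
  have "v u = 0" unfolding u_def using c pi by (simp add: v_divide v_power k_def)
  then have u: "u \<in> val_ring v" "u \<notin> val_ideal v" using unz by (auto simp: val_ring_def val_ideal_def)
  have "[:c:] = smult u [:\<pi> ^ k:]" using pi by (simp add: u_def)
  then have "len Q [:c:] = len Q [:\<pi> ^ k:]"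
    unfolding len_def using len_const_unit_mult[OF Q(1) u, of "[:\<pi> ^ k:]"] pV ring_setD(7)[OF ring_V]
    by (simp add: integral_ring)
  then show ?thesis using pk k_def by simp
qed

lemma Int_A_submodule: "submodule_of R C \<Longrightarrow> Vc \<subseteq> R \<Longrightarrow> submodule_of Vc (C \<inter> A)"
  using ring_setD(2,3,4)[OF ring_A] Vc_A unfolding submodule_of_def by blast

text \<open>O is a localisation of V[t], so an O-submodule is determined by its intersection with
  V[t]. This bounds the length by that of V[t] / (Q, m) over V, m being the maximal ideal of
  V.\<close>

lemma len_pi_le:
  assumes Q: "Q \<in> integral_polys v" "lead_coeff Q = 1" and pi: "\<pi> \<noteq> 0" "v \<pi> = 1"
  shows "len Q [:\<pi>:] \<le> enat (degree Q)"
proof -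
  have pV: "[:\<pi>:] \<in> integral_polys v" using pi by (auto intro!: integral_ring simp: val_ring_def)
  have sm: "submodule_of Vc (ideal2 Q [:\<pi>:] \<inter> A)"
    by (rule Int_A_submodule[OF ideal2_submodule]) (use Vc_A A_Ox in auto)
  have "len Q [:\<pi>:] \<le> quotient_length Vc A (ideal2 Q [:\<pi>:] \<inter> A)"
    unfolding len_def
  proof (rule quotient_length_mono_map[of "\<lambda>C. C \<inter> A"])
    show "Ox \<inter> A = A" using A_Ox by auto
    show "submodule_of Vc (C \<inter> A)" if "submodule_of Ox C" for C
      by (rule Int_A_submodule[OF that]) (use Vc_A A_Ox in auto)
    fix C C' assume C: "submodule_of Ox C" "submodule_of Ox C'" "C \<subset> C'" "C' \<subseteq> Ox"
    then obtain x where x: "x \<in> C'" "x \<notin> C" by blast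
    then obtain a s where as: "x = a / s" "a \<in> A" "s \<in> A" "s \<notin> Mx" using C(4) Ox_iff by blast
    have snz: "s \<noteq> 0" using as zero_Mx by auto
    have "a \<in> C'"
      using submoduleD(3)[OF C(2), of s x] x as A_Ox snz by auto
    moreover have "a \<notin> C"
      using submoduleD(3)[OF C(1) unit_Ox[OF as(3,4)], of a] x as by auto
    ultimately show "C \<inter> A \<subset> C' \<inter> A" using C(3) as(2) by blast
  qed simp
  also have "\<dots> \<le> quotient_length Vc A (baseideal Q)"
  proof (rule quotient_length_antimono[OF ring_Vc submodule_restrict[OF baseideal_submodule Vc_A] sm])
    show "submodule_of Vc A" by (rule submodule_restrict[OF submodule_self[OF ring_A] Vc_A])
    have "baseideal Q \<subseteq> ideal2 Q [:\<pi>:]"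
      unfolding val_ideal_sum[OF pi] ideal2_def using A_Ox by blast
    then show "baseideal Q \<subseteq> ideal2 Q [:\<pi>:] \<inter> A" using baseideal_sub[OF Q(1)] by auto
  qed simp
  also have "\<dots> \<le> enat (degree Q)" by (rule base_length[OF Q])
  finally show ?thesis .
qed

lemma residue_degree_eq: "residue_degree v Ox = quotient_length Vc Ox mO"
  by (simp add: residue_degree_def Vc_def mO_def)

lemma Vc_Ox: "Vc \<subseteq> Ox"
  using Vc_A A_Ox by auto

lemma baseideal_Mx: "to_fract Q \<in> Mx \<Longrightarrow> baseideal Q \<subseteq> Mx"
proof
  assume Q: "to_fract Q \<in> Mx"
  note m = submoduleD[OF Mx_sub(1)]
  fix z assume "z \<in> baseideal Q"
  then obtain x c y where z: "z = x * to_fract Q + y * to_fract [:c:]" "x \<in> A" "c \<in> val_ideal v" "y \<in> A"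
    unfolding baseideal_def by (auto simp: mult.commute)
  then show "z \<in> Mx" using m Q pi_Mx by blast
qed

end

text \<open>Intersecting such ideals one after the other gives a strictly decreasing sequence of
  submodules above (Q, m), so their number is at most the length of V[t] / (Q, m), which is at most
  the degree of Q.\<close>

lemma (in dvr) finite_maximal:
  assumes Q: "Q \<in> integral_polys v" "lead_coeff Q = 1"
  shows "finite {M. maximal_ideal_of A M \<and> (\<lambda>c. to_fract [:c:]) ` val_ideal v \<subseteq> M \<and> to_fract Q \<in> M}"
    (is "finite ?S")
proof (rule ccontr)
  assume "infinite ?S"
  then obtain F where F: "finite F" "card F = Suc (degree Q)" "F \<subseteq> ?S"
    using infinite_arbitrarily_large[of ?S "Suc (degree Q)"] by blast
  have sp: "special_pt v M" if "M \<in> ?S" for M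
    using that ring_A by unfold_locales auto
  have "enat (card F) \<le> quotient_length Vc A (A \<inter> \<Inter>F) \<and> submodule_of A (A \<inter> \<Inter>F) \<and> baseideal Q \<subseteq> A \<inter> \<Inter>F"
    if "finite F" "F \<subseteq> ?S" for F
    using that
  proof (induction F rule: finite_induct)
    case empty
    then show ?case using submodule_self[OF ring_A] baseideal_sub[OF Q(1)] by (simp add: zero_enat_def[symmetric])
  next
    case (insert M F)
    define N where "N = A \<inter> \<Inter>F"
    have IH: "enat (card F) \<le> quotient_length Vc A N" "submodule_of A N" "baseideal Q \<subseteq> N"
      using insert by (auto simp: N_def)
    have M: "M \<in> ?S" using insert by auto
    interpret special_pt v M by (rule sp[OF M])
    \<comment> \<open>A product of elements, one from each earlier ideal and each outside
      \<open>M\<close>, lies in all earlier ideals, but not in the prime ideal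
      \<open>M\<close>.\<close>
    have ex: "\<exists>x\<in>A \<inter> \<Inter>F'. x \<notin> M" if "finite F'" "F' \<subseteq> F" for F'
      using that
    proof (induction F' rule: finite_induct)
      case empty
      then show ?case using one_notin ring_setD(1)[OF ring_A] by auto
    next
      case (insert M' F')
      then obtain x where x: "x \<in> A" "x \<in> \<Inter>F'" "x \<notin> M" by auto
      have "M' \<in> F" using insert.prems by simp
      then have M': "M' \<in> ?S" "M' \<noteq> M" using \<open>insert M F \<subseteq> ?S\<close> \<open>M \<notin> F\<close> by blast+
      interpret m': special_pt v M' by (rule sp[OF M'(1)])
      have "\<not> M' \<subseteq> M"
      proof
        assume "M' \<subseteq> M"
        then have "M = M' \<or> M = A" using m'.mx Mx_sub unfolding maximal_ideal_of_def by blast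
        then show False using M'(2) Mx_sub(2) by auto
      qed
      then obtain y where y: "y \<in> M'" "y \<notin> M" by auto
      have yA: "y \<in> A" using y m'.Mx_sub(2) by auto
      have "x * y \<notin> M" using prime_Mx[OF x(1) yA] x y by blast
      moreover have "x * y \<in> A" using ring_setD(4)[OF ring_A x(1) yA] .
      moreover have "x * y \<in> M'" using submoduleD(3)[OF m'.Mx_sub(1) x(1) y(1)] .
      moreover have "x * y \<in> K" if "K \<in> F'" for K
      proof -
        have "K \<in> F" using that insert.prems by auto
        then have "K \<in> ?S" using \<open>insert M F \<subseteq> ?S\<close> by blast
        then interpret k: special_pt v K by (rule sp)
        have "y * x \<in> K" using submoduleD(3)[OF k.Mx_sub(1) yA, of x] x(2) that by blast
        then show ?thesis by (simp add: mult.commute)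
      qed
      ultimately show ?case by blast
    qed
    have N': "A \<inter> \<Inter>(insert M F) = N \<inter> M" by (auto simp: N_def)
    have sub: "submodule_of A (N \<inter> M)" using IH(2) Mx_sub(1) unfolding submodule_of_def by blast
    have "N \<inter> M \<subset> N" using ex[OF insert.hyps(1)] by (auto simp: N_def)
    then have one: "1 \<le> quotient_length Vc N (N \<inter> M)"
      using has_chain_le[OF has_chain_one[of Vc "N \<inter> M" N]] submodule_restrict[OF sub Vc_A] submodule_restrict[OF IH(2) Vc_A]
      by (simp add: one_enat_def)
    have "quotient_length Vc A (N \<inter> M) = quotient_length Vc A N + quotient_length Vc N (N \<inter> M)"
      by (rule quotient_length_add[OF ring_Vc submodule_restrict[OF sub Vc_A] submodule_restrict[OF IH(2) Vc_A]
            submodule_restrict[OF submodule_self[OF ring_A] Vc_A]]) (auto simp: N_def)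
    also have "\<dots> \<ge> enat (card F) + 1" by (intro add_mono IH one)
    finally have "enat (card (insert M F)) \<le> quotient_length Vc A (N \<inter> M)"
      using insert.hyps by (simp add: one_enat_def)
    moreover have "baseideal Q \<subseteq> N \<inter> M" using IH(3) baseideal_Mx M by auto
    ultimately show ?case unfolding N' using sub by blast
  qed
  from this[OF F(1,3)] have *: "enat (card F) \<le> quotient_length Vc A (A \<inter> \<Inter>F)" "submodule_of A (A \<inter> \<Inter>F)" "baseideal Q \<subseteq> A \<inter> \<Inter>F"
    by auto
  have "quotient_length Vc A (A \<inter> \<Inter>F) \<le> quotient_length Vc A (baseideal Q)"
    by (rule quotient_length_antimono[OF ring_Vc submodule_restrict[OF baseideal_submodule Vc_A]
          submodule_restrict[OF *(2) Vc_A] submodule_restrict[OF submodule_self[OF ring_A] Vc_A] *(3)]) auto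
  then have "enat (card F) \<le> enat (degree Q)" using *(1) base_length[OF Q] by (meson order_trans)
  then show False using F(2) by simp
qed

lemma poly_at_hom:
  "poly_at s (p + q) = poly_at s p + poly_at s q" "poly_at s (p * q) = poly_at s p * poly_at s q"
  "poly_at s (- p) = - poly_at s p" "poly_at s [:c:] = to_fract [:c:]" "poly_at s 1 = 1"
  "poly_at s (pCons c p) = to_fract [:c:] + s * poly_at s p" "poly_at s 0 = 0"
proof -
  have a: "to_fract [:x + y:] = to_fract [:x:] + to_fract [:y:]" for x y :: 'a
    by (simp flip: to_fract_add)
  have m: "to_fract [:x * y:] = to_fract [:x:] * to_fract [:y:]" for x y :: 'a
    by (simp flip: to_fract_mult add: mult.commute)
  show add: "poly_at s (p + q) = poly_at s p + poly_at s q" for p q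
    unfolding poly_at_def by (subst map_poly_hom_add) (simp_all add: a)
  show "poly_at s (p * q) = poly_at s p * poly_at s q"
    unfolding poly_at_def by (subst map_poly_hom_mult) (simp_all add: a m)
  show z: "poly_at s 0 = 0" by (simp add: poly_at_def)
  show "poly_at s (- p) = - poly_at s p" using add[of p "- p"] z by (simp add: eq_neg_iff_add_eq_0 add.commute)
  show "poly_at s [:c:] = to_fract [:c:]" "poly_at s (pCons c p) = to_fract [:c:] + s * poly_at s p"
    by (simp_all add: poly_at_def map_poly_pCons)
  show "poly_at s 1 = 1" by (simp add: poly_at_def one_pCons[symmetric])
qed

lemma poly_at_coord: "poly_at coord p = to_fract p"
proof (induction p)
  case (pCons c p)
  have "to_fract (pCons c p) = to_fract ([:c:] + [:0, 1:] * p)" by simp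
  then show ?case using pCons by (simp only: poly_at_hom(6) to_fract_add to_fract_mult coord_def)
qed (simp add: poly_at_hom)

section \<open>Rational points of the special fibre\<close>

context dvr
begin

lemma lin_dec:
  assumes a: "a \<in> val_ring v" and p: "p \<in> integral_polys v"
  shows "\<exists>c\<in>integral_polys v. p = [:- a, 1:] * c + [:poly p a:]"
proof -
  have pa: "[:poly p a:] \<in> integral_polys v" using poly_integral[OF p a] by (rule integral_ring)
  have Qi: "[:- a, 1:] \<in> integral_polys v"
    using integral_ring(4)[OF integral_ring(8) integral_ring(5)[OF a]] by simp
  have "poly (p - [:poly p a:]) a = 0" by simp
  then obtain c where c: "p - [:poly p a:] = [:- a, 1:] * c" unfolding poly_eq_0_iff_dvd by (elim dvdE)
  have "c \<in> integral_polys v"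
    by (rule integral_divide_monic[OF Qi]) (use integral_ring(4)[OF p pa] c in auto)
  moreover have "p = [:- a, 1:] * c + [:poly p a:]" using c by (metis diff_add_cancel)
  ultimately show ?thesis by blast
qed

lemma lin_integral: "a \<in> val_ring v \<Longrightarrow> [:- a, 1:] \<in> integral_polys v"
  using integral_ring(4)[OF integral_ring(8) integral_ring(5)] by simp

text \<open>The point where t = a modulo the maximal ideal of V, as the kernel of evaluation at a
  followed by reduction.\<close>

lemma lin_maximal:
  assumes a: "a \<in> val_ring v"
  defines "M \<equiv> {to_fract p | p. p \<in> integral_polys v \<and> poly p a \<in> val_ideal v}"
  shows "special_pt v M" "to_fract [:- a, 1:] \<in> M"
proof -
  note rA = ring_setD[OF ring_A]
  have vi: "0 \<in> val_ideal v" "x \<in> val_ideal v \<Longrightarrow> y \<in> val_ideal v \<Longrightarrow> x + y \<in> val_ideal v"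
    "x \<in> val_ring v \<Longrightarrow> y \<in> val_ideal v \<Longrightarrow> x * y \<in> val_ideal v" "1 \<notin> val_ideal v" for x y
  proof -
    show "x \<in> val_ideal v \<Longrightarrow> y \<in> val_ideal v \<Longrightarrow> x + y \<in> val_ideal v"
      using v_add[of x y] by (cases "x = 0 \<or> y = 0 \<or> x + y = 0") (auto simp: val_ideal_def)
    show "x \<in> val_ring v \<Longrightarrow> y \<in> val_ideal v \<Longrightarrow> x * y \<in> val_ideal v"
      using v_mult[of x y] by (cases "x = 0 \<or> y = 0") (auto simp: val_ideal_def val_ring_def)
  qed (auto simp: val_ideal_def)
  have sub: "submodule_of A M"
    unfolding submodule_of_def
  proof (intro conjI ballI)
    show "0 \<in> M" unfolding M_def using integral_ring(7) vi(1) by (intro CollectI exI[of _ 0]) auto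
  next
    fix x y assume "x \<in> M" "y \<in> M"
    then obtain p q where "x = to_fract p" "y = to_fract q" "p \<in> integral_polys v" "q \<in> integral_polys v"
      "poly p a \<in> val_ideal v" "poly q a \<in> val_ideal v" unfolding M_def by blast
    then show "x + y \<in> M" unfolding M_def using integral_ring(1) vi(2)
      by (intro CollectI exI[of _ "p + q"]) auto
  next
    fix x y assume "x \<in> A" "y \<in> M"
    then obtain p q where "x = to_fract p" "y = to_fract q" "p \<in> integral_polys v" "q \<in> integral_polys v"
      "poly q a \<in> val_ideal v" unfolding M_def A_def by blast
    then show "x * y \<in> M" unfolding M_def using integral_ring(2) vi(3) poly_integral[OF _ a]
      by (intro CollectI exI[of _ "p * q"]) auto
  qed
  have one: "1 \<notin> M"
  proof
    assume "1 \<in> M"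
    then obtain p where "to_fract p = to_fract 1" "poly p a \<in> val_ideal v" unfolding M_def by auto
    then show False using vi(4) by (simp only: to_fract_eq_iff poly_1) 
  qed
  have MA: "M \<subseteq> A" by (auto simp: M_def A_def)
  show Q: "to_fract [:- a, 1:] \<in> M" unfolding M_def using lin_integral[OF a] vi(1) by auto
  have max: "J = M \<or> J = A" if J: "submodule_of A J" "M \<subseteq> J" "J \<subseteq> A" for J
  proof (cases "J \<subseteq> M")
    case False
    then obtain x where x: "x \<in> J" "x \<notin> M" by blast
    then obtain p where p: "x = to_fract p" "p \<in> integral_polys v" using J(3) by (auto simp: A_def)
    have u: "poly p a \<in> val_ring v" "poly p a \<notin> val_ideal v"
      using x p poly_integral[OF _ a] unfolding M_def by blast+
    obtain c where c: "c \<in> integral_polys v" "p = [:- a, 1:] * c + [:poly p a:]" using lin_dec[OF a p(2)] by blast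
    have "to_fract [:poly p a:] = x - to_fract c * to_fract [:- a, 1:]"
    proof -
      have "to_fract [:poly p a:] = to_fract (p - c * [:- a, 1:])"
        using c(2) by (metis add_diff_cancel_left' mult.commute)
      then show ?thesis using p(1) by (simp only: to_fract_diff to_fract_mult)
    qed
    also have "\<dots> \<in> J"
      by (rule submodule_diff[OF ring_A J(1) x(1)]) (use submoduleD(3)[OF J(1) A_I[OF c(1)]] Q J(2) in blast)
    finally have "to_fract [:poly p a:] \<in> J" .
    moreover have "to_fract [:inverse (poly p a):] \<in> A" using val_unit[OF u] by (intro A_I integral_ring) auto
    ultimately have "to_fract [:inverse (poly p a):] * to_fract [:poly p a:] \<in> J" using submoduleD(3)[OF J(1)] by blast
    then have "1 \<in> J" using val_unit[OF u] tf_const(1)[of "inverse (poly p a)" "poly p a"] tf_const(3) by simp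
    then have "x \<in> J" if "x \<in> A" for x using submoduleD(3)[OF J(1) that, of 1] by simp
    then show ?thesis using J(3) by auto
  qed (use J in auto)
  have "maximal_ideal_of A M"
    unfolding maximal_ideal_of_def using sub max one rA(1) MA by blast
  moreover have "(\<lambda>c. to_fract [:c:]) ` val_ideal v \<subseteq> M"
  proof
    fix x assume "x \<in> (\<lambda>c. to_fract [:c:]) ` val_ideal v"
    then obtain c where "x = to_fract [:c:]" "c \<in> val_ideal v" by blast
    then show "x \<in> M" unfolding M_def using integral_ring(5)[of c]
      by (intro CollectI exI[of _ "[:c:]"]) (auto simp: val_ideal_def val_ring_def)
  qed
  ultimately show "special_pt v M" using ring_A by unfold_locales auto
qed

end

context special_pt
begin

lemma lin_Mx:
  assumes a: "a \<in> val_ring v" "to_fract [:- a, 1:] \<in> Mx" and p: "p \<in> integral_polys v"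
  shows "to_fract p \<in> Mx \<longleftrightarrow> poly p a \<in> val_ideal v"
proof -
  note m = submoduleD[OF Mx_sub(1)]
  obtain c where c: "c \<in> integral_polys v" "p = [:- a, 1:] * c + [:poly p a:]" using lin_dec[OF a(1) p] by blast
  have ca: "to_fract c * to_fract [:- a, 1:] \<in> Mx" by (rule m(3)[OF A_I[OF c(1)] a(2)])
  have tp: "to_fract p = to_fract c * to_fract [:- a, 1:] + to_fract [:poly p a:]"
    using arg_cong[OF c(2), of to_fract] by (simp only: to_fract_add to_fract_mult mult.commute)
  show ?thesis
  proof
    assume "poly p a \<in> val_ideal v"
    then have "to_fract [:poly p a:] \<in> Mx" using pi_Mx by blast
    then show "to_fract p \<in> Mx" unfolding tp by (rule m(2)[OF ca])
  next
    assume pm: "to_fract p \<in> Mx"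
    have "to_fract [:poly p a:] = to_fract p - to_fract c * to_fract [:- a, 1:]" using tp by simp
    also have "\<dots> \<in> Mx" by (rule submodule_diff[OF ring_A Mx_sub(1) pm ca])
    finally show "poly p a \<in> val_ideal v" using const_unit_notin poly_integral[OF p a(1)] by blast
  qed
qed

lemma lin_Mx_eq:
  assumes a: "a \<in> val_ring v" "to_fract [:- a, 1:] \<in> Mx"
  shows "Mx = {to_fract p | p. p \<in> integral_polys v \<and> poly p a \<in> val_ideal v}"
proof -
  have "Mx \<subseteq> to_fract ` integral_polys v" using Mx_sub(2) by (auto simp: A_def)
  then show ?thesis using lin_Mx[OF a] by blast
qed

text \<open>A denominator s allowed at this point has a unit as value s(a). So modulo (t - a, \<pi>)
  every element of the local ring is congruent to a constant from V: the quotient is the residue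
  field of V.\<close>

lemma lin_len:
  assumes a: "a \<in> val_ring v" "to_fract [:- a, 1:] \<in> Mx" and pi: "\<pi> \<noteq> 0" "v \<pi> = 1"
  shows "len [:- a, 1:] [:\<pi>:] = 1" "residue_degree v Ox = 1"
proof -
  define Q where "Q = [:- a, 1:]"
  define I where "I = ideal2 Q [:\<pi>:]"
  have Qi: "Q \<in> integral_polys v" unfolding Q_def by (rule lin_integral[OF a(1)])
  have piV: "\<pi> \<in> val_ring v" "\<pi> \<in> val_ideal v" using pi by (auto simp: val_ring_def val_ideal_def)
  have pii: "[:\<pi>:] \<in> integral_polys v" by (rule integral_ring(5)[OF piV(1)])
  have subI: "submodule_of Ox I" unfolding I_def by (rule ideal2_submodule)
  have IO: "I \<subseteq> Ox" unfolding I_def by (rule ideal2_sub_Ox[OF Qi pii])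
  have ImO: "I \<subseteq> mO"
    unfolding I_def
  proof (rule ideal2_least[OF mO_submodule])
    show "to_fract Q \<in> mO" "to_fract [:\<pi>:] \<in> mO"
      using mO_A a(2) pi_Mx piV(2) unfolding Q_def by blast+
  qed
  have D1: "\<exists>r\<in>val_ring v. x - to_fract [:r:] \<in> I" if x: "x \<in> Ox" for x
  proof -
    obtain p s where ps: "x = to_fract p / to_fract s" "p \<in> integral_polys v" "s \<in> integral_polys v" "to_fract s \<notin> Mx"
    proof -
      obtain b s where bs: "x = b / s" "b \<in> A" "s \<in> A" "s \<notin> Mx" using x unfolding Ox_iff by blast
      moreover obtain p q where "b = to_fract p" "p \<in> integral_polys v" "s = to_fract q" "q \<in> integral_polys v"
        using bs unfolding A_def by blast
      ultimately show thesis by (intro that[of p q]) simp_all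
    qed
    have sa: "poly s a \<in> val_ring v" "poly s a \<notin> val_ideal v"
      using lin_Mx[OF a ps(3)] ps(4) poly_integral[OF ps(3) a(1)] by auto
    note su = val_unit[OF sa]
    define r where "r = poly p a * inverse (poly s a)"
    have r: "r \<in> val_ring v" unfolding r_def using ring_setD(4)[OF ring_V] poly_integral[OF ps(2) a(1)] su by blast
    have q: "p - smult r s \<in> integral_polys v" using ps r by (intro integral_ring)
    have "poly (p - smult r s) a = 0" using su by (simp add: r_def)
    then obtain c where c: "c \<in> integral_polys v" "p - smult r s = Q * c"
      using lin_dec[OF a(1) q] unfolding Q_def by auto
    have snz: "to_fract s \<noteq> 0" using ps(4) zero_Mx by metis
    have "x - to_fract [:r:] = to_fract (p - smult r s) / to_fract s"
    proof -
      have "to_fract (smult r s) = to_fract [:r:] * to_fract s" by (simp flip: to_fract_mult)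
      then show ?thesis unfolding ps(1) to_fract_diff using snz by (simp add: diff_divide_distrib)
    qed
    also have "\<dots> = to_fract Q * (to_fract c / to_fract s) + to_fract [:\<pi>:] * 0" unfolding c(2) by simp
    also have "\<dots> \<in> I" unfolding I_def
      by (rule mem_ideal2I[OF Ox_I[OF A_I[OF c(1)] A_I[OF ps(3)] ps(4)] rO(2)])
    finally show ?thesis using r by blast
  qed
  have piI: "to_fract [:r:] \<in> I" if r: "r \<in> val_ideal v" for r
  proof -
    obtain d where d: "d \<in> val_ring v" "r = \<pi> * d" using val_ideal_div[OF pi r] by blast
    have "to_fract [:d:] * to_fract [:\<pi>:] \<in> I" unfolding I_def
      by (rule submoduleD(3)[OF ideal2_submodule tf_Ox[OF integral_ring(5)[OF d(1)]] ideal2_gens(2)])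
    then show ?thesis using d tf_const(1)[of d \<pi>] by (simp add: mult.commute)
  qed
  have one: "1 \<notin> I" using ImO rO(1) by (auto simp: mO_def)
  have max: "N = Ox" if N: "submodule_of Vc N" "I \<subset> N" "N \<subseteq> Ox" for N
  proof -
    obtain z where z: "z \<in> N" "z \<notin> I" using N(2) by blast
    obtain r where r: "r \<in> val_ring v" "z - to_fract [:r:] \<in> I" using D1 z N(3) by blast
    have "r \<notin> val_ideal v"
    proof
      assume "r \<in> val_ideal v"
      then have "(z - to_fract [:r:]) + to_fract [:r:] \<in> I" using submoduleD(2)[OF subI r(2)] piI by blast
      then show False using z by simp
    qed
    note ru = val_unit[OF r(1) this]
    have "to_fract [:r:] = z - (z - to_fract [:r:])" by simp
    also have "\<dots> \<in> N" by (rule submodule_diff[OF ring_Vc N(1) z(1)]) (use r N(2) in blast)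
    finally have "to_fract [:inverse r:] * to_fract [:r:] \<in> N" using submoduleD(3)[OF N(1)] Vc_I ru by blast
    then have oneN: "1 \<in> N" using ru tf_const(1)[of "inverse r" r] tf_const(3) by simp
    have "x \<in> N" if x: "x \<in> Ox" for x
    proof -
      obtain s where s: "s \<in> val_ring v" "x - to_fract [:s:] \<in> I" using D1[OF x] by blast
      have "to_fract [:s:] * 1 \<in> N" using submoduleD(3)[OF N(1) Vc_I[OF s(1)] oneN] .
      then have "(x - to_fract [:s:]) + to_fract [:s:] * 1 \<in> N" using submoduleD(2)[OF N(1)] s(2) N(2) by blast
      then show ?thesis by simp
    qed
    then show ?thesis using N(3) by auto
  qed
  have IsO: "I \<subset> Ox" using IO one rO(1) by auto
  have "len Q [:\<pi>:] \<le> 1"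
    unfolding len_def I_def[symmetric]
    by (rule quotient_length_le_one) (use max submodule_restrict[OF _ Vc_Ox] in blast)
  moreover have "1 \<le> len Q [:\<pi>:]"
    unfolding len_def I_def[symmetric]
    using has_chain_le[OF has_chain_one[OF subI submodule_self[OF ring_Ox] IsO]] by (simp add: one_enat_def)
  ultimately show "len [:- a, 1:] [:\<pi>:] = 1" unfolding Q_def by (rule antisym)
  have "mO = I"
  proof
    show "mO \<subseteq> I"
    proof
      fix x assume x: "x \<in> mO"
      then have xO: "x \<in> Ox" by (simp add: mO_def)
      obtain r where r: "r \<in> val_ring v" "x - to_fract [:r:] \<in> I" using D1[OF xO] by blast
      have "to_fract [:r:] = x - (x - to_fract [:r:])" by simp
      also have "\<dots> \<in> mO" by (rule submodule_diff[OF ring_Ox mO_submodule x]) (use r ImO in blast)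
      finally have "to_fract [:r:] \<in> mO" .
      then have "to_fract [:r:] \<in> Mx" using mO_A A_I[OF integral_ring(5)[OF r(1)]] by blast
      then have "r \<in> val_ideal v" using const_unit_notin[OF r(1)] by blast
      then have "(x - to_fract [:r:]) + to_fract [:r:] \<in> I" using submoduleD(2)[OF subI r(2)] piI by blast
      then show "x \<in> I" by simp
    qed
  qed (rule ImO)
  then have rd: "residue_degree v Ox = quotient_length Vc Ox I" unfolding residue_degree_eq by simp
  have "residue_degree v Ox \<le> 1" unfolding rd by (rule quotient_length_le_one) (use max in blast)
  moreover have "1 \<le> residue_degree v Ox" unfolding rd
    using has_chain_le[OF has_chain_one[OF submodule_restrict[OF subI Vc_Ox] submodule_restrict[OF submodule_self[OF ring_Ox] Vc_Ox] IsO]]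
    by (simp add: one_enat_def)
  ultimately show "residue_degree v Ox = 1" by (rule antisym)
qed

lemma coord_Ox: "coord \<in> Ox"
  unfolding coord_def by (rule tf_Ox[OF integral_ring(8)])

lemma Ox_special: "Ox \<in> special_points v"
proof -
  have "poly_at coord ` integral_polys v = A" by (simp add: poly_at_coord A_def)
  then have "A \<in> charts v" by (auto simp: charts_def)
  then show ?thesis unfolding special_points_def Ox_def using mx pi_Mx by blast
qed

text \<open>The link between intersection numbers and the lengths \<open>len\<close>: both
  subschemes are principal in the first chart.\<close>

lemma generated_ideal2:
  assumes D: "fst Z = (\<lambda>q. Q * q) ` integral_polys v" and H: "fst Y = (\<lambda>q. g * q) ` integral_polys v"
  shows "local_intersection Z Y Ox = len Q g"
proof -
  have gen_sub: "generated_module Ox S \<subseteq> N" if "submodule_of Ox N" "S \<subseteq> N" for S N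
    unfolding generated_module_def using that by blast
  have gen_sup: "S \<subseteq> generated_module Ox S" for S unfolding generated_module_def by blast
  have st: "stalk_ideal Z Ox = generated_module Ox (to_fract ` (\<lambda>q. Q * q) ` integral_polys v)"
    "stalk_ideal Y Ox = generated_module Ox (to_fract ` (\<lambda>q. g * q) ` integral_polys v)"
    unfolding stalk_ideal_def using coord_Ox D H by (simp_all add: poly_at_coord)
  have "generated_module Ox (stalk_ideal Z Ox \<union> stalk_ideal Y Ox) = ideal2 Q g"
  proof
    have "to_fract (r * q) \<in> ideal2 Q g" if "q \<in> integral_polys v" "to_fract r \<in> ideal2 Q g" for q r
      using submoduleD(3)[OF ideal2_submodule tf_Ox[OF that(1)] that(2)] by (simp add: mult.commute)
    then have "to_fract ` (\<lambda>q. Q * q) ` integral_polys v \<subseteq> ideal2 Q g" "to_fract ` (\<lambda>q. g * q) ` integral_polys v \<subseteq> ideal2 Q g"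
      using ideal2_gens by blast+
    then show "generated_module Ox (stalk_ideal Z Ox \<union> stalk_ideal Y Ox) \<subseteq> ideal2 Q g"
      unfolding st by (intro gen_sub ideal2_submodule Un_least)
    show "ideal2 Q g \<subseteq> generated_module Ox (stalk_ideal Z Ox \<union> stalk_ideal Y Ox)"
    proof -
      have "Q * 1 \<in> (\<lambda>q. Q * q) ` integral_polys v" "g * 1 \<in> (\<lambda>q. g * q) ` integral_polys v"
        using integral_ring(6) by blast+
      then have "to_fract Q \<in> stalk_ideal Z Ox" "to_fract g \<in> stalk_ideal Y Ox"
        unfolding st using gen_sup by fastforce+
      then show ?thesis unfolding generated_module_def using ideal2_least by blast
    qed
  qed
  then show ?thesis by (simp add: local_intersection_def len_def)
qed

end

text \<open>A unit u of the local ring in the ideal of Z makes the sum of the two ideals the whole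
  ring.\<close>

lemma local_intersection_zero:
  assumes R: "ring_set R" and gen: "(if coord \<in> R then poly_at coord ` fst Z else poly_at (inverse coord) ` snd Z) \<subseteq> R"
    "(if coord \<in> R then poly_at coord ` fst Y else poly_at (inverse coord) ` snd Y) \<subseteq> R"
    and u: "u \<in> (if coord \<in> R then poly_at coord ` fst Z else poly_at (inverse coord) ` snd Z)" "u \<noteq> 0" "inverse u \<in> R"
  shows "local_intersection Z Y R = 0"
proof -
  have gen_sub: "generated_module R S \<subseteq> R" if "S \<subseteq> R" for S
    unfolding generated_module_def using that submodule_self[OF R] by blast
  have s: "stalk_ideal Z R \<subseteq> R" "stalk_ideal Y R \<subseteq> R" unfolding stalk_ideal_def by (intro gen_sub gen)+
  have "u \<in> stalk_ideal Z R" unfolding stalk_ideal_def generated_module_def using u(1) by blast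
  then have "u \<in> N" if "submodule_of R N" "stalk_ideal Z R \<union> stalk_ideal Y R \<subseteq> N" for N using that by blast
  then have "inverse u * u \<in> N" if "submodule_of R N" "stalk_ideal Z R \<union> stalk_ideal Y R \<subseteq> N" for N
    using submoduleD(3)[OF that(1) u(3)] that by blast
  then have "x * 1 \<in> N" if "submodule_of R N" "stalk_ideal Z R \<union> stalk_ideal Y R \<subseteq> N" "x \<in> R" for N x
    using submoduleD(3)[OF that(1,3), of 1] that u(2) by fastforce
  then have "R \<subseteq> generated_module R (stalk_ideal Z R \<union> stalk_ideal Y R)" unfolding generated_module_def by fastforce
  then have "generated_module R (stalk_ideal Z R \<union> stalk_ideal Y R) = R" using gen_sub s by (simp add: subset_antisym)
  then show ?thesis unfolding local_intersection_def using quotient_length_refl[OF submodule_self[OF R] R] by simp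
qed

section \<open>Points of the second chart and the sum over the special fibre\<close>

context dvr
begin

lemma integral_pCons: "pCons c p \<in> integral_polys v \<longleftrightarrow> c \<in> val_ring v \<and> p \<in> integral_polys v"
proof
  assume a: "pCons c p \<in> integral_polys v"
  have "coeff (pCons c p) 0 \<in> val_ring v" "coeff (pCons c p) (Suc i) \<in> val_ring v" for i
    using a unfolding integral_polys_def by blast+
  then show "c \<in> val_ring v \<and> p \<in> integral_polys v" by (simp add: integral_polys_def)
qed (auto simp: integral_polys_def coeff_pCons split: nat.split)

lemma coord_nz: "coord \<noteq> (0 :: 'k poly fract)"
  unfolding coord_def by simp

lemma poly_at_mem:
  assumes "ring_set R" "Vc \<subseteq> R" "s \<in> R" "p \<in> integral_polys v"
  shows "poly_at s p \<in> R"
  using assms(4)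
proof (induction p)
  case 0
  then show ?case using ring_setD(2)[OF assms(1)] by (simp add: poly_at_hom)
next
  case (pCons c p)
  then have "c \<in> val_ring v" "poly_at s p \<in> R" by (auto simp: integral_pCons)
  then show ?case using ring_setD(3,4)[OF assms(1)] assms(2,3) Vc_I unfolding poly_at_hom(6) by blast
qed

lemma ring_poly_at: "ring_set (poly_at s ` integral_polys v)"
  unfolding ring_set_def
proof (intro conjI ballI)
  show "1 \<in> poly_at s ` integral_polys v"
    by (rule image_eqI[of _ _ 1]) (simp_all add: integral_ring poly_at_hom)
  show "-1 \<in> poly_at s ` integral_polys v"
    by (rule image_eqI[of _ _ "-1"]) (simp_all add: integral_ring poly_at_hom)
  fix a b assume "a \<in> poly_at s ` integral_polys v" "b \<in> poly_at s ` integral_polys v"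
  then obtain p q where "a = poly_at s p" "b = poly_at s q" "p \<in> integral_polys v" "q \<in> integral_polys v" by blast
  then have "a + b = poly_at s (p + q)" "a * b = poly_at s (p * q)" "p + q \<in> integral_polys v" "p * q \<in> integral_polys v"
    by (simp_all add: integral_ring poly_at_hom)
  then show "a + b \<in> poly_at s ` integral_polys v" "a * b \<in> poly_at s ` integral_polys v" by blast+
qed

lemma poly_at_var: "s \<in> poly_at s ` integral_polys v"
proof (rule image_eqI)
  show "s = poly_at s [:0, 1:]" by (simp add: poly_at_hom flip: one_pCons)
qed (rule integral_ring(8))

lemma clear_denominator:
  assumes "p \<in> integral_polys v"
  shows "\<exists>N0. \<forall>N\<ge>N0. coord ^ N * poly_at (inverse coord) p \<in> A"
  using assms
proof (induction p)
  case 0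
  then show ?case using ring_setD(2)[OF ring_A] by (simp add: poly_at_hom)
next
  case (pCons c p)
  then obtain N0 where N0: "\<And>N. N \<ge> N0 \<Longrightarrow> coord ^ N * poly_at (inverse coord) p \<in> A" by (auto simp: integral_pCons)
  have cA: "coord \<in> A" unfolding coord_def by (rule A_I[OF integral_ring(8)])
  have c: "to_fract [:c:] \<in> A" using pCons.prems by (intro A_I integral_ring) (simp add: integral_pCons)
  have "coord ^ N * poly_at (inverse coord) (pCons c p) \<in> A" if N: "N \<ge> Suc N0" for N
  proof -
    obtain N' where N': "N = Suc N'" "N' \<ge> N0" using N by (cases N) auto
    have "coord ^ N * poly_at (inverse coord) (pCons c p)
        = coord ^ N * to_fract [:c:] + coord ^ N' * poly_at (inverse coord) p"
      unfolding poly_at_hom(6) N'(1) using coord_nz by (simp add: field_simps)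
    also have "\<dots> \<in> A"
      by (rule ring_setD(3)[OF ring_A ring_setD(4)[OF ring_A ring_setD(7)[OF ring_A cA] c] N0[OF N'(2)]])
    finally show ?thesis .
  qed
  then show ?case by blast
qed

text \<open>
  A point of the second chart on the zero scheme of a monic polynomial lies in the first chart: modulo the
  maximal ideal, \<open>1/t\<close> is a polynomial in \<open>t\<close>.
\<close>
lemma second_chart:
  fixes a2 a4 a6 :: 'k
  defines "P \<equiv> [:a6, a4, a2, 1:]" and "s \<equiv> inverse coord"
  assumes cV: "a2 \<in> val_ring v" "a4 \<in> val_ring v" "a6 \<in> val_ring v"
    and M: "maximal_ideal_of (poly_at s ` integral_polys v) M" "(\<lambda>c. to_fract [:c:]) ` val_ideal v \<subseteq> M"
  defines "R \<equiv> localization (poly_at s ` integral_polys v) M"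
  assumes tR: "coord \<in> R" and PR: "inverse (to_fract P) \<notin> R"
  shows "\<exists>Mx. special_pt v Mx \<and> R = localization A Mx"
proof -
  define A2 where "A2 = poly_at s ` integral_polys v"
  interpret l: loc_ring A2 M
    using M(1) ring_poly_at by unfold_locales (auto simp: A2_def)
  have RO: "R = l.Ox" by (simp only: R_def A2_def[symmetric] l.Ox_def)
  note rR = l.rO
  note m = submoduleD[OF l.mO_submodule]
  have VA2: "Vc \<subseteq> A2"
  proof
    fix x assume "x \<in> Vc"
    then obtain c where c: "c \<in> val_ring v" "x = to_fract [:c:]" by (auto simp: Vc_def)
    then show "x \<in> A2" unfolding A2_def by (intro image_eqI[of _ _ "[:c:]"]) (simp_all add: poly_at_hom integral_ring)
  qed
  have VO: "Vc \<subseteq> l.Ox" using VA2 l.A_Ox by auto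
  have sA2: "s \<in> A2" unfolding A2_def by (rule poly_at_var)
  have sO: "s \<in> l.Ox" using sA2 l.A_Ox by auto
  have tO: "coord \<in> l.Ox" using tR RO by simp
  have st: "s * coord = 1" unfolding s_def using coord_nz by simp
  have AO: "A \<subseteq> l.Ox"
  proof
    fix x assume "x \<in> A"
    then obtain p where "x = poly_at coord p" "p \<in> integral_polys v" by (auto simp: A_def poly_at_coord)
    then show "x \<in> l.Ox" using poly_at_mem[OF l.ring_Ox VO tO] by blast
  qed
  have viO: "to_fract [:c:] * x \<in> l.mO" if "c \<in> val_ideal v" "x \<in> l.Ox" for c x
  proof -
    have "to_fract [:c:] \<in> l.mO" using M(2) that(1) l.mO_A by blast
    from m(3)[OF that(2) this] show ?thesis by (simp add: mult.commute)
  qed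
  have Pi: "P \<in> integral_polys v" unfolding P_def using cV ring_setD(1)[OF ring_V] by (simp add: integral_pCons integral_ring)
  have Pm: "to_fract P \<in> l.mO" using AO A_I[OF Pi] PR RO by (auto simp: l.mO_def)
  define t where "t = (coord :: 'k poly fract)"
  have Peq: "to_fract P = to_fract [:a6:] + t * (to_fract [:a4:] + t * (to_fract [:a2:] + t))"
  proof -
    have "poly_at coord P = to_fract [:a6:] + t * (to_fract [:a4:] + t * (to_fract [:a2:] + t))"
      unfolding P_def t_def by (simp add: poly_at_hom flip: one_pCons)
    then show ?thesis by (simp only: poly_at_coord)
  qed
  have cA: "to_fract [:c:] \<in> A" if "c \<in> val_ring v" for c using that Vc_I Vc_A by blast
  have tA: "t \<in> A" unfolding t_def coord_def by (rule A_I[OF integral_ring(8)])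
  have unit: "\<exists>a\<in>A. s - a \<in> l.mO" if c: "c \<in> val_ring v" "c \<notin> val_ideal v" and g: "g \<in> A" "to_fract [:c:] * s + g \<in> l.mO" for c g
  proof -
    have i: "inverse c \<in> val_ring v" "c \<noteq> 0" using val_unit[OF c] by auto
    have e: "to_fract [:inverse c:] * to_fract [:c:] = 1" using i tf_const(1)[of "inverse c" c] tf_const(3) by simp
    have "to_fract [:inverse c:] * (to_fract [:c:] * s + g) \<in> l.mO"
      by (rule m(3)[OF _ g(2)]) (use Vc_I[OF i(1)] VO in blast)
    also have "to_fract [:inverse c:] * (to_fract [:c:] * s + g) = s - (- (to_fract [:inverse c:] * g))"
      using e by (simp add: distrib_left mult.assoc[symmetric])
    finally show ?thesis using ring_setD(4,5)[OF ring_A] cA[OF i(1)] g(1) by blast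
  qed
  note rA = ring_setD[OF ring_A]
  \<comment> \<open>Multiplying P by s = 1/t gives a6 s + g1 in the maximal ideal. If a6 is not a
    unit, then g1 lies there, and multiplying by s again gives a4 s + g2, then likewise a2 s + 1.
    The first unit among a6, a4, a2 allows solving for s; if there is none, 1 would be in the
    maximal ideal.\<close>
  have s_red: "\<exists>a\<in>A. s - a \<in> l.mO"
  proof -
    have step: "g \<in> l.mO" if "to_fract [:c:] * s + g \<in> l.mO" "c \<in> val_ideal v" for c g
      using submodule_diff[OF l.ring_Ox l.mO_submodule that(1) viO[OF that(2) sO]] by simp
    define g1 where "g1 = to_fract [:a4:] + t * (to_fract [:a2:] + t)"
    define g2 where "g2 = to_fract [:a2:] + t"
    have gA: "g1 \<in> A" "g2 \<in> A" unfolding g1_def g2_def by (intro rA(3,4) cA cV tA)+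
    have stx: "s * (c + t * x) = c * s + x" for c x using st by (simp add: t_def algebra_simps)
    have "s * to_fract P \<in> l.mO" by (rule m(3)[OF sO Pm])
    moreover have "s * to_fract P = to_fract [:a6:] * s + g1" unfolding Peq g1_def by (rule stx)
    ultimately have 1: "to_fract [:a6:] * s + g1 \<in> l.mO" by simp
    have 2: "to_fract [:a4:] * s + g2 \<in> l.mO" if "a6 \<in> val_ideal v"
    proof -
      have "s * g1 \<in> l.mO" by (rule m(3)[OF sO step[OF 1 that]])
      moreover have "s * g1 = to_fract [:a4:] * s + g2" unfolding g1_def g2_def by (rule stx)
      ultimately show ?thesis by simp
    qed
    have 3: "to_fract [:a2:] * s + 1 \<in> l.mO" if "a6 \<in> val_ideal v" "a4 \<in> val_ideal v"
    proof -
      have "s * g2 \<in> l.mO" by (rule m(3)[OF sO step[OF 2[OF that(1)] that(2)]])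
      moreover have "s * g2 = to_fract [:a2:] * s + 1" unfolding g2_def using stx[of _ 1] by simp
      ultimately show ?thesis by simp
    qed
    have 4: False if "a6 \<in> val_ideal v" "a4 \<in> val_ideal v" "a2 \<in> val_ideal v"
      using step[OF 3[OF that(1,2)] that(3)] rR(1) by (auto simp: l.mO_def)
    show ?thesis using unit[OF cV(3) _ gA(1) 1] unit[OF cV(2) _ gA(2) 2] unit[OF cV(1) _ rA(1) 3] 4 by blast
  qed
  have A2_red: "\<exists>a\<in>A. poly_at s p - a \<in> l.mO" if "p \<in> integral_polys v" for p
    using that
  proof (induction p)
    case 0
    then show ?case using rA(2) m(1) by (intro bexI[of _ 0]) (simp_all add: poly_at_hom)
  next
    case (pCons c p)
    then obtain a where a: "a \<in> A" "poly_at s p - a \<in> l.mO" by (auto simp: integral_pCons)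
    obtain b where b: "b \<in> A" "s - b \<in> l.mO" using s_red by blast
    have "s * (poly_at s p - a) + a * (s - b) \<in> l.mO" by (intro m(2) m(3)[OF sO a(2)] m(3)[OF _ b(2)]) (use a(1) AO in blast)
    moreover have "s * (poly_at s p - a) + a * (s - b) = poly_at s (pCons c p) - (to_fract [:c:] + a * b)"
      unfolding poly_at_hom(6) by (simp add: algebra_simps)
    ultimately have "poly_at s (pCons c p) - (to_fract [:c:] + a * b) \<in> l.mO" by simp
    moreover have "to_fract [:c:] + a * b \<in> A" using pCons.prems by (intro rA(3,4) cA a b) (simp add: integral_pCons)
    ultimately show ?case by blast
  qed
  \<comment> \<open>From 1 = b r + n with n in \<open>M\<close> it follows that a / b is congruent
    to a r, an element of the chart ring.\<close>
  have O_red: "\<exists>a\<in>A. x - a \<in> l.mO" if xO: "x \<in> l.Ox" for x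
  proof -
    obtain a b where ab: "x = a / b" "a \<in> A2" "b \<in> A2" "b \<notin> M" using xO unfolding l.Ox_iff by blast
    have bnz: "b \<noteq> 0" using ab l.zero_Mx by auto
    obtain r n where rm: "r \<in> A2" "n \<in> M" "1 = b * r + n" using l.comax[OF ab(3,4)] by blast
    have "a * r \<in> A2" using ring_setD(4)[OF l.rA0] ab rm by blast
    then obtain p where p: "a * r = poly_at s p" "p \<in> integral_polys v" unfolding A2_def by blast
    obtain a' where a': "a' \<in> A" "a * r - a' \<in> l.mO" using A2_red[OF p(2)] unfolding p(1) by blast
    have "x * n \<in> l.mO" using m(3)[OF xO, of n] rm(2) l.mO_A by blast
    then have "x * n + (a * r - a') \<in> l.mO" using m(2) a'(2) by blast
    moreover have "x * n + a * r = x"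
    proof -
      have "x * n + a * r = x * (b * r + n)" using ab(1) bnz by (simp add: field_simps)
      then show ?thesis using rm(3) by simp
    qed
    ultimately have "x - a' \<in> l.mO" by (metis add_diff_eq)
    then show ?thesis using a'(1) by blast
  qed
  define Mx where "Mx = l.mO \<inter> A"
  have sub: "submodule_of A Mx" using l.mO_submodule submodule_self[OF ring_A] AO unfolding submodule_of_def Mx_def by blast
  have one: "1 \<notin> Mx" using rR(1) by (simp add: Mx_def l.mO_def)
  have max: "J = Mx \<or> J = A" if J: "submodule_of A J" "Mx \<subseteq> J" "J \<subseteq> A" for J
  proof (cases "J \<subseteq> Mx")
    case False
    then obtain x where x: "x \<in> J" "x \<notin> l.mO" "x \<in> A" using J(3) unfolding Mx_def by blast
    then have xi: "x \<in> l.Ox" "x \<noteq> 0" "inverse x \<in> l.Ox" using AO by (auto simp: l.mO_def)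
    obtain a where a: "a \<in> A" "inverse x - a \<in> l.mO" using O_red[OF xi(3)] by blast
    have "x * (inverse x - a) \<in> l.mO" by (rule m(3)[OF xi(1) a(2)])
    moreover have e: "x * (inverse x - a) = 1 - a * x" using xi(2) by (simp add: algebra_simps)
    ultimately have "1 - a * x \<in> Mx" unfolding Mx_def using rA(6)[OF rA(1) rA(4)[OF a(1) x(3)]] by simp
    moreover have "a * x \<in> J" by (rule submoduleD(3)[OF J(1) a(1) x(1)])
    ultimately have "(1 - a * x) + a * x \<in> J" using submoduleD(2)[OF J(1)] J(2) by blast
    then have "1 \<in> J" by simp
    then have "x \<in> J" if "x \<in> A" for x using submoduleD(3)[OF J(1) that, of 1] by simp
    then show ?thesis using J(3) by auto
  qed (use J in auto)
  have "maximal_ideal_of A Mx" unfolding maximal_ideal_of_def using sub max one rA(1) by (auto simp: Mx_def)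
  moreover have "(\<lambda>c. to_fract [:c:]) ` val_ideal v \<subseteq> Mx"
  proof -
    have "(\<lambda>c. to_fract [:c:]) ` val_ideal v \<subseteq> A" using cA by (auto simp: val_ideal_def val_ring_def)
    then show ?thesis using M(2) l.mO_A by (auto simp: Mx_def)
  qed
  ultimately have "special_pt v Mx" using ring_A by unfold_locales auto
  moreover have "l.Ox = localization A Mx"
  proof
    show "localization A Mx \<subseteq> l.Ox"
    proof
      fix x assume "x \<in> localization A Mx"
      then obtain a b where ab: "x = a / b" "a \<in> A" "b \<in> A" "b \<notin> l.mO" unfolding localization_def Mx_def by blast
      then have "inverse b \<in> l.Ox" using AO by (auto simp: l.mO_def)
      then show "x \<in> l.Ox" unfolding ab(1) divide_inverse using rR(4) ab(2) AO by blast
    qed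
    \<comment> \<open>Numerator and denominator become polynomials in t after multiplication by a
      high power of t, which is a unit of the local ring as s is its inverse.\<close>
    show "l.Ox \<subseteq> localization A Mx"
    proof
      fix x assume "x \<in> l.Ox"
      then obtain a b where ab: "x = a / b" "a \<in> A2" "b \<in> A2" "b \<notin> M" unfolding l.Ox_iff by blast
      obtain p q where pq: "a = poly_at s p" "p \<in> integral_polys v" "b = poly_at s q" "q \<in> integral_polys v"
        using ab unfolding A2_def by blast
      obtain N1 where N1: "\<And>N. N \<ge> N1 \<Longrightarrow> coord ^ N * a \<in> A" using clear_denominator[OF pq(2)] pq(1) s_def by blast
      obtain N2 where N2: "\<And>N. N \<ge> N2 \<Longrightarrow> coord ^ N * b \<in> A" using clear_denominator[OF pq(4)] pq(3) s_def by blast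
      define c where "c = (coord :: 'k poly fract) ^ (max N1 N2)"
      have cA': "c * a \<in> A" "c * b \<in> A" using N1 N2 by (auto simp: c_def)
      have cnz: "c \<noteq> 0" using coord_nz by (simp add: c_def)
      have bnz: "b \<noteq> 0" using ab l.zero_Mx by auto
      have "inverse (c * b) = s ^ (max N1 N2) * (1 / b)" by (simp add: c_def s_def field_simps)
      also have "\<dots> \<in> l.Ox" by (rule rR(4)[OF rR(7)[OF sO] l.unit_Ox[OF ab(3,4)]])
      finally have "c * b \<notin> l.mO" using cnz bnz by (auto simp: l.mO_def)
      moreover have "x = (c * a) / (c * b)" using ab cnz by simp
      ultimately show "x \<in> localization A Mx" unfolding localization_def Mx_def using cA' by blast
    qed
  qed
  ultimately show ?thesis using RO by blast
qed

text \<open>If t is not in the local ring, then s = 1/t is in the maximal ideal, and the reversed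
  polynomial 1 + a2 s + a4 s^2 + a6 s^3 is a unit, so the local intersection is zero. It is also
  zero where P is a unit. All remaining points belong to the first chart.\<close>

lemma special_cases:
  fixes a2 a4 a6 :: 'k
  defines "P \<equiv> [:a6, a4, a2, 1:]"
  assumes cV: "a2 \<in> val_ring v" "a4 \<in> val_ring v" "a6 \<in> val_ring v"
    and R: "R \<in> special_points v" and H: "fst H \<subseteq> integral_polys v" "snd H \<subseteq> integral_polys v"
    and nz: "local_intersection (zero_scheme v P) H R \<noteq> 0"
  shows "\<exists>Mx. special_pt v Mx \<and> to_fract P \<in> Mx \<and> R = loc_ring.Ox A Mx"
proof -
  let ?s = "inverse coord :: 'k poly fract"
  note rV = ring_setD[OF ring_V]
  have Pi: "P \<in> integral_polys v" unfolding P_def using cV rV(1) by (simp add: integral_pCons integral_ring)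
  have rP: "reflect_poly P = [:1, a2, a4, a6:]" unfolding P_def reflect_poly_def by simp
  have rPi: "reflect_poly P \<in> integral_polys v" unfolding rP using cV rV(1) by (simp add: integral_pCons integral_ring)
  have Z: "fst (zero_scheme v P) \<subseteq> integral_polys v" "snd (zero_scheme v P) \<subseteq> integral_polys v"
    "P \<in> fst (zero_scheme v P)" "reflect_poly P \<in> snd (zero_scheme v P)"
  proof -
    show "fst (zero_scheme v P) \<subseteq> integral_polys v" "snd (zero_scheme v P) \<subseteq> integral_polys v"
      using integral_ring(2) Pi rPi by (auto simp: zero_scheme_def)
    show "P \<in> fst (zero_scheme v P)" unfolding zero_scheme_def fst_conv by (rule image_eqI[of _ _ 1]) (simp_all add: integral_ring)
    show "reflect_poly P \<in> snd (zero_scheme v P)" unfolding zero_scheme_def snd_conv by (rule image_eqI[of _ _ 1]) (simp_all add: integral_ring)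
  qed
  obtain A' M where AM: "R = localization A' M" "A' \<in> charts v" "maximal_ideal_of A' M" "(\<lambda>c. to_fract [:c:]) ` val_ideal v \<subseteq> M"
    using R unfolding special_points_def by blast
  have A'r: "ring_set A'" using AM(2) ring_poly_at by (auto simp: charts_def)
  interpret l: loc_ring A' M using A'r AM(3) by unfold_locales
  have RO: "R = l.Ox" by (simp add: AM(1) l.Ox_def)
  have VA': "Vc \<subseteq> A'"
  proof
    fix x assume "x \<in> Vc"
    then obtain c where c: "c \<in> val_ring v" "x = to_fract [:c:]" by (auto simp: Vc_def)
    then have "x \<in> poly_at s ` integral_polys v" for s by (intro image_eqI[of _ _ "[:c:]"]) (simp_all add: poly_at_hom integral_ring)
    then show "x \<in> A'" using AM(2) by (auto simp: charts_def)
  qed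
  have rR: "ring_set R" "Vc \<subseteq> R" using l.ring_Ox VA' l.A_Ox RO by auto
  have cA: "poly_at coord ` integral_polys v = A" by (simp add: poly_at_coord A_def)
  have tR: "coord \<in> R"
  proof (rule ccontr)
    assume n: "coord \<notin> R"
    have "coord \<in> A" unfolding coord_def by (rule A_I[OF integral_ring(8)])
    then have A': "A' = poly_at ?s ` integral_polys v" using AM(2) cA n RO l.A_Ox by (auto simp: charts_def)
    have sA: "?s \<in> A'" unfolding A' by (rule poly_at_var)
    have "1 / ?s = coord" by (simp add: divide_inverse)
    then have sM: "?s \<in> M" using l.unit_Ox[OF sA] n RO by (metis (full_types))
    define u where "u = poly_at ?s (reflect_poly P)"
    define w where "w = poly_at ?s [:a2, a4, a6:]"
    have wA: "w \<in> A'" "u \<in> A'" unfolding A' w_def u_def using cV rPi by (auto simp: integral_pCons integral_ring)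
    have uw: "u = 1 + w * ?s" unfolding u_def rP w_def by (subst poly_at_hom(6)) (simp add: mult.commute flip: one_pCons)
    have uM: "u \<notin> M"
    proof
      assume "u \<in> M"
      then have "u - w * ?s \<in> M" using submodule_diff[OF A'r l.Mx_sub(1)] submoduleD(3)[OF l.Mx_sub(1) wA(1) sM] by blast
      then show False using l.one_notin uw by simp
    qed
    have "local_intersection (zero_scheme v P) H R = 0"
    proof (rule local_intersection_zero[OF rR(1), of _ _ u])
      have "poly_at ?s ` S \<subseteq> R" if "S \<subseteq> integral_polys v" for S using that l.A_Ox RO unfolding A' by blast
      then show "(if coord \<in> R then poly_at coord ` fst (zero_scheme v P) else poly_at ?s ` snd (zero_scheme v P)) \<subseteq> R"
        "(if coord \<in> R then poly_at coord ` fst H else poly_at ?s ` snd H) \<subseteq> R" using n Z H by simp_all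
      show "u \<in> (if coord \<in> R then poly_at coord ` fst (zero_scheme v P) else poly_at ?s ` snd (zero_scheme v P))"
        using n Z(4) by (simp add: u_def)
      show "u \<noteq> 0" using uM l.zero_Mx by metis
      show "inverse u \<in> R" using l.unit_Ox[OF wA(2) uM] RO by (simp add: inverse_eq_divide)
    qed
    then show False using nz by simp
  qed
  have PR: "inverse (to_fract P) \<notin> R"
  proof
    assume i: "inverse (to_fract P) \<in> R"
    have "local_intersection (zero_scheme v P) H R = 0"
    proof (rule local_intersection_zero[OF rR(1), of _ _ "to_fract P"])
      have "poly_at coord ` S \<subseteq> R" if "S \<subseteq> integral_polys v" for S using that poly_at_mem[OF rR tR] by blast
      then show "(if coord \<in> R then poly_at coord ` fst (zero_scheme v P) else poly_at ?s ` snd (zero_scheme v P)) \<subseteq> R"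
        "(if coord \<in> R then poly_at coord ` fst H else poly_at ?s ` snd H) \<subseteq> R" using tR Z H by simp_all
      show "to_fract P \<in> (if coord \<in> R then poly_at coord ` fst (zero_scheme v P) else poly_at ?s ` snd (zero_scheme v P))"
        using tR Z(3) by (simp add: poly_at_coord)
      show "to_fract P \<noteq> 0" by (simp add: P_def)
    qed (rule i)
    then show False using nz by simp
  qed
  have "\<exists>Mx. special_pt v Mx \<and> R = localization A Mx"
  proof (cases "A' = A")
    case True
    then have "special_pt v M" using AM ring_A by unfold_locales auto
    then show ?thesis using AM(1) True by blast
  next
    case False
    then have A': "A' = poly_at ?s ` integral_polys v" using AM(2) cA by (auto simp: charts_def)
    show ?thesis using second_chart[OF cV, of M] AM tR PR unfolding A' P_def by blast
  qed
  then obtain Mx where Mx: "special_pt v Mx" "R = localization A Mx" by blast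
  interpret x: special_pt v Mx by (rule Mx(1))
  have RO': "R = x.Ox" by (simp add: Mx(2) x.Ox_def)
  have "to_fract P \<in> Mx"
    using x.unit_Ox[OF A_I[OF Pi]] PR RO' by (auto simp: inverse_eq_divide)
  then show ?thesis using Mx(1) RO' by blast
qed

definition "fibre_pts P = {M. maximal_ideal_of A M \<and> (\<lambda>c. to_fract [:c:]) ` val_ideal v \<subseteq> M \<and> to_fract P \<in> M}"

lemma fibre_pts_iff: "M \<in> fibre_pts P \<longleftrightarrow> special_pt v M \<and> to_fract P \<in> M"
proof
  assume a: "M \<in> fibre_pts P"
  then have "special_pt v M" using ring_A unfolding fibre_pts_def by unfold_locales auto
  then show "special_pt v M \<and> to_fract P \<in> M" using a by (simp add: fibre_pts_def)
next
  assume a: "special_pt v M \<and> to_fract P \<in> M"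
  then interpret special_pt v M by simp
  show "M \<in> fibre_pts P" using mx pi_Mx a by (simp add: fibre_pts_def)
qed

text \<open>Points are local rings in the definition and maximal ideals of V[t] here. The ideal is
  recovered from the local ring as the trace of its maximal ideal on V[t], so the reindexing is
  injective.\<close>

lemma intersection_number_sum:
  fixes a2 a4 a6 :: 'k
  defines "P \<equiv> [:a6, a4, a2, 1:]"
  assumes cV: "a2 \<in> val_ring v" "a4 \<in> val_ring v" "a6 \<in> val_ring v"
    and H: "fst H = (\<lambda>q. g * q) ` integral_polys v" "g \<in> integral_polys v" "snd H \<subseteq> integral_polys v"
  shows "intersection_number v (zero_scheme v P) H =
    (\<Sum>M\<in>fibre_pts P. the_enat (special_pt.len v M P g) * the_enat (residue_degree v (loc_ring.Ox A M)))"
proof -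
  have Pi: "P \<in> integral_polys v" unfolding P_def using cV ring_setD(1)[OF ring_V] by (simp add: integral_pCons integral_ring)
  have fin: "finite (fibre_pts P)" unfolding fibre_pts_def by (rule finite_maximal[OF Pi]) (simp add: P_def)
  have H1: "fst H \<subseteq> integral_polys v" using H integral_ring(2) by auto
  let ?Z = "zero_scheme v P"
  have li: "local_intersection ?Z H (loc_ring.Ox A M) = special_pt.len v M P g" if "M \<in> fibre_pts P" for M
  proof -
    interpret special_pt v M using that by (simp add: fibre_pts_iff)
    show ?thesis by (rule generated_ideal2) (simp_all add: zero_scheme_def H)
  qed
  have inj: "inj_on (loc_ring.Ox A) (fibre_pts P)"
  proof
    fix M N assume MN: "M \<in> fibre_pts P" "N \<in> fibre_pts P" "loc_ring.Ox A M = loc_ring.Ox A N"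
    interpret m: special_pt v M using MN by (simp add: fibre_pts_iff)
    interpret n: special_pt v N using MN by (simp add: fibre_pts_iff)
    have eq: "m.mO = n.mO" unfolding m.mO_def n.mO_def by (simp only: MN(3))
    have "M = m.mO \<inter> A" by (rule m.mO_A[symmetric])
    also have "\<dots> = n.mO \<inter> A" by (simp only: eq)
    also have "\<dots> = N" by (rule n.mO_A)
    finally show "M = N" .
  qed
  have "intersection_number v ?Z H = (\<Sum>R\<in>loc_ring.Ox A ` fibre_pts P. the_enat (local_intersection ?Z H R) * the_enat (residue_degree v R))"
    unfolding intersection_number_def
  proof (rule sum.mono_neutral_left)
    show "finite (loc_ring.Ox A ` fibre_pts P)" using fin by simp
    show "{R \<in> special_points v. local_intersection ?Z H R \<noteq> 0} \<subseteq> loc_ring.Ox A ` fibre_pts P"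
    proof
      fix R assume "R \<in> {R \<in> special_points v. local_intersection ?Z H R \<noteq> 0}"
      then have R: "R \<in> special_points v" "local_intersection ?Z H R \<noteq> 0" by auto
      show "R \<in> loc_ring.Ox A ` fibre_pts P"
        using special_cases[OF cV R(1) H1 H(3) R(2)[unfolded P_def]] fibre_pts_iff unfolding P_def by blast
    qed
    show "\<forall>i\<in>loc_ring.Ox A ` fibre_pts P - {R \<in> special_points v. local_intersection ?Z H R \<noteq> 0}.
       the_enat (local_intersection ?Z H i) * the_enat (residue_degree v i) = 0"
    proof
      fix R assume R: "R \<in> loc_ring.Ox A ` fibre_pts P - {R \<in> special_points v. local_intersection ?Z H R \<noteq> 0}"
      then obtain M where M: "M \<in> fibre_pts P" "R = loc_ring.Ox A M" by blast
      interpret special_pt v M using M by (simp add: fibre_pts_iff)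
      have "R \<in> special_points v" unfolding M(2) by (rule Ox_special)
      then have "local_intersection ?Z H R = 0" using R by simp
      then show "the_enat (local_intersection ?Z H R) * the_enat (residue_degree v R) = 0"
        by (simp add: zero_enat_def)
    qed
  qed
  also have "\<dots> = (\<Sum>M\<in>fibre_pts P. the_enat (special_pt.len v M P g) * the_enat (residue_degree v (loc_ring.Ox A M)))"
    by (simp add: sum.reindex[OF inj] li)
  finally show ?thesis .
qed

end

section \<open>Integrality and the closure of the torsion\<close>

lemma divpol_closed:
  assumes zero: "0 \<in> S" and one: "1 \<in> S" and diff: "\<And>x y. x \<in> S \<Longrightarrow> y \<in> S \<Longrightarrow> x - y \<in> S"
    and mult: "\<And>x y. x \<in> S \<Longrightarrow> y \<in> S \<Longrightarrow> x * y \<in> S"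
    and mem: "A \<in> S" "\<alpha> \<in> S" "\<beta> \<in> S"
  shows "divpol A \<alpha> \<beta> n \<in> S"
proof (induction n rule: less_induct)
  case (less n)
  have pow: "x ^ k \<in> S" if "x \<in> S" for x k using that by (induction k) (auto intro: one mult)
  have "1 - (0 - 1) \<in> S" by (intro diff zero one)
  then have two: "2 \<in> S" by simp
  have IH: "divpol A \<alpha> \<beta> m \<in> S" if "n > 4" "m \<le> n div 2 + 2" for m using less that by auto
  show ?case
  proof (cases "n > 4")
    case True
    then show ?thesis by (subst divpol.simps) (auto intro!: diff mult pow one mem IH)
  next
    case False
    then have "n = 0 \<or> n = Suc 0 \<or> n = 2 \<or> n = 3 \<or> n = 4" by auto
    then show ?thesis by (auto intro!: diff mult pow one zero two mem)
  qed
qed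

context dvr
begin

lemma val_ideal_closed:
  "0 \<in> val_ideal v" "x \<in> val_ideal v \<Longrightarrow> y \<in> val_ideal v \<Longrightarrow> x + y \<in> val_ideal v"
  "x \<in> val_ring v \<Longrightarrow> y \<in> val_ideal v \<Longrightarrow> x * y \<in> val_ideal v"
  "y \<in> val_ring v \<Longrightarrow> x \<in> val_ideal v \<Longrightarrow> x * y \<in> val_ideal v"
  "x \<in> val_ideal v \<Longrightarrow> - x \<in> val_ideal v"
  "x \<in> val_ideal v \<Longrightarrow> y \<in> val_ideal v \<Longrightarrow> x - y \<in> val_ideal v"
  "1 \<notin> val_ideal v" "x \<in> val_ideal v \<Longrightarrow> x \<in> val_ring v"
proof -
  show add: "x \<in> val_ideal v \<Longrightarrow> y \<in> val_ideal v \<Longrightarrow> x + y \<in> val_ideal v" for x y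
    using v_add[of x y] by (cases "x = 0 \<or> y = 0 \<or> x + y = 0") (auto simp: val_ideal_def)
  show "x \<in> val_ring v \<Longrightarrow> y \<in> val_ideal v \<Longrightarrow> x * y \<in> val_ideal v"
    using v_mult[of x y] by (cases "x = 0 \<or> y = 0") (auto simp: val_ideal_def val_ring_def)
  show "y \<in> val_ring v \<Longrightarrow> x \<in> val_ideal v \<Longrightarrow> x * y \<in> val_ideal v"
    using v_mult[of x y] by (cases "x = 0 \<or> y = 0") (auto simp: val_ideal_def val_ring_def)
  show neg: "x \<in> val_ideal v \<Longrightarrow> - x \<in> val_ideal v" for x by (auto simp: val_ideal_def v_minus)
  show "x \<in> val_ideal v \<Longrightarrow> y \<in> val_ideal v \<Longrightarrow> x - y \<in> val_ideal v" using add[of x "- y"] neg by simp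
qed (auto simp: val_ideal_def val_ring_def)

lemma unit_mult:
  assumes x: "x \<in> val_ring v" "x \<notin> val_ideal v" and y: "y \<in> val_ring v" "y \<notin> val_ideal v"
  shows "x * y \<notin> val_ideal v"
proof -
  have "x \<noteq> 0" "v x = 0" "y \<noteq> 0" "v y = 0" using val_unit[OF x] val_unit[OF y] by blast+
  then show ?thesis by (simp add: val_ideal_def v_mult)
qed

lemma unit_power:
  assumes x: "x \<in> val_ring v" "x \<notin> val_ideal v"
  shows "x ^ n \<notin> val_ideal v"
proof -
  have "x \<noteq> 0" "v x = 0" using val_unit[OF x] by blast+
  then show ?thesis by (simp add: val_ideal_def v_power)
qed

lemma of_nat_V: "of_nat n \<in> val_ring v" "numeral k \<in> val_ring v"
proof -
  show *: "of_nat n \<in> val_ring v" for n by (induction n) (use ring_setD[OF ring_V] in auto)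
  show "numeral k \<in> val_ring v" using *[of "numeral k"] by simp
qed

text \<open>Gauss: take the lowest unit coefficient of each factor. In the product, at the sum of
  their indices, every other contribution lies in the maximal ideal.\<close>

lemma primitive_mult:
  assumes p: "p \<in> integral_polys v" "coeff p i \<notin> val_ideal v"
    and q: "q \<in> integral_polys v" "coeff q j \<notin> val_ideal v"
  shows "\<exists>k. coeff (p * q) k \<notin> val_ideal v"
proof -
  define i0 where "i0 = (LEAST i. coeff p i \<notin> val_ideal v)"
  define j0 where "j0 = (LEAST j. coeff q j \<notin> val_ideal v)"
  have i0: "coeff p i0 \<notin> val_ideal v" "\<And>i. i < i0 \<Longrightarrow> coeff p i \<in> val_ideal v"
    unfolding i0_def by (rule LeastI[of "\<lambda>i. coeff p i \<notin> val_ideal v", OF p(2)]) (use not_less_Least in blast)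
  have j0: "coeff q j0 \<notin> val_ideal v" "\<And>j. j < j0 \<Longrightarrow> coeff q j \<in> val_ideal v"
    unfolding j0_def by (rule LeastI[of "\<lambda>i. coeff q i \<notin> val_ideal v", OF q(2)]) (use not_less_Least in blast)
  have int: "coeff p i \<in> val_ring v" "coeff q i \<in> val_ring v" for i using p q by (auto simp: integral_polys_def)
  have s: "(\<And>i. i \<in> I \<Longrightarrow> g i \<in> val_ideal v) \<Longrightarrow> sum g I \<in> val_ideal v" for g and I :: "nat set"
    by (induction I rule: infinite_finite_induct) (auto simp: val_ideal_closed)
  define r where "r = (\<Sum>i\<in>{..i0 + j0} - {i0}. coeff p i * coeff q (i0 + j0 - i))"
  have r: "r \<in> val_ideal v" unfolding r_def
  proof (rule s)
    fix i assume i: "i \<in> {..i0 + j0} - {i0}"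
    show "coeff p i * coeff q (i0 + j0 - i) \<in> val_ideal v"
    proof (cases "i < i0")
      case True
      then show ?thesis by (intro val_ideal_closed(4) int i0(2))
    next
      case False
      then have "i0 + j0 - i < j0" using i by auto
      then show ?thesis by (intro val_ideal_closed(3) int j0(2))
    qed
  qed
  have "coeff (p * q) (i0 + j0) = coeff p i0 * coeff q j0 + r"
    unfolding coeff_mult r_def by (subst sum.remove[of _ i0]) auto
  moreover have "coeff p i0 * coeff q j0 \<notin> val_ideal v" by (rule unit_mult[OF int(1) i0(1) int(2) j0(1)])
  ultimately have "coeff (p * q) (i0 + j0) \<notin> val_ideal v"
    using val_ideal_closed(6)[OF _ r, of "coeff (p * q) (i0 + j0)"] by auto
  then show ?thesis by blast
qed

lemma clear_denominators:
  assumes pi: "\<pi> \<noteq> 0" "v \<pi> = 1"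
  shows "\<exists>N0. \<forall>N\<ge>N0. smult (\<pi> ^ N) q \<in> integral_polys v"
proof (induction q)
  case 0
  then show ?case by (simp add: integral_ring)
next
  case (pCons c q)
  then obtain N0 where N0: "\<And>N. N \<ge> N0 \<Longrightarrow> smult (\<pi> ^ N) q \<in> integral_polys v" by blast
  have "\<pi> ^ N * c \<in> val_ring v" if "N \<ge> nat (- v c)" for N
    using pi that by (cases "c = 0") (auto simp: val_ring_def v_mult v_power)
  then have "smult (\<pi> ^ N) (pCons c q) \<in> integral_polys v" if "N \<ge> max N0 (nat (- v c))" for N
    using N0 that by (simp add: integral_pCons)
  then show ?case by blast
qed

text \<open>Let k be least with \<pi>^k q integral. If k > 0, then \<pi>^k q is primitive, hence so
  is p \<pi>^k q; but this is \<pi>^k times the integral polynomial p q.\<close>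

lemma gauss_integral:
  assumes p: "p \<in> integral_polys v" "coeff p i \<notin> val_ideal v" and pq: "p * q \<in> integral_polys v"
  shows "q \<in> integral_polys v"
proof -
  obtain \<pi> where pi: "\<pi> \<noteq> 0" "v \<pi> = 1" using uniformizer by blast
  have piI: "\<pi> \<in> val_ideal v" using pi by (simp add: val_ideal_def)
  define k where "k = (LEAST N. smult (\<pi> ^ N) q \<in> integral_polys v)"
  have k: "smult (\<pi> ^ k) q \<in> integral_polys v" "\<And>j. j < k \<Longrightarrow> smult (\<pi> ^ j) q \<notin> integral_polys v"
  proof -
    obtain N where "smult (\<pi> ^ N) q \<in> integral_polys v" using clear_denominators[OF pi] by blast
    then show "smult (\<pi> ^ k) q \<in> integral_polys v" unfolding k_def by (rule LeastI)
  qed (auto simp: k_def dest: not_less_Least)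
  show ?thesis
  proof (cases k)
    case 0
    then show ?thesis using k(1) by simp
  next
    case (Suc j)
    have "\<exists>m. coeff (smult (\<pi> ^ k) q) m \<notin> val_ideal v"
    proof (rule ccontr)
      assume "\<not> ?thesis"
      then have all: "\<pi> ^ k * coeff q m \<in> val_ideal v" for m by simp
      have "coeff (smult (\<pi> ^ j) q) m \<in> val_ring v" for m
      proof -
        obtain d where "d \<in> val_ring v" "\<pi> ^ k * coeff q m = \<pi> * d" using val_ideal_div[OF pi all] by blast
        then show ?thesis using pi Suc by simp
      qed
      then have "smult (\<pi> ^ j) q \<in> integral_polys v" by (simp add: integral_polys_def)
      then show False using k(2)[of j] Suc by simp
    qed
    then obtain l where l: "coeff (p * smult (\<pi> ^ k) q) l \<notin> val_ideal v" using primitive_mult[OF p k(1)] by blast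
    have "coeff (p * q) l \<in> val_ring v" using pq unfolding integral_polys_def by blast
    then have "\<pi> ^ j * coeff (p * q) l \<in> val_ring v"
      using ring_setD(4,7)[OF ring_V] val_ideal_closed(8)[OF piI] by blast
    then have "\<pi> * (\<pi> ^ j * coeff (p * q) l) \<in> val_ideal v" by (rule val_ideal_closed(4)[OF _ piI])
    then show ?thesis using l Suc by (simp add: mult.assoc)
  qed
qed

text \<open>Divide by a coefficient of least valuation; the leading coefficient is one of the
  competitors, which bounds the valuation of the content.\<close>

lemma primitive_part:
  assumes T: "T \<in> integral_polys v" "T \<noteq> 0"
  obtains z p i where "T = smult z p" "p \<in> integral_polys v" "coeff p i \<notin> val_ideal v"
    "z \<noteq> 0" "0 \<le> v z" "v z \<le> v (lead_coeff T)"
proof -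
  define S where "S = {i. i \<le> degree T \<and> coeff T i \<noteq> 0}"
  have "finite S" "degree T \<in> S" using T by (auto simp: S_def)
  then obtain i where i: "is_arg_min (\<lambda>i. v (coeff T i)) (\<lambda>i. i \<in> S) i"
    using ex_is_arg_min_if_finite[of S "\<lambda>i. v (coeff T i)"] by blast
  then have iS: "i \<in> S" and min: "\<And>j. j \<in> S \<Longrightarrow> v (coeff T i) \<le> v (coeff T j)"
    unfolding is_arg_min_linorder by auto
  define z where "z = coeff T i"
  have z: "z \<noteq> 0" using iS by (simp add: z_def S_def)
  have zV: "0 \<le> v z" using T(1) z unfolding z_def integral_polys_def val_ring_def by blast
  have "coeff (smult (inverse z) T) j \<in> val_ring v" for j
  proof (cases "coeff T j = 0")
    case False
    then have "j \<in> S" by (auto simp: S_def le_degree)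
    then have "v z \<le> v (coeff T j)" using min by (simp add: z_def)
    then show ?thesis using False z by (simp add: val_ring_def v_mult v_inverse)
  qed (simp add: val_ring_def)
  then have "smult (inverse z) T \<in> integral_polys v" by (simp add: integral_polys_def)
  moreover have "coeff (smult (inverse z) T) i \<notin> val_ideal v" using z val_ideal_closed(7) by (simp add: z_def)
  moreover have "T = smult z (smult (inverse z) T)" using z by simp
  moreover have "v z \<le> v (lead_coeff T)" using min[OF \<open>degree T \<in> S\<close>] by (simp add: z_def)
  ultimately show thesis using that z zV by blast
qed

end

text \<open>Division with remainder commutes with the field extension: a nonzero remainder stays
  nonzero, and its degree stays too small for divisibility.\<close>

lemma map_poly_to_ac_dvd:
  fixes p q :: "'k::field poly"
  shows "map_poly to_ac p dvd map_poly to_ac q \<longleftrightarrow> p dvd q"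
proof
  have hadd: "map_poly to_ac (a + b) = map_poly to_ac a + map_poly to_ac b"
    and hmult: "map_poly to_ac (a * b) = map_poly to_ac a * map_poly to_ac b" for a b :: "'k poly"
    by (rule map_poly_hom_add map_poly_hom_mult; simp)+
  show "p dvd q \<Longrightarrow> map_poly to_ac p dvd map_poly to_ac q" by (auto simp: hmult elim!: dvdE)
  assume d: "map_poly to_ac p dvd map_poly to_ac q"
  have deg: "degree (map_poly to_ac r) = degree r" for r :: "'k poly" by (rule degree_map_poly) simp
  show "p dvd q"
  proof (rule ccontr)
    assume n: "\<not> p dvd q"
    have nz: "q mod p \<noteq> 0" using n by (simp add: mod_eq_0_iff_dvd)
    have "map_poly to_ac q = map_poly to_ac p * map_poly to_ac (q div p) + map_poly to_ac (q mod p)"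
      unfolding hmult[symmetric] hadd[symmetric] by simp
    then have "map_poly to_ac p dvd map_poly to_ac (q mod p)" using d by (metis dvd_add_right_iff dvd_triv_left)
    moreover have "map_poly to_ac (q mod p) \<noteq> 0" using nz by (simp add: map_poly_eq_0_iff)
    ultimately have le: "degree p \<le> degree (q mod p)" using dvd_imp_degree_le deg by metis
    show False
    proof (cases "p = 0")
      case True
      then show ?thesis using d n by (simp add: map_poly_eq_0_iff)
    next
      case False
      then show ?thesis using degree_mod_less[OF False, of q] nz le by auto
    qed
  qed
qed

section \<open>Descent to K and the closure of the torsion divisor\<close>

context cubic
begin

text \<open>A nonzero constant multiple of the torsion polynomial, which is defined over the
  algebraic closure, with coefficients already in K.\<close>

definition "T n = (if odd n then G n else M (n div 2))"

lemma T_even: "T (2 * k) = M k"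
  by (simp add: T_def)

lemma map_T:
  assumes n: "n \<ge> 1"
  shows "map_poly to_ac (T n) = smult (to_ac (lead_coeff (T n))) (torsion_poly (Weierstrass 0 (to_ac a2) 0 (to_ac a4) (to_ac a6)) n)"
proof -
  interpret ac: cubic_ac "to_ac a2" "to_ac a4" "to_ac a6"
  proof
    show "(2 :: 'a alg_closure) \<noteq> 0" using two to_ac_eq_0_iff[of "2 :: 'a"] by simp
    have "cubic_disc (to_ac a2) (to_ac a4) (to_ac a6) = to_ac (cubic_disc a2 a4 a6)" by (simp add: cubic_disc_def)
    then show "cubic_disc (to_ac a2) (to_ac a4) (to_ac a6) \<noteq> 0" using disc by simp
  qed
  define h where "h = (map_poly to_ac :: 'a poly \<Rightarrow> _)"
  have hadd: "h (a + b) = h a + h b" and hmult: "h (a * b) = h a * h b" for a b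
    unfolding h_def by (rule map_poly_hom_add map_poly_hom_mult; simp)+
  have h1: "h 1 = 1" by (simp add: h_def)
  have hpow: "h (a ^ k) = h a ^ k" for a k by (induction k) (simp_all add: h1 hmult)
  have h4: "h 4 = 4" unfolding h_def by (simp add: numeral_poly map_poly_pCons)
  have hP: "h P = ac.P" unfolding h_def P_def ac.P_def by (simp add: map_poly_pCons)
  have hP': "h P' = ac.P'" "h [:a2, 3:] = [:to_ac a2, 3:]" unfolding h_def P'_def ac.P'_def by (simp_all add: map_poly_pCons)
  have hf: "h (f m) = ac.f m" for m
    unfolding f_def ac.f_def using divpol_hom[of h "4 * P" "[:a2, 3:]" P' m] by (simp add: hadd hmult h1 h4 hP hP')
  have hG: "h (G m) = ac.G m" for m unfolding G_def ac.G_def by (simp add: hmult hpow hf h4 hP h1)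
  have deg: "degree (h r) = degree r" for r unfolding h_def by (rule degree_map_poly) simp
  have lead: "lead_coeff (h r) = to_ac (lead_coeff r)" for r using deg[of r] by (simp add: h_def coeff_map_poly)
  have e: "ac.e m = e m" for m unfolding ac.e_def e_def hG[symmetric] deg ..
  have L: "ac.L m = to_ac (L m)" for m unfolding ac.L_def L_def hG[symmetric] lead ..
  show ?thesis
  proof (cases "odd n")
    case True
    then show ?thesis using ac.torsion_poly_odd[OF True] by (simp add: T_def L L_def[symmetric] hG[symmetric] h_def)
  next
    case False
    then obtain k where k: "n = 2 * k" by auto
    then have k1: "k \<ge> 1" using n by simp
    have "(4 * ac.P) ^ e k * h (M k) = h (G (2 * k))" unfolding G_even[OF k1] by (simp add: hmult hpow h4 hP)
    also have "\<dots> = (4 * ac.P) ^ e k * ac.M k" unfolding hG ac.G_even[OF k1] e ..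
    finally have hM: "h (M k) = ac.M k" using ac.four_poly ac.P_nz by simp
    have "lead_coeff (M k) = L k" using lead_M[OF k1] by (rule conjunct2)
    then show ?thesis using ac.torsion_poly_even[OF k1] unfolding hM[symmetric] L k T_even by (simp add: h_def)
  qed
qed

lemma T_nz: "n \<ge> 1 \<Longrightarrow> T n \<noteq> 0"
proof (cases "odd n")
  case True
  then show "n \<ge> 1 \<Longrightarrow> T n \<noteq> 0" unfolding T_def using G_nz by simp
next
  case False
  assume n: "n \<ge> 1"
  obtain k where k: "n = 2 * k" using False by auto
  then have "k \<ge> 1" using n by simp
  then show ?thesis using lead_M[of k] L_nz[of k] k by (auto simp: T_def)
qed

lemma torsion_closure_fst:
  assumes n: "n \<ge> 1"
  shows "fst (torsion_closure v (Weierstrass 0 a2 0 a4 a6) n) = {g. T n dvd g} \<inter> integral_polys v"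
proof -
  have "to_ac (lead_coeff (T n)) \<noteq> 0" using T_nz[OF n] by simp
  then have "torsion_poly (Weierstrass 0 (to_ac a2) 0 (to_ac a4) (to_ac a6)) n dvd q \<longleftrightarrow> map_poly to_ac (T n) dvd q" for q
    unfolding map_T[OF n] by (simp add: smult_dvd_iff)
  then show ?thesis
    by (simp add: torsion_closure_def zariski_closure_def image_over_base_def map_poly_to_ac_dvd)
qed

end

locale integral_cubic = dvr v + cubic a2 a4 a6 for v :: "'k::field \<Rightarrow> int" and a2 a4 a6 :: "'k" +
  assumes cV: "a2 \<in> val_ring v" "a4 \<in> val_ring v" "a6 \<in> val_ring v"
begin

lemma integral_numeral: "numeral k \<in> integral_polys v"
  unfolding numeral_poly by (rule integral_ring(5)[OF of_nat_V(2)])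

lemma P_integral: "P \<in> integral_polys v" "P' \<in> integral_polys v" "[:a2, 3:] \<in> integral_polys v"
  unfolding P_def P'_def integral_pCons by (intro conjI ring_setD[OF ring_V] cV of_nat_V integral_ring(7))+

lemma G_integral: "f n \<in> integral_polys v" "G n \<in> integral_polys v" "M n \<in> integral_polys v" "T n \<in> integral_polys v"
proof -
  show f: "f n \<in> integral_polys v" for n
    unfolding f_def by (rule divpol_closed) (assumption | intro integral_ring P_integral integral_numeral)+
  show G: "G n \<in> integral_polys v" for n
  proof -
    have "(if even n then 4 * P else 1) \<in> integral_polys v"
      using integral_ring(2)[OF integral_numeral P_integral(1)] integral_ring(6) by simp
    then show ?thesis unfolding G_def by (rule integral_ring(2)[OF _ integral_ring(10)[OF f]])
  qed
  have Th: "\<Theta> n \<in> integral_polys v" for n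
  proof -
    have "(if even n then 1 else 4 * P) \<in> integral_polys v"
      using integral_ring(2)[OF integral_numeral P_integral(1)] integral_ring(6) by simp
    then show ?thesis unfolding \<Theta>_def by (rule integral_ring(2)[OF integral_ring(2)[OF _ f] f])
  qed
  have Ph: "\<Phi> n \<in> integral_polys v" for n
    unfolding \<Phi>_def by (intro integral_ring G Th)
  have c: "coeff (G n) j \<in> val_ring v" for n j using G[of n] by (simp add: integral_polys_def)
  have s: "(\<And>i. i \<in> I \<Longrightarrow> g i \<in> integral_polys v) \<Longrightarrow> sum g I \<in> integral_polys v" for g and I :: "nat set"
    by (induction I rule: infinite_finite_induct) (auto simp: integral_ring)
  show M: "M n \<in> integral_polys v" for n
    unfolding M_def by (intro s integral_ring c Ph G)
  show "T n \<in> integral_polys v" unfolding T_def using G M by simp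
qed

text \<open>By the Gauss lemma, the integral multiples over K of \<open>T n\<close> are the integral
  multiples of its primitive part p. The content z is not computed but only bounded by the leading
  coefficient; this is one source of the error term.\<close>

lemma closure_principal:
  assumes n: "n \<ge> 1"
  obtains z p where "T n = smult z p" "p \<in> integral_polys v" "z \<noteq> 0" "0 \<le> v z" "v z \<le> v (lead_coeff (T n))"
    "fst (torsion_closure v (Weierstrass 0 a2 0 a4 a6) n) = (\<lambda>q. p * q) ` integral_polys v"
    "snd (torsion_closure v (Weierstrass 0 a2 0 a4 a6) n) \<subseteq> integral_polys v"
proof -
  obtain z p i where p: "T n = smult z p" "p \<in> integral_polys v" "coeff p i \<notin> val_ideal v"
    "z \<noteq> 0" "0 \<le> v z" "v z \<le> v (lead_coeff (T n))"
    by (rule primitive_part[OF G_integral(4) T_nz[OF n]])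
  have "{g. T n dvd g} \<inter> integral_polys v = (\<lambda>q. p * q) ` integral_polys v"
  proof (intro equalityI subsetI)
    fix g assume "g \<in> {g. T n dvd g} \<inter> integral_polys v"
    then have g: "p dvd g" "g \<in> integral_polys v" using p(1,4) by (auto simp: smult_dvd_iff)
    then obtain q where q: "g = p * q" by (elim dvdE)
    then have "q \<in> integral_polys v" using gauss_integral[OF p(2,3)] g(2) by simp
    then show "g \<in> (\<lambda>q. p * q) ` integral_polys v" using q by blast
  next
    fix g assume "g \<in> (\<lambda>q. p * q) ` integral_polys v"
    then show "g \<in> {g. T n dvd g} \<inter> integral_polys v" using p(1,2,4) integral_ring(2) by (auto simp: smult_dvd_iff)
  qed
  moreover have "snd (torsion_closure v (Weierstrass 0 a2 0 a4 a6) n) \<subseteq> integral_polys v"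
    by (simp add: torsion_closure_def zariski_closure_def)
  ultimately show thesis using that[OF p(1,2,4,5,6)] torsion_closure_fst[OF n] by simp
qed

end

section \<open>Intersection numbers with the torsion\<close>

text \<open>In the nodal case a lifts the double root of the reduction. Then 3 a + a2 reduces to the
  difference of the double and the simple root, and a2^2 - 3 a4 to the square of that difference;
  that both are units means that the double root is not a triple one.\<close>

locale semistable_cubic = integral_cubic v a2 a4 a6 for v :: "'k::field \<Rightarrow> int" and a2 a4 a6 :: 'k +
  assumes v_two: "v 2 = 0"
    and node: "v (cubic_disc a2 a4 a6) = 0 \<or>
      (\<exists>a\<in>val_ring v. 2 * (a2^2 - 3 * a4) * a = 9 * a6 - a2 * a4 \<and>
        a2^2 - 3 * a4 \<noteq> 0 \<and> v (a2^2 - 3 * a4) = 0 \<and> 3 * a + a2 \<noteq> 0 \<and> v (3 * a + a2) = 0)"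
begin

abbreviation "D \<equiv> cubic_disc a2 a4 a6"

lemma D_V: "D \<in> val_ring v" "v D \<ge> 0"
proof -
  note r = ring_setD[OF ring_V]
  show "D \<in> val_ring v" unfolding cubic_disc_def by (intro r cV of_nat_V)
  then show "v D \<ge> 0" using disc by (simp add: val_ring_def)
qed

lemma unitI: "c \<noteq> 0 \<Longrightarrow> v c = 0 \<Longrightarrow> c \<in> val_ring v \<and> c \<notin> val_ideal v \<and> inverse c \<in> val_ring v"
  by (simp add: val_ring_def val_ideal_def v_inverse)

text \<open>Put E = a2^2 - 3 a4. Multiplying P(a) by (2 E)^3 allows replacing 2 E a by 9 a6 - a2 a4;
  the resulting expression in the coefficients is divisible by disc(P).\<close>

lemma nodal_value:
  assumes a: "2 * (a2^2 - 3 * a4) * a = 9 * a6 - a2 * a4" and nz: "a2^2 - 3 * a4 \<noteq> 0"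
  shows "4 * (a2^2 - 3 * a4)^2 * poly P a = - ((3 * a + a2) * D)"
proof -
  define E where "E = a2^2 - 3 * a4"
  define N where "N = 9 * a6 - a2 * a4"
  have N: "2 * E * a = N" using a by (simp add: E_def N_def)
  have "2 * E * (4 * E^2 * poly P a) = (2 * E * a)^3 + 2 * a2 * E * (2 * E * a)^2 + 4 * a4 * E^2 * (2 * E * a) + 8 * a6 * E^3"
    by (simp add: P_def power2_eq_square power3_eq_cube algebra_simps)
  also have "\<dots> = N^3 + 2 * a2 * E * N^2 + 4 * a4 * E^2 * N + 8 * a6 * E^3" unfolding N ..
  also have "\<dots> = - (3 * N + 2 * E * a2) * D"
    unfolding N_def E_def cubic_disc_def by (simp add: power2_eq_square power3_eq_cube algebra_simps)
  also have "\<dots> = 2 * E * (- ((3 * a + a2) * D))" unfolding N[symmetric] by (simp add: algebra_simps)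
  finally have "2 * E * (4 * E^2 * poly P a) = 2 * E * (- ((3 * a + a2) * D))" .
  moreover have "2 * E \<noteq> 0" unfolding E_def by (rule no_zero_divisors[OF two nz])
  ultimately have "4 * E^2 * poly P a = - ((3 * a + a2) * D)" by (metis mult_left_cancel)
  then show ?thesis by (simp add: E_def)
qed

text \<open>Division of 9 P by P': the quotient is 3 x + a2, and a is chosen as the zero of the
  linear remainder.\<close>

lemma nodal_slope:
  assumes a: "2 * (a2^2 - 3 * a4) * a = 9 * a6 - a2 * a4"
  shows "smult 9 P - [:a2, 3:] * P' = smult (- (2 * (a2^2 - 3 * a4))) [:- a, 1:]"
    "9 * poly P a = (3 * a + a2) * poly P' a"
proof -
  show *: "smult 9 P - [:a2, 3:] * P' = smult (- (2 * (a2^2 - 3 * a4))) [:- a, 1:]"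
    using a by (simp add: P_def P'_def power2_eq_square algebra_simps)
  have "poly (smult 9 P - [:a2, 3:] * P') a = 0" unfolding * by simp
  then show "9 * poly P a = (3 * a + a2) * poly P' a" by (simp add: algebra_simps)
qed

text \<open>Good reduction: the resultant identity puts the unit disc(P) into the ideal (P,
  P').\<close>

lemma len_derivative_unit:
  assumes "special_pt v Mx" "v D = 0"
  shows "special_pt.len v Mx P P' = 0"
proof -
  interpret x: special_pt v Mx by (rule assms)
  obtain u w where uw: "P * u + P' * w = [:D:]" "u \<in> integral_polys v" "w \<in> integral_polys v"
  proof
    show "P * [:-4 * a2^3 + 15 * a2 * a4 - 27 * a6, 18 * a4 - 6 * a2^2:] + P' *
      [:a2^2 * a4 - 4 * a4^2 + 3 * a2 * a6, 2 * a2^3 - 7 * a2 * a4 + 9 * a6, 2 * a2^2 - 6 * a4:] = [:D:]"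
      using bezout_disc by (simp only: mult.commute)
    note r = ring_setD[OF ring_V]
    have "-4 = - (4 :: 'k)" by simp
    then have m4: "-4 \<in> val_ring v" using r(5)[OF of_nat_V(2)[of "num.Bit0 (num.Bit0 num.One)"]] by simp
    show "[:-4 * a2^3 + 15 * a2 * a4 - 27 * a6, 18 * a4 - 6 * a2^2:] \<in> integral_polys v"
      "[:a2^2 * a4 - 4 * a4^2 + 3 * a2 * a6, 2 * a2^3 - 7 * a2 * a4 + 9 * a6, 2 * a2^2 - 6 * a4:] \<in> integral_polys v"
      unfolding integral_pCons by (intro conjI m4 r cV of_nat_V integral_ring(7))+
  qed
  have Du: "D \<in> val_ring v" "D \<notin> val_ideal v" using unitI[OF disc assms(2)] by auto
  show ?thesis
  proof (rule x.ideal2_top_if_unit[OF P_integral(1,2) integral_ring(5)[OF Du(1)] x.const_unit_notin[OF Du]])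
    have "to_fract [:D:] = to_fract P * to_fract u + to_fract P' * to_fract w" unfolding uw(1)[symmetric] by simp
    then show "to_fract [:D:] \<in> x.ideal2 P P'" using x.mem_ideal2I[OF x.tf_Ox x.tf_Ox, OF uw(2,3)] by simp
  qed
qed

text \<open>The linear remainder of 9 P by P' is a unit times x - a, so x - a and with it P(a) lie
  in (P, P'). Conversely, P and P' are congruent to P(a) and P'(a) modulo x - a, and P'(a) is a
  multiple of P(a) because 3 a + a2 is a unit.\<close>

lemma ideal2_nodal:
  assumes "special_pt v Mx" and a: "a \<in> val_ring v" "2 * (a2^2 - 3 * a4) * a = 9 * a6 - a2 * a4"
    "a2^2 - 3 * a4 \<noteq> 0" "v (a2^2 - 3 * a4) = 0" "3 * a + a2 \<noteq> 0" "v (3 * a + a2) = 0"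
  shows "special_pt.ideal2 v Mx P P' = special_pt.ideal2 v Mx [:- a, 1:] [:poly P a:]"
proof -
  interpret x: special_pt v Mx by (rule assms)
  note r = ring_setD[OF ring_V]
  define k where "k = inverse (- (2 * (a2^2 - 3 * a4)))"
  have knz: "- (2 * (a2^2 - 3 * a4)) \<noteq> 0" unfolding neg_equal_0_iff_equal by (rule no_zero_divisors[OF two a(3)])
  have "v (- (2 * (a2^2 - 3 * a4))) = 0" unfolding v_minus using v_mult[OF two a(3)] v_two a(4) by simp
  then have k: "k \<in> val_ring v" unfolding k_def using unitI[OF knz] by blast
  have l: "[:- a, 1:] \<in> integral_polys v" by (rule lin_integral[OF a(1)])
  have "[:- a, 1:] = smult k (smult 9 P - [:a2, 3:] * P')" unfolding nodal_slope(1)[OF a(2)] using knz by (simp add: k_def)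
  also have "\<dots> = P * [:9 * k:] + P' * smult (- k) [:a2, 3:]"
  proof -
    have "smult k (smult 9 P - R * P') = P * [:9 * k:] + P' * smult (- k) R" for R
      by (simp add: smult_diff_right mult.commute)
    then show ?thesis .
  qed
  finally have "[:- a, 1:] = P * [:9 * k:] + P' * smult (- k) [:a2, 3:]" .
  then have "to_fract [:- a, 1:] = to_fract P * to_fract [:9 * k:] + to_fract P' * to_fract (smult (- k) [:a2, 3:])"
    by (metis to_fract_add to_fract_mult)
  moreover have "[:9 * k:] \<in> integral_polys v" "smult (- k) [:a2, 3:] \<in> integral_polys v"
    using k by (intro integral_ring P_integral r of_nat_V; simp add: r)+
  ultimately have la: "to_fract [:- a, 1:] \<in> x.ideal2 P P'" using x.mem_ideal2I[OF x.tf_Ox x.tf_Ox] by metis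
  obtain q where q: "q \<in> integral_polys v" "P = [:- a, 1:] * q + [:poly P a:]" using lin_dec[OF a(1) P_integral(1)] by blast
  obtain q' where q': "q' \<in> integral_polys v" "P' = [:- a, 1:] * q' + [:poly P' a:]" using lin_dec[OF a(1) P_integral(2)] by blast
  have tq: "to_fract P = to_fract [:- a, 1:] * to_fract q + to_fract [:poly P a:]"
    using arg_cong[OF q(2), of to_fract] by (simp only: to_fract_add to_fract_mult)
  note s = submoduleD[OF x.ideal2_submodule]
  have ca: "to_fract [:poly P a:] \<in> x.ideal2 P P'"
  proof -
    have "to_fract [:poly P a:] = to_fract P - to_fract q * to_fract [:- a, 1:]" using tq by (simp add: mult.commute)
    also have "\<dots> \<in> x.ideal2 P P'"
      by (rule submodule_diff[OF x.ring_Ox x.ideal2_submodule x.ideal2_gens(1) s(3)[OF x.tf_Ox[OF q(1)] la]])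
    finally show ?thesis .
  qed
  let ?J = "x.ideal2 [:- a, 1:] [:poly P a:]"
  have "to_fract P \<in> ?J"
    unfolding tq using x.mem_ideal2I[OF x.tf_Ox[OF q(1)] x.rO(1), of "[:- a, 1:]" "[:poly P a:]"] by simp
  moreover have "to_fract P' \<in> ?J"
  proof -
    define g where "g = 9 * inverse (3 * a + a2)"
    have g: "g \<in> val_ring v" unfolding g_def using unitI[OF a(5,6)] r(4) of_nat_V by blast
    have "poly P' a = poly P a * g" using nodal_slope(2)[OF a(2)] a(5) by (simp add: g_def field_simps)
    then have "P' = [:- a, 1:] * q' + [:poly P a:] * [:g:]" using q'(2) by (simp add: mult.commute)
    then have "to_fract P' = to_fract [:- a, 1:] * to_fract q' + to_fract [:poly P a:] * to_fract [:g:]"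
      by (metis to_fract_add to_fract_mult)
    then show ?thesis using x.mem_ideal2I[OF x.tf_Ox[OF q'(1)] x.tf_Ox[OF integral_ring(5)[OF g]], of "[:- a, 1:]" "[:poly P a:]"] by simp
  qed
  ultimately show ?thesis
    by (intro equalityI x.ideal2_least[OF x.ideal2_submodule] la ca)
qed

text \<open>In the nodal case only the rational point t = a contributes. Its residue degree is 1,
  and the length there is v(P(a)), which equals v(disc(P)) by \<open>nodal_value\<close>.\<close>

lemma sum_len_derivative:
  "(\<Sum>N\<in>fibre_pts P. the_enat (special_pt.len v N P P') * the_enat (residue_degree v (loc_ring.Ox A N))) = nat (v D)"
  "N \<in> fibre_pts P \<Longrightarrow> special_pt.len v N P P' \<noteq> \<infinity>"
proof -
  let ?w = "\<lambda>N. the_enat (special_pt.len v N P P') * the_enat (residue_degree v (loc_ring.Ox A N))"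
  have "sum ?w (fibre_pts P) = nat (v D) \<and> (\<forall>N\<in>fibre_pts P. special_pt.len v N P P' \<noteq> \<infinity>)"
  proof (cases "v D = 0")
    case True
    then have "special_pt.len v N P P' = 0" if "N \<in> fibre_pts P" for N
      using len_derivative_unit that fibre_pts_iff by blast
    then show ?thesis using True by (simp add: zero_enat_def)
  next
    case False
    then obtain a where a: "a \<in> val_ring v" "2 * (a2^2 - 3 * a4) * a = 9 * a6 - a2 * a4"
      "a2^2 - 3 * a4 \<noteq> 0" "v (a2^2 - 3 * a4) = 0" "3 * a + a2 \<noteq> 0" "v (3 * a + a2) = 0" using node by blast
    obtain \<pi> where pi: "\<pi> \<noteq> 0" "v \<pi> = 1" using uniformizer by blast
    define c where "c = poly P a"
    have cv: "4 * (a2^2 - 3 * a4)^2 * c = - ((3 * a + a2) * D)" unfolding c_def by (rule nodal_value[OF a(2,3)])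
    have c0: "c \<noteq> 0" using cv a(5) disc by auto
    have "v (2 * 2) = v 2 + v 2" by (rule v_mult[OF two two])
    then have v4: "v 4 = 0" using v_two by simp
    have "v (4 * (a2^2 - 3 * a4)^2 * c) = v c" using v_mult v_power four a(3,4) c0 v4 by simp
    moreover have "v (- ((3 * a + a2) * D)) = v D" unfolding v_minus using v_mult[OF a(5) disc] a(6) by simp
    ultimately have vc: "v c = v D" unfolding cv by simp
    have lenP': "special_pt.len v N P P' = (if to_fract [:- a, 1:] \<in> N then enat (nat (v D)) else 0)" if N: "special_pt v N" for N
    proof -
      interpret x: special_pt v N by (rule N)
      have l: "[:- a, 1:] \<in> integral_polys v" by (rule lin_integral[OF a(1)])
      have cI: "[:c:] \<in> integral_polys v" unfolding c_def by (rule integral_ring(5)[OF poly_integral[OF P_integral(1) a(1)]])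
      have eq: "x.len P P' = x.len [:- a, 1:] [:c:]" unfolding x.len_def ideal2_nodal[OF N a] c_def ..
      show ?thesis
      proof (cases "to_fract [:- a, 1:] \<in> N")
        case True
        have "x.len [:- a, 1:] [:c:] = of_nat (nat (v c)) * x.len [:- a, 1:] [:\<pi>:]"
          by (rule x.len_const[OF l _ pi c0]) (use vc D_V in simp_all)
        then show ?thesis using True x.lin_len(1)[OF a(1) True pi] eq vc by (simp add: of_nat_eq_enat)
      next
        case False
        then show ?thesis using x.ideal2_top_if_unit[OF l cI l False x.ideal2_gens(1)] eq by simp
      qed
    qed
    define M0 where "M0 = {to_fract p | p. p \<in> integral_polys v \<and> poly p a \<in> val_ideal v}"
    have M0: "special_pt v M0" "to_fract [:- a, 1:] \<in> M0" unfolding M0_def by (rule lin_maximal[OF a(1)])+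
    have "c \<in> val_ideal v" using vc False D_V(2) by (simp add: val_ideal_def)
    then have "to_fract P \<in> M0" unfolding M0_def c_def using P_integral(1) by blast
    then have M0f: "M0 \<in> fibre_pts P" using M0(1) by (simp add: fibre_pts_iff)
    have fin: "finite (fibre_pts P)" unfolding fibre_pts_def by (rule finite_maximal[OF P_integral(1) lead_P])
    have zero: "?w N = 0" if N: "N \<in> fibre_pts P - {M0}" for N
    proof -
      have sM: "special_pt v N" using N by (simp add: fibre_pts_iff)
      have "to_fract [:- a, 1:] \<notin> N"
      proof
        assume "to_fract [:- a, 1:] \<in> N"
        then have "N = M0" unfolding M0_def by (rule special_pt.lin_Mx_eq[OF sM a(1)])
        then show False using N by simp
      qed
      then show ?thesis using lenP'[OF sM] by (simp add: zero_enat_def)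
    qed
    have w0: "?w M0 = nat (v D)"
    proof -
      interpret x: special_pt v M0 by (rule M0(1))
      show ?thesis using lenP'[OF M0(1)] M0(2) x.lin_len(2)[OF a(1) M0(2) pi] by (simp add: one_enat_def)
    qed
    have "sum ?w (fibre_pts P) = ?w M0 + sum ?w (fibre_pts P - {M0})" by (rule sum.remove[OF fin M0f])
    also have "sum ?w (fibre_pts P - {M0}) = 0" by (rule sum.neutral) (use zero in blast)
    finally have "sum ?w (fibre_pts P) = nat (v D)" using w0 by simp
    moreover have "special_pt.len v N P P' \<noteq> \<infinity>" if "N \<in> fibre_pts P" for N
      using lenP'[of N] that by (simp add: fibre_pts_iff zero_enat_def)
    ultimately show ?thesis by blast
  qed
  then show "sum ?w (fibre_pts P) = nat (v D)" "N \<in> fibre_pts P \<Longrightarrow> special_pt.len v N P P' \<noteq> \<infinity>" by auto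
qed

lemma coprime_derivative: "P dvd P' * b \<Longrightarrow> P dvd b"
proof -
  assume d: "P dvd P' * b"
  obtain u w where uw: "u * P + w * P' = [:D:]" using bezout_disc by blast
  have "[:D:] * b = P * (u * b) + w * (P' * b)" unfolding uw[symmetric] by (simp add: algebra_simps)
  then have "P dvd [:D:] * b" using d by (metis dvd_add dvd_mult dvd_triv_left)
  then show ?thesis using disc by (simp add: dvd_smult_iff)
qed

text \<open>Both sides compute one length: by the congruence, z p and c P'^k generate the same ideal
  together with P, and lengths are additive over these factors. All lengths are finite, so the
  result may be stated in natural numbers.\<close>

lemma local_formula:
  assumes N: "N \<in> fibre_pts P" and pi: "\<pi> \<noteq> 0" "v \<pi> = 1"
    and z: "z \<noteq> 0" "0 \<le> v z" and c: "c \<noteq> 0" "0 \<le> v c" and p: "p \<in> integral_polys v"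
    and cong: "P dvd smult z p - smult c (P' ^ k)"
  shows "the_enat (special_pt.len v N P p) + nat (v z) * the_enat (special_pt.len v N P [:\<pi>:])
     = nat (v c) * the_enat (special_pt.len v N P [:\<pi>:]) + k * the_enat (special_pt.len v N P P')"
proof -
  have sM: "special_pt v N" using N by (simp add: fibre_pts_iff)
  interpret x: special_pt v N by (rule sM)
  note lm = x.len_mult[OF P_integral(1) lead_P]
  have pw: "x.len P (P' ^ j) = of_nat j * x.len P P'" for j
  proof (induction j)
    case 0
    have "x.len P 1 = 0" by (rule x.ideal2_top(2)[OF P_integral(1) integral_ring(6)]) (use x.ideal2_gens(2)[of 1 P] in simp)
    then show ?case by simp
  next
    case (Suc j)
    have "x.len P (P' * P' ^ j) = x.len P P' + x.len P (P' ^ j)"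
      by (rule lm[OF P_integral(2) integral_ring(10)[OF P_integral(2)] coprime_derivative])
    then show ?case using Suc by (simp add: algebra_simps)
  qed
  have zV: "[:z:] \<in> integral_polys v" "[:c:] \<in> integral_polys v" using z c by (auto intro!: integral_ring simp: val_ring_def)
  have cop: "P dvd [:y:] * b \<Longrightarrow> P dvd b" if "y \<noteq> 0" for y b using that by (simp add: dvd_smult_iff)
  have ci: "smult c (P' ^ k) \<in> integral_polys v" using integral_ring(2)[OF zV(2) integral_ring(10)[OF P_integral(2)], of k] by simp
  have zi: "smult z p \<in> integral_polys v" using integral_ring(2)[OF zV(1) p] by simp
  obtain q where q: "smult z p - smult c (P' ^ k) = P * q" using cong by (elim dvdE)
  have qi: "q \<in> integral_polys v"
    by (rule integral_divide_monic[OF P_integral(1) lead_P]) (use integral_ring(4)[OF zi ci] q in simp)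
  have "smult z p = smult c (P' ^ k) + P * q" using q by (simp add: algebra_simps)
  then have "x.ideal2 P (smult z p) = x.ideal2 P (smult c (P' ^ k))" by (rule x.ideal2_cong[OF P_integral(1) qi])
  then have eq: "x.len P ([:z:] * p) = x.len P ([:c:] * P' ^ k)" by (simp add: x.len_def)
  have l1: "x.len P ([:z:] * p) = x.len P [:z:] + x.len P p" by (rule lm[OF zV(1) p cop[OF z(1)]])
  have l2: "x.len P ([:c:] * P' ^ k) = x.len P [:c:] + x.len P (P' ^ k)"
    by (rule lm[OF zV(2) integral_ring(10)[OF P_integral(2)] cop[OF c(1)]])
  obtain l where l: "x.len P [:\<pi>:] = enat l" using x.len_pi_le[OF P_integral(1) lead_P pi] by (cases "x.len P [:\<pi>:]") auto
  obtain d where d: "x.len P P' = enat d" using sum_len_derivative(2)[OF N] by blast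
  have lz: "x.len P [:z:] = enat (nat (v z) * l)" using x.len_const[OF P_integral(1) lead_P pi z] l by (simp add: of_nat_eq_enat)
  have lc: "x.len P [:c:] = enat (nat (v c) * l)" using x.len_const[OF P_integral(1) lead_P pi c] l by (simp add: of_nat_eq_enat)
  have "enat (nat (v z) * l) + x.len P p = enat (nat (v c) * l + k * d)"
    using eq l1 l2 lz lc pw[of k] d by (simp add: of_nat_eq_enat)
  then obtain m where m: "x.len P p = enat m" "nat (v z) * l + m = nat (v c) * l + k * d" by (cases "x.len P p") auto
  show ?thesis using m by (simp add: l d)
qed

text \<open>The intersection number of the zeroes of P with the special fibre. It is independent of
  n and is the factor with which valuations of constants enter.\<close>

definition "fibre_weight = (\<Sum>N\<in>fibre_pts P. the_enat (special_pt.len v N P [:SOME \<pi>. \<pi> \<noteq> 0 \<and> v \<pi> = 1:])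
   * the_enat (residue_degree v (loc_ring.Ox A N)))"

text \<open>The local formulas are summed with the residue degrees as weights; j is the valuation of
  the content of \<open>T n\<close>.\<close>

lemma intersection_formula:
  assumes n: "n \<ge> 1" and c: "c \<noteq> 0" "0 \<le> v c" and cong: "P dvd T n - smult c (P' ^ k)"
  shows "\<exists>j\<le>nat (v (lead_coeff (T n))).
    intersection_number v (zero_scheme v P) (torsion_closure v (Weierstrass 0 a2 0 a4 a6) n) + j * fibre_weight
      = nat (v c) * fibre_weight + k * nat (v D)"
proof -
  define \<pi> where "\<pi> = (SOME \<pi>. \<pi> \<noteq> 0 \<and> v \<pi> = 1)"
  have pi: "\<pi> \<noteq> 0" "v \<pi> = 1" using someI_ex[OF uniformizer] by (auto simp: \<pi>_def)
  obtain z p where zp: "T n = smult z p" "p \<in> integral_polys v" "z \<noteq> 0" "0 \<le> v z" "v z \<le> v (lead_coeff (T n))"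
    "fst (torsion_closure v (Weierstrass 0 a2 0 a4 a6) n) = (\<lambda>q. p * q) ` integral_polys v"
    "snd (torsion_closure v (Weierstrass 0 a2 0 a4 a6) n) \<subseteq> integral_polys v"
    by (rule closure_principal[OF n])
  let ?l = "\<lambda>N g. the_enat (special_pt.len v N P g)" and ?d = "\<lambda>N. the_enat (residue_degree v (loc_ring.Ox A N))"
  define I where "I = intersection_number v (zero_scheme v P) (torsion_closure v (Weierstrass 0 a2 0 a4 a6) n)"
  have I: "I = (\<Sum>N\<in>fibre_pts P. ?l N p * ?d N)"
    unfolding I_def P_def by (rule intersection_number_sum[OF cV zp(6,2,7)])
  have loc: "?l N p + nat (v z) * ?l N [:\<pi>:] = nat (v c) * ?l N [:\<pi>:] + k * ?l N P'" if "N \<in> fibre_pts P" for N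
    by (rule local_formula[OF that pi zp(3,4) c zp(2)]) (use cong zp(1) in simp)
  have C: "fibre_weight = (\<Sum>N\<in>fibre_pts P. ?l N [:\<pi>:] * ?d N)" by (simp add: fibre_weight_def \<pi>_def)
  have "I + nat (v z) * fibre_weight = (\<Sum>N\<in>fibre_pts P. (?l N p + nat (v z) * ?l N [:\<pi>:]) * ?d N)"
    unfolding I C by (simp add: sum.distrib sum_distrib_left algebra_simps)
  also have "\<dots> = (\<Sum>N\<in>fibre_pts P. (nat (v c) * ?l N [:\<pi>:] + k * ?l N P') * ?d N)"
    by (rule sum.cong[OF refl]) (simp only: loc)
  also have "\<dots> = nat (v c) * fibre_weight + k * (\<Sum>N\<in>fibre_pts P. ?l N P' * ?d N)"
    unfolding C by (simp add: sum.distrib sum_distrib_left algebra_simps)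
  finally have "I + nat (v z) * fibre_weight = nat (v c) * fibre_weight + k * nat (v D)"
    unfolding sum_len_derivative(1) .
  moreover have "nat (v z) \<le> nat (v (lead_coeff (T n)))" using zp(5) by simp
  ultimately show ?thesis unfolding I_def by blast
qed

lemma L_V: "k \<ge> 1 \<Longrightarrow> 0 \<le> v (L k)"
proof -
  assume k: "k \<ge> 1"
  have "L k \<in> val_ring v" using G_integral(2)[of k] unfolding L_def integral_polys_def by blast
  then show ?thesis using L_nz[OF k] by (simp add: val_ring_def)
qed

lemma intersection_odd:
  "\<exists>j\<le>nat (v (L (2 * k + 1))).
    intersection_number v (zero_scheme v P) (torsion_closure v (Weierstrass 0 a2 0 a4 a6) (2 * k + 1)) + j * fibre_weight
      = 2 * k * (k + 1) * nat (v D)"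
  using intersection_formula[of "2 * k + 1" 1 "2 * k * (k + 1)"] G_odd_mod_P[of k] by (simp add: T_def L_def)

text \<open>The constant in the congruence modulo P is the leading coefficient \<open>L k\<close>
  itself. With n = 2 k the factor 2 deg(\<open>G k\<close>) is n^2 / 2 - 2
  \<open>e k\<close>.\<close>

lemma intersection_even:
  assumes k: "k \<ge> 1"
  shows "\<exists>j\<le>nat (v (L k)).
    intersection_number v (zero_scheme v P) (torsion_closure v (Weierstrass 0 a2 0 a4 a6) (2 * k)) + j * fibre_weight
      = nat (v (L k)) * fibre_weight + 2 * degree (G k) * nat (v D)"
proof -
  have lead: "lead_coeff (T (2 * k)) = L k" unfolding T_even using lead_M[OF k] by (rule conjunct2)
  show ?thesis
    using intersection_formula[of "2 * k" "L k" "2 * degree (G k)"] M_mod_P[of k] L_nz[OF k] L_V[OF k] k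
    unfolding lead unfolding T_even by simp
qed

end

section \<open>Growth of the leading coefficients and the limit\<close>

text \<open>Over the residue field a nonzero multiple of Q has degree at least deg Q > 0 and is not
  constant.\<close>

lemma (in dvr) monic_multiple_constant:
  assumes Q: "Q \<in> integral_polys v" "lead_coeff Q = 1" "degree Q \<ge> 1" and q: "q \<in> integral_polys v"
    and high: "\<And>i. i \<ge> 1 \<Longrightarrow> coeff (Q * q) i \<in> val_ideal v"
  shows "coeff q j \<in> val_ideal v"
proof (rule ccontr)
  assume "coeff q j \<notin> val_ideal v"
  define B where "B = {j. coeff q j \<notin> val_ideal v}"
  have "B \<subseteq> {..degree q}"
  proof
    fix i assume "i \<in> B"
    then have "coeff q i \<noteq> 0" using val_ideal_closed(1) unfolding B_def by auto
    then show "i \<in> {..degree q}" by (simp add: le_degree)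
  qed
  then have fin: "finite B" by (rule finite_subset) simp
  have "j \<in> B" using \<open>coeff q j \<notin> val_ideal v\<close> by (simp add: B_def)
  define m where "m = Max B"
  have m: "coeff q m \<notin> val_ideal v" using Max_in[OF fin] \<open>j \<in> B\<close> unfolding m_def B_def by blast
  have above: "coeff q i \<in> val_ideal v" if "i > m" for i
    using Max_ge[OF fin, of i] that unfolding m_def B_def by auto
  have s: "(\<And>i. i \<in> I \<Longrightarrow> g i \<in> val_ideal v) \<Longrightarrow> sum g I \<in> val_ideal v" for g and I :: "nat set"
    by (induction I rule: infinite_finite_induct) (auto simp: val_ideal_closed)
  let ?d = "degree Q"
  define r where "r = (\<Sum>i\<in>{..?d + m} - {?d}. coeff Q i * coeff q (?d + m - i))"
  have r: "r \<in> val_ideal v" unfolding r_def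
  proof (rule s)
    fix i assume i: "i \<in> {..?d + m} - {?d}"
    show "coeff Q i * coeff q (?d + m - i) \<in> val_ideal v"
    proof (cases "i < ?d")
      case True
      then have "?d + m - i > m" by simp
      then show ?thesis using above Q(1) by (intro val_ideal_closed(3)) (simp_all add: integral_polys_def)
    next
      case False
      then have "coeff Q i = 0" using i by (intro coeff_eq_0) auto
      then show ?thesis using val_ideal_closed(1) by simp
    qed
  qed
  have "coeff (Q * q) (?d + m) = coeff q m + r"
    unfolding coeff_mult r_def by (subst sum.remove[of _ ?d]) (use Q(2) in auto)
  then have "coeff q m = coeff (Q * q) (?d + m) - r" by simp
  also have "\<dots> \<in> val_ideal v" using Q(3) by (intro val_ideal_closed(6) high r) simp
  finally show False using m by simp
qed

context semistable_cubic
begin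

text \<open>
  If \<open>[n]\<close> has maximal defect then \<open>G n\<close> is a constant, congruent to a power of \<open>P'\<close> modulo \<open>P\<close>. At a node
  this is impossible: \<open>P'\<close> vanishes at the double root of the reduction of \<open>P\<close>, but not at the simple one.
\<close>
lemma full_defect:
  assumes k: "k \<ge> 1" and full: "e (2 * k + 1) = (2 * k + 1)^2"
  shows "v D = 0 \<and> v (L (2 * k + 1)) = 0"
proof -
  note r = ring_setD[OF ring_V]
  define n where "n = 2 * k + 1"
  define N where "N = 2 * k * (k + 1)"
  define c where "c = L n"
  have n1: "n \<ge> 1" by (simp add: n_def)
  have "degree (G n) = 0" using degree_G[OF n1] full by (simp add: n_def)
  then have G: "G n = [:c:]" unfolding c_def L_def by (metis degree_eq_zeroE coeff_pCons_0)
  have cnz: "c \<noteq> 0" unfolding c_def by (rule L_nz[OF n1])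
  have cV: "c \<in> val_ring v" using G_integral(2)[of n] unfolding G integral_pCons by simp
  have Pw: "P' ^ N \<in> integral_polys v" by (rule integral_ring(10)[OF P_integral(2)])
  obtain q where q: "[:c:] - P' ^ N = P * q" using G_odd_mod_P[of k] G unfolding n_def N_def by (metis dvdE)
  have qi: "q \<in> integral_polys v"
    by (rule integral_divide_monic[OF P_integral(1) lead_P])
       (use integral_ring(4)[OF integral_ring(5)[OF cV] Pw] q in simp)
  have ev: "c = poly P' x ^ N + poly P x * poly q x" for x
    using arg_cong[OF q, of "\<lambda>g. poly g x"] by (simp add: algebra_simps)
  have vD: "v D = 0"
  proof (rule ccontr)
    assume "v D \<noteq> 0"
    then obtain a where a: "a \<in> val_ring v" "2 * (a2^2 - 3 * a4) * a = 9 * a6 - a2 * a4"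
      "a2^2 - 3 * a4 \<noteq> 0" "v (a2^2 - 3 * a4) = 0" "3 * a + a2 \<noteq> 0" "v (3 * a + a2) = 0" using node by blast
    define \<gamma> where "\<gamma> = 3 * a + a2"
    have g: "\<gamma> \<in> val_ring v" "\<gamma> \<notin> val_ideal v" "inverse \<gamma> \<in> val_ring v" "\<gamma> \<noteq> 0"
      using unitI[OF a(5,6)] a(5) unfolding \<gamma>_def by auto
    have E: "4 * (a2^2 - 3 * a4)^2 * poly P a = - (\<gamma> * D)" unfolding \<gamma>_def by (rule nodal_value[OF a(2,3)])
    have DI: "D \<in> val_ideal v" using \<open>v D \<noteq> 0\<close> D_V(2) by (simp add: val_ideal_def)
    have "v (2 * 2) = v 2 + v 2" by (rule v_mult[OF two two])
    then have v4: "v 4 = 0" using v_two by simp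
    define u where "u = 4 * (a2^2 - 3 * a4)^2"
    have "u \<noteq> 0" unfolding u_def using four a(3) by simp
    moreover have "v u = 0" unfolding u_def using v_mult[of 4 "(a2^2 - 3 * a4)^2"] v_power[OF a(3)] four a(3,4) v4 by simp
    ultimately have u: "inverse u \<in> val_ring v" "u \<noteq> 0" using unitI by auto
    have "poly P a = inverse u * (- (\<gamma> * D))" using E u(2) unfolding u_def by (simp add: field_simps)
    also have "\<dots> \<in> val_ideal v" by (intro val_ideal_closed(3)[OF u(1)] val_ideal_closed(5) val_ideal_closed(3)[OF g(1) DI])
    finally have Pa: "poly P a \<in> val_ideal v" .
    have "poly P' a = inverse \<gamma> * (9 * poly P a)"
      using nodal_slope(2)[OF a(2)] g(4) unfolding \<gamma>_def by (simp add: field_simps)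
    also have "\<dots> \<in> val_ideal v" by (intro val_ideal_closed(3)[OF g(3)] val_ideal_closed(3)[OF of_nat_V(2) Pa])
    finally have P'a: "poly P' a \<in> val_ideal v" .
    obtain N' where N': "N = Suc N'" using k unfolding N_def by (cases "2 * k * (k + 1)") auto
    have P'V: "poly P' x \<in> val_ring v" "poly q x \<in> val_ring v" if "x \<in> val_ring v" for x
      using poly_integral P_integral(2) qi that by auto
    have "poly P' a ^ N \<in> val_ideal v" unfolding N' power_Suc by (rule val_ideal_closed(4)[OF r(7)[OF P'V(1)[OF a(1)]] P'a])
    moreover have "poly P a * poly q a \<in> val_ideal v" by (rule val_ideal_closed(4)[OF P'V(2)[OF a(1)] Pa])
    ultimately have cI: "c \<in> val_ideal v" unfolding ev[of a] by (rule val_ideal_closed(2))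
    \<comment> \<open>This is -a2 - 2 a, the lift of the simple root, since the roots sum to -a2.
      Taylor expansion at a gives P(x1) = P(a) - \<gamma> P'(a) exactly.\<close>
    define x1 where "x1 = a - \<gamma>"
    have x1: "x1 \<in> val_ring v" unfolding x1_def by (rule r(6)[OF a(1) g(1)])
    have "poly P x1 = poly P a - \<gamma> * poly P' a"
      unfolding x1_def \<gamma>_def P_def P'_def by (simp add: power2_eq_square power3_eq_cube algebra_simps)
    also have "\<dots> \<in> val_ideal v" by (rule val_ideal_closed(6)[OF Pa val_ideal_closed(3)[OF g(1) P'a]])
    finally have Px1: "poly P x1 \<in> val_ideal v" .
    have e1: "poly P' x1 = poly P' a + \<gamma> * \<gamma>"
      unfolding x1_def \<gamma>_def P'_def by (simp add: algebra_simps)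
    have P'x1: "poly P' x1 \<notin> val_ideal v"
    proof
      assume "poly P' x1 \<in> val_ideal v"
      then have "poly P' x1 - poly P' a \<in> val_ideal v" by (rule val_ideal_closed(6)[OF _ P'a])
      then show False using unit_mult[OF g(1,2) g(1,2)] e1 by simp
    qed
    have "poly P' x1 ^ N = c - poly P x1 * poly q x1" using ev[of x1] by simp
    also have "\<dots> \<in> val_ideal v" by (rule val_ideal_closed(6)[OF cI val_ideal_closed(4)[OF P'V(2)[OF x1] Px1]])
    finally show False using unit_power[OF P'V(1)[OF x1] P'x1] by blast
  qed
  \<comment> \<open>Modulo P, disc(P)^N is congruent to (w P')^N and hence to c w^N. If c were in
    the maximal ideal, then disc(P)^N - c w^N would be a multiple of P that reduces to a constant;
    this forces disc(P)^N into the maximal ideal, although disc(P) is a unit.\<close>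
  have "c \<notin> val_ideal v"
  proof
    assume cI: "c \<in> val_ideal v"
    obtain u w where uw: "u * P + w * P' = [:D:]" "w \<in> integral_polys v"
    proof
      show "[:-4 * a2^3 + 15 * a2 * a4 - 27 * a6, 18 * a4 - 6 * a2^2:] * P +
        [:a2^2 * a4 - 4 * a4^2 + 3 * a2 * a6, 2 * a2^3 - 7 * a2 * a4 + 9 * a6, 2 * a2^2 - 6 * a4:] * P' = [:D:]"
        by (rule bezout_disc)
      show "[:a2^2 * a4 - 4 * a4^2 + 3 * a2 * a6, 2 * a2^3 - 7 * a2 * a4 + 9 * a6, 2 * a2^2 - 6 * a4:] \<in> integral_polys v"
        unfolding integral_pCons by (intro conjI r integral_cubic.cV[OF integral_cubic_axioms] of_nat_V integral_ring(7))
    qed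
    have "(w * P') ^ N mod P = [:D:] ^ N mod P"
      by (rule power_mod_cong) (simp add: mod_eq_dvd_iff flip: uw(1))
    then have "P dvd [:D:] ^ N - (w * P') ^ N" by (metis mod_eq_dvd_iff)
    moreover have "[:D:] ^ N - (w * P') ^ N = [:D ^ N:] - smult c (w ^ N) + w ^ N * ([:c:] - P' ^ N)"
      by (simp add: poly_const_pow power_mult_distrib algebra_simps)
    ultimately have "P dvd [:D ^ N:] - smult c (w ^ N)" unfolding q by (metis dvd_add_left_iff dvd_mult dvd_triv_left)
    then obtain q' where q': "[:D ^ N:] - smult c (w ^ N) = P * q'" by (elim dvdE)
    have wN: "w ^ N \<in> integral_polys v" by (rule integral_ring(10)[OF uw(2)])
    have qi': "q' \<in> integral_polys v"
      by (rule integral_divide_monic[OF P_integral(1) lead_P])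
         (unfold q'[symmetric], rule integral_ring(4)[OF integral_ring(5)[OF r(7)[OF D_V(1)]] integral_ring(9)[OF cV wN]])
    have cw: "c * coeff (w ^ N) i \<in> val_ideal v" for i
      using wN by (intro val_ideal_closed(4)[OF _ cI]) (simp add: integral_polys_def)
    have "coeff q' j \<in> val_ideal v" for j
    proof (rule monic_multiple_constant[OF P_integral(1) lead_P _ qi'])
      fix i :: nat assume "i \<ge> 1"
      then have "coeff (P * q') i = - (c * coeff (w ^ N) i)" unfolding q'[symmetric] by (cases i) simp_all
      then show "coeff (P * q') i \<in> val_ideal v" using val_ideal_closed(5)[OF cw] by simp
    qed simp
    then have "a6 * coeff q' 0 \<in> val_ideal v" using integral_cubic.cV(3)[OF integral_cubic_axioms] by (intro val_ideal_closed(3))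
    moreover have "D ^ N = a6 * coeff q' 0 + c * coeff (w ^ N) 0"
    proof -
      have "coeff ([:D ^ N:] - smult c (w ^ N)) 0 = coeff (P * q') 0" unfolding q' ..
      then show ?thesis by (simp add: coeff_mult P_def algebra_simps)
    qed
    ultimately have "D ^ N \<in> val_ideal v" using val_ideal_closed(2)[OF _ cw[of 0]] by simp
    then show False using unit_power[OF D_V(1)] unitI[OF disc vD] by blast
  qed
  then have "v c = 0" using val_unit[OF cV] by blast
  then show ?thesis using vD unfolding c_def n_def by simp
qed

lemma e_L_unit:
  assumes "of_nat m \<notin> val_ideal v"
  shows "e m = 1" "v (L m) = 0" "L m \<noteq> 0"
proof -
  have m: "of_nat m \<noteq> (0 :: 'k)" "v (of_nat m) = 0" using val_unit[OF of_nat_V(1) assms] by auto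
  show "e m = 1" "v (L m) = 0" "L m \<noteq> 0" using e_L_of_nat[OF m(1)] m v_power[OF m(1), of 2] by auto
qed

text \<open>For n = p^k m with m a unit, \<open>e n\<close> is (e p)^k, and v(L n) is the k-th term
  of the recursion that multiplies by \<open>e p\<close> and adds v(L p). Both grow like powers of
  \<open>e p\<close>, up to a factor that the choice of s below absorbs.\<close>

lemma growth:
  "\<exists>\<theta> B. 0 \<le> \<theta> \<and> \<theta> < 2 \<and> 0 \<le> B \<and> (\<forall>n\<ge>1. real_of_int (v (L n)) \<le> B * real n powr \<theta> \<and>
     real (e n) * real_of_int (v D) \<le> B * real n powr \<theta>)"
proof (cases "\<exists>n\<ge>1. (of_nat n :: 'k) \<in> val_ideal v")
  case False
  then have "real_of_int (v (L n)) \<le> v D * real n powr 0 \<and> real (e n) * real_of_int (v D) \<le> v D * real n powr 0" if "n \<ge> 1" for n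
    using e_L_unit[of n] that D_V(2) by simp
  then show ?thesis using D_V(2) by (intro exI[of _ 0] exI[of _ "real_of_int (v D)"]) auto
next
  case True
  \<comment> \<open>The residue characteristic, as the least positive integer in the maximal
    ideal.\<close>
  define p where "p = (LEAST n. n \<ge> 1 \<and> (of_nat n :: 'k) \<in> val_ideal v)"
  have p: "p \<ge> 1" "(of_nat p :: 'k) \<in> val_ideal v"
    using LeastI_ex[OF True] unfolding p_def by auto
  have small: "(of_nat j :: 'k) \<notin> val_ideal v" if "j \<ge> 1" "j < p" for j
    using not_less_Least[of j] that unfolding p_def by blast
  have p1: "p \<noteq> 1" using p(2) val_ideal_closed(7) by auto
  have unit: "(of_nat m :: 'k) \<notin> val_ideal v" if m: "\<not> p dvd m" for m
  proof
    assume mI: "(of_nat m :: 'k) \<in> val_ideal v"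
    have "m = p * (m div p) + m mod p" by simp
    then have "(of_nat m :: 'k) = of_nat p * of_nat (m div p) + of_nat (m mod p)" by (metis of_nat_add of_nat_mult)
    then have "(of_nat (m mod p) :: 'k) = of_nat m - of_nat p * of_nat (m div p)" by simp
    also have "\<dots> \<in> val_ideal v" by (rule val_ideal_closed(6)[OF mI val_ideal_closed(4)[OF of_nat_V(1) p(2)]])
    finally show False using small[of "m mod p"] m p(1) by (auto simp: dvd_eq_mod_eq_0)
  qed
  have "odd p"
  proof
    assume "even p"
    then obtain i where i: "p = 2 * i" by (elim evenE)
    then have "(of_nat i :: 'k) \<notin> val_ideal v" using small[of i] p(1) by auto
    moreover have "(2 :: 'k) \<notin> val_ideal v" using unitI[OF two v_two] by simp
    ultimately have "2 * (of_nat i :: 'k) \<notin> val_ideal v" using unit_mult[OF of_nat_V(2) _ of_nat_V(1)] by blast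
    then show False using p(2) i by simp
  qed
  then obtain l where l: "p = 2 * l + 1" by (elim oddE)
  have l1: "l \<ge> 1" using l p1 by auto
  define E where "E = e p"
  define w where "w = v (L p)"
  have w0: "0 \<le> w" unfolding w_def by (rule L_V[OF p(1)])
  have pk: "p ^ k \<ge> 1" for k using p(1) by simp
  have ep: "e (p ^ k) = E ^ k" for k
  proof (induction k)
    case 0
    then show ?case using e_L_of_nat[of 1] by simp
  next
    case (Suc k)
    then show ?case using e_L_mult(1)[OF pk[of k] p(1)] by (simp add: E_def)
  qed
  have wp: "v (L (p ^ Suc k)) = w + E * v (L (p ^ k))" for k
    using e_L_mult(2)[OF pk[of k] p(1)] v_mult[OF L_nz[OF p(1)], of "L (p ^ k) ^ E"] v_power[OF L_nz[OF pk[of k]], of E] L_nz[OF pk[of k]]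
    by (simp add: E_def w_def)
  have w00: "v (L (p ^ 0)) = 0" using e_L_of_nat[of 1] by simp
  have dec: "\<exists>k. p ^ k \<le> n \<and> e n = E ^ k \<and> v (L n) = v (L (p ^ k))" if n: "n \<ge> 1" for n
  proof -
    have "\<not> is_unit p" "n \<noteq> 0" using p1 n by auto
    then obtain m where m: "n = p ^ multiplicity p n * m" "\<not> p dvd m" by (metis multiplicity_decompose')
    define k where "k = multiplicity p n"
    have m1: "m \<ge> 1" using m(1) n by (cases m) auto
    note um = e_L_unit[OF unit[OF m(2)]]
    have nk: "n = p ^ k * m" using m(1) by (simp add: k_def)
    have "e n = E ^ k" unfolding nk e_L_mult(1)[OF m1 pk] um(1) ep by simp
    moreover have "v (L n) = v (L (p ^ k))"
      unfolding nk e_L_mult(2)[OF m1 pk] using v_mult[OF L_nz[OF pk[of k]], of "L m ^ e (p ^ k)"] v_power[OF um(3)] um by simp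
    moreover have "p ^ k \<le> n" unfolding nk using m1 by simp
    ultimately show ?thesis by blast
  qed
  show ?thesis
  proof (cases "E = p^2")
    case True
    then have fd: "v D = 0" "w = 0" using full_defect[OF l1] unfolding E_def w_def l by auto
    have "v (L (p ^ k)) = 0" for k by (induction k) (use w00 wp fd in \<open>simp_all del: power_Suc\<close>)
    then have "v (L n) = 0" if "n \<ge> 1" for n using dec[OF that] by auto
    then show ?thesis using fd by (intro exI[of _ 0]) auto
  next
    case False
    have "E \<le> p^2" unfolding E_def e_def by simp
    then have "E < p^2" using False by simp
    then have "E + 1 \<le> p^2" by simp
    then have "real (E + 1) \<le> real (p^2)" by (simp only: of_nat_le_iff)
    then have Ep: "real E + 1 \<le> real p ^ 2" by simp
    have E1: "E \<ge> 1" unfolding E_def by (rule e_pos[OF p(1)])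
    \<comment> \<open>A number strictly between \<open>e p\<close> and p^2, so that \<theta> < 2.
      The margin 1/2 absorbs the summand w of the recursion: w s^k + E (2 w s^k) = 2 w s^(k+1). For
      E = 1 the valuations grow linearly in k, so a base larger than E is required.\<close>
    define s where "s = real E + 1 / 2"
    define \<theta> where "\<theta> = log (real p) s"
    have pr: "real p > 1" using p(1) p1 by simp
    have s1: "s \<ge> 1" "s < real p ^ 2" using E1 Ep by (auto simp: s_def)
    have \<theta>0: "0 \<le> \<theta>" unfolding \<theta>_def using pr s1 by simp
    have "real p powr \<theta> = s" unfolding \<theta>_def using pr s1 by simp
    have "\<theta> < log (real p) (real p ^ 2)" unfolding \<theta>_def using pr s1 by (subst log_less_cancel_iff) auto
    also have "log (real p) (real p ^ 2) = 2" using pr by (simp add: log_nat_power)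
    finally have \<theta>2: "\<theta> < 2" .
    have sk: "s ^ k \<le> real n powr \<theta>" if "p ^ k \<le> n" for k n
    proof -
      have "s ^ k = (real p powr \<theta>) powr real k" using \<open>real p powr \<theta> = s\<close> s1 by (simp add: powr_realpow)
      also have "\<dots> = (real p powr real k) powr \<theta>" by (simp add: powr_powr mult.commute)
      also have "real p powr real k = real p ^ k" using pr by (simp add: powr_realpow)
      also have "(real p ^ k) powr \<theta> \<le> real n powr \<theta>"
      proof (rule powr_mono2[OF \<theta>0])
        have "real (p ^ k) \<le> real n" using that by (simp only: of_nat_le_iff)
        then show "real p ^ k \<le> real n" by simp
      qed (use pr in simp)
      finally show ?thesis .
    qed
    have wk: "real_of_int (v (L (p ^ k))) \<le> 2 * w * s ^ k" for k
    proof (induction k)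
      case 0
      then show ?case using w00 w0 by simp
    next
      case (Suc k)
      have "s ^ k \<ge> 1" using s1 by simp
      then have ws: "real_of_int w \<le> w * s ^ k" using w0 mult_left_mono[of 1 "s ^ k" "real_of_int w"] by simp
      have "real_of_int (v (L (p ^ Suc k))) = w + E * real_of_int (v (L (p ^ k)))" unfolding wp by simp
      also have "\<dots> \<le> w * s ^ k + E * (2 * w * s ^ k)" by (intro add_mono ws mult_left_mono Suc) simp
      also have "\<dots> = 2 * w * s ^ Suc k" by (simp add: s_def algebra_simps)
      finally show ?case .
    qed
    define B where "B = 2 * real_of_int w + real_of_int (v D)"
    have B: "2 * w \<le> B" "v D \<le> B" "0 \<le> B" using w0 D_V(2) by (auto simp: B_def)
    have "real_of_int (v (L n)) \<le> B * real n powr \<theta> \<and> real (e n) * real_of_int (v D) \<le> B * real n powr \<theta>" if n: "n \<ge> 1" for n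
    proof -
      obtain k where k: "p ^ k \<le> n" "e n = E ^ k" "v (L n) = v (L (p ^ k))" using dec[OF n] by blast
      have "real_of_int (v (L n)) \<le> 2 * w * s ^ k" unfolding k(3) by (rule wk)
      also have "\<dots> \<le> B * real n powr \<theta>" using B sk[OF k(1)] w0 s1 by (intro mult_mono) auto
      finally have 1: "real_of_int (v (L n)) \<le> B * real n powr \<theta>" .
      have "real (e n) = real E ^ k" unfolding k(2) by simp
      also have "\<dots> \<le> s ^ k" by (rule power_mono) (simp_all add: s_def)
      also have "\<dots> \<le> real n powr \<theta>" by (rule sk[OF k(1)])
      finally have "real (e n) * real_of_int (v D) \<le> real n powr \<theta> * B" using B D_V(2) by (intro mult_mono) auto
      then show ?thesis using 1 by (simp add: mult.commute)
    qed
    then show ?thesis using \<theta>0 \<theta>2 B(3) by blast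
  qed
qed

lemma intersection_limit:
  "(\<lambda>n. 1 / (real n)^2 * real (intersection_number v (zero_scheme v P) (torsion_closure v (Weierstrass 0 a2 0 a4 a6) n)))
     \<longlonglongrightarrow> 1 / 2 * real_of_int (v D)"
proof -
  define I where "I n = real (intersection_number v (zero_scheme v P) (torsion_closure v (Weierstrass 0 a2 0 a4 a6) n))" for n
  define C where "C = real fibre_weight"
  define d where "d = real_of_int (v D)"
  have d0: "d \<ge> 0" and nd: "real (nat (v D)) = d" using D_V(2) by (auto simp: d_def)
  have C0: "C \<ge> 0" by (simp add: C_def)
  obtain \<theta> B where tB: "0 \<le> \<theta>" "\<theta> < 2" "0 \<le> B" "\<And>n. n \<ge> 1 \<Longrightarrow> real_of_int (v (L n)) \<le> B * real n powr \<theta>"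
    "\<And>n. n \<ge> 1 \<Longrightarrow> real (e n) * d \<le> B * real n powr \<theta>"
    using growth unfolding d_def by blast
  \<comment> \<open>The term d / 2 comes from the exponent (n^2 - 1) / 2 for odd n. The factor C
    accounts for contents and leading coefficients, and the 2 for the defect \<open>e k\<close> with
    n = 2 k.\<close>
  have bound: "\<bar>I n - (real n)^2 / 2 * d\<bar> \<le> d / 2 + (C + 2) * (B * real n powr \<theta>)" if n: "n \<ge> 1" for n
  proof (cases "odd n")
    case True
    then obtain k where k: "n = 2 * k + 1" by (elim oddE)
    obtain j where j: "j \<le> nat (v (L n))" "intersection_number v (zero_scheme v P) (torsion_closure v (Weierstrass 0 a2 0 a4 a6) n) + j * fibre_weight
      = 2 * k * (k + 1) * nat (v D)" using intersection_odd[of k] unfolding k by blast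
    have "I n + real j * C = 2 * real k * (real k + 1) * d"
      using arg_cong[OF j(2), of real] nd by (simp add: I_def C_def algebra_simps)
    moreover have "(real n)^2 / 2 * d = 2 * real k * (real k + 1) * d + d / 2"
      unfolding k by (simp add: power2_eq_square algebra_simps)
    ultimately have eq: "I n - (real n)^2 / 2 * d = - (real j * C) - d / 2" by linarith
    have "real j \<le> real_of_int (v (L n))" using j(1) L_V[OF n] by linarith
    then have "real j \<le> B * real n powr \<theta>" using tB(4)[OF n] by simp
    then have "real j * C \<le> (B * real n powr \<theta>) * C" by (rule mult_right_mono[OF _ C0])
    moreover have "0 \<le> real j * C" using C0 by simp
    moreover have "0 \<le> B * real n powr \<theta>" using tB(3) by simp
    ultimately show ?thesis unfolding eq using d0 by (simp add: algebra_simps)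
  next
    case False
    then obtain k where k: "n = 2 * k" by auto
    then have k1: "k \<ge> 1" using n by simp
    obtain j where j: "j \<le> nat (v (L k))" "intersection_number v (zero_scheme v P) (torsion_closure v (Weierstrass 0 a2 0 a4 a6) n) + j * fibre_weight
      = nat (v (L k)) * fibre_weight + 2 * degree (G k) * nat (v D)" using intersection_even[OF k1] unfolding k by blast
    have "e k \<le> k^2" unfolding e_def by simp
    then have dG: "real (degree (G k)) = (real k)^2 - real (e k)" unfolding degree_G[OF k1] by (simp add: of_nat_diff)
    have "I n + real j * C = real (nat (v (L k))) * C + 2 * real (degree (G k)) * d"
      using arg_cong[OF j(2), of real] nd by (simp add: I_def C_def)
    moreover have "(real n)^2 / 2 * d = 2 * (real k)^2 * d" unfolding k by (simp add: power2_eq_square)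
    ultimately have eq: "I n - (real n)^2 / 2 * d = (real (nat (v (L k))) - real j) * C - 2 * (real (e k) * d)"
      unfolding dG left_diff_distrib right_diff_distrib by (simp only: mult.assoc)
    have kn: "real k powr \<theta> \<le> real n powr \<theta>" by (rule powr_mono2[OF tB(1)]) (use k in auto)
    have Bk: "B * real k powr \<theta> \<le> B * real n powr \<theta>" by (rule mult_left_mono[OF kn tB(3)])
    have "real (nat (v (L k))) - real j \<le> B * real n powr \<theta>" using tB(4)[OF k1] L_V[OF k1] Bk by simp
    then have 1: "(real (nat (v (L k))) - real j) * C \<le> (B * real n powr \<theta>) * C" by (rule mult_right_mono[OF _ C0])
    have 2: "0 \<le> (real (nat (v (L k))) - real j) * C" using j(1) C0 by simp
    have 3: "real (e k) * d \<le> B * real n powr \<theta>" using tB(5)[OF k1] Bk by simp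
    have 4: "0 \<le> real (e k) * d" using d0 by simp
    have 5: "0 \<le> (B * real n powr \<theta>) * C" using tB(3) C0 by simp
    have 6: "(C + 2) * (B * real n powr \<theta>) = (B * real n powr \<theta>) * C + 2 * (B * real n powr \<theta>)"
      by (simp only: distrib_right mult.commute)
    show ?thesis unfolding eq 6 using 1 2 3 4 5 d0 by linarith
  qed
  have "(\<lambda>n. 1 / (real n)^2 * I n - 1 / 2 * d) \<longlonglongrightarrow> 0"
  proof (rule Lim_null_comparison)
    show "\<forall>\<^sub>F n in sequentially. norm (1 / (real n)^2 * I n - 1 / 2 * d)
        \<le> d / 2 * real n powr (-2) + (C + 2) * B * real n powr (\<theta> - 2)"
    proof (rule eventually_mono[OF eventually_ge_at_top[of 1]])
      fix n :: nat assume n: "1 \<le> n"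
      have n2: "real n powr (-2) = 1 / (real n)^2" using n by (simp add: powr_minus_divide)
      have "1 / (real n)^2 * I n - 1 / 2 * d = (I n - (real n)^2 / 2 * d) * (1 / (real n)^2)" using n by (simp add: field_simps)
      then have "norm (1 / (real n)^2 * I n - 1 / 2 * d) = \<bar>I n - (real n)^2 / 2 * d\<bar> * (1 / (real n)^2)"
        by (simp add: abs_mult)
      also have "\<dots> \<le> (d / 2 + (C + 2) * (B * real n powr \<theta>)) * (1 / (real n)^2)"
        by (rule mult_right_mono[OF bound[OF n]]) simp
      also have "\<dots> = d / 2 * real n powr (-2) + (C + 2) * B * (real n powr \<theta> * real n powr (-2))"
        unfolding n2 by (simp only: distrib_right mult.assoc)
      also have "real n powr \<theta> * real n powr (-2) = real n powr (\<theta> - 2)" by (simp flip: powr_add)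
      finally show "norm (1 / (real n)^2 * I n - 1 / 2 * d)
        \<le> d / 2 * real n powr (-2) + (C + 2) * B * real n powr (\<theta> - 2)" .
    qed
    have "(\<lambda>n. real n powr (-2)) \<longlonglongrightarrow> 0" "(\<lambda>n. real n powr (\<theta> - 2)) \<longlonglongrightarrow> 0"
      by (rule tendsto_neg_powr[OF _ filterlim_real_sequentially]; use tB(2) in simp)+
    then show "(\<lambda>n. d / 2 * real n powr (-2) + (C + 2) * B * real n powr (\<theta> - 2)) \<longlonglongrightarrow> 0"
      by (intro tendsto_add_zero tendsto_mult_right_zero)
  qed
  then show ?thesis unfolding I_def d_def by (rule LIM_zero_cancel)
qed

end

section \<open>Reduction\<close>

lemma discriminant_eq_cubic_disc: "discriminant (Weierstrass 0 a2 0 a4 a6) = 16 * cubic_disc a2 a4 a6"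
  by (simp add: discriminant_def cubic_disc_def power2_eq_square power3_eq_cube algebra_simps)

lemma singular_point_iff:
  "singular_point (Weierstrass 0 b2 0 b4 b6) x y \<longleftrightarrow>
     y^2 = x^3 + b2 * x^2 + b4 * x + b6 \<and> 3 * x^2 + 2 * b2 * x + b4 = 0 \<and> 2 * y = 0"
  by (simp only: singular_point_def weierstrass_fun_def weierstrass.sel mult_zero_left add_0_left add_0_right
      diff_0 neg_equal_0_iff_equal right_minus_eq)

text \<open>The equation y^2 = P(x) has no mixed term, so the slopes of the two tangents are
  opposite; being distinct, they exclude characteristic 2, and then y = 0. Comparing quadratic
  terms, \<alpha>^2 = 3 x + b2. The last two formulas restate P(x) = P'(x) = 0.\<close>

lemma node_slopes:
  fixes b2 b4 b6 :: "'f::field"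
  assumes "node (Weierstrass 0 b2 0 b4 b6) x y"
  shows "(2 :: 'f) \<noteq> 0" "3 * x + b2 \<noteq> 0" "b2^2 - 3 * b4 = (3 * x + b2)^2" "2 * (b2^2 - 3 * b4) * x = 9 * b6 - b2 * b4"
proof -
  obtain \<alpha> \<beta> where ab: "\<alpha> \<noteq> \<beta>" and fact: "\<And>s t. weierstrass_fun (Weierstrass 0 b2 0 b4 b6) s t =
      ((t - y) - \<alpha> * (s - x)) * ((t - y) - \<beta> * (s - x)) - (s - x)^3"
    and sing: "y^2 = x^3 + b2 * x^2 + b4 * x + b6" "3 * x^2 + 2 * b2 * x + b4 = 0" "2 * y = 0"
    using assms unfolding node_def singular_point_iff by blast
  have F: "(y + t)^2 - ((x + s)^3 + b2 * (x + s)^2 + b4 * (x + s) + b6) = (t - \<alpha> * s) * (t - \<beta> * s) - s^3" for s t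
    using fact[of "x + s" "y + t"] by (simp add: weierstrass_fun_def)
  \<comment> \<open>This combination of four values extracts the coefficient of s t, which is 0 for
    the equation and -(\<alpha> + \<beta>) for the product of tangents.\<close>
  have "((y + 1)^2 - ((x + 1)^3 + b2 * (x + 1)^2 + b4 * (x + 1) + b6))
      - ((y + 0)^2 - ((x + 1)^3 + b2 * (x + 1)^2 + b4 * (x + 1) + b6))
      - ((y + 1)^2 - ((x + 0)^3 + b2 * (x + 0)^2 + b4 * (x + 0) + b6))
      + ((y + 0)^2 - ((x + 0)^3 + b2 * (x + 0)^2 + b4 * (x + 0) + b6)) = - (\<alpha> + \<beta>)"
    unfolding F by (simp add: algebra_simps)
  then have sum: "\<beta> = - \<alpha>" by (simp add: algebra_simps eq_neg_iff_add_eq_0)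
  show two: "(2 :: 'f) \<noteq> 0"
  proof
    assume "(2 :: 'f) = 0"
    then have "\<alpha> + \<alpha> = 0" by (metis mult_2 mult_zero_left)
    then show False using ab sum by (simp add: eq_neg_iff_add_eq_0)
  qed
  then have \<alpha>: "\<alpha> \<noteq> 0" using ab sum by auto
  have "y = 0" using sing(3) two by simp
  then have "\<alpha>^2 = (x + 1)^3 + b2 * (x + 1)^2 + b4 * (x + 1) + b6 - 1"
    using F[of 0 1] unfolding sum by (simp add: power2_eq_square algebra_simps)
  also have "\<dots> = (x^3 + b2 * x^2 + b4 * x + b6) + (3 * x^2 + 2 * b2 * x + b4) + (3 * x + b2)"
    by (simp add: power2_eq_square power3_eq_cube algebra_simps)
  also have "\<dots> = 3 * x + b2" using sing \<open>y = 0\<close> by simp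
  finally show "3 * x + b2 \<noteq> 0" using \<alpha> by auto
  have "(3 * x + b2)^2 = b2^2 - 3 * b4 + 3 * (3 * x^2 + 2 * b2 * x + b4)"
    by (simp add: power2_eq_square algebra_simps)
  then show "b2^2 - 3 * b4 = (3 * x + b2)^2" using sing(2) by simp
  have Px: "x^3 + b2 * x^2 + b4 * x + b6 = 0" using sing(1) \<open>y = 0\<close> by simp
  have "9 * (x^3 + b2 * x^2 + b4 * x + b6) - (3 * x + b2) * (3 * x^2 + 2 * b2 * x + b4)
      = 9 * b6 - b2 * b4 - 2 * (b2^2 - 3 * b4) * x"
    by (simp add: power2_eq_square power3_eq_cube algebra_simps)
  then have "9 * b6 - b2 * b4 - 2 * (b2^2 - 3 * b4) * x = 0" unfolding Px sing(2) by (metis diff_self mult_zero_right)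
  then show "2 * (b2^2 - 3 * b4) * x = 9 * b6 - b2 * b4" by (metis right_minus_eq)
qed

text \<open>Split the cubic into linear factors; its discriminant is the square of the product of
  the root differences, and a double root with y = 0 is a singular point.\<close>

lemma singular_if_disc_zero:
  fixes b2 b4 b6 :: "'f::alg_closed_field"
  assumes "cubic_disc b2 b4 b6 = 0"
  shows "\<exists>x. singular_point (Weierstrass 0 b2 0 b4 b6) x 0"
proof -
  obtain r where r: "poly [:b6, b4, b2, 1:] r = 0" using alg_closed_imp_poly_has_root[of "[:b6, b4, b2, 1:]"] by auto
  obtain s where s: "poly [:b4 + r * (b2 + r), b2 + r, 1:] s = 0"
    using alg_closed_imp_poly_has_root[of "[:b4 + r * (b2 + r), b2 + r, 1:]"] by auto
  define t where "t = - b2 - r - s"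
  have b2: "b2 = - (r + s + t)" by (simp add: t_def)
  have "b4 = - (s * (b2 + r + s) + r * (b2 + r))" using s by (simp add: algebra_simps eq_neg_iff_add_eq_0)
  then have b4: "b4 = r * s + r * t + s * t" unfolding b2 by (simp add: algebra_simps)
  have "b6 = - (r * (b4 + r * (b2 + r)))" using r by (simp add: algebra_simps eq_neg_iff_add_eq_0)
  then have b6: "b6 = - (r * s * t)" unfolding b4 b2 by (simp add: algebra_simps)
  have "cubic_disc b2 b4 b6 = ((r - s) * (r - t) * (s - t))^2"
    unfolding b2 b4 b6 cubic_disc_def by (simp add: power2_eq_square power3_eq_cube algebra_simps)
  then have "r = s \<or> r = t \<or> s = t" using assms by auto
  moreover have "singular_point (Weierstrass 0 b2 0 b4 b6) r 0" if "r = s \<or> r = t"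
    using that unfolding singular_point_iff b2 b4 b6 by (auto simp: power2_eq_square power3_eq_cube algebra_simps)
  moreover have "singular_point (Weierstrass 0 b2 0 b4 b6) s 0" if "s = t"
    unfolding singular_point_iff b2 b4 b6 that by (simp add: power2_eq_square power3_eq_cube algebra_simps)
  ultimately show ?thesis by blast
qed

text \<open>In characteristic 2 the condition 2 y = 0 is void: take a root x of P', which exists
  since 3 is nonzero, and for y a square root of P(x).\<close>

lemma singular_if_char_two:
  fixes b2 b4 b6 :: "'f::alg_closed_field"
  assumes two: "(2 :: 'f) = 0"
  shows "\<exists>x y. singular_point (Weierstrass 0 b2 0 b4 b6) x y"
proof -
  have three: "(3 :: 'f) \<noteq> 0"
  proof
    assume "(3 :: 'f) = 0"
    then have "(3 :: 'f) - 2 = 0" using two by simp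
    then show False by simp
  qed
  obtain x where x: "poly [:b4, 2 * b2, 3:] x = 0"
    using alg_closed_imp_poly_has_root[of "[:b4, 2 * b2, 3:]"] three by auto
  define c where "c = x^3 + b2 * x^2 + b4 * x + b6"
  obtain y where "poly [:- c, 0, 1:] y = 0" using alg_closed_imp_poly_has_root[of "[:- c, 0, 1:]"] by auto
  then have "y^2 = c" by (simp add: power2_eq_square)
  moreover have "3 * x^2 + 2 * b2 * x + b4 = 0" using x by (simp add: power2_eq_square algebra_simps)
  moreover have "2 * y = 0" using two by simp
  ultimately show ?thesis unfolding singular_point_iff c_def by blast
qed

text \<open>Applied to the residue map followed by the embedding into an algebraic closure of the
  residue field, where semi-stability is formulated.\<close>

locale reduction = dvr v for v :: "'k::field \<Rightarrow> int" +
  fixes \<rho> :: "'k \<Rightarrow> 'l::field"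
  assumes one: "\<rho> 1 = 1"
    and add: "x \<in> val_ring v \<Longrightarrow> y \<in> val_ring v \<Longrightarrow> \<rho> (x + y) = \<rho> x + \<rho> y"
    and mult: "x \<in> val_ring v \<Longrightarrow> y \<in> val_ring v \<Longrightarrow> \<rho> (x * y) = \<rho> x * \<rho> y"
    and ker: "x \<in> val_ring v \<Longrightarrow> \<rho> x = 0 \<longleftrightarrow> x \<in> val_ideal v"
begin

lemma diff: "x \<in> val_ring v \<Longrightarrow> y \<in> val_ring v \<Longrightarrow> \<rho> (x - y) = \<rho> x - \<rho> y"
  using add[of "x - y" y] ring_setD(6)[OF ring_V, of x y] by simp

lemma power: "x \<in> val_ring v \<Longrightarrow> \<rho> (x ^ n) = \<rho> x ^ n"
  by (induction n) (simp_all add: one mult ring_setD(7)[OF ring_V])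

lemma numeral: "\<rho> (numeral n) = numeral n"
proof -
  have zero: "\<rho> 0 = 0" using ker[of 0] by (simp add: val_ring_def val_ideal_def)
  have "\<rho> (of_nat m) = of_nat m" for m
  proof (induction m)
    case (Suc m)
    then show ?case using add[OF ring_setD(1)[OF ring_V] of_nat_V(1)[of m]] by (simp add: one)
  qed (simp add: zero)
  from this[of "numeral n"] show ?thesis by simp
qed

lemmas closed = ring_setD(4,6,7)[OF ring_V] of_nat_V(2)

lemma disc_hom:
  assumes "a2 \<in> val_ring v" "a4 \<in> val_ring v" "a6 \<in> val_ring v"
  shows "\<rho> (cubic_disc a2 a4 a6) = cubic_disc (\<rho> a2) (\<rho> a4) (\<rho> a6)"
proof -
  note hom = add diff mult power numeral closed ring_setD(3)[OF ring_V]
  show ?thesis unfolding cubic_disc_def by (simp add: hom assms)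
qed

end

text \<open>A singular point of the reduction is a node, which excludes residue characteristic 2. If
  disc(P) reduces to 0, there is a node with y = 0; the formula for its x-coordinate has unit
  coefficients 2 and a2^2 - 3 a4 over V, so the same formula defines the integral lift a.\<close>

lemma semistable_cubicI:
  fixes v :: "'k::field \<Rightarrow> int" and red :: "'k \<Rightarrow> 'r::field"
  assumes v: "discrete_valuation v" and red: "residue_map v red"
    and ell: "elliptic_curve (Weierstrass 0 a2 0 a4 a6)" and int: "integral_equation v (Weierstrass 0 a2 0 a4 a6)"
    and sst: "semistable_reduction red (Weierstrass 0 a2 0 a4 a6)"
  shows "semistable_cubic v a2 a4 a6"
proof -
  interpret dvr v by unfold_locales (rule v)
  note rV = ring_setD[OF ring_V]
  have cV: "a2 \<in> val_ring v" "a4 \<in> val_ring v" "a6 \<in> val_ring v"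
    using int by (auto simp: integral_equation_def)
  have ns: "\<not> singular_point (Weierstrass 0 (to_ac a2) 0 (to_ac a4) (to_ac a6)) x y" for x y
    using ell by (simp add: elliptic_curve_def)
  have two: "(2 :: 'k) \<noteq> 0"
  proof
    assume "(2 :: 'k) = 0"
    then have "to_ac (2 :: 'k) = 0" by simp
    then show False using singular_if_char_two[of "to_ac a2" "to_ac a4" "to_ac a6"] ns by simp
  qed
  have disc: "cubic_disc a2 a4 a6 \<noteq> 0"
  proof
    assume "cubic_disc a2 a4 a6 = 0"
    then have "to_ac (cubic_disc a2 a4 a6) = 0" by simp
    then have "cubic_disc (to_ac a2) (to_ac a4) (to_ac a6) = 0" by (simp add: cubic_disc_def)
    then show False using singular_if_disc_zero ns by blast
  qed
  define \<rho> where "\<rho> x = to_ac (red x)" for x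
  interpret reduction v \<rho>
    using red by unfold_locales (auto simp: \<rho>_def residue_map_def)
  have nodal: "node (Weierstrass 0 (\<rho> a2) 0 (\<rho> a4) (\<rho> a6)) x y" if "singular_point (Weierstrass 0 (\<rho> a2) 0 (\<rho> a4) (\<rho> a6)) x y" for x y
  proof -
    have "\<rho> 0 = 0" using ker[of 0] by (simp add: val_ring_def val_ideal_def)
    then show ?thesis using sst that by (simp add: semistable_reduction_def \<rho>_def Let_def)
  qed
  have "(2 :: 'r alg_closure) \<noteq> 0"
    using singular_if_char_two[of "\<rho> a2" "\<rho> a4" "\<rho> a6"] nodal node_slopes(1) by blast
  then have u2: "2 \<notin> val_ideal v" using ker[OF of_nat_V(2)] numeral by metis
  then have v2: "v 2 = 0" using val_unit[OF of_nat_V(2)] by blast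
  show ?thesis
  proof (unfold_locales)
    show "2 \<noteq> (0 :: 'k)" by (rule two)
    show "cubic_disc a2 a4 a6 \<noteq> 0" by (rule disc)
    show "a2 \<in> val_ring v" "a4 \<in> val_ring v" "a6 \<in> val_ring v" by (rule cV)+
    show "v 2 = 0" by (rule v2)
    let ?E = "a2^2 - 3 * a4"
    show "v (cubic_disc a2 a4 a6) = 0 \<or>
      (\<exists>a\<in>val_ring v. 2 * ?E * a = 9 * a6 - a2 * a4 \<and>
        ?E \<noteq> 0 \<and> v ?E = 0 \<and> 3 * a + a2 \<noteq> 0 \<and> v (3 * a + a2) = 0)"
    proof (cases "cubic_disc a2 a4 a6 \<in> val_ideal v")
      case False
      have "cubic_disc a2 a4 a6 \<in> val_ring v" unfolding cubic_disc_def by (intro rV cV of_nat_V)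
      then show ?thesis using val_unit False by blast
    next
      case True
      have "\<rho> (cubic_disc a2 a4 a6) = 0" using True ker val_ideal_closed(8) by blast
      then have "cubic_disc (\<rho> a2) (\<rho> a4) (\<rho> a6) = 0" unfolding disc_hom[OF cV] .
      then obtain x where x: "singular_point (Weierstrass 0 (\<rho> a2) 0 (\<rho> a4) (\<rho> a6)) x 0"
        using singular_if_disc_zero by blast
      note n = node_slopes[OF nodal[OF x]]
      have EV: "?E \<in> val_ring v" by (intro rV cV of_nat_V)
      have \<rho>E: "\<rho> ?E = (\<rho> a2)^2 - 3 * \<rho> a4"
        using diff[OF rV(7)[OF cV(1)] rV(4)[OF of_nat_V(2) cV(2)]] power[OF cV(1)] mult[OF of_nat_V(2) cV(2)] numeral by metis
      have "\<rho> ?E \<noteq> 0" unfolding \<rho>E n(3) using n(2) by simp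
      then have "?E \<notin> val_ideal v" using ker[OF EV] by blast
      then have E: "?E \<noteq> 0" "v ?E = 0" "inverse ?E \<in> val_ring v" using val_unit[OF EV] by blast+
      have i2: "inverse 2 \<in> val_ring v" using val_unit[OF of_nat_V(2) u2] by blast
      define a where "a = inverse 2 * inverse ?E * (9 * a6 - a2 * a4)"
      have NV: "9 * a6 - a2 * a4 \<in> val_ring v" by (intro rV cV of_nat_V)
      have aV: "a \<in> val_ring v" unfolding a_def by (intro rV(4) i2 E(3) NV)
      have a: "2 * ?E * a = 9 * a6 - a2 * a4"
      proof -
        have "2 * ?E * a = (2 * inverse 2) * (?E * inverse ?E) * (9 * a6 - a2 * a4)" unfolding a_def by (simp only: ac_simps)
        then show ?thesis using two E(1) by simp
      qed
      have "\<rho> (2 * ?E * a) = 2 * \<rho> ?E * \<rho> a"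
        using mult[OF rV(4)[OF of_nat_V(2) EV] aV] mult[OF of_nat_V(2) EV] numeral by metis
      moreover have "\<rho> (9 * a6 - a2 * a4) = 9 * \<rho> a6 - \<rho> a2 * \<rho> a4"
        using diff[OF rV(4)[OF of_nat_V(2) cV(3)] rV(4)[OF cV(1,2)]] mult[OF of_nat_V(2) cV(3)] mult[OF cV(1,2)] numeral by metis
      ultimately have "2 * \<rho> ?E * \<rho> a = 2 * \<rho> ?E * x" using a n(4) unfolding \<rho>E by metis
      moreover have "2 * \<rho> ?E \<noteq> 0" by (rule no_zero_divisors[OF n(1) \<open>\<rho> ?E \<noteq> 0\<close>])
      ultimately have ax: "\<rho> a = x" by (metis mult_left_cancel)
      have gV: "3 * a + a2 \<in> val_ring v" by (intro rV aV cV of_nat_V)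
      have "\<rho> (3 * a + a2) = 3 * x + \<rho> a2"
        using add[OF rV(4)[OF of_nat_V(2) aV] cV(1)] mult[OF of_nat_V(2) aV] numeral ax by metis
      then have "3 * a + a2 \<notin> val_ideal v" using ker[OF gV] n(2) by simp
      then have "3 * a + a2 \<noteq> 0" "v (3 * a + a2) = 0" using val_unit[OF gV] by blast+
      then show ?thesis using aV a E(1,2) by blast
    qed
  qed
qed

theorem mainTheorem1:
  fixes v :: "'k::field \<Rightarrow> int"
    and red :: "'k \<Rightarrow> 'r::field"
    and a2 a4 a6 :: 'k
    and P :: "'k poly"
    and E :: "'k weierstrass"
  assumes "discrete_valuation v"
    and "residue_map v red"
    and "P = [:a6, a4, a2, 1:]"
    and "E = Weierstrass 0 a2 0 a4 a6"
    and "elliptic_curve E"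
    and "minimal_equation v E"
    and "semistable_reduction red E"
  shows "(\<lambda>n. 1 / (real n)^2 *
            real (intersection_number v (zero_scheme v P) (torsion_closure v E n)))
         \<longlonglongrightarrow> 1 / 2 * real_of_int (v (discriminant E))"
proof -
  have int: "integral_equation v E" using assms(6) by (simp add: minimal_equation_def)
  interpret s: semistable_cubic v a2 a4 a6
    by (rule semistable_cubicI[OF assms(1,2)]) (use assms(4,5,7) int in simp_all)
  \<comment> \<open>The discriminant of E is 16 = 2^4 times that of P, and 2 is a unit of V.\<close>
  have "v ((2 :: 'k) ^ 4) = 0" using s.v_power[OF s.two, of 4] s.v_two by simp
  then have v16: "v 16 = 0" by simp
  have "(2 :: 'k) ^ 4 = 16" by simp
  then have n16: "(16 :: 'k) \<noteq> 0" using power_not_zero[OF s.two, of 4] by metis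
  have "v (discriminant E) = v (cubic_disc a2 a4 a6)"
    unfolding assms(4) discriminant_eq_cubic_disc using s.v_mult[OF n16 s.disc] v16 by simp
  moreover have "s.P = P" using assms(3) by (simp add: s.P_def)
  ultimately show ?thesis using s.intersection_limit assms(4) by simp
qed

end
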